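(* Let $O$ be an open subset of $\ell^2$ for which there is a continuously Fréchet differentiable function $g:\ell^2\to\mathbb R$ with $\partial O=\{\mathbf x:g(\mathbf x)=0\}$, $O=\{\mathbf x:g(\mathbf x)>0\}$ and $Dg(\mathbf x)\neq0$ for each $\mathbf x\in\partial O$. Suppose that $f\in W^{1,2}(O)$. Then there exists a sequence $\{\varphi_n\}_{n=1}^\infty\subset C_{F,b}^\infty(\ell^2)\cap C_{F,0}^\infty(\ell^2)$ such that $$\lim_{n\to\infty}\|\varphi_n-f\|_{W^{1,2}(O)}=0 .$$
   Context: Fix positive numbers $(a_i)_{i\ge1}$ with $\sum_ia_i<\infty$. $\ell^2$ is the real space of square-summable sequences $\mathbf x=(x_i)_{i\in\mathbb N}$, $(\mathbf e_i)$ its standard basis, $D_i$ the partial derivative along $\mathbf e_i$, $B_r(\mathbf x)$ the open ball. $P$ is the Borel probability measure on $\ell^2$ obtained by restricting the product measure $\prod_i\frac1{\sqrt{2\pi a_i^2}}e^{-x_i^2/(2a_i^2)}dx_i$ from $\mathbb R^{\mathbb N}$. For $V\subset\ell^2$ open: $f:V\to\mathbb R$ is $F$-continuous if for all $\mathbf x\in V$, $n\in\mathbb N$ the map $(s_1,\dots,s_n)\mapsto f(\mathbf x+\sum_{k\le n}s_k\mathbf e_k)$ is continuous on the open set where it is defined. $C_F^\infty(V)$ is the set of real-valued $F$-continuous Borel functions on $V$ all of whose partial derivatives (of all orders) exist and are uniformly bounded, $F$-continuous and Borel. $C_{F,b}^\infty(V)$ is the set of $f\in C_F^\infty(V)$ with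 $\sup_V(|f|+|D^\alpha f|)<\infty$ for every finitely supported multi-index $\alpha$. $E\stackrel{\circ}{\subset}V$ means: there are $\rho,R>0$ with $\bigcup_{\mathbf x\in E}B_\rho(\mathbf x)\subset V$ and $E\subset B_R(0)$. The test class $C_{F,0}^\infty(V)$ is the set of $f\in C_F^\infty(V)$ with $\sup_V(|f|+\sum_i|D_if|^2)<\infty$ and $\operatorname{supp}f\stackrel{\circ}{\subset}V$. With $D_i^*\varphi=-D_i\varphi+\frac{x_i}{a_i^2}\varphi$, a function $f\in L^2(V,P)$ has weak derivative $D_if=q\in L^2(V,P)$ if $\int_Vq\varphi\,dP=\int_VfD_i^*\varphi\,dP$ for all $\varphi\in C_{F,0}^\infty(V)$. $W^{1,2}(V)$ is the set of $f\in L^2(V,P)$ with all $D_if\in L^2(V,P)$ and $\|f\|^2_{W^{1,2}(V)}=\int_V|f|^2dP+\sum_ia_i^2\int_V|D_if|^2dP<\infty$. *)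

theory Defs
  imports "HOL-Probability.Probability"
begin

section \<open>The real Hilbert space of square-summable sequences\<close>

typedef ell2 = "{x :: nat \<Rightarrow> real. summable (\<lambda>i. (x i)\<^sup>2)}"
  morphisms coord Abs_ell2
  by (rule exI[of _ "\<lambda>_. 0"]) simp

lemma summable_coord_sq: "summable (\<lambda>i. (coord x i)\<^sup>2)"
  using coord[of x] by simp

lemma summable_coord_mult: "summable (\<lambda>i. coord x i * coord y i)"
proof (rule summable_comparison_test')
  show "summable (\<lambda>i. (coord x i)\<^sup>2 + (coord y i)\<^sup>2)"
    by (intro summable_add summable_coord_sq)
  fix i
  have "2 * \<bar>coord x i\<bar> * \<bar>coord y i\<bar> \<le> \<bar>coord x i\<bar>\<^sup>2 + \<bar>coord y i\<bar>\<^sup>2"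
    by (rule sum_squares_bound)
  moreover have "0 \<le> \<bar>coord x i\<bar> * \<bar>coord y i\<bar>" by simp
  ultimately show "norm (coord x i * coord y i) \<le> (coord x i)\<^sup>2 + (coord y i)\<^sup>2"
    unfolding real_norm_def abs_mult power2_abs by linarith
qed

instantiation ell2 :: real_inner
begin

definition zero_ell2 :: ell2 where "0 = Abs_ell2 (\<lambda>_. 0)"
definition plus_ell2 :: "ell2 \<Rightarrow> ell2 \<Rightarrow> ell2"
  where "x + y = Abs_ell2 (\<lambda>i. coord x i + coord y i)"
definition minus_ell2 :: "ell2 \<Rightarrow> ell2 \<Rightarrow> ell2"
  where "x - y = Abs_ell2 (\<lambda>i. coord x i - coord y i)"
definition uminus_ell2 :: "ell2 \<Rightarrow> ell2"
  where "- (x :: ell2) = Abs_ell2 (\<lambda>i. - coord x i)"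
definition scaleR_ell2 :: "real \<Rightarrow> ell2 \<Rightarrow> ell2"
  where "c *\<^sub>R x = Abs_ell2 (\<lambda>i. c * coord x i)"
definition inner_ell2 :: "ell2 \<Rightarrow> ell2 \<Rightarrow> real"
  where "x \<bullet> y = (\<Sum>i. coord x i * coord y i)"
definition norm_ell2 :: "ell2 \<Rightarrow> real"
  where "norm x = sqrt (x \<bullet> (x :: ell2))"
definition dist_ell2 :: "ell2 \<Rightarrow> ell2 \<Rightarrow> real"
  where "dist x y = norm (x - (y :: ell2))"
definition sgn_ell2 :: "ell2 \<Rightarrow> ell2"
  where "sgn x = inverse (norm x) *\<^sub>R (x :: ell2)"
definition uniformity_ell2 :: "(ell2 \<times> ell2) filter"
  where "(uniformity :: (ell2 \<times> ell2) filter) = (INF e\<in>{0<..}. principal {(x :: ell2, y). dist x y < e})"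
definition open_ell2 :: "ell2 set \<Rightarrow> bool"
  where "open (U :: ell2 set) \<longleftrightarrow> (\<forall>x\<in>U. \<forall>\<^sub>F (x', y) in uniformity. x' = x \<longrightarrow> y \<in> U)"

lemma coord_zero [simp]: "coord 0 i = 0"
  by (simp add: zero_ell2_def Abs_ell2_inverse)

lemma coord_add [simp]: "coord (x + y) i = coord x i + coord y i"
proof -
  have "summable (\<lambda>i. (coord x i)\<^sup>2 + (coord y i)\<^sup>2 + 2 * (coord x i * coord y i))"
    by (intro summable_add summable_mult summable_coord_sq summable_coord_mult)
  then show ?thesis
    by (simp add: plus_ell2_def Abs_ell2_inverse power2_sum algebra_simps)
qed

lemma coord_scaleR [simp]: "coord (c *\<^sub>R x) i = c * coord x i"
  by (simp add: scaleR_ell2_def Abs_ell2_inverse power_mult_distrib summable_mult summable_coord_sq)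

lemma coord_uminus [simp]: "coord (- x) i = - coord x i"
  by (simp add: uminus_ell2_def Abs_ell2_inverse summable_coord_sq)

lemma coord_diff [simp]: "coord (x - y) i = coord x i - coord y i"
proof -
  have "x - y = x + - y"
    by (simp add: minus_ell2_def plus_ell2_def)
  then show ?thesis by simp
qed

lemma ell2_eqI: "(\<And>i. coord x i = coord y i) \<Longrightarrow> x = y"
  by (simp add: coord_inject[symmetric] fun_eq_iff)

instance
proof
  fix x y z :: ell2 and c d :: real
  show "x + y + z = x + (y + z)" "x + y = y + x" "0 + x = x" "- x + x = 0" "x - y = x + - y"
    "c *\<^sub>R (x + y) = c *\<^sub>R x + c *\<^sub>R y" "(c + d) *\<^sub>R x = c *\<^sub>R x + d *\<^sub>R x"
    "c *\<^sub>R d *\<^sub>R x = (c * d) *\<^sub>R x" "1 *\<^sub>R x = x"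
    by (auto intro!: ell2_eqI simp: algebra_simps)
  show "dist x y = norm (x - y)" by (rule dist_ell2_def)
  show "sgn x = inverse (norm x) *\<^sub>R x" by (rule sgn_ell2_def)
  show "uniformity = (INF e\<in>{0<..}. principal {(x::ell2, y). dist x y < e})"
    by (rule uniformity_ell2_def)
  show "open U \<longleftrightarrow> (\<forall>x\<in>U. \<forall>\<^sub>F (x', y) in uniformity. x' = x \<longrightarrow> y \<in> U)" for U :: "ell2 set"
    by (rule open_ell2_def)
  show "x \<bullet> y = y \<bullet> x" by (simp add: inner_ell2_def mult.commute)
  show "(x + y) \<bullet> z = x \<bullet> z + y \<bullet> z"
    by (simp add: inner_ell2_def distrib_right suminf_add summable_coord_mult)
  show "(c *\<^sub>R x) \<bullet> y = c * (x \<bullet> y)"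
    by (simp add: inner_ell2_def mult.assoc suminf_mult summable_coord_mult)
  show "0 \<le> x \<bullet> x"
    by (simp add: inner_ell2_def suminf_nonneg summable_coord_mult)
  show "x \<bullet> x = 0 \<longleftrightarrow> x = 0"
  proof
    assume "x \<bullet> x = 0"
    then have "\<forall>i. coord x i * coord x i = 0"
      using suminf_eq_zero_iff[OF summable_coord_mult[of x x]] by (simp add: inner_ell2_def)
    then show "x = 0" by (auto intro: ell2_eqI)
  qed (simp add: inner_ell2_def)
  show "norm x = sqrt (x \<bullet> x)" by (rule norm_ell2_def)
qed

end

definition basis :: "nat \<Rightarrow> ell2"
  where "basis i = Abs_ell2 (\<lambda>j. if j = i then 1 else 0)"

lemma coord_basis: "coord (basis i) j = (if j = i then 1 else 0)"
proof -
  have "summable (\<lambda>j. (if j = i then 1 else 0 :: real)\<^sup>2)"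
    by (rule summable_finite[of "{i}"]) auto
  then show ?thesis by (simp add: basis_def Abs_ell2_inverse)
qed


section \<open>The Gaussian measure\<close>

text \<open>The product measure is concentrated on the square-summable sequences when the
  variances \<open>(a i)\<^sup>2\<close> are summable; it is restricted to them and transported to the
  Borel sets of the normed space.\<close>

definition gauss :: "(nat \<Rightarrow> real) \<Rightarrow> ell2 measure"
  where "gauss a =
    distr (restrict_space (Pi\<^sub>M UNIV (\<lambda>i. density lborel (\<lambda>x. ennreal (normal_density 0 (a i) x))))
            {x. summable (\<lambda>i. (x i)\<^sup>2)})
      borel Abs_ell2"


section \<open>Classes of smooth functions\<close>

text \<open>A function \<open>V \<rightarrow> \<real>\<close> is a total function whose values outside \<open>V\<close> are irrelevant.
  All definitions are intended for open \<open>V\<close>.\<close>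

definition F_continuous :: "ell2 set \<Rightarrow> (ell2 \<Rightarrow> real) \<Rightarrow> bool"
  where "F_continuous V f \<longleftrightarrow>
    (\<forall>x\<in>V. \<forall>n.
      continuous_map
        (subtopology (Euclidean_space n) {s. x + (\<Sum>k<n. s k *\<^sub>R basis k) \<in> V})
        euclideanreal
        (\<lambda>s. f (x + (\<Sum>k<n. s k *\<^sub>R basis k))))"

definition partial :: "nat \<Rightarrow> (ell2 \<Rightarrow> real) \<Rightarrow> ell2 \<Rightarrow> real"
  where "partial i f x = deriv (\<lambda>t. f (x + t *\<^sub>R basis i)) 0"

definition has_partial :: "nat \<Rightarrow> (ell2 \<Rightarrow> real) \<Rightarrow> ell2 \<Rightarrow> bool"
  where "has_partial i f x \<longleftrightarrow> (\<lambda>t. f (x + t *\<^sub>R basis i)) field_differentiable (at 0)"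

text \<open>A multi-index is represented by a list of directions, repeated according to
  multiplicity, and the partial derivatives are taken in the order of the list, starting from
  its end. For functions in the class \<open>C_F\<close> below the order does not matter, as the restrictions
  to finite-dimensional affine subspaces have continuous partial derivatives of all orders.\<close>

fun partials :: "nat list \<Rightarrow> (ell2 \<Rightarrow> real) \<Rightarrow> ell2 \<Rightarrow> real"
  where
    "partials [] f = f"
  | "partials (i # is) f = partial i (partials is f)"

text \<open>Each derivative has its own bound on \<open>V\<close>. A bound common to all orders would
  force compactly supported functions of one variable to vanish.\<close>

definition C_F :: "ell2 set \<Rightarrow> (ell2 \<Rightarrow> real) set"
  where "C_F V = {f.
    F_continuous V f \<and> f \<in> borel_measurable (restrict_space borel V) \<and>
    (\<forall>is i. \<forall>x\<in>V. has_partial i (partials is f) x) \<and>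
    (\<forall>is. is \<noteq> [] \<longrightarrow>
      bounded (partials is f ` V) \<and>
      F_continuous V (partials is f) \<and>
      partials is f \<in> borel_measurable (restrict_space borel V))}"

definition C_Fb :: "ell2 set \<Rightarrow> (ell2 \<Rightarrow> real) set"
  where "C_Fb V = {f \<in> C_F V. \<forall>is. bdd_above ((\<lambda>x. \<bar>f x\<bar> + \<bar>partials is f x\<bar>) ` V)}"

definition well_inside :: "ell2 set \<Rightarrow> ell2 set \<Rightarrow> bool"
  where "well_inside E V \<longleftrightarrow>
    (\<exists>\<rho>>0. \<exists>R>0. (\<Union>x\<in>E. ball x \<rho>) \<subseteq> V \<and> E \<subseteq> ball 0 R)"

text \<open>The sum over all directions is taken in the extended nonnegative reals, so that its
  finiteness includes convergence.\<close>

definition C_F0 :: "ell2 set \<Rightarrow> (ell2 \<Rightarrow> real) set"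
  where "C_F0 V = {f \<in> C_F V.
    (SUP x\<in>V. ennreal \<bar>f x\<bar> + (\<Sum>i. ennreal ((partial i f x)\<^sup>2))) < \<infinity> \<and>
    well_inside (closure {x \<in> V. f x \<noteq> 0}) V}"


section \<open>Weak derivatives and the Sobolev space\<close>

text \<open>Functions in \<open>L2\<close> and \<open>W12\<close> are Borel representatives of their almost-everywhere classes.\<close>

definition L2 :: "(nat \<Rightarrow> real) \<Rightarrow> ell2 set \<Rightarrow> (ell2 \<Rightarrow> real) set"
  where "L2 a V = {f.
    set_borel_measurable (gauss a) V f \<and> set_integrable (gauss a) V (\<lambda>x. (f x)\<^sup>2)}"

definition adj_partial :: "(nat \<Rightarrow> real) \<Rightarrow> nat \<Rightarrow> (ell2 \<Rightarrow> real) \<Rightarrow> ell2 \<Rightarrow> real"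
  where "adj_partial a i \<phi> x = - partial i \<phi> x + coord x i / (a i)\<^sup>2 * \<phi> x"

definition has_weak_partial ::
    "(nat \<Rightarrow> real) \<Rightarrow> ell2 set \<Rightarrow> nat \<Rightarrow> (ell2 \<Rightarrow> real) \<Rightarrow> (ell2 \<Rightarrow> real) \<Rightarrow> bool"
  where "has_weak_partial a V i f q \<longleftrightarrow>
    f \<in> L2 a V \<and> q \<in> L2 a V \<and>
    (\<forall>\<phi>\<in>C_F0 V. (LINT x:V|gauss a. q x * \<phi> x) = (LINT x:V|gauss a. f x * adj_partial a i \<phi> x))"

text \<open>The weak derivative is unique up to null sets, so the norm below does not depend on
  the choice of a representative.\<close>

definition weak_partial :: "(nat \<Rightarrow> real) \<Rightarrow> ell2 set \<Rightarrow> nat \<Rightarrow> (ell2 \<Rightarrow> real) \<Rightarrow> ell2 \<Rightarrow> real"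
  where "weak_partial a V i f = (SOME q. has_weak_partial a V i f q)"

definition W12 :: "(nat \<Rightarrow> real) \<Rightarrow> ell2 set \<Rightarrow> (ell2 \<Rightarrow> real) set"
  where "W12 a V = {f \<in> L2 a V.
    (\<forall>i. \<exists>q. has_weak_partial a V i f q) \<and>
    summable (\<lambda>i. (a i)\<^sup>2 * (LINT x:V|gauss a. (weak_partial a V i f x)\<^sup>2))}"

definition W12_norm :: "(nat \<Rightarrow> real) \<Rightarrow> ell2 set \<Rightarrow> (ell2 \<Rightarrow> real) \<Rightarrow> real"
  where "W12_norm a V f = sqrt
    ((LINT x:V|gauss a. (f x)\<^sup>2) +
     (\<Sum>i. (a i)\<^sup>2 * (LINT x:V|gauss a. (weak_partial a V i f x)\<^sup>2)))"

end

theory Submission imports Defs begin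

text \<open>Truncation: let \<open>w\<^sub>i = min (1 / a\<^sub>i) T\<close>. A cutoff in the norm \<open>(\<Sum>\<^sub>i w\<^sub>i x\<^sub>i\<^sup>2)\<^sup>1\<^sup>/\<^sup>2\<close> at scale
  \<open>\<rho>\<close> costs little in the Sobolev norm, as \<open>\<Sum>\<^sub>i a\<^sub>i\<^sup>2 w\<^sub>i \<le> \<Sum>\<^sub>i a\<^sub>i\<close>, and for large \<open>T\<close> its support is
  close to the compact box \<open>\<bar>x\<^sub>i\<bar> \<le> 3 \<rho> \<surd>a\<^sub>i\<close>, hence is covered by finitely many balls from any open
  cover. With a partition of unity it remains to treat functions supported in a small ball.

  Localisation: if the ball meets \<open>\<partial>U\<close>, some \<open>D\<^sub>i g\<close> is nonzero there, so that the translate of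
  \<open>U\<close> by a small multiple \<open>t\<close> of \<open>e\<^sub>i\<close> has, inside the ball, a positive distance to the complement
  of \<open>U\<close>. A cutoff that is 1 there and supported in \<open>U\<close> yields an element of \<open>W\<^sup>1\<^sup>,\<^sup>2(\<ell>\<^sup>2)\<close> which, moved back by
  \<open>-t e\<^sub>i\<close>, is close to the given function on \<open>U\<close>.

  Whole space: the Mehler (Ornstein--Uhlenbeck) operators in finitely many coordinates map
  \<open>W\<^sup>1\<^sup>,\<^sup>2(\<ell>\<^sup>2)\<close> to smooth functions, commute with the derivatives up to a factor, are contractions
  of \<open>L\<^sup>2\<close> and converge strongly to the identity.

  Cutoffs: a Lipschitz function becomes smooth in every coordinate, with the same Lipschitz constant,
  by averaging it over short segments infinitely often in each coordinate direction; the lengths of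
  the segments are summable.\<close>

section \<open>The sequence space\<close>

text \<open>Two absences shape the proof: balls of \<open>ell2\<close> are not compact, and no
  translation-invariant measure is available. An infinite partition of unity need not have a common
  gradient bound, so a finite cover is wanted, and that exists only near a compact set. The weight
  \<open>1 / a i\<close> is natural because \<open>(coord x i)\<^sup>2 / a i\<close> has expectation
  \<open>a i\<close>; the weighted norm is then finite almost everywhere, but it is infinite at some
  points, and only the truncation at \<open>T\<close> makes the cutoff Lipschitz on
  \<open>ell2\<close>. Its weighted gradient bound does not depend on \<open>T\<close>, so
  \<open>T\<close> may be chosen last, after the cover. Translations go along one basis vector,
  where the density is explicit; it is bounded on bounded sets only, so functions are first confined
  to balls. The Mehler kernel replaces convolution: its adjoint derivative in one variable is a
  multiple of its derivative in the other, which yields the commutation with weak derivatives.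
  Inside the proof, functions are extended by zero, carry an explicit family of weak derivatives,
  and are measured in \<open>ennreal\<close>, so that summability is never a side condition.\<close>

lemma norm_sq_ell2: "(norm (x::ell2))\<^sup>2 = (\<Sum>i. (coord x i)\<^sup>2)"
  by (simp add: norm_ell2_def inner_ell2_def power2_eq_square suminf_nonneg
      summable_coord_mult)

lemma coord_eq_inner: "coord x i = x \<bullet> basis i"
proof -
  have "(\<Sum>j. coord x j * coord (basis i) j) = (\<Sum>j\<in>{i}. coord x j * coord (basis i) j)"
    by (rule suminf_finite) (auto simp: coord_basis)
  then show ?thesis by (simp add: inner_ell2_def coord_basis)
qed

lemma norm_basis [simp]: "norm (basis i) = 1"
  by (simp add: norm_eq_sqrt_inner coord_eq_inner[symmetric] coord_basis)

lemma abs_coord_le_norm: "\<bar>coord x i\<bar> \<le> norm x"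
  using Cauchy_Schwarz_ineq2[of x "basis i"] by (simp add: coord_eq_inner)

lemma continuous_on_coord [continuous_intros]:
  "continuous_on A f \<Longrightarrow> continuous_on A (\<lambda>x. coord (f x) i)"
  unfolding coord_eq_inner by (intro continuous_intros)

lemma coord_measurable [measurable]: "(\<lambda>x. coord x i) \<in> borel_measurable borel"
  by (intro borel_measurable_continuous_onI continuous_intros)

lemma coord_sum [simp]: "coord (sum f A) i = (\<Sum>j\<in>A. coord (f j) i)"
  by (simp add: coord_eq_inner inner_sum_left)

lemma coord_Abs [simp]: "summable (\<lambda>i. (x i)\<^sup>2) \<Longrightarrow> coord (Abs_ell2 x) i = x i"
  by (simp add: Abs_ell2_inverse)

lemma coord_sum_basis: "coord (\<Sum>k<n. s k *\<^sub>R basis k) i = (if i < n then s i else 0)"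
  by (simp add: coord_basis if_distrib sum.delta cong: if_cong)

text \<open>The squared error is the tail of the convergent series of the
  \<open>(coord x k)\<^sup>2\<close>.\<close>

lemma basis_expansion: "(\<lambda>n. \<Sum>k<n. coord x k *\<^sub>R basis k) \<longlonglongrightarrow> x"
proof -
  have eq: "(norm (x - (\<Sum>k<n. coord x k *\<^sub>R basis k)))\<^sup>2 = (norm x)\<^sup>2 - (\<Sum>k<n. (coord x k)\<^sup>2)" for n
  proof -
    have "(\<Sum>i. (coord (x - (\<Sum>k<n. coord x k *\<^sub>R basis k)) i)\<^sup>2)
        = (\<Sum>i. (coord x i)\<^sup>2 - (if i \<in> {..<n} then (coord x i)\<^sup>2 else 0))"
      by (intro suminf_cong) (simp add: coord_sum_basis del: coord_sum)
    also have "\<dots> = (\<Sum>i. (coord x i)\<^sup>2) - (\<Sum>i. (if i \<in> {..<n} then (coord x i)\<^sup>2 else 0))"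
      by (rule suminf_diff[symmetric]) (auto intro: summable_coord_sq)
    also have "(\<Sum>i. (if i \<in> {..<n} then (coord x i)\<^sup>2 else 0)) = (\<Sum>k<n. (coord x k)\<^sup>2)"
      by (subst suminf_finite[of "{..<n}"]) auto
    finally show ?thesis by (simp add: norm_sq_ell2)
  qed
  have "(\<lambda>n. (norm x)\<^sup>2 - (\<Sum>k<n. (coord x k)\<^sup>2)) \<longlonglongrightarrow> (norm x)\<^sup>2 - (norm x)\<^sup>2"
    unfolding norm_sq_ell2 by (intro tendsto_intros summable_LIMSEQ summable_coord_sq)
  then have "(\<lambda>n. (norm (x - (\<Sum>k<n. coord x k *\<^sub>R basis k)))\<^sup>2) \<longlonglongrightarrow> 0"
    unfolding eq by simp
  then have "(\<lambda>n. sqrt ((norm (x - (\<Sum>k<n. coord x k *\<^sub>R basis k)))\<^sup>2)) \<longlonglongrightarrow> sqrt 0"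
    by (rule tendsto_real_sqrt)
  then have "(\<lambda>n. norm (x - (\<Sum>k<n. coord x k *\<^sub>R basis k))) \<longlonglongrightarrow> 0"
    by simp
  then show ?thesis
    by (simp add: LIMSEQ_iff norm_minus_commute)
qed

text \<open>Rational combinations of initial basis vectors, coded by lists of rationals, suffice.
  Separability serves the Borel measurability of the map from sequences into
  \<open>ell2\<close>.\<close>

lemma countable_dense_ell2:
  "\<exists>D::ell2 set. countable D \<and> (\<forall>x. \<forall>e>0. \<exists>d\<in>D. dist d x < e)"
proof -
  define D :: "ell2 set" where "D = range (\<lambda>l::rat list. \<Sum>i<length l. of_rat (l ! i) *\<^sub>R basis i)"
  have "\<exists>d\<in>D. dist d x < e" if "e > 0" for x :: ell2 and e :: real
  proof -
    from LIMSEQ_D[OF basis_expansion[of x], of "e/2"] that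
    obtain n where "\<forall>m\<ge>n. norm ((\<Sum>k<m. coord x k *\<^sub>R basis k) - x) < e / 2" by auto
    then have n: "norm ((\<Sum>k<n. coord x k *\<^sub>R basis k) - x) < e / 2" by blast
    \<comment> \<open>Each of the \<open>n\<close> coefficients may be off by
      \<open>\<delta>\<close>, in total at most \<open>e / 2\<close>; the \<open>+ 1\<close> covers
      \<open>n = 0\<close>.\<close>
    define \<delta> where "\<delta> = e / (2 * (real n + 1))"
    have \<delta>: "\<delta> > 0" using that by (simp add: \<delta>_def)
    have "\<exists>q::rat. \<bar>of_rat q - coord x k\<bar> < \<delta>" for k
    proof -
      have "coord x k - \<delta> < coord x k + \<delta>" using \<delta> by simp
      then obtain q where "coord x k - \<delta> < of_rat q" "of_rat q < coord x k + \<delta>"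
        using of_rat_dense by blast
      then show ?thesis by (intro exI[of _ q]) auto
    qed
    then obtain q :: "nat \<Rightarrow> rat" where q: "\<And>k. \<bar>of_rat (q k) - coord x k\<bar> < \<delta>" by metis
    let ?d = "\<Sum>k<n. of_rat (q k) *\<^sub>R basis k :: ell2"
    have "?d = (\<Sum>i<length (map q [0..<n]). of_rat (map q [0..<n] ! i) *\<^sub>R basis i)"
      by simp
    then have "?d \<in> D" unfolding D_def by blast
    moreover have "dist ?d x < e"
    proof -
      have "norm (?d - (\<Sum>k<n. coord x k *\<^sub>R basis k)) = norm (\<Sum>k<n. (of_rat (q k) - coord x k) *\<^sub>R basis k)"
        by (simp add: sum_subtractf[symmetric] scaleR_diff_left[symmetric])
      also have "\<dots> \<le> (\<Sum>k<n. \<delta>)"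
        by (rule sum_norm_le) (use q in \<open>auto intro: less_imp_le\<close>)
      also have "\<dots> = real n * e / (2 * (real n + 1))" by (simp add: \<delta>_def)
      also have "\<dots> \<le> e / 2" using that by (simp add: field_simps)
      finally show ?thesis using n norm_triangle_lt[of "?d - (\<Sum>k<n. coord x k *\<^sub>R basis k)" "(\<Sum>k<n. coord x k *\<^sub>R basis k) - x" e]
        by (simp add: dist_norm)
    qed
    ultimately show ?thesis by blast
  qed
  moreover have "countable D" unfolding D_def by (rule countable_image) simp
  ultimately show ?thesis by blast
qed

text \<open>Reduces measurability of a map into \<open>ell2\<close> to measurability of its
  distances from fixed points.\<close>

lemma open_ell2_countable_balls:
  fixes V :: "ell2 set" assumes "open V"
  obtains B :: "(ell2 \<times> real) set" where "countable B" "V = (\<Union>(d,r)\<in>B. ball d r)"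
proof -
  obtain D :: "ell2 set" where D: "countable D" "\<And>x e. e > 0 \<Longrightarrow> \<exists>d\<in>D. dist d x < e"
    using countable_dense_ell2 by blast
  define B where "B = {(d, r) \<in> D \<times> range (\<lambda>n. 1 / real (Suc n)). ball d r \<subseteq> V}"
  have "countable B"
    unfolding B_def by (rule countable_subset[of _ "D \<times> range (\<lambda>n. 1 / real (Suc n))"]) (use D in auto)
  moreover have "V \<subseteq> (\<Union>(d,r)\<in>B. ball d r)"
  proof
    fix x assume "x \<in> V"
    then obtain e where e: "e > 0" "ball x e \<subseteq> V" using assms openE by blast
    obtain n where n: "1 / real (Suc n) < e / 2" using nat_approx_posE[of "e/2"] e by auto
    obtain d where d: "d \<in> D" "dist d x < 1 / real (Suc n)" using D(2)[of "1 / real (Suc n)"] by auto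
    have "ball d (1 / real (Suc n)) \<subseteq> ball x e"
    proof
      fix y assume "y \<in> ball d (1 / real (Suc n))"
      then have "dist d y < e / 2" using n by simp
      moreover have "dist x d < e / 2" using d n by (simp add: dist_commute)
      ultimately show "y \<in> ball x e" using dist_triangle[of x y d] by simp
    qed
    then have "(d, 1 / real (Suc n)) \<in> B" using d e by (auto simp: B_def)
    then show "x \<in> (\<Union>(d,r)\<in>B. ball d r)" using d by (force simp: dist_commute)
  qed
  ultimately show ?thesis by (intro that[of B]) (auto simp: B_def)
qed

section \<open>Smoothness along finitely many coordinates\<close>

text \<open>Relational form of \<open>partial\<close>. Since \<open>deriv\<close> has a value even
  where no derivative exists, this keeps existence and value together through the calculus
  rules.\<close>

definition has_pd :: "(ell2 \<Rightarrow> real) \<Rightarrow> nat \<Rightarrow> ell2 \<Rightarrow> real \<Rightarrow> bool"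
  where "has_pd f i x D \<longleftrightarrow> ((\<lambda>t. f (x + t *\<^sub>R basis i)) has_field_derivative D) (at 0)"

lemma has_partial_iff: "has_partial i f x \<longleftrightarrow> (\<exists>D. has_pd f i x D)"
  by (simp add: has_partial_def has_pd_def field_differentiable_def)

lemma has_pd_imp_partial: "has_pd f i x D \<Longrightarrow> partial i f x = D"
  by (simp add: has_pd_def partial_def DERIV_imp_deriv)

lemma has_partial_has_pd: "has_partial i f x \<Longrightarrow> has_pd f i x (partial i f x)"
  using has_partial_iff has_pd_imp_partial by blast

lemma has_pd_add: "has_pd f i x D \<Longrightarrow> has_pd g i x E \<Longrightarrow> has_pd (\<lambda>x. f x + g x) i x (D + E)"
  by (simp add: has_pd_def DERIV_add)

lemma has_pd_mult:
  "has_pd f i x D \<Longrightarrow> has_pd g i x E \<Longrightarrow> has_pd (\<lambda>x. f x * g x) i x (D * g x + f x * E)"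
  unfolding has_pd_def by (drule (1) DERIV_mult) (simp add: ac_simps)

lemma has_pd_const: "has_pd (\<lambda>x. c) i x 0"
  by (simp add: has_pd_def)

lemma has_pd_shift: "has_pd f i (x + v) D \<Longrightarrow> has_pd (\<lambda>x. f (x + v)) i x D"
  by (simp add: has_pd_def algebra_simps)

lemma has_pd_coord: "has_pd (\<lambda>x. coord x j) i x (if i = j then 1 else 0)"
  by (auto simp: has_pd_def coord_basis intro!: derivative_eq_intros)

lemma eventually_line_in_open:
  assumes "open V" "x \<in> (V::ell2 set)"
  shows "eventually (\<lambda>t. x + t *\<^sub>R basis i \<in> V) (nhds 0)"
proof -
  have "continuous_on UNIV (\<lambda>t. x + t *\<^sub>R basis i)" by (intro continuous_intros)
  then have "open ((\<lambda>t. x + t *\<^sub>R basis i) -` V)"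
    using assms(1) open_vimage by blast
  then show ?thesis
    using assms(2) by (auto simp: eventually_nhds intro!: exI[of _ "(\<lambda>t. x + t *\<^sub>R basis i) -` V"])
qed

lemma has_pd_cong:
  assumes "open V" "x \<in> V" "\<And>y. y \<in> V \<Longrightarrow> f y = g y"
  shows "has_pd f i x D \<longleftrightarrow> has_pd g i x D"
proof -
  have ev: "eventually (\<lambda>t. f (x + t *\<^sub>R basis i) = g (x + t *\<^sub>R basis i)) (nhds 0)"
    using eventually_line_in_open[OF assms(1,2)] by eventually_elim (rule assms(3))
  show ?thesis unfolding has_pd_def
    by (rule DERIV_cong_ev) (use ev in auto)
qed

lemma partial_cong:
  assumes "open V" "x \<in> V" "\<And>y. y \<in> V \<Longrightarrow> f y = g y"
  shows "partial i f x = partial i g x"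
proof -
  have ev: "eventually (\<lambda>t. f (x + t *\<^sub>R basis i) = g (x + t *\<^sub>R basis i)) (nhds 0)"
    using eventually_line_in_open[OF assms(1,2)] by eventually_elim (rule assms(3))
  show ?thesis unfolding partial_def by (rule deriv_cong_ev) (use ev in auto)
qed

text \<open>\<open>has_pd\<close> differentiates at parameter 0 only; moving the base point gives
  the derivative at every parameter of the line, as the mean value theorem requires.\<close>

lemma has_pd_line:
  assumes "has_partial i f (x + t *\<^sub>R basis i)"
  shows "((\<lambda>t. f (x + t *\<^sub>R basis i)) has_field_derivative partial i f (x + t *\<^sub>R basis i)) (at t)"
proof -
  have "((\<lambda>s. f (x + (s + t) *\<^sub>R basis i)) has_field_derivative partial i f (x + t *\<^sub>R basis i)) (at 0)"
    using has_partial_has_pd[OF assms] by (simp add: has_pd_def algebra_simps)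
  then show ?thesis using DERIV_shift[of "\<lambda>t. f (x + t *\<^sub>R basis i)" _ 0 t] by simp
qed

text \<open>\<open>Euclidean_space n\<close> consists of the sequences that vanish from index
  \<open>n\<close> on, with the product topology, so the abstract condition becomes an ordinary
  \<open>continuous_on\<close>.\<close>

lemma F_continuous_iff:
  "F_continuous V f \<longleftrightarrow> (\<forall>x\<in>V. \<forall>n.
     continuous_on {s. (\<forall>i\<ge>n. s i = 0) \<and> x + (\<Sum>k<n. s k *\<^sub>R basis k) \<in> V}
       (\<lambda>s. f (x + (\<Sum>k<n. s k *\<^sub>R basis k))))"
proof -
  have "subtopology (Euclidean_space n) {s. x + (\<Sum>k<n. s k *\<^sub>R basis k) \<in> V} =
     top_of_set {s. (\<forall>i\<ge>n. s i = 0) \<and> x + (\<Sum>k<n. s k *\<^sub>R basis k) \<in> V}" for x n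
    unfolding Euclidean_space_def euclidean_product_topology subtopology_subtopology
    by (rule arg_cong[where f="subtopology euclidean"]) auto
  then show ?thesis unfolding F_continuous_def by simp
qed

lemma continuous_on_slice:
  "continuous_on A (\<lambda>s::nat \<Rightarrow> real. (x::ell2) + (\<Sum>k<n. s k *\<^sub>R basis k))"
  by (intro continuous_intros continuous_on_subset[OF continuous_on_product_coordinates]) auto

lemma continuous_imp_F_continuous:
  assumes "continuous_on V f" shows "F_continuous V f"
  unfolding F_continuous_iff
  by (intro ballI allI continuous_on_compose2[OF assms continuous_on_slice]) auto

lemma F_continuous_cong:
  assumes "\<And>x. x \<in> V \<Longrightarrow> f x = g x" "F_continuous V f" shows "F_continuous V g"
  unfolding F_continuous_iff
proof (intro ballI allI)
  fix x n assume "x \<in> V"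
  then have "continuous_on {s. (\<forall>i\<ge>n. s i = 0) \<and> x + (\<Sum>k<n. s k *\<^sub>R basis k) \<in> V}
       (\<lambda>s. f (x + (\<Sum>k<n. s k *\<^sub>R basis k)))"
    using assms(2) unfolding F_continuous_iff by blast
  then show "continuous_on {s. (\<forall>i\<ge>n. s i = 0) \<and> x + (\<Sum>k<n. s k *\<^sub>R basis k) \<in> V}
       (\<lambda>s. g (x + (\<Sum>k<n. s k *\<^sub>R basis k)))"
    by (rule continuous_on_eq) (simp add: assms(1))
qed

lemma F_continuous_mult:
  "F_continuous V f \<Longrightarrow> F_continuous V g \<Longrightarrow> F_continuous V (\<lambda>x. f x * g x)"
  unfolding F_continuous_iff by (auto intro: continuous_on_mult)

lemma F_continuous_add:
  "F_continuous V f \<Longrightarrow> F_continuous V g \<Longrightarrow> F_continuous V (\<lambda>x. f x + g x)"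
  unfolding F_continuous_iff by (auto intro: continuous_on_add)

lemma F_continuous_subset:
  assumes "F_continuous V f" "W \<subseteq> V" shows "F_continuous W f"
  unfolding F_continuous_iff
proof (intro ballI allI)
  fix x n assume "x \<in> W"
  then have "continuous_on {s. (\<forall>i\<ge>n. s i = 0) \<and> x + (\<Sum>k<n. s k *\<^sub>R basis k) \<in> V}
       (\<lambda>s. f (x + (\<Sum>k<n. s k *\<^sub>R basis k)))"
    using assms unfolding F_continuous_iff by blast
  then show "continuous_on {s. (\<forall>i\<ge>n. s i = 0) \<and> x + (\<Sum>k<n. s k *\<^sub>R basis k) \<in> W}
       (\<lambda>s. f (x + (\<Sum>k<n. s k *\<^sub>R basis k)))"
    by (rule continuous_on_subset) (use assms(2) in auto)
qed

text \<open>Continuity is local, but F-continuity only tests slices through points of the set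
  itself: a slice based in \<open>V\<close> may enter \<open>W\<close> elsewhere.\<close>

lemma F_continuous_Un:
  assumes "open V" "open W" "F_continuous V f" "F_continuous W f"
  shows "F_continuous (V \<union> W) f"
  unfolding F_continuous_iff
proof (intro ballI allI)
  fix x n assume x: "x \<in> V \<union> W"
  let ?T = "\<lambda>s. x + (\<Sum>k<n. s k *\<^sub>R basis k)"
  let ?E = "\<lambda>V. {s. (\<forall>i\<ge>n. s i = 0) \<and> ?T s \<in> V}"
  \<comment> \<open>If the slice meets \<open>X\<close> at parameter \<open>r\<close>, it is rebased
    at that point by the substitution \<open>s - r\<close>; if it does not, there is nothing to
    show.\<close>
  have *: "continuous_on (?E X) (\<lambda>s. f (?T s))" if "F_continuous X f" for X
  proof (cases "?E X = {}")
    case False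
    then obtain r where r: "\<forall>i\<ge>n. r i = 0" "?T r \<in> X" by auto
    have c: "continuous_on {s. (\<forall>i\<ge>n. s i = 0) \<and> ?T r + (\<Sum>k<n. s k *\<^sub>R basis k) \<in> X}
       (\<lambda>s. f (?T r + (\<Sum>k<n. s k *\<^sub>R basis k)))"
      using that r unfolding F_continuous_iff by blast
    have d: "continuous_on (?E X) (\<lambda>s k. s k - r k)"
      by (intro continuous_on_coordinatewise_then_product continuous_intros
          continuous_on_subset[OF continuous_on_product_coordinates]) auto
    have eq: "?T r + (\<Sum>k<n. (s k - r k) *\<^sub>R basis k) = ?T s" for s
      by (simp add: scaleR_diff_left sum_subtractf)
    have "continuous_on (?E X) (\<lambda>s. f (?T r + (\<Sum>k<n. (s k - r k) *\<^sub>R basis k)))"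
      by (rule continuous_on_compose2[OF c d]) (auto simp: eq r(1))
    then show ?thesis unfolding eq .
  next
    case True show ?thesis unfolding True by simp
  qed
  have op: "open (?T -` X)" if "open X" for X
    by (rule open_vimage[OF that continuous_on_slice])
  show "continuous_on (?E (V \<union> W)) (\<lambda>s. f (?T s))"
    unfolding continuous_on_eq_continuous_within
  proof
    fix s assume s: "s \<in> ?E (V \<union> W)"
    have loc: "continuous (at s within ?E (V \<union> W)) (\<lambda>s. f (?T s))"
      if "?T s \<in> X" "open X" "F_continuous X f" "X \<subseteq> V \<union> W" for X
    proof -
      have "continuous (at s within ?E X) (\<lambda>s. f (?T s))"
        using *[OF that(3)] s that(1) by (auto simp: continuous_on_eq_continuous_within)
      moreover have "at s within ?E X = at s within ?E (V \<union> W)"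
        using at_within_nhd[of s "?T -` X" "?E X" "?E (V \<union> W)"] that op[OF that(2)] by blast
      ultimately show ?thesis by simp
    qed
    show "continuous (at s within ?E (V \<union> W)) (\<lambda>s. f (?T s))"
      using s loc[of V] loc[of W] assms by blast
  qed
qed

text \<open>Differs from \<open>C_F\<close> by also bounding the function itself, so that the empty
  list needs no exceptional treatment in the closure arguments below.\<close>

definition F_smooth :: "ell2 set \<Rightarrow> (ell2 \<Rightarrow> real) \<Rightarrow> bool"
  where "F_smooth V f \<longleftrightarrow> (\<forall>is.
    (\<forall>i. \<forall>x\<in>V. has_partial i (partials is f) x) \<and> bounded (partials is f ` V) \<and>
    F_continuous V (partials is f) \<and> partials is f \<in> borel_measurable (restrict_space borel V))"

text \<open>Real partial sums stand for the series over all directions in \<open>C_F0\<close>; this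
  keeps convergence questions and \<open>ennreal\<close> out of the algebra.\<close>

definition grad_bound :: "ell2 set \<Rightarrow> (ell2 \<Rightarrow> real) \<Rightarrow> real \<Rightarrow> bool"
  where "grad_bound V f C \<longleftrightarrow> (\<forall>x\<in>V. \<forall>n. (\<Sum>i<n. (partial i f x)\<^sup>2) \<le> C)"

text \<open>A family closed under one differentiation contains, up to equality on \<open>V\<close>,
  the derivatives of every order. Openness of \<open>V\<close> is what allows an equality on
  \<open>V\<close> to be differentiated.\<close>

lemma partials_coinduct:
  assumes V: "open V" and f: "f \<in> S"
    and step: "\<And>h i. h \<in> S \<Longrightarrow> \<exists>h'\<in>S. \<forall>x\<in>V. has_pd h i x (h' x)"
  shows "\<exists>h\<in>S. \<forall>x\<in>V. partials is f x = h x"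
proof (induction "is")
  case (Cons i "is")
  then obtain h where h: "h \<in> S" "\<And>x. x \<in> V \<Longrightarrow> partials is f x = h x" by blast
  obtain h' where h': "h' \<in> S" "\<And>x. x \<in> V \<Longrightarrow> has_pd h i x (h' x)" using step[OF h(1)] by blast
  have "partials (i # is) f x = h' x" if "x \<in> V" for x
    using partial_cong[OF V that h(2)] has_pd_imp_partial[OF h'(2)[OF that]] by simp
  with h' show ?case by blast
qed (use f in auto)

text \<open>Smoothness of infinite order by coinduction: it suffices to exhibit a family of
  admissible functions that is stable under single derivatives. No formula for a higher derivative
  is ever needed.\<close>

lemma F_smooth_coinduct:
  assumes V: "open V" and f: "f \<in> S"
    and base: "\<And>h. h \<in> S \<Longrightarrow> bounded (h ` V) \<and> F_continuous V h \<and> h \<in> borel_measurable (restrict_space borel V)"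
    and step: "\<And>h i. h \<in> S \<Longrightarrow> \<exists>h'\<in>S. \<forall>x\<in>V. has_pd h i x (h' x)"
  shows "F_smooth V f"
proof -
  have rep: "\<exists>h\<in>S. \<forall>x\<in>V. partials is f x = h x" for "is"
    using partials_coinduct[OF V f step] .
  show ?thesis unfolding F_smooth_def
  proof
    fix "is"
    obtain h where h: "h \<in> S" "\<And>x. x \<in> V \<Longrightarrow> partials is f x = h x" using rep by blast
    have "has_partial i (partials is f) x" if "x \<in> V" for i x
      using step[OF h(1), of i] has_pd_cong[OF V that, of "partials is f" h] h(2) that
      unfolding has_partial_iff by blast
    moreover have "partials is f ` V = h ` V" using h by auto
    moreover have "F_continuous V (partials is f)"
      using F_continuous_cong[of V h] h base by auto
    moreover have "partials is f \<in> borel_measurable (restrict_space borel V)"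
      using base[OF h(1)] h(2) measurable_cong[of "restrict_space borel V" "partials is f" h]
      by (auto simp: space_restrict_space)
    ultimately show "(\<forall>i. \<forall>x\<in>V. has_partial i (partials is f) x) \<and> bounded (partials is f ` V) \<and>
      F_continuous V (partials is f) \<and> partials is f \<in> borel_measurable (restrict_space borel V)"
      using base[OF h(1)] by auto
  qed
qed

section \<open>Algebra, gluing and translation of smooth functions\<close>

lemma F_smoothD:
  assumes "F_smooth V f"
  shows "x \<in> V \<Longrightarrow> has_partial i (partials is f) x" "bounded (partials is f ` V)"
    "F_continuous V (partials is f)" "partials is f \<in> borel_measurable (restrict_space borel V)"
  using assms by (auto simp: F_smooth_def)

lemma F_smooth_has_pd: "F_smooth V f \<Longrightarrow> x \<in> V \<Longrightarrow> has_pd f i x (partial i f x)"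
  using F_smoothD(1)[of V f x i "[]"] has_partial_has_pd by simp

lemma F_smooth_partials_has_pd:
  "F_smooth V f \<Longrightarrow> x \<in> V \<Longrightarrow> has_pd (partials is f) i x (partials (i # is) f x)"
  using F_smoothD(1)[of V f x i "is"] has_partial_has_pd by simp

text \<open>Every derivative of a product has this shape by the Leibniz rule, when \<open>A\<close>
  and \<open>B\<close> hold all derivatives of the two factors; it is the coinduction family for
  products.\<close>

inductive_set prod_span :: "(ell2 \<Rightarrow> real) set \<Rightarrow> (ell2 \<Rightarrow> real) set \<Rightarrow> (ell2 \<Rightarrow> real) set"
  for A B where
    prod: "u \<in> A \<Longrightarrow> v \<in> B \<Longrightarrow> (\<lambda>x. u x * v x) \<in> prod_span A B"
  | add: "u \<in> prod_span A B \<Longrightarrow> v \<in> prod_span A B \<Longrightarrow> (\<lambda>x. u x + v x) \<in> prod_span A B"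

lemma bounded_mult_image:
  fixes u v :: "'a \<Rightarrow> real"
  assumes "bounded (u ` V)" "bounded (v ` V)" shows "bounded ((\<lambda>x. u x * v x) ` V)"
proof -
  obtain a b where "\<And>x. x \<in> V \<Longrightarrow> \<bar>u x\<bar> \<le> a" "\<And>x. x \<in> V \<Longrightarrow> \<bar>v x\<bar> \<le> b"
    using assms by (auto simp: bounded_iff)
  then have "\<And>x. x \<in> V \<Longrightarrow> \<bar>u x * v x\<bar> \<le> a * b"
    unfolding abs_mult by (meson abs_ge_zero mult_mono order_trans)
  then show ?thesis by (auto simp: bounded_iff)
qed

lemma F_smooth_mult:
  assumes V: "open V" and f: "F_smooth V f" and g: "F_smooth V g"
  shows "F_smooth V (\<lambda>x. f x * g x)"
proof -
  let ?A = "range (\<lambda>is. partials is f)" and ?B = "range (\<lambda>is. partials is g)"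
  have "f \<in> ?A" "g \<in> ?B" using partials.simps(1) by (metis rangeI)+
  show ?thesis
  proof (rule F_smooth_coinduct[OF V, of _ "prod_span ?A ?B"])
    show "(\<lambda>x. f x * g x) \<in> prod_span ?A ?B" by (rule prod_span.prod) fact+
  next
    fix h assume "h \<in> prod_span ?A ?B"
    then show "bounded (h ` V) \<and> F_continuous V h \<and> h \<in> borel_measurable (restrict_space borel V)"
    proof induction
      case (prod u v)
      then show ?case using F_smoothD(2-4)[OF f] F_smoothD(2-4)[OF g]
        by (auto intro!: bounded_mult_image F_continuous_mult borel_measurable_times)
    next
      case (add u v)
      then show ?case
        by (auto intro!: bounded_plus_comp F_continuous_add)
    qed
  next
    fix h i assume "h \<in> prod_span ?A ?B"
    then show "\<exists>h'\<in>prod_span ?A ?B. \<forall>x\<in>V. has_pd h i x (h' x)"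
    proof induction
      case (prod u v)
      then obtain k l where kl: "u = partials k f" "v = partials l g" by auto
      have "(\<lambda>x. partials (i # k) f x * v x + u x * partials (i # l) g x) \<in> prod_span ?A ?B"
        by (intro prod_span.intros) (use prod in blast)+
      moreover have "\<forall>x\<in>V. has_pd (\<lambda>x. u x * v x) i x (partials (i # k) f x * v x + u x * partials (i # l) g x)"
        unfolding kl using f g by (intro ballI has_pd_mult F_smooth_partials_has_pd) auto
      ultimately show ?case by fast
    next
      case (add u v)
      then obtain u' v' where "u' \<in> prod_span ?A ?B" "\<forall>x\<in>V. has_pd u i x (u' x)"
        "v' \<in> prod_span ?A ?B" "\<forall>x\<in>V. has_pd v i x (v' x)" by blast
      then show ?case
        by (intro bexI[of _ "\<lambda>x. u' x + v' x"]) (auto intro: has_pd_add prod_span.add)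
    qed
  qed
qed

lemma F_smooth_const: "open V \<Longrightarrow> F_smooth V (\<lambda>x. c)"
proof (rule F_smooth_coinduct[where S="range (\<lambda>c x. c)"])
  fix h and i :: nat assume "h \<in> range (\<lambda>(c::real) (x::ell2). c)"
  then show "\<exists>h'\<in>range (\<lambda>c x. c). \<forall>x\<in>V. has_pd h i x (h' x)"
    by (intro bexI[of _ "\<lambda>x. 0"]) (auto intro: has_pd_const)
next
  fix h assume "h \<in> range (\<lambda>(c::real) (x::ell2). c)"
  then show "bounded (h ` V) \<and> F_continuous V h \<and> h \<in> borel_measurable (restrict_space borel V)"
    by (auto intro!: continuous_imp_F_continuous continuous_intros simp: bounded_iff)
qed auto

lemma F_smooth_add:
  assumes V: "open V" and f: "F_smooth V f" and g: "F_smooth V g"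
  shows "F_smooth V (\<lambda>x. f x + g x)"
proof (rule F_smooth_coinduct[OF V, where S="range (\<lambda>is x. partials is f x + partials is g x)"])
  show "(\<lambda>x. f x + g x) \<in> range (\<lambda>is x. partials is f x + partials is g x)"
    by (rule range_eqI[of _ _ "[]"]) simp
next
  fix h assume "h \<in> range (\<lambda>is x. partials is f x + partials is g x)"
  then show "bounded (h ` V) \<and> F_continuous V h \<and> h \<in> borel_measurable (restrict_space borel V)"
    using F_smoothD(2-4)[OF f] F_smoothD(2-4)[OF g]
    by (auto intro!: bounded_plus_comp F_continuous_add)
next
  fix h i assume "h \<in> range (\<lambda>is x. partials is f x + partials is g x)"
  then obtain k where "h = (\<lambda>x. partials k f x + partials k g x)" by auto
  then show "\<exists>h'\<in>range (\<lambda>is x. partials is f x + partials is g x). \<forall>x\<in>V. has_pd h i x (h' x)"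
    using f g by (intro bexI[of _ "\<lambda>x. partials (i # k) f x + partials (i # k) g x"])
      (auto intro!: has_pd_add F_smooth_partials_has_pd simp del: partials.simps)
qed

lemma F_smooth_subset:
  "F_smooth V f \<Longrightarrow> W \<subseteq> V \<Longrightarrow> F_smooth W f"
  unfolding F_smooth_def
  by (meson F_continuous_subset bounded_subset image_mono in_mono measurable_restrict_mono)

lemma restrict_space_measurable_Un:
  fixes f :: "ell2 \<Rightarrow> real"
  assumes "open V" "open W" "f \<in> borel_measurable (restrict_space borel V)" "f \<in> borel_measurable (restrict_space borel W)"
  shows "f \<in> borel_measurable (restrict_space borel (V \<union> W))"
proof -
  have V: "V \<in> sets borel" "W \<in> sets borel" using assms by auto
  have m: "(\<lambda>x. indicator V x *\<^sub>R f x) \<in> borel_measurable borel" "(\<lambda>x. indicator W x *\<^sub>R f x) \<in> borel_measurable borel"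
    using assms V by (simp_all add: borel_measurable_restrict_space_iff)
  have "(\<lambda>x. indicator (V \<union> W) x *\<^sub>R f x) = (\<lambda>x. if x \<in> V then indicator V x *\<^sub>R f x else indicator W x *\<^sub>R f x)"
    by (auto simp: indicator_def)
  also have "\<dots> \<in> borel_measurable borel"
    using V by (intro measurable_If_set m) auto
  finally show ?thesis using V by (simp add: borel_measurable_restrict_space_iff)
qed

lemma F_smooth_Un:
  assumes "open V" "open W" "F_smooth V f" "F_smooth W f"
  shows "F_smooth (V \<union> W) f"
  using assms unfolding F_smooth_def
  by (auto simp: image_Un intro: F_continuous_Un restrict_space_measurable_Un)

lemma F_smooth_cong:
  assumes V: "open V" and eq: "\<And>x. x \<in> V \<Longrightarrow> f x = g x" and f: "F_smooth V f"
  shows "F_smooth V g"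
proof (rule F_smooth_coinduct[OF V, where S="insert g (range (\<lambda>is. partials is f))"])
  fix h assume h: "h \<in> insert g (range (\<lambda>is. partials is f))"
  have "f \<in> borel_measurable (restrict_space borel V) \<longleftrightarrow> g \<in> borel_measurable (restrict_space borel V)"
    by (rule measurable_cong) (auto simp: space_restrict_space eq)
  moreover have "f ` V = g ` V" using eq by auto
  moreover note F_continuous_cong[OF eq]
  ultimately show "bounded (h ` V) \<and> F_continuous V h \<and> h \<in> borel_measurable (restrict_space borel V)"
    using h F_smoothD(2-4)[OF f] F_smoothD(2-4)[OF f, of "[]"] by auto
next
  fix h i assume h: "h \<in> insert g (range (\<lambda>is. partials is f))"
  have "\<forall>x\<in>V. has_pd g i x (partials [i] f x)"
    using has_pd_cong[OF V _ eq] F_smooth_has_pd[OF f] by auto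
  with h F_smooth_partials_has_pd[OF f]
  show "\<exists>h'\<in>insert g (range (\<lambda>is. partials is f)). \<forall>x\<in>V. has_pd h i x (h' x)"
    by blast
qed simp

lemma borel_measurable_restrict_UNIV:
  "f \<in> borel_measurable (restrict_space borel UNIV) \<longleftrightarrow> f \<in> borel_measurable borel" for f :: "ell2 \<Rightarrow> real"
  by (simp add: borel_measurable_restrict_space_iff)

lemma partials_shift: "partials is (\<lambda>x. f (x + v)) = (\<lambda>x. partials is f (x + v))"
  by (induction "is") (auto simp: partial_def algebra_simps)

lemma F_smooth_shift:
  assumes "F_smooth UNIV f" shows "F_smooth UNIV (\<lambda>x. f (x + v))"
proof (rule F_smooth_coinduct[where S="range (\<lambda>is x. partials is f (x + v))"])
  show "(\<lambda>x. f (x + v)) \<in> range (\<lambda>is x. partials is f (x + v))"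
    by (rule range_eqI[of _ _ "[]"]) simp
next
  fix h assume "h \<in> range (\<lambda>is x. partials is f (x + v))"
  then obtain k where h: "h = (\<lambda>x. partials k f (x + v))" by auto
  have "bounded (range h)"
    using F_smoothD(2)[OF assms, of k] unfolding h bounded_iff by auto
  moreover have "F_continuous UNIV h" unfolding F_continuous_iff
  proof (intro ballI allI)
    fix x n
    have "continuous_on {s. (\<forall>i\<ge>n. s i = 0) \<and> (x + v) + (\<Sum>k<n. s k *\<^sub>R basis k) \<in> UNIV}
       (\<lambda>s. partials k f ((x + v) + (\<Sum>k<n. s k *\<^sub>R basis k)))"
      using F_smoothD(3)[OF assms, of k] unfolding F_continuous_iff by blast
    moreover have "h (x + y) = partials k f ((x + v) + y)" for y
      by (simp add: h ac_simps)
    ultimately show "continuous_on {s. (\<forall>i\<ge>n. s i = 0) \<and> x + (\<Sum>k<n. s k *\<^sub>R basis k) \<in> UNIV}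
       (\<lambda>s. h (x + (\<Sum>k<n. s k *\<^sub>R basis k)))" by simp
  qed
  moreover have "h \<in> borel_measurable borel"
    unfolding h
  proof (rule measurable_compose[of "\<lambda>x. x + v" borel borel "partials k f"])
    show "(\<lambda>x. x + v) \<in> borel_measurable borel"
      by (intro borel_measurable_continuous_onI continuous_intros)
    show "partials k f \<in> borel_measurable borel"
      using F_smoothD(4)[OF assms, of k] by (simp add: borel_measurable_restrict_UNIV)
  qed
  ultimately show "bounded (range h) \<and> F_continuous UNIV h \<and> h \<in> borel_measurable (restrict_space borel UNIV)"
    by (simp add: borel_measurable_restrict_UNIV)
next
  fix h i assume "h \<in> range (\<lambda>is x. partials is f (x + v))"
  then obtain k where h: "h = (\<lambda>x. partials k f (x + v))" by auto
  show "\<exists>h'\<in>range (\<lambda>is x. partials is f (x + v)). \<forall>x\<in>UNIV. has_pd h i x (h' x)"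
    unfolding h by (intro bexI[of _ "\<lambda>x. partials (i # k) f (x + v)"])
      (auto intro!: has_pd_shift F_smooth_partials_has_pd[OF assms] simp del: partials.simps)
qed auto

section \<open>Supports well inside an open set, and the test class\<close>

lemma well_inside_closure: "well_inside E V \<Longrightarrow> closure E \<subseteq> V"
proof -
  assume "well_inside E V"
  then obtain \<rho> where r: "\<rho> > 0" "(\<Union>x\<in>E. ball x \<rho>) \<subseteq> V" by (auto simp: well_inside_def)
  show ?thesis
  proof
    fix y assume "y \<in> closure E"
    then obtain x where "x \<in> E" "dist x y < \<rho>" using r closure_approachable by blast
    then have "y \<in> (\<Union>x\<in>E. ball x \<rho>)" by auto
    then show "y \<in> V" using r by blast
  qed
qed

lemma well_inside_mono:
  assumes "E \<subseteq> E'" "well_inside E' V" shows "well_inside E V"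
proof -
  obtain \<rho> R where r: "\<rho> > 0" "(\<Union>x\<in>E'. ball x \<rho>) \<subseteq> V" "R > 0" "E' \<subseteq> ball 0 R"
    using assms(2) by (auto simp: well_inside_def)
  then have "(\<Union>x\<in>E. ball x \<rho>) \<subseteq> V" "E \<subseteq> ball 0 R" using assms(1) by (blast, blast)
  with r show ?thesis unfolding well_inside_def by blast
qed

text \<open>Halving the uniform distance \<open>\<rho>\<close> absorbs the passage to the closure.
  From here on supports are replaced by the plain sets where a function is nonzero.\<close>

lemma well_inside_closure_iff: "well_inside (closure E) V \<longleftrightarrow> well_inside E V"
proof
  assume "well_inside (closure E) V"
  then obtain \<rho> R where r: "\<rho> > 0" "(\<Union>x\<in>closure E. ball x \<rho>) \<subseteq> V" "R > 0" "closure E \<subseteq> ball 0 R"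
    by (auto simp: well_inside_def)
  have "(\<Union>x\<in>E. ball x \<rho>) \<subseteq> V" "E \<subseteq> ball 0 R"
    using r(2,4) closure_subset[of E] by (meson UN_mono order_refl subset_trans)+
  with r show "well_inside E V" unfolding well_inside_def by blast
next
  assume "well_inside E V"
  then obtain \<rho> R where r: "\<rho> > 0" "(\<Union>x\<in>E. ball x \<rho>) \<subseteq> V" "R > 0" "E \<subseteq> ball 0 R" by (auto simp: well_inside_def)
  have "(\<Union>x\<in>closure E. ball x (\<rho>/2)) \<subseteq> V"
  proof
    fix z assume "z \<in> (\<Union>x\<in>closure E. ball x (\<rho>/2))"
    then obtain y where y: "y \<in> closure E" "dist y z < \<rho>/2" by auto
    obtain x where "x \<in> E" "dist x y < \<rho>/2" using y r closure_approachable[of y E] half_gt_zero by blast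
    then have "z \<in> ball x \<rho>" using y dist_triangle[of x z y] by simp
    then show "z \<in> V" using r \<open>x \<in> E\<close> by blast
  qed
  moreover have "closure E \<subseteq> ball 0 (R + 1)"
    using closure_minimal[OF order_trans[OF r(4) ball_subset_cball] closed_cball] by force
  ultimately show "well_inside (closure E) V" unfolding well_inside_def using r
    by (intro exI[of _ "\<rho>/2"] conjI exI[of _ "R+1"]) auto
qed

text \<open>\<open>V\<close> and the complement of \<open>closure E\<close> are open and cover the
  space; on the first the smoothness of \<open>f\<close> is given, on the second \<open>f\<close> is
  0.\<close>

lemma F_smooth_zero_extension:
  assumes "open V" "F_smooth V f" "well_inside E V" "\<And>x. x \<notin> E \<Longrightarrow> f x = 0"
  shows "F_smooth UNIV f"
proof -
  have "F_smooth (- closure E) f"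
    by (rule F_smooth_cong[OF _ _ F_smooth_const[of _ 0]]) (use assms(4) closure_subset in auto)
  then have "F_smooth (V \<union> - closure E) f" using assms by (intro F_smooth_Un) auto
  moreover have "V \<union> - closure E = UNIV" using well_inside_closure[OF assms(3)] by auto
  ultimately show ?thesis by simp
qed

text \<open>The supremum in \<open>C_F0\<close> bounds function and gradient together; taken apart,
  one real constant serves both, and put together again it is doubled.\<close>

lemma grad_bound_iff_ennreal:
  "(\<exists>C. (\<forall>x\<in>V. \<bar>f x\<bar> \<le> C) \<and> grad_bound V f C) \<longleftrightarrow>
   (SUP x\<in>V. ennreal \<bar>f x\<bar> + (\<Sum>i. ennreal ((partial i f x)\<^sup>2))) < \<infinity>"
proof
  assume "\<exists>C. (\<forall>x\<in>V. \<bar>f x\<bar> \<le> C) \<and> grad_bound V f C"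
  then obtain C where C: "\<And>x. x \<in> V \<Longrightarrow> \<bar>f x\<bar> \<le> C" "grad_bound V f C" by blast
  have "(SUP x\<in>V. ennreal \<bar>f x\<bar> + (\<Sum>i. ennreal ((partial i f x)\<^sup>2))) \<le> ennreal C + ennreal C"
  proof (rule SUP_least)
    fix x assume x: "x \<in> V"
    have "(\<Sum>i. ennreal ((partial i f x)\<^sup>2)) \<le> ennreal C"
    proof (rule suminf_le_const)
      fix n show "(\<Sum>i<n. ennreal ((partial i f x)\<^sup>2)) \<le> ennreal C"
        using C(2) x by (simp add: grad_bound_def ennreal_leI)
    qed simp
    then show "ennreal \<bar>f x\<bar> + (\<Sum>i. ennreal ((partial i f x)\<^sup>2)) \<le> ennreal C + ennreal C"
      using C(1)[OF x] by (intro add_mono ennreal_leI)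
  qed
  also have "\<dots> < \<infinity>" by (simp add: ennreal_add_less_top)
  finally show "(SUP x\<in>V. ennreal \<bar>f x\<bar> + (\<Sum>i. ennreal ((partial i f x)\<^sup>2))) < \<infinity>" .
next
  assume *: "(SUP x\<in>V. ennreal \<bar>f x\<bar> + (\<Sum>i. ennreal ((partial i f x)\<^sup>2))) < \<infinity>" (is "?S < _")
  obtain C where C: "?S = ennreal C" "C \<ge> 0"
    using * by (cases ?S rule: ennreal_cases) (simp_all only: less_irrefl infinity_ennreal_def)
  have le: "ennreal \<bar>f x\<bar> + (\<Sum>i. ennreal ((partial i f x)\<^sup>2)) \<le> ennreal C" if "x \<in> V" for x
    unfolding C(1)[symmetric] by (rule SUP_upper[OF that])
  have 1: "\<bar>f x\<bar> \<le> C" if "x \<in> V" for x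
  proof -
    have "ennreal \<bar>f x\<bar> \<le> ennreal C"
      by (rule order_trans[OF add_increasing2[OF zero_le order_refl] le[OF that]])
    then show ?thesis using C by simp
  qed
  moreover have "grad_bound V f C" unfolding grad_bound_def
  proof (intro ballI allI)
    fix x n assume "x \<in> V"
    have "ennreal (\<Sum>i<n. (partial i f x)\<^sup>2) = (\<Sum>i<n. ennreal ((partial i f x)\<^sup>2))" by simp
    also have "\<dots> \<le> (\<Sum>i. ennreal ((partial i f x)\<^sup>2))" by (rule sum_le_suminf) auto
    also have "\<dots> \<le> ennreal C"
      by (rule order_trans[OF add_increasing[OF zero_le order_refl] le[OF \<open>x \<in> V\<close>]])
    finally show "(\<Sum>i<n. (partial i f x)\<^sup>2) \<le> C" using C by simp
  qed
  ultimately show "\<exists>C. (\<forall>x\<in>V. \<bar>f x\<bar> \<le> C) \<and> grad_bound V f C" by blast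
qed

text \<open>\<open>C_F\<close> does not bound the function itself; the supremum condition of
  \<open>C_F0\<close> supplies that bound, which is why the test class fits
  \<open>F_smooth\<close>.\<close>

lemma C_F0_iff:
  "f \<in> C_F0 V \<longleftrightarrow> F_smooth V f \<and> (\<exists>C. grad_bound V f C) \<and> well_inside {x \<in> V. f x \<noteq> 0} V"
proof
  assume f: "f \<in> C_F0 V"
  then obtain C where C: "\<forall>x\<in>V. \<bar>f x\<bar> \<le> C" "grad_bound V f C"
    using grad_bound_iff_ennreal[of V f] unfolding C_F0_def by blast
  have f': "f \<in> C_F V" "well_inside {x \<in> V. f x \<noteq> 0} V"
    using f by (auto simp: C_F0_def well_inside_closure_iff)
  have "bounded (f ` V)" using C by (auto simp: bounded_iff)
  then have "F_smooth V f"
    using f'(1) unfolding F_smooth_def C_F_def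
    by (intro allI, case_tac "is = []") (auto dest: spec[of _ "[]"])
  with C f' show "F_smooth V f \<and> (\<exists>C. grad_bound V f C) \<and> well_inside {x \<in> V. f x \<noteq> 0} V" by blast
next
  assume f: "F_smooth V f \<and> (\<exists>C. grad_bound V f C) \<and> well_inside {x \<in> V. f x \<noteq> 0} V"
  then obtain C where C: "grad_bound V f C" by blast
  obtain b where b: "\<forall>x\<in>V. \<bar>f x\<bar> \<le> b"
    using F_smoothD(2)[of V f "[]"] f by (auto simp: bounded_iff)
  have "(\<forall>x\<in>V. \<bar>f x\<bar> \<le> max b C) \<and> grad_bound V f (max b C)"
    using b C unfolding grad_bound_def by (meson max.cobounded1 max.cobounded2 order_trans)
  then have "(SUP x\<in>V. ennreal \<bar>f x\<bar> + (\<Sum>i. ennreal ((partial i f x)\<^sup>2))) < \<infinity>"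
    using grad_bound_iff_ennreal by blast
  moreover have "f \<in> C_F V"
    using f F_smoothD(3,4)[of V f "[]"] unfolding F_smooth_def C_F_def by auto
  ultimately show "f \<in> C_F0 V" using f by (auto simp: C_F0_def well_inside_closure_iff)
qed

lemma F_smooth_imp_C_Fb:
  assumes "F_smooth V f" shows "f \<in> C_Fb V"
proof -
  have "f \<in> C_F V"
    using assms F_smoothD(3,4)[OF assms, of "[]"] unfolding F_smooth_def C_F_def by auto
  moreover have "bdd_above ((\<lambda>x. \<bar>f x\<bar> + \<bar>partials is f x\<bar>) ` V)" for "is"
  proof -
    obtain b c where "\<And>x. x \<in> V \<Longrightarrow> \<bar>f x\<bar> \<le> b" "\<And>x. x \<in> V \<Longrightarrow> \<bar>partials is f x\<bar> \<le> c"
      using F_smoothD(2)[OF assms, of "[]"] F_smoothD(2)[OF assms, of "is"] by (auto simp: bounded_iff)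
    then show ?thesis by (intro bdd_aboveI[of _ "b + c"]) (auto intro: add_mono)
  qed
  ultimately show ?thesis by (simp add: C_Fb_def)
qed

lemma partial_mult:
  "F_smooth V f \<Longrightarrow> F_smooth V g \<Longrightarrow> x \<in> V \<Longrightarrow>
   partial i (\<lambda>x. f x * g x) x = partial i f x * g x + f x * partial i g x"
  by (intro has_pd_imp_partial has_pd_mult F_smooth_has_pd)

lemma sq_sum_le: "(a + b)\<^sup>2 \<le> 2 * a\<^sup>2 + 2 * (b::real)\<^sup>2"
  using sum_squares_bound[of a b] by (simp add: power2_sum)

lemma grad_bound_mult:
  assumes "F_smooth V f" "F_smooth V g" "grad_bound V f C" "grad_bound V g D"
  shows "\<exists>C. grad_bound V (\<lambda>x. f x * g x) C"
proof -
  obtain b c where b: "\<And>x. x \<in> V \<Longrightarrow> \<bar>f x\<bar> \<le> b" and c: "\<And>x. x \<in> V \<Longrightarrow> \<bar>g x\<bar> \<le> c"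
    using F_smoothD(2)[OF assms(1), of "[]"] F_smoothD(2)[OF assms(2), of "[]"] by (auto simp: bounded_iff)
  have "(\<Sum>i<n. (partial i (\<lambda>x. f x * g x) x)\<^sup>2) \<le> 2 * c\<^sup>2 * C + 2 * b\<^sup>2 * D" if "x \<in> V" for x n
  proof -
    have "(\<Sum>i<n. (partial i (\<lambda>x. f x * g x) x)\<^sup>2)
       \<le> (\<Sum>i<n. 2 * (g x)\<^sup>2 * (partial i f x)\<^sup>2 + 2 * (f x)\<^sup>2 * (partial i g x)\<^sup>2)"
      unfolding partial_mult[OF assms(1,2) that]
      by (intro sum_mono order_trans[OF sq_sum_le]) (simp add: power_mult_distrib)
    also have "\<dots> = 2 * (g x)\<^sup>2 * (\<Sum>i<n. (partial i f x)\<^sup>2) + 2 * (f x)\<^sup>2 * (\<Sum>i<n. (partial i g x)\<^sup>2)"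
      by (simp add: sum.distrib sum_distrib_left)
    also have "\<dots> \<le> 2 * c\<^sup>2 * C + 2 * b\<^sup>2 * D"
      using assms(3,4) that b[OF that] c[OF that] unfolding grad_bound_def
      by (intro add_mono mult_mono sum_nonneg) (auto simp: abs_le_square_iff[symmetric])
    finally show ?thesis .
  qed
  then show ?thesis unfolding grad_bound_def by blast
qed

text \<open>Two uses: \<open>W = V\<close> for multiplication inside one domain, and
  \<open>V = UNIV\<close> for carrying a weak derivative from \<open>W\<close> to the whole
  space.\<close>

lemma C_F0_mult:
  assumes "open V" "open W" "\<phi> \<in> C_F0 V" "W \<subseteq> V" "F_smooth W \<psi>" "grad_bound W \<psi> C"
    and "well_inside {x \<in> W. \<psi> x * \<phi> x \<noteq> 0} W"
  shows "(\<lambda>x. \<psi> x * \<phi> x) \<in> C_F0 W"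
proof -
  obtain D where D: "grad_bound V \<phi> D" using assms(3) C_F0_iff by blast
  have "F_smooth W \<phi>" "grad_bound W \<phi> D"
    using assms(3,4) D F_smooth_subset by (auto simp: C_F0_iff grad_bound_def)
  then show ?thesis
    unfolding C_F0_iff using assms by (auto intro: F_smooth_mult grad_bound_mult)
qed

section \<open>Smoothing Lipschitz functions\<close>

definition avg :: "real \<Rightarrow> nat \<Rightarrow> (ell2 \<Rightarrow> real) \<Rightarrow> ell2 \<Rightarrow> real"
  where "avg e i h x = integral {-e..e} (\<lambda>r. h (x + r *\<^sub>R basis i)) / (2 * e)"

lemma continuous_on_line:
  assumes "continuous_on UNIV (h::ell2 \<Rightarrow> real)"
  shows "continuous_on A (\<lambda>r. h (x + r *\<^sub>R basis i))"
  by (rule continuous_on_compose2[OF assms]) (auto intro!: continuous_intros)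

lemma integrable_on_line:
  assumes "continuous_on UNIV (h::ell2 \<Rightarrow> real)"
  shows "(\<lambda>r. h (x + r *\<^sub>R basis i)) integrable_on {a..b}"
  by (intro integrable_continuous_real continuous_on_line assms)

lemma avg_between:
  assumes h: "continuous_on UNIV h" and e: "e > 0"
    and "\<And>r. \<bar>r\<bar> \<le> e \<Longrightarrow> l \<le> h (x + r *\<^sub>R basis i) \<and> h (x + r *\<^sub>R basis i) \<le> u"
  shows "l \<le> avg e i h x \<and> avg e i h x \<le> u"
proof -
  have "integral {-e..e} (\<lambda>r. l) \<le> integral {-e..e} (\<lambda>r. h (x + r *\<^sub>R basis i))"
    "integral {-e..e} (\<lambda>r. h (x + r *\<^sub>R basis i)) \<le> integral {-e..e} (\<lambda>r. u)"
    by (intro integral_le integrable_on_line h; use assms(3) in force)+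
  with e show ?thesis by (simp add: avg_def field_simps)
qed

lemma avg_diff:
  assumes "continuous_on UNIV f" "continuous_on UNIV g"
  shows "avg e i (\<lambda>x. f x - g x) x = avg e i f x - avg e i g x"
  unfolding avg_def by (subst integral_diff) (auto intro: integrable_on_line assms simp: diff_divide_distrib)

lemma avg_dist:
  assumes "continuous_on UNIV f" "continuous_on UNIV g" "e > 0" "\<And>x. \<bar>f x - g x\<bar> \<le> C"
  shows "\<bar>avg e i f x - avg e i g x\<bar> \<le> C"
proof -
  have "- C \<le> avg e i (\<lambda>x. f x - g x) x \<and> avg e i (\<lambda>x. f x - g x) x \<le> C"
  proof (rule avg_between)
    show "- C \<le> f y - g y \<and> f y - g y \<le> C" for y
      using assms(4)[of y] by linarith
  qed (auto intro!: continuous_intros assms(1-3))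
  then show ?thesis using assms by (simp add: avg_diff abs_le_iff)
qed

lemma avg_shift: "avg e i (\<lambda>x. h (x + v)) x = avg e i h (x + v)"
  by (simp add: avg_def algebra_simps)

lemma continuous_on_shift:
  assumes "continuous_on UNIV (h::ell2 \<Rightarrow> real)"
  shows "continuous_on UNIV (\<lambda>x. h (x + v))"
  by (rule continuous_on_compose2[OF assms]) (auto intro!: continuous_intros)

lemma avg_shift_bound:
  assumes "continuous_on UNIV h" "e > 0" "\<And>x. \<bar>h (x + v) - h x\<bar> \<le> C"
  shows "\<bar>avg e i h (x + v) - avg e i h x\<bar> \<le> C"
  using avg_dist[OF continuous_on_shift[OF assms(1)] assms(1,2), of v C i x] assms(3) by (simp add: avg_shift)

lemma lipschitz_iff_shift:
  "L-lipschitz_on UNIV (h::ell2 \<Rightarrow> real) \<longleftrightarrow> L \<ge> 0 \<and> (\<forall>v x. \<bar>h (x + v) - h x\<bar> \<le> L * norm v)"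
proof
  assume *: "L-lipschitz_on UNIV h"
  show "L \<ge> 0 \<and> (\<forall>v x. \<bar>h (x + v) - h x\<bar> \<le> L * norm v)"
  proof (intro conjI allI)
    fix v x
    show "\<bar>h (x + v) - h x\<bar> \<le> L * norm v"
      using lipschitz_onD[OF *, of "x + v" x] by (simp add: dist_norm)
  qed (rule lipschitz_on_nonneg[OF *])
next
  assume *: "L \<ge> 0 \<and> (\<forall>v x. \<bar>h (x + v) - h x\<bar> \<le> L * norm v)"
  show "L-lipschitz_on UNIV h"
  proof (rule lipschitz_onI)
    fix x y
    show "dist (h x) (h y) \<le> L * dist x y"
      using *[THEN conjunct2, rule_format, of y "x - y"] by (simp add: dist_norm)
  qed (use * in simp)
qed

lemma avg_lipschitz:
  assumes "L-lipschitz_on UNIV h" "e > 0" shows "L-lipschitz_on UNIV (avg e i h)"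
  using assms avg_shift_bound[OF lipschitz_on_continuous_on[OF assms(1)] assms(2)]
  by (simp add: lipschitz_iff_shift)

lemma avg_near:
  assumes "L-lipschitz_on UNIV h" "e > 0" shows "\<bar>avg e i h x - h x\<bar> \<le> L * e"
proof -
  have "h x - L * e \<le> avg e i h x \<and> avg e i h x \<le> h x + L * e"
  proof (rule avg_between[OF lipschitz_on_continuous_on[OF assms(1)] assms(2)])
    fix r assume "\<bar>r\<bar> \<le> e"
    then have "L * norm (r *\<^sub>R basis i) \<le> L * e"
      using assms by (intro mult_left_mono) (auto simp: lipschitz_on_def)
    moreover have "\<bar>h (x + r *\<^sub>R basis i) - h x\<bar> \<le> L * norm (r *\<^sub>R basis i)"
      using assms unfolding lipschitz_iff_shift by blast
    ultimately show "h x - L * e \<le> h (x + r *\<^sub>R basis i) \<and> h (x + r *\<^sub>R basis i) \<le> h x + L * e" by linarith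
  qed
  then show ?thesis by linarith
qed

text \<open>Fubini for a continuous integrand on a rectangle. Commutation is what allows any chosen
  average to be treated as the outermost one.\<close>

lemma avg_commute:
  assumes "continuous_on UNIV h"
  shows "avg d i (avg e j h) x = avg e j (avg d i h) x"
proof -
  let ?f = "\<lambda>r s. h (x + r *\<^sub>R basis i + s *\<^sub>R basis j)"
  have "continuous_on (cbox (-d,-e) (d,e)) (\<lambda>(r,s). ?f r s)"
    unfolding case_prod_beta
    by (rule continuous_on_compose2[OF assms]) (auto intro!: continuous_intros)
  from integral_swap_continuous[OF this]
  have "integral {-d..d} (\<lambda>r. integral {-e..e} (?f r)) = integral {-e..e} (\<lambda>s. integral {-d..d} (\<lambda>r. ?f r s))"
    by simp
  then show ?thesis
    unfolding avg_def integral_divide by (simp add: ac_simps)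
qed

text \<open>The fundamental theorem of calculus at both ends of the segment. The derivative involves
  only translates of \<open>h\<close>, so one averaging buys one derivative from mere
  continuity.\<close>

lemma has_pd_avg:
  assumes h: "continuous_on UNIV h" and e: "e > 0"
  shows "has_pd (avg e i h) i x ((h (x + e *\<^sub>R basis i) - h (x - e *\<^sub>R basis i)) / (2 * e))"
proof -
  let ?u = "\<lambda>r. h (x + r *\<^sub>R basis i)"
  \<comment> \<open>The lower limit lies one unit beyond \<open>-e\<close>, so that both endpoints
    \<open>t - e\<close> and \<open>t + e\<close> are interior for
    \<open>\<bar>t\<bar> < 1\<close>.\<close>
  let ?F = "\<lambda>t. integral {-e-1..t} ?u"
  have F: "(?F has_real_derivative ?u t) (at t)" if "t \<in> {-e-1<..<e+1}" for t
  proof -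
    have "(?F has_real_derivative ?u t) (at t within {-e-1..e+1})"
      by (rule integral_has_real_derivative) (use that in \<open>auto intro: continuous_on_line h\<close>)
    then show ?thesis using that at_within_interior[of t "{-e-1..e+1}"] by simp
  qed
  have "((\<lambda>t. ?F (t + e)) has_real_derivative ?u e) (at 0)"
    using DERIV_shift[of ?F "?u e" 0 e] F[of e] e by simp
  moreover have "((\<lambda>t. ?F (t + - e)) has_real_derivative ?u (-e)) (at 0)"
    using DERIV_shift[of ?F "?u (-e)" 0 "-e"] F[of "-e"] e by simp
  ultimately have D: "((\<lambda>t. (?F (t + e) - ?F (t + - e)) / (2 * e)) has_real_derivative (?u e - ?u (-e)) / (2 * e)) (at 0)"
    by (intro DERIV_cdivide DERIV_diff)
  have eq: "avg e i h (x + t *\<^sub>R basis i) = (?F (t + e) - ?F (t + - e)) / (2 * e)" if "\<bar>t\<bar> < 1" for t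
  proof -
    have "integral {-e..e} (?u \<circ> (\<lambda>r. r + t)) = integral {-e+t..e+t} ?u"
      by (rule integral_shift) (intro continuous_on_line h)
    moreover have "?F (t + - e) + integral {-e+t..e+t} ?u = ?F (t + e)"
      using Henstock_Kurzweil_Integration.integral_combine[of "-e-1" "-e+t" "e+t" ?u] e that
        integrable_on_line[OF h] by (simp add: ac_simps)
    moreover have "?u \<circ> (\<lambda>r. r + t) = (\<lambda>r. h (x + t *\<^sub>R basis i + r *\<^sub>R basis i))"
      by (auto simp: algebra_simps)
    ultimately show ?thesis by (simp add: avg_def)
  qed
  have "eventually (\<lambda>t. t \<in> {-1<..<1::real}) (nhds 0)" by (rule eventually_nhds_in_open) auto
  then have "eventually (\<lambda>t. avg e i h (x + t *\<^sub>R basis i) = (?F (t + e) - ?F (t + - e)) / (2 * e)) (nhds 0)"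
    by eventually_elim (rule eq, auto)
  then show ?thesis unfolding has_pd_def
    using D by (subst DERIV_cong_ev[OF refl _ refl]) simp_all
qed

definition avg_dir :: "nat \<Rightarrow> nat" where "avg_dir n = fst (prod_decode n)"

text \<open>The widths sum to \<open>e\<close>, so all averages together reach no farther than
  distance \<open>e\<close>; the geometric decay gives the rate of convergence.\<close>

definition avg_width :: "real \<Rightarrow> nat \<Rightarrow> real" where "avg_width e n = e / 2 ^ Suc n"

text \<open>Every direction occurs infinitely often, which gives the limit derivatives of all orders
  in it. The averages commute, so that one of them can be moved out of the limit and its index
  into the set \<open>D\<close> of those left out.\<close>

fun avgs :: "real \<Rightarrow> nat set \<Rightarrow> nat \<Rightarrow> (ell2 \<Rightarrow> real) \<Rightarrow> ell2 \<Rightarrow> real" where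
  "avgs e D 0 h = h"
| "avgs e D (Suc n) h = (if n \<in> D then avgs e D n h
     else avg (avg_width e n) (avg_dir n) (avgs e D n h))"

definition smoothing :: "real \<Rightarrow> nat set \<Rightarrow> (ell2 \<Rightarrow> real) \<Rightarrow> ell2 \<Rightarrow> real"
  where "smoothing e D h x = lim (\<lambda>N. avgs e D N h x)"

lemma avg_width_pos: "e > 0 \<Longrightarrow> avg_width e n > 0"
  by (simp add: avg_width_def)

lemma avgs_lipschitz:
  "L-lipschitz_on UNIV h \<Longrightarrow> e > 0 \<Longrightarrow> L-lipschitz_on UNIV (avgs e D n h)"
  by (induction n) (auto intro: avg_lipschitz avg_width_pos)

lemma avgs_shift_bound:
  assumes "L-lipschitz_on UNIV h" "e > 0" "\<And>x. \<bar>h (x + v) - h x\<bar> \<le> C"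
  shows "\<bar>avgs e D n h (x + v) - avgs e D n h x\<bar> \<le> C"
proof (induction n arbitrary: x)
  case (Suc n)
  then show ?case
    using avg_shift_bound[OF lipschitz_on_continuous_on[OF avgs_lipschitz[OF assms(1,2)]] avg_width_pos[OF assms(2)]]
    by simp
qed (use assms in simp)

lemma sum_avg_width: "(\<Sum>k<N. avg_width e k) = e - e / 2 ^ N"
  by (induction N) (auto simp: avg_width_def field_simps)

text \<open>Locality: after \<open>n\<close> averages a value depends only on \<open>h\<close>
  within the sum of the first \<open>n\<close> widths. Plateaus of \<open>h\<close> therefore
  survive, which is how cutoffs stay equal to 1 and 0 where required.\<close>

lemma avgs_between:
  assumes "L-lipschitz_on UNIV h" "e > 0"
    and "\<And>y. y \<in> cball x (\<Sum>k<n. avg_width e k) \<Longrightarrow> l \<le> h y \<and> h y \<le> u"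
  shows "l \<le> avgs e D n h x \<and> avgs e D n h x \<le> u"
  using assms(3)
proof (induction n arbitrary: x)
  case (Suc n)
  have w: "avg_width e n > 0" using assms by (simp add: avg_width_pos)
  have *: "l \<le> avgs e D n h (x + r *\<^sub>R basis (avg_dir n)) \<and> avgs e D n h (x + r *\<^sub>R basis (avg_dir n)) \<le> u"
    if "\<bar>r\<bar> \<le> avg_width e n" for r
  proof (rule Suc.IH)
    fix y assume y: "y \<in> cball (x + r *\<^sub>R basis (avg_dir n)) (\<Sum>k<n. avg_width e k)"
    have "dist x y \<le> dist x (x + r *\<^sub>R basis (avg_dir n)) + dist (x + r *\<^sub>R basis (avg_dir n)) y"
      by (rule dist_triangle)
    also have "dist x (x + r *\<^sub>R basis (avg_dir n)) = \<bar>r\<bar>" by (simp add: dist_norm)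
    finally have "y \<in> cball x (\<Sum>k<Suc n. avg_width e k)" using y that by simp
    then show "l \<le> h y \<and> h y \<le> u" by (rule Suc.prems)
  qed
  show ?case
    using avg_between[OF lipschitz_on_continuous_on[OF avgs_lipschitz[OF assms(1,2)]] w *] *[of 0] w
    by simp
qed simp

text \<open>Telescoping leaves exactly \<open>C / 2 ^ n - C / 2 ^ (n + k)\<close>, which is at once
  the Cauchy estimate and the error bound.\<close>

lemma geometric_steps_converge:
  fixes a :: "nat \<Rightarrow> real"
  assumes "\<And>n. \<bar>a (Suc n) - a n\<bar> \<le> C / 2 ^ Suc n"
  shows "a \<longlonglongrightarrow> lim a" "\<bar>a n - lim a\<bar> \<le> C / 2 ^ n"
proof -
  have "0 \<le> C / 2 ^ Suc 0" by (rule order_trans[OF abs_ge_zero assms[of 0]])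
  then have C: "C \<ge> 0" by (simp add: zero_le_divide_iff)
  have le: "\<bar>a (n + k) - a n\<bar> \<le> C / 2 ^ n - C / 2 ^ (n + k)" for n k
  proof (induction k)
    case (Suc k)
    have "\<bar>a (n + Suc k) - a n\<bar> \<le> \<bar>a (Suc (n + k)) - a (n + k)\<bar> + \<bar>a (n + k) - a n\<bar>" by simp
    also have "\<dots> \<le> C / 2 ^ Suc (n + k) + (C / 2 ^ n - C / 2 ^ (n + k))"
      by (intro add_mono assms Suc)
    also have "\<dots> = C / 2 ^ n - C / 2 ^ (n + Suc k)" by (simp add: field_simps)
    finally show ?case .
  qed simp
  have le': "\<bar>a m - a n\<bar> \<le> C / 2 ^ n" if "m \<ge> n" for m n
    using le[of n "m - n"] that C by (auto intro: order_trans)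
  have "Cauchy a"
  proof (rule metric_CauchyI)
    fix d :: real assume "d > 0"
    have "(\<lambda>n. C * (1/2) ^ n) \<longlonglongrightarrow> C * 0" by (intro tendsto_intros LIMSEQ_power_zero) simp
    then have "eventually (\<lambda>n. C * (1/2) ^ n < d / 2) sequentially"
      by (rule order_tendstoD(2)) (use \<open>d > 0\<close> in simp)
    then obtain N where N: "C / 2 ^ N < d / 2"
      by (auto simp: eventually_sequentially power_divide)
    show "\<exists>M. \<forall>m\<ge>M. \<forall>n\<ge>M. dist (a m) (a n) < d"
    proof (intro exI[of _ N] allI impI)
      fix m n assume "m \<ge> N" "n \<ge> N"
      then show "dist (a m) (a n) < d" using le'[of N m] le'[of N n] N unfolding dist_real_def by linarith
    qed
  qed
  then show lim: "a \<longlonglongrightarrow> lim a" using convergent_LIMSEQ_iff real_Cauchy_convergent by blast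
  have "(\<lambda>m. \<bar>a n - a m\<bar>) \<longlonglongrightarrow> \<bar>a n - lim a\<bar>" by (intro tendsto_intros lim)
  then show "\<bar>a n - lim a\<bar> \<le> C / 2 ^ n"
    by (rule LIMSEQ_le_const2) (intro exI[of _ n] allI impI, subst abs_minus_commute, erule le')
qed

lemma
  assumes "L-lipschitz_on UNIV h" "e > 0"
  shows avgs_tendsto: "(\<lambda>N. avgs e D N h x) \<longlonglongrightarrow> smoothing e D h x"
    and avgs_dist: "\<bar>avgs e D N h x - smoothing e D h x\<bar> \<le> L * e / 2 ^ N"
proof -
  have L: "L \<ge> 0" using assms by (simp add: lipschitz_on_def)
  have *: "\<bar>avgs e D (Suc n) h x - avgs e D n h x\<bar> \<le> (L * e) / 2 ^ Suc n" for n
  proof -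
    have "\<bar>avg (avg_width e n) (avg_dir n) (avgs e D n h) x - avgs e D n h x\<bar> \<le> L * avg_width e n"
      by (rule avg_near[OF avgs_lipschitz[OF assms] avg_width_pos[OF assms(2)]])
    then show ?thesis using L assms(2) by (simp add: avg_width_def)
  qed
  show "(\<lambda>N. avgs e D N h x) \<longlonglongrightarrow> smoothing e D h x" "\<bar>avgs e D N h x - smoothing e D h x\<bar> \<le> L * e / 2 ^ N"
    unfolding smoothing_def by (rule geometric_steps_converge[of "\<lambda>N. avgs e D N h x", OF *])+
qed

lemma smoothing_shift_bound:
  assumes "L-lipschitz_on UNIV h" "e > 0" "\<And>x. \<bar>h (x + v) - h x\<bar> \<le> C"
  shows "\<bar>smoothing e D h (x + v) - smoothing e D h x\<bar> \<le> C"
proof (rule LIMSEQ_le_const2)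
  show "(\<lambda>n. \<bar>avgs e D n h (x + v) - avgs e D n h x\<bar>) \<longlonglongrightarrow> \<bar>smoothing e D h (x + v) - smoothing e D h x\<bar>"
    by (intro tendsto_intros avgs_tendsto[OF assms(1,2)])
qed (use avgs_shift_bound[OF assms] in blast)

lemma smoothing_lipschitz:
  assumes "L-lipschitz_on UNIV h" "e > 0" shows "L-lipschitz_on UNIV (smoothing e D h)"
  using assms smoothing_shift_bound[OF assms] by (simp add: lipschitz_iff_shift)

lemma smoothing_between:
  assumes "L-lipschitz_on UNIV h" "e > 0"
    and "\<And>y. y \<in> cball x e \<Longrightarrow> l \<le> h y \<and> h y \<le> u"
  shows "l \<le> smoothing e D h x \<and> smoothing e D h x \<le> u"
proof -
  have "l \<le> avgs e D n h x \<and> avgs e D n h x \<le> u" for n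
  proof (rule avgs_between[OF assms(1,2)])
    fix y assume "y \<in> cball x (\<Sum>k<n. avg_width e k)"
    then have "y \<in> cball x e" using assms(2) by (auto simp: sum_avg_width intro: order_trans)
    then show "l \<le> h y \<and> h y \<le> u" by (rule assms(3))
  qed
  then show ?thesis
    using avgs_tendsto[OF assms(1,2), of D x] LIMSEQ_le_const LIMSEQ_le_const2 by meson
qed

text \<open>Once applied, the average with index \<open>n\<close> is pushed outward past each later
  one by commutation.\<close>

lemma avgs_insert:
  assumes "L-lipschitz_on UNIV h" "e > 0" "n \<notin> D"
  shows "avgs e D (Suc n + k) h = avg (avg_width e n) (avg_dir n) (avgs e (insert n D) (Suc n + k) h)"
proof (induction k)
  case 0
  have "avgs e (insert n D) m h = avgs e D m h" if "m \<le> n" for m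
    using that by (induction m) auto
  then show ?case using assms by simp
next
  case (Suc k)
  let ?m = "Suc n + k"
  have "avg d i (avg d' j (avgs e (insert n D) ?m h)) = avg d' j (avg d i (avgs e (insert n D) ?m h))" for d d' i j
    by (intro ext avg_commute lipschitz_on_continuous_on[OF avgs_lipschitz[OF assms(1,2)]])
  moreover have "avgs e D (Suc ?m) h = (if ?m \<in> D then avgs e D ?m h
     else avg (avg_width e ?m) (avg_dir ?m) (avgs e D ?m h))"
   "avgs e (insert n D) (Suc ?m) h = (if ?m \<in> D then avgs e (insert n D) ?m h
     else avg (avg_width e ?m) (avg_dir ?m) (avgs e (insert n D) ?m h))" by simp_all
  ultimately show ?case using Suc by (simp only: add_Suc_right split: if_split) metis
qed

text \<open>Limit of \<open>avgs_insert\<close>: the convergence is uniform with rate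
  \<open>L * e / 2 ^ N\<close>, and \<open>avg\<close> does not increase uniform distances. It
  exposes one average of the limit, ready to be differentiated.\<close>

lemma smoothing_insert:
  assumes "L-lipschitz_on UNIV h" "e > 0" "n \<notin> D"
  shows "smoothing e D h = avg (avg_width e n) (avg_dir n) (smoothing e (insert n D) h)"
proof
  fix x
  let ?A = "avg (avg_width e n) (avg_dir n)"
  have c: "continuous_on UNIV (avgs e (insert n D) m h)" "continuous_on UNIV (smoothing e (insert n D) h)" for m
    using avgs_lipschitz[OF assms(1,2)] smoothing_lipschitz[OF assms(1,2)] lipschitz_on_continuous_on by blast+
  have lim: "(\<lambda>k. avgs e D (k + Suc n) h x) \<longlonglongrightarrow> smoothing e D h x"
    using avgs_tendsto[OF assms(1,2)] by (rule LIMSEQ_ignore_initial_segment)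
  have bd: "\<bar>avgs e D (k + Suc n) h x - ?A (smoothing e (insert n D) h) x\<bar> \<le> (L * e) * (1/2) ^ (k + Suc n)" for k
  proof -
    have "avgs e D (k + Suc n) h = ?A (avgs e (insert n D) (k + Suc n) h)"
      using avgs_insert[OF assms, of k] by (simp only: add.commute)
    moreover have "\<bar>?A (avgs e (insert n D) (k + Suc n) h) x - ?A (smoothing e (insert n D) h) x\<bar> \<le> L * e / 2 ^ (k + Suc n)"
      by (rule avg_dist[OF c avg_width_pos[OF assms(2)]]) (rule avgs_dist[OF assms(1,2)])
    ultimately show ?thesis by (simp add: power_divide)
  qed
  have "(\<lambda>k. (L * e) * (1/2) ^ (k + Suc n)) \<longlonglongrightarrow> (L * e) * 0"
    by (intro tendsto_intros LIMSEQ_ignore_initial_segment[where f="\<lambda>k. (1/2) ^ k"] LIMSEQ_power_zero) simp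
  then have "(\<lambda>k. (L * e) * (1/2) ^ (k + Suc n)) \<longlonglongrightarrow> 0" by (simp only: mult_zero_right)
  from Lim_null_comparison[OF always_eventually this,
      of "\<lambda>k. avgs e D (k + Suc n) h x - ?A (smoothing e (insert n D) h) x"]
  have "(\<lambda>k. avgs e D (k + Suc n) h x - ?A (smoothing e (insert n D) h) x) \<longlonglongrightarrow> 0"
    using bd unfolding real_norm_def by blast
  then have "(\<lambda>k. avgs e D (k + Suc n) h x) \<longlonglongrightarrow> ?A (smoothing e (insert n D) h) x"
    by (simp add: LIM_zero_iff)
  then show "smoothing e D h x = ?A (smoothing e (insert n D) h) x"
    using lim LIMSEQ_unique by blast
qed

text \<open>Coinduction family for the smoothing: each derivative omits one more average and forms a
  difference of two translates, so finite omission sets and finite linear combinations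
  suffice.\<close>

inductive_set smoothings :: "real \<Rightarrow> (ell2 \<Rightarrow> real) \<Rightarrow> (ell2 \<Rightarrow> real) set" for e h where
  base: "finite D \<Longrightarrow> (\<lambda>x. c * smoothing e D h (x + v)) \<in> smoothings e h"
| add: "f \<in> smoothings e h \<Longrightarrow> g \<in> smoothings e h \<Longrightarrow> (\<lambda>x. f x + g x) \<in> smoothings e h"

lemma smoothings_step:
  assumes "L-lipschitz_on UNIV h" "e > 0" "f \<in> smoothings e h"
  shows "\<exists>f'\<in>smoothings e h. \<forall>x\<in>UNIV. has_pd f i x (f' x)"
  using assms(3)
proof induction
  case (base D c v)
  \<comment> \<open>Direction \<open>i\<close> is averaged at infinitely many indices while
    \<open>D\<close> is finite; one such index is still available for differentiation.\<close>
  have "infinite (range (\<lambda>j. prod_encode (i, j)))"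
    by (rule range_inj_infinite) (auto simp: inj_on_def)
  then obtain n where "n \<notin> D" "n \<in> range (\<lambda>j. prod_encode (i, j))"
    using base by (meson finite_subset subsetI)
  then have n: "n \<notin> D" "avg_dir n = i" by (auto simp: avg_dir_def)
  let ?s = "smoothing e (insert n D) h" and ?w = "avg_width e n"
  have c: "continuous_on UNIV ?s" using smoothing_lipschitz[OF assms(1,2)] lipschitz_on_continuous_on by blast
  let ?f' = "\<lambda>x. c / (2 * ?w) * ?s (x + (v + ?w *\<^sub>R basis i)) + - c / (2 * ?w) * ?s (x + (v - ?w *\<^sub>R basis i))"
  have "?f' \<in> smoothings e h"
    by (intro smoothings.intros) (use base in auto)
  moreover have "has_pd (\<lambda>x. c * smoothing e D h (x + v)) i x (?f' x)" for x
  proof -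
    have "has_pd (smoothing e D h) i (x + v) ((?s (x + v + ?w *\<^sub>R basis i) - ?s (x + v - ?w *\<^sub>R basis i)) / (2 * ?w))"
      using has_pd_avg[OF c avg_width_pos[OF assms(2)]] smoothing_insert[OF assms(1,2) n(1)] n(2) by simp
    from has_pd_mult[OF has_pd_const has_pd_shift[OF this], of c]
    show ?thesis by (simp add: algebra_simps diff_divide_distrib)
  qed
  ultimately show ?case by (intro bexI[of _ ?f']) simp_all
next
  case (add f g)
  then obtain f' g' where "f' \<in> smoothings e h" "\<forall>x\<in>UNIV. has_pd f i x (f' x)"
        "g' \<in> smoothings e h" "\<forall>x\<in>UNIV. has_pd g i x (g' x)" by blast
  then show ?case
    by (intro bexI[of _ "\<lambda>x. f' x + g' x"]) (auto intro: has_pd_add smoothings.add)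
qed

text \<open>The third property is stated for each vector \<open>v\<close> separately and not as a
  Lipschitz constant: the weighted cutoff needs bounds in two different norms from the same
  smoothing.\<close>

lemma Lipschitz_smoothing:
  assumes h: "L-lipschitz_on UNIV (h::ell2 \<Rightarrow> real)" "bounded (range h)" and e: "e > 0"
  obtains g where "F_smooth UNIV g" "\<And>is. continuous_on UNIV (partials is g)"
    "\<And>v C x. (\<And>x. \<bar>h (x + v) - h x\<bar> \<le> C) \<Longrightarrow> \<bar>g (x + v) - g x\<bar> \<le> C"
    "\<And>x l u. (\<And>y. y \<in> cball x e \<Longrightarrow> l \<le> h y \<and> h y \<le> u) \<Longrightarrow> l \<le> g x \<and> g x \<le> u"
proof
  let ?S = "smoothings e h" and ?g = "smoothing e {} h"
  obtain B where B: "\<And>x. \<bar>h x\<bar> \<le> B" using h(2) by (auto simp: bounded_iff)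
  have g: "?g \<in> ?S" using smoothings.base[of "{}" 1 e h 0] by simp
  have c: "continuous_on UNIV f \<and> bounded (range f)" if "f \<in> ?S" for f
    using that
  proof induction
    case (base D c v)
    have "continuous_on UNIV (smoothing e D h)"
      using smoothing_lipschitz[OF h(1) e] lipschitz_on_continuous_on by blast
    moreover have "\<bar>c * smoothing e D h (x + v)\<bar> \<le> \<bar>c\<bar> * B" for x
    proof -
      have "- B \<le> smoothing e D h (x + v) \<and> smoothing e D h (x + v) \<le> B"
        by (rule smoothing_between[OF h(1) e]) (metis B abs_le_iff minus_le_iff)
      then show ?thesis by (simp add: abs_mult mult_left_mono abs_le_iff)
    qed
    ultimately show ?case
      by (auto intro!: continuous_intros continuous_on_shift simp: bounded_iff)
  qed (auto intro!: continuous_intros bounded_plus_comp)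
  note step = smoothings_step[OF h(1) e]
  show "F_smooth UNIV ?g"
  proof (rule F_smooth_coinduct[OF open_UNIV g _ step])
    fix f assume "f \<in> ?S"
    then show "bounded (range f) \<and> F_continuous UNIV f \<and> f \<in> borel_measurable (restrict_space borel UNIV)"
      using c by (auto simp: borel_measurable_restrict_UNIV intro: continuous_imp_F_continuous borel_measurable_continuous_onI)
  qed
  show "continuous_on UNIV (partials is ?g)" for "is"
  proof -
    obtain f where "f \<in> ?S" "\<forall>x\<in>UNIV. partials is ?g x = f x"
      using partials_coinduct[OF open_UNIV g step] by blast
    then have "partials is ?g = f" by auto
    then show ?thesis using c \<open>f \<in> ?S\<close> by simp
  qed
  show "\<bar>?g (x + v) - ?g x\<bar> \<le> C" if "\<And>x. \<bar>h (x + v) - h x\<bar> \<le> C" for x v C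
    using smoothing_shift_bound[OF h(1) e that] .
  show "l \<le> ?g x \<and> ?g x \<le> u" if "\<And>y. y \<in> cball x e \<Longrightarrow> l \<le> h y \<and> h y \<le> u" for x l u
    using smoothing_between[OF h(1) e that] .
qed

section \<open>Gradient bounds from Lipschitz bounds, and separating functions\<close>

lemma mvt_symmetric:
  fixes f :: "real \<Rightarrow> real"
  assumes "\<And>t. (f has_real_derivative f' t) (at t)"
  shows "\<exists>\<xi>. \<bar>\<xi>\<bar> \<le> \<bar>\<tau>\<bar> \<and> f \<tau> - f 0 = \<tau> * f' \<xi>"
proof -
  consider "\<tau> = 0" | "\<tau> > 0" | "\<tau> < 0" by linarith
  then show ?thesis
  proof cases
    case 2
    then obtain z where "0 < z" "z < \<tau>" "f \<tau> - f 0 = (\<tau> - 0) * f' z" using MVT2[of 0 \<tau> f f'] assms by blast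
    then show ?thesis by (intro exI[of _ z]) auto
  next
    case 3
    then obtain z where "\<tau> < z" "z < 0" "f 0 - f \<tau> = (0 - \<tau>) * f' z" using MVT2[of \<tau> 0 f f'] assms by blast
    then show ?thesis by (intro exI[of _ z]) auto
  qed auto
qed

text \<open>Coordinates are added one at a time: the mean value theorem expresses the new increment
  by a nearby value of the partial derivative, and continuity on \<open>ell2\<close> gives its
  limit.\<close>

lemma directional_derivative:
  assumes g: "F_smooth UNIV g" and c: "\<And>i. continuous_on UNIV (partial i g)"
  shows "((\<lambda>t. g (x + t *\<^sub>R (\<Sum>i<n. s i *\<^sub>R basis i))) has_real_derivative (\<Sum>i<n. s i * partial i g x)) (at 0)"
proof (induction n)
  case (Suc n)
  define w where "w = (\<Sum>i<n. s i *\<^sub>R basis i)"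
  define r where "r t = g (x + t *\<^sub>R w + (t * s n) *\<^sub>R basis n) - g (x + t *\<^sub>R w)" for t
  have "\<exists>z. dist z x \<le> \<bar>t\<bar> * (norm w + \<bar>s n\<bar>) \<and> r t = t * s n * partial n g z" for t
  proof -
    have "((\<lambda>\<tau>. g (x + t *\<^sub>R w + \<tau> *\<^sub>R basis n)) has_real_derivative partial n g (x + t *\<^sub>R w + \<tau> *\<^sub>R basis n)) (at \<tau>)" for \<tau>
      by (rule has_pd_line) (use F_smoothD(1)[OF g, of _ n "[]"] in simp)
    from mvt_symmetric[OF this, of "t * s n"] obtain \<xi> where xi: "\<bar>\<xi>\<bar> \<le> \<bar>t * s n\<bar>"
      "r t = t * s n * partial n g (x + t *\<^sub>R w + \<xi> *\<^sub>R basis n)"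
      unfolding r_def by auto
    have "dist (x + t *\<^sub>R w + \<xi> *\<^sub>R basis n) x \<le> norm (t *\<^sub>R w) + norm (\<xi> *\<^sub>R basis n)"
      by (simp add: dist_norm add.assoc norm_triangle_ineq del: norm_scaleR)
    also have "\<dots> \<le> \<bar>t\<bar> * (norm w + \<bar>s n\<bar>)" using xi(1) by (simp add: abs_mult algebra_simps)
    finally show ?thesis using xi(2) by blast
  qed
  then obtain z where z: "\<And>t. dist (z t) x \<le> \<bar>t\<bar> * (norm w + \<bar>s n\<bar>)" "\<And>t. r t = t * s n * partial n g (z t)" by metis
  have "((\<lambda>t. dist (z t) x) \<longlongrightarrow> 0) (at 0)"
  proof (rule tendsto_sandwich[of "\<lambda>_. 0" _ _ "\<lambda>t. \<bar>t\<bar> * (norm w + \<bar>s n\<bar>)"])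
    show "((\<lambda>t. \<bar>t\<bar> * (norm w + \<bar>s n\<bar>)) \<longlongrightarrow> 0) (at (0::real))"
      by (auto intro!: tendsto_eq_intros)
  qed (use z(1) in \<open>auto intro!: always_eventually\<close>)
  then have "(z \<longlongrightarrow> x) (at 0)" by (rule tendsto_dist_iff[THEN iffD2])
  then have "((\<lambda>t. partial n g (z t)) \<longlongrightarrow> partial n g x) (at 0)"
    by (rule continuous_on_tendsto_compose[OF c[of n]]) auto
  then have "((\<lambda>t. s n * partial n g (z t)) \<longlongrightarrow> s n * partial n g x) (at 0)" by (intro tendsto_intros)
  moreover have "eventually (\<lambda>t. s n * partial n g (z t) = (r (0 + t) - r 0) / t) (at 0)"
    unfolding z(2) by (auto simp: eventually_at_filter)
  ultimately have "(\<lambda>t. (r (0 + t) - r 0) / t) \<midarrow>0\<rightarrow> s n * partial n g x"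
    by (rule Lim_transform_eventually)
  then have "(r has_real_derivative s n * partial n g x) (at 0)" unfolding DERIV_def .
  from DERIV_add[OF Suc[folded w_def] this]
  have "((\<lambda>t. g (x + t *\<^sub>R w) + r t) has_real_derivative (\<Sum>i<Suc n. s i * partial i g x)) (at 0)" by simp
  moreover have "g (x + t *\<^sub>R w) + r t = g (x + t *\<^sub>R (\<Sum>i<Suc n. s i *\<^sub>R basis i))" for t
    by (simp add: r_def w_def scaleR_add_right add.assoc)
  ultimately show ?case by (simp add: algebra_simps)
qed simp

text \<open>Duality with the weighted norm. Along the direction
  \<open>s i = partial i g x / b i\<close> the derivative equals the sum \<open>Q\<close> in
  question, and this direction has weighted length \<open>sqrt Q\<close>; the Lipschitz bound
  becomes \<open>Q \<le> C * sqrt Q\<close>.\<close>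

lemma weighted_gradient_bound:
  fixes b :: "nat \<Rightarrow> real"
  assumes g: "F_smooth UNIV g" and c: "\<And>i. continuous_on UNIV (partial i g)" and b: "\<And>i. b i > 0" and C: "C \<ge> 0"
    and lip: "\<And>x s. \<bar>g (x + (\<Sum>i<n. s i *\<^sub>R basis i)) - g x\<bar> \<le> C * sqrt (\<Sum>i<n. b i * (s i)\<^sup>2)"
  shows "(\<Sum>i<n. (partial i g x)\<^sup>2 / b i) \<le> C\<^sup>2"
proof -
  define Q where "Q = (\<Sum>i<n. (partial i g x)\<^sup>2 / b i)"
  define s where "s i = partial i g x / b i" for i
  let ?w = "\<Sum>i<n. s i *\<^sub>R basis i"
  have Q0: "Q \<ge> 0" unfolding Q_def using b by (intro sum_nonneg) (simp add: less_imp_le)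
  have 1: "(\<Sum>i<n. s i * partial i g x) = Q" by (simp add: Q_def s_def power2_eq_square)
  have 2: "(\<Sum>i<n. b i * (t * s i)\<^sup>2) = t\<^sup>2 * Q" for t
    unfolding Q_def s_def sum_distrib_left using b by (intro sum.cong) (auto simp: power2_eq_square field_simps less_imp_neq[symmetric])
  have "((\<lambda>t. g (x + t *\<^sub>R ?w)) has_real_derivative Q) (at 0)"
    using directional_derivative[OF g c, of x s n] unfolding 1 .
  then have "(\<lambda>t. (g (x + (0 + t) *\<^sub>R ?w) - g (x + 0 *\<^sub>R ?w)) / t) \<midarrow>0\<rightarrow> Q" unfolding DERIV_def .
  then have lim: "((\<lambda>t. (g (x + t *\<^sub>R ?w) - g x) / t) \<longlongrightarrow> Q) (at_right 0)"
    by (simp add: filterlim_at_split)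
  have "Q \<le> C * sqrt Q"
  proof (rule tendsto_upperbound[OF lim])
    have "(g (x + t *\<^sub>R ?w) - g x) / t \<le> C * sqrt Q" if "t > 0" for t
    proof -
      have "\<bar>g (x + (\<Sum>i<n. (t * s i) *\<^sub>R basis i)) - g x\<bar> \<le> C * sqrt (t\<^sup>2 * Q)"
        using lip[of x "\<lambda>i. t * s i"] unfolding 2 .
      then have "\<bar>g (x + t *\<^sub>R ?w) - g x\<bar> \<le> t * (C * sqrt Q)"
        using that by (simp add: scaleR_sum_right real_sqrt_mult ac_simps)
      then show ?thesis using that by (simp add: divide_le_eq abs_le_iff mult.commute)
    qed
    then show "eventually (\<lambda>t. (g (x + t *\<^sub>R ?w) - g x) / t \<le> C * sqrt Q) (at_right 0)"
      by (auto simp: eventually_at_filter)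
  qed simp
  then have "sqrt Q * sqrt Q \<le> C * sqrt Q" using Q0 by simp
  then have "sqrt Q \<le> C"
    using C Q0 mult_right_le_imp_le[of "sqrt Q" "sqrt Q" C] by (cases "Q = 0") (auto simp: less_le)
  then have "(sqrt Q)\<^sup>2 \<le> C\<^sup>2" using Q0 by (intro power_mono) auto
  then show ?thesis using Q0 unfolding Q_def by simp
qed

lemma norm_sum_basis: "norm (\<Sum>i<n. s i *\<^sub>R basis i) = sqrt (\<Sum>i<n. (s i)\<^sup>2)"
proof -
  have "(norm (\<Sum>i<n. s i *\<^sub>R basis i))\<^sup>2 = (\<Sum>i<n. (s i)\<^sup>2)"
    unfolding norm_sq_ell2 coord_sum_basis by (subst suminf_finite[of "{..<n}"]) auto
  then show ?thesis by (metis norm_ge_zero real_sqrt_unique)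
qed

lemma Lipschitz_grad_bound:
  assumes "F_smooth UNIV g" "\<And>i. continuous_on UNIV (partial i g)" "L-lipschitz_on UNIV g"
  shows "grad_bound UNIV g (L\<^sup>2)"
  unfolding grad_bound_def
proof (intro ballI allI)
  fix x n
  have "(\<Sum>i<n. (partial i g x)\<^sup>2 / 1) \<le> L\<^sup>2"
    by (rule weighted_gradient_bound) (use assms in \<open>auto simp: lipschitz_iff_shift norm_sum_basis[symmetric]\<close>)
  then show "(\<Sum>i<n. (partial i g x)\<^sup>2) \<le> L\<^sup>2" by simp
qed

text \<open>A smooth Urysohn function for sets at a uniform distance. Its gradient bound comes from
  the Lipschitz constant of the distance function, so no compactness enters.\<close>

lemma smooth_separation:
  fixes A :: "ell2 set" assumes d: "d > 0"
  obtains \<psi> C where "F_smooth UNIV \<psi>" "grad_bound UNIV \<psi> C" "\<And>x. 0 \<le> \<psi> x \<and> \<psi> x \<le> 1"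
    "\<And>x. x \<in> A \<Longrightarrow> \<psi> x = 1" "\<And>x. \<psi> x \<noteq> 0 \<Longrightarrow> \<exists>a\<in>A. dist a x < d"
proof (cases "A = {}")
  case True
  have "partial i (\<lambda>x. 0) x = 0" for i x using has_pd_imp_partial[OF has_pd_const] .
  then show ?thesis using True
    by (intro that[of "\<lambda>x. 0" 0]) (auto intro: F_smooth_const simp: grad_bound_def)
next
  case False
  \<comment> \<open>The profile is 1 up to distance \<open>d / 3\<close> and 0 from
    \<open>2 * d / 3\<close> on, so that smoothing with radius \<open>d / 3\<close> spoils neither
    end.\<close>
  define h where "h x = min 1 (max 0 (2 - 3 * infdist x A / d))" for x
  have lip: "(3/d)-lipschitz_on UNIV h"
  proof (rule lipschitz_onI)
    fix x y
    have "\<bar>h x - h y\<bar> \<le> \<bar>3 * infdist x A / d - 3 * infdist y A / d\<bar>" unfolding h_def by linarith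
    also have "\<dots> = 3 / d * \<bar>infdist x A - infdist y A\<bar>" using d by (simp add: abs_if field_simps)
    also have "\<dots> \<le> 3 / d * dist x y" using d by (intro mult_left_mono infdist_triangle_abs) auto
    finally show "dist (h x) (h y) \<le> 3 / d * dist x y" by (simp add: dist_real_def)
  qed (use d in auto)
  have bd: "bounded (range h)" by (auto simp: bounded_iff h_def intro!: exI[of _ 1])
  have d3: "d / 3 > 0" using d by simp
  obtain g where g: "F_smooth UNIV g" "\<And>is. continuous_on UNIV (partials is g)"
    "\<And>v C x. (\<And>x. \<bar>h (x + v) - h x\<bar> \<le> C) \<Longrightarrow> \<bar>g (x + v) - g x\<bar> \<le> C"
    "\<And>x l u. (\<And>y. y \<in> cball x (d/3) \<Longrightarrow> l \<le> h y \<and> h y \<le> u) \<Longrightarrow> l \<le> g x \<and> g x \<le> u"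
    by (rule Lipschitz_smoothing[OF lip bd d3]) blast
  have "(3/d)-lipschitz_on UNIV g"
    using lip g(3) d unfolding lipschitz_iff_shift by blast
  then have gb: "grad_bound UNIV g ((3/d)\<^sup>2)"
    using Lipschitz_grad_bound[OF g(1)] g(2)[of "[_]"] by simp
  have one: "g x = 1" if "x \<in> A" for x
  proof -
    have "1 \<le> g x \<and> g x \<le> 1"
    proof (rule g(4))
      fix y assume "y \<in> cball x (d/3)"
      then have "infdist y A \<le> d / 3" using infdist_le[OF that, of y] by (simp add: dist_commute)
      then have "3 * infdist y A / d \<le> 1" using d by (simp add: field_simps)
      then show "1 \<le> h y \<and> h y \<le> 1" by (simp add: h_def)
    qed
    then show ?thesis by simp
  qed
  have zero: "g x = 0" if x: "\<And>a. a \<in> A \<Longrightarrow> dist a x \<ge> d" for x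
  proof -
    have "0 \<le> g x \<and> g x \<le> 0"
    proof (rule g(4))
      fix y assume y: "y \<in> cball x (d/3)"
      have "2 * d / 3 \<le> infdist y A"
        unfolding infdist_notempty[OF False]
      proof (rule cINF_greatest[OF False])
        fix a assume "a \<in> A"
        then have "d \<le> dist a x" by (rule x)
        also have "\<dots> \<le> dist y a + dist x y" using dist_triangle[of a x y] by (simp add: dist_commute)
        finally show "2 * d / 3 \<le> dist y a" using y by simp
      qed
      then have "2 \<le> 3 * infdist y A / d" using d by (simp add: field_simps)
      then show "0 \<le> h y \<and> h y \<le> 0" by (simp add: h_def)
    qed
    then show ?thesis by simp
  qed
  show ?thesis
  proof (rule that[OF g(1) gb])
    show "0 \<le> g x \<and> g x \<le> 1" for x by (rule g(4)) (simp add: h_def)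
    show "\<exists>a\<in>A. dist a x < d" if "g x \<noteq> 0" for x using zero[of x] that by force
  qed (use one in auto)
qed

section \<open>The Gaussian measure\<close>

lemma summable_iff_ennreal:
  fixes f :: "nat \<Rightarrow> real"
  assumes "\<And>i. 0 \<le> f i"
  shows "summable f \<longleftrightarrow> (\<Sum>i. ennreal (f i)) \<noteq> \<infinity>"
  unfolding infinity_ennreal_def
  by (rule iffI) (erule ennreal_suminf_neq_top[OF _ assms], erule summable_suminf_not_top[OF assms])

text \<open>Variance plus squared bias, by expanding \<open>x - u\<close> around the mean. The
  Mehler transition needs it with a mean different from \<open>u\<close>.\<close>

lemma nn_integral_normal_sq:
  assumes "\<sigma> > 0"
  shows "(\<integral>\<^sup>+x. ennreal (normal_density \<mu> \<sigma> x * (x - u)\<^sup>2) \<partial>lborel) = ennreal (\<sigma>\<^sup>2 + (\<mu> - u)\<^sup>2)"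
proof -
  have "has_bochner_integral lborel (\<lambda>x. normal_density \<mu> \<sigma> x * (x - \<mu>) ^ (2 * 1)) (\<sigma>\<^sup>2)"
    using normal_moment_even[OF assms, of \<mu> 1] by (simp add: fact_numeral)
  moreover have "has_bochner_integral lborel (\<lambda>x. normal_density \<mu> \<sigma> x * (x - \<mu>) ^ (2 * 0 + 1)) 0"
    using normal_moment_odd[OF assms, of \<mu> 0] by simp
  moreover have "has_bochner_integral lborel (\<lambda>x. normal_density \<mu> \<sigma> x * (x - \<mu>) ^ (2 * 0)) 1"
    using normal_moment_even[OF assms, of \<mu> 0] by simp
  ultimately have "has_bochner_integral lborel
     (\<lambda>x. normal_density \<mu> \<sigma> x * (x - \<mu>) ^ (2 * 1) + (2 * (\<mu> - u) * (normal_density \<mu> \<sigma> x * (x - \<mu>) ^ (2 * 0 + 1))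
       + (\<mu> - u)\<^sup>2 * (normal_density \<mu> \<sigma> x * (x - \<mu>) ^ (2 * 0)))) (\<sigma>\<^sup>2 + (2 * (\<mu> - u) * 0 + (\<mu> - u)\<^sup>2 * 1))"
    by (intro has_bochner_integral_add has_bochner_integral_mult_right)
  also have "(\<lambda>x. normal_density \<mu> \<sigma> x * (x - \<mu>) ^ (2 * 1) + (2 * (\<mu> - u) * (normal_density \<mu> \<sigma> x * (x - \<mu>) ^ (2 * 0 + 1))
       + (\<mu> - u)\<^sup>2 * (normal_density \<mu> \<sigma> x * (x - \<mu>) ^ (2 * 0)))) = (\<lambda>x. normal_density \<mu> \<sigma> x * (x - u)\<^sup>2)"
    by (rule ext) (simp add: power2_eq_square algebra_simps)
  finally have "has_bochner_integral lborel (\<lambda>x. normal_density \<mu> \<sigma> x * (x - u)\<^sup>2) (\<sigma>\<^sup>2 + (\<mu> - u)\<^sup>2)" by simp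
  then show ?thesis
    by (subst nn_integral_eq_integral) (auto simp: has_bochner_integral_iff)
qed

locale gaussian_ell2 =
  fixes a :: "nat \<Rightarrow> real"
  assumes a_pos: "\<And>i. a i > 0" and a_summable: "summable a"
begin

abbreviation N where "N i \<equiv> density lborel (\<lambda>x. ennreal (normal_density 0 (a i) x))"
abbreviation M where "M \<equiv> Pi\<^sub>M UNIV N"
abbreviation G where "G \<equiv> gauss a"

lemma prob_space_N: "prob_space (N i)"
  by (rule prob_space_normal_density[OF a_pos])


lemma prob_space_M: "prob_space M"
  by (rule prob_space_PiM[OF prob_space_N])

lemma space_M [simp]: "space M = UNIV"
  by (simp add: space_PiM PiE_UNIV_domain)

lemma sets_M [measurable_cong]: "sets M = sets (Pi\<^sub>M UNIV (\<lambda>_. borel))"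
  by (intro sets_PiM_cong) auto

lemma nn_integral_N: "f \<in> borel_measurable borel \<Longrightarrow>
  (\<integral>\<^sup>+x. f x \<partial>N i) = (\<integral>\<^sup>+x. ennreal (normal_density 0 (a i) x) * f x \<partial>lborel)"
  by (subst nn_integral_density) auto

lemma nn_integral_M_prod:
  assumes J: "finite J" and f: "\<And>j. j \<in> J \<Longrightarrow> f j \<in> borel_measurable borel"
  shows "(\<integral>\<^sup>+\<omega>. (\<Prod>j\<in>J. f j (\<omega> j)) \<partial>M) = (\<Prod>j\<in>J. \<integral>\<^sup>+x. f j x \<partial>N j)"
proof -
  interpret PN: product_prob_space N UNIV
    by (rule product_prob_spaceI[OF prob_space_N])
  have "(\<integral>\<^sup>+\<omega>. (\<Prod>j\<in>J. f j (\<omega> j)) \<partial>M) = (\<integral>\<^sup>+\<omega>. (\<Prod>j\<in>J. f j (restrict \<omega> J j)) \<partial>M)"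
    by simp
  also have "\<dots> = (\<integral>\<^sup>+\<omega>. (\<Prod>j\<in>J. f j (\<omega> j)) \<partial>distr M (Pi\<^sub>M J N) (\<lambda>\<omega>. restrict \<omega> J))"
  proof -
    have 1: "(\<lambda>\<omega>. \<Prod>j\<in>J. f j (\<omega> j)) \<in> borel_measurable (Pi\<^sub>M J N)"
    proof (rule borel_measurable_prod_ennreal)
      fix j assume j: "j \<in> J"
      have "f j \<in> borel_measurable (N j)" using f[OF j] by simp
      then show "(\<lambda>\<omega>. f j (\<omega> j)) \<in> borel_measurable (Pi\<^sub>M J N)"
        using measurable_component_singleton[OF j, of N] by (rule measurable_compose[rotated])
    qed
    have 2: "(\<lambda>\<omega>. restrict \<omega> J) \<in> measurable M (Pi\<^sub>M J N)"
      by (rule measurable_restrict_subset) simp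
    show ?thesis by (rule nn_integral_distr[OF 2, symmetric]) (use 1 in simp)
  qed
  also have "distr M (Pi\<^sub>M J N) (\<lambda>\<omega>. restrict \<omega> J) = Pi\<^sub>M J N"
    by (rule PN.distr_PiM_restrict_finite[OF J]) simp
  also have "(\<integral>\<^sup>+\<omega>. (\<Prod>j\<in>J. f j (\<omega> j)) \<partial>Pi\<^sub>M J N) = (\<Prod>j\<in>J. \<integral>\<^sup>+x. f j x \<partial>N j)"
    by (rule PN.product_nn_integral_prod[OF J]) (use f in simp)
  finally show ?thesis .
qed

lemma nn_integral_N_sq: "(\<integral>\<^sup>+x. ennreal (x\<^sup>2) \<partial>N i) = ennreal ((a i)\<^sup>2)"
proof -
  have "(\<integral>\<^sup>+x. ennreal (x\<^sup>2) \<partial>N i) = (\<integral>\<^sup>+x. ennreal (normal_density 0 (a i) x * (x - 0)\<^sup>2) \<partial>lborel)"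
    by (subst nn_integral_N) (auto simp: ennreal_mult')
  then show ?thesis using nn_integral_normal_sq[OF a_pos, of 0 i 0] by simp
qed

definition sq_summable :: "(nat \<Rightarrow> real) set" where "sq_summable = {\<omega>. summable (\<lambda>i. (\<omega> i)\<^sup>2)}"

lemma sq_summable_eq: "sq_summable = {\<omega>\<in>space M. (\<Sum>i. ennreal ((\<omega> i)\<^sup>2)) \<noteq> \<infinity>}"
  unfolding sq_summable_def space_M by (subst summable_iff_ennreal) auto

lemma sq_summable_sets [measurable]: "sq_summable \<in> sets M"
  unfolding sq_summable_eq by measurable

lemma a_sq_summable: "summable (\<lambda>i. (a i)\<^sup>2)"
proof (rule summable_comparison_test'[OF summable_mult2[OF a_summable]])
  show "norm ((a i)\<^sup>2) \<le> a i * suminf a" for i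
    using sum_le_suminf[OF a_summable, of "{i}"] a_pos
    by (auto simp: power2_eq_square less_imp_le intro!: mult_left_mono)
qed

text \<open>The expected sum of squares is the sum of the \<open>(a i)\<^sup>2\<close>, so the
  restriction in \<open>gauss\<close> discards only a null set.\<close>

lemma AE_sq_summable: "AE \<omega> in M. \<omega> \<in> sq_summable"
proof -
  have "(\<integral>\<^sup>+\<omega>. (\<Sum>i. ennreal ((\<omega> i)\<^sup>2)) \<partial>M) = (\<Sum>i. \<integral>\<^sup>+\<omega>. ennreal ((\<omega> i)\<^sup>2) \<partial>M)"
    by (rule nn_integral_suminf) measurable
  also have "\<dots> = (\<Sum>i. ennreal ((a i)\<^sup>2))"
  proof (rule suminf_cong)
    fix i
    show "(\<integral>\<^sup>+\<omega>. ennreal ((\<omega> i)\<^sup>2) \<partial>M) = ennreal ((a i)\<^sup>2)"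
      using nn_integral_M_prod[of "{i}" "\<lambda>_ x. ennreal (x\<^sup>2)"] by (simp add: nn_integral_N_sq)
  qed
  also have "\<dots> \<noteq> \<infinity>" using a_sq_summable summable_iff_ennreal[of "\<lambda>i. (a i)\<^sup>2"] by simp
  finally have "AE \<omega> in M. (\<Sum>i. ennreal ((\<omega> i)\<^sup>2)) \<noteq> \<infinity>"
    by (intro nn_integral_PInf_AE) (auto simp del: infinity_ennreal_def, measurable)
  then show ?thesis by eventually_elim (simp add: sq_summable_eq)
qed

text \<open>A total version of \<open>Abs_ell2\<close>: the null set of sequences that are not
  square-summable goes to 0, so that \<open>gauss\<close> becomes an ordinary image of the product
  measure.\<close>

definition to_ell2 :: "(nat \<Rightarrow> real) \<Rightarrow> ell2" where "to_ell2 \<omega> = (if \<omega> \<in> sq_summable then Abs_ell2 \<omega> else 0)"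

lemma coord_to_ell2: "coord (to_ell2 \<omega>) i = (if \<omega> \<in> sq_summable then \<omega> i else 0)"
  by (simp add: to_ell2_def sq_summable_def)

text \<open>Open sets are countable unions of balls, and distances are countable series in the
  coordinates, which are measurable for the product.\<close>

lemma to_ell2_measurable [measurable]: "to_ell2 \<in> borel_measurable M"
proof (rule borel_measurableI)
  fix V :: "ell2 set" assume "open V"
  then obtain B :: "(ell2 \<times> real) set" where B: "countable B" "V = (\<Union>(d,r)\<in>B. ball d r)"
    using open_ell2_countable_balls by blast
  have [measurable]: "(\<lambda>\<omega>. coord (to_ell2 \<omega>) i) \<in> borel_measurable M" for i
    unfolding coord_to_ell2 by measurable
  have "(\<lambda>\<omega>. dist d (to_ell2 \<omega>)) \<in> borel_measurable M" for d
  proof -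
    have "dist d (to_ell2 \<omega>) = sqrt (\<Sum>i. (coord d i - coord (to_ell2 \<omega>) i)\<^sup>2)" for \<omega>
      using norm_sq_ell2[of "d - to_ell2 \<omega>"] by (simp add: dist_norm real_sqrt_unique)
    then show ?thesis by simp
  qed
  then have "{\<omega>\<in>space M. dist d (to_ell2 \<omega>) < r} \<in> sets M" for d r
    by measurable
  then have "(\<Union>(d,r)\<in>B. {\<omega>\<in>space M. dist d (to_ell2 \<omega>) < r}) \<in> sets M"
    using B(1) by (intro sets.countable_UN'') auto
  also have "(\<Union>(d,r)\<in>B. {\<omega>\<in>space M. dist d (to_ell2 \<omega>) < r}) = to_ell2 -` V \<inter> space M"
    unfolding B(2) by (auto simp: case_prod_beta intro!: rev_bexI)
  finally show "to_ell2 -` V \<inter> space M \<in> sets M" .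
qed

lemma sets_G [simp, measurable_cong]: "sets G = sets borel"
  by (simp add: gauss_def)

lemma space_G [simp]: "space G = UNIV"
  by (simp add: gauss_def)

lemma G_eq: "G = distr M borel to_ell2"
proof (rule measure_eqI)
  fix A assume "A \<in> sets G"
  then have A: "A \<in> sets borel" by simp
  have "Abs_ell2 \<in> measurable (restrict_space M sq_summable) borel"
  proof (rule measurable_cong[THEN iffD1])
    show "to_ell2 \<omega> = Abs_ell2 \<omega>" if "\<omega> \<in> space (restrict_space M sq_summable)" for \<omega>
      using that by (simp add: to_ell2_def space_restrict_space)
  qed (rule measurable_restrict_space1, measurable)
  then have "emeasure G A = emeasure (restrict_space M sq_summable) (Abs_ell2 -` A \<inter> space (restrict_space M sq_summable))"
    unfolding gauss_def sq_summable_def[symmetric] using A by (rule emeasure_distr)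
  also have "\<dots> = emeasure M (Abs_ell2 -` A \<inter> sq_summable)"
    by (subst emeasure_restrict_space) (auto simp: space_restrict_space)
  also have "\<dots> = emeasure M (to_ell2 -` A \<inter> space M)"
  proof (rule emeasure_eq_AE)
    show "AE \<omega> in M. \<omega> \<in> Abs_ell2 -` A \<inter> sq_summable \<longleftrightarrow> \<omega> \<in> to_ell2 -` A \<inter> space M"
      using AE_sq_summable by eventually_elim (auto simp: to_ell2_def)
    have "Abs_ell2 -` A \<inter> sq_summable = (to_ell2 -` A \<inter> space M) \<inter> sq_summable" by (auto simp: to_ell2_def)
    also have "\<dots> \<in> sets M" using A by measurable
    finally show "Abs_ell2 -` A \<inter> sq_summable \<in> sets M" .
    show "to_ell2 -` A \<inter> space M \<in> sets M" using A by measurable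
  qed
  also have "\<dots> = emeasure (distr M borel to_ell2) A" using A by (simp add: emeasure_distr)
  finally show "emeasure G A = emeasure (distr M borel to_ell2) A" .
qed simp

lemma prob_space_G: "prob_space G"
  unfolding G_eq
  by (rule prob_space.prob_space_distr[OF prob_space_M to_ell2_measurable])

lemma nn_integral_G: "h \<in> borel_measurable borel \<Longrightarrow> (\<integral>\<^sup>+x. h x \<partial>G) = (\<integral>\<^sup>+\<omega>. h (to_ell2 \<omega>) \<partial>M)"
  unfolding G_eq by (subst nn_integral_distr[OF to_ell2_measurable]) auto

lemma nn_integral_G_prod:
  assumes J: "finite J" and f: "\<And>j. j \<in> J \<Longrightarrow> f j \<in> borel_measurable borel"
  shows "(\<integral>\<^sup>+x. (\<Prod>j\<in>J. f j (coord x j)) \<partial>G) = (\<Prod>j\<in>J. \<integral>\<^sup>+x. f j x \<partial>N j)"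
proof -
  have "(\<lambda>x. \<Prod>j\<in>J. f j (coord x j)) \<in> borel_measurable borel"
    by (rule borel_measurable_prod_ennreal) (rule measurable_compose[OF coord_measurable f])
  then have "(\<integral>\<^sup>+x. (\<Prod>j\<in>J. f j (coord x j)) \<partial>G) = (\<integral>\<^sup>+\<omega>. (\<Prod>j\<in>J. f j (coord (to_ell2 \<omega>) j)) \<partial>M)"
    by (rule nn_integral_G)
  also have "\<dots> = (\<integral>\<^sup>+\<omega>. (\<Prod>j\<in>J. f j (\<omega> j)) \<partial>M)"
    by (rule nn_integral_cong_AE) (use AE_sq_summable in eventually_elim, simp add: coord_to_ell2)
  finally show ?thesis using nn_integral_M_prod[OF assms] by simp
qed

lemma nn_integral_coord_sq: "(\<integral>\<^sup>+x. ennreal ((coord x i)\<^sup>2) \<partial>G) = ennreal ((a i)\<^sup>2)"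
  using nn_integral_G_prod[of "{i}" "\<lambda>_ x. ennreal (x\<^sup>2)"] by (simp add: nn_integral_N_sq)

text \<open>The origin of the weights \<open>1 / a i\<close>: the expected weighted sum is the sum
  of the \<open>a i\<close> themselves, finite by assumption.\<close>

lemma AE_weighted_summable: "AE x in G. (\<Sum>i. ennreal ((coord x i)\<^sup>2 / a i)) \<noteq> \<infinity>"
proof -
  have "(\<integral>\<^sup>+x. (\<Sum>i. ennreal ((coord x i)\<^sup>2 / a i)) \<partial>G) = (\<Sum>i. \<integral>\<^sup>+x. ennreal ((coord x i)\<^sup>2 / a i) \<partial>G)"
    by (rule nn_integral_suminf) measurable
  also have "\<dots> = (\<Sum>i. ennreal (a i))"
  proof (rule suminf_cong)
    fix i
    have "(\<integral>\<^sup>+x. ennreal ((coord x i)\<^sup>2 / a i) \<partial>G) = (\<integral>\<^sup>+x. ennreal (1 / a i) * ennreal ((coord x i)\<^sup>2) \<partial>G)"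
      by (intro nn_integral_cong) (use a_pos[of i] in \<open>simp add: ennreal_mult[symmetric]\<close>)
    also have "\<dots> = ennreal (1 / a i) * ennreal ((a i)\<^sup>2)"
      by (subst nn_integral_cmult) (auto simp: nn_integral_coord_sq)
    also have "\<dots> = ennreal (a i)" using a_pos[of i] by (simp add: ennreal_mult[symmetric] power2_eq_square)
    finally show "(\<integral>\<^sup>+x. ennreal ((coord x i)\<^sup>2 / a i) \<partial>G) = ennreal (a i)" .
  qed
  also have "\<dots> \<noteq> \<infinity>" using a_summable a_pos summable_iff_ennreal[of a] by (simp add: less_imp_le)
  finally show ?thesis
    by (intro nn_integral_PInf_AE) (auto simp del: infinity_ennreal_def, measurable)
qed

subsection \<open>Translations along the coordinate axes\<close>

text \<open>Cameron--Martin density: the law of \<open>x + t *\<^sub>R basis j\<close> under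
  \<open>gauss a\<close>, relative to \<open>gauss a\<close>.\<close>

definition shift_density :: "nat \<Rightarrow> real \<Rightarrow> ell2 \<Rightarrow> real"
  where "shift_density j t x = exp (t * coord x j / (a j)\<^sup>2 - t\<^sup>2 / (2 * (a j)\<^sup>2))"

lemma shift_density_measurable [measurable]: "shift_density j t \<in> borel_measurable borel"
  unfolding shift_density_def[abs_def] by measurable

lemma nn_integral_N_shift:
  assumes [measurable]: "k \<in> borel_measurable borel"
  shows "(\<integral>\<^sup>+x. k (x + t) \<partial>N j) = (\<integral>\<^sup>+x. ennreal (exp (t * x / (a j)\<^sup>2 - t\<^sup>2 / (2 * (a j)\<^sup>2))) * k x \<partial>N j)"
proof -
  have n: "normal_density 0 (a j) (x - t) = normal_density 0 (a j) x * exp (t * x / (a j)\<^sup>2 - t\<^sup>2 / (2 * (a j)\<^sup>2))" for x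
  proof -
    have "-(x - t - 0)\<^sup>2 / (2 * s) = -(x - 0)\<^sup>2 / (2 * s) + (t * x / s - t\<^sup>2 / (2 * s))" if "s > 0" for s
      using that by (simp add: power2_diff add_divide_distrib diff_divide_distrib)
    from this[of "(a j)\<^sup>2"] a_pos[of j]
    have "-(x - t - 0)\<^sup>2 / (2 * (a j)\<^sup>2) = -(x - 0)\<^sup>2 / (2 * (a j)\<^sup>2) + (t * x / (a j)\<^sup>2 - t\<^sup>2 / (2 * (a j)\<^sup>2))"
      by simp
    then show ?thesis unfolding normal_density_def by (simp only: exp_add mult.assoc)
  qed
  have "(\<integral>\<^sup>+x. k (x + t) \<partial>N j) = (\<integral>\<^sup>+x. ennreal (normal_density 0 (a j) x) * k (x + t) \<partial>lborel)"
    by (subst nn_integral_N) auto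
  also have "\<dots> = (\<integral>\<^sup>+x. ennreal (normal_density 0 (a j) (-t + 1 * x)) * k (-t + 1 * x + t) \<partial>lborel)"
    by (subst nn_integral_real_affine[where c=1 and t="-t"]) auto
  also have "\<dots> = (\<integral>\<^sup>+x. ennreal (normal_density 0 (a j) x) * (ennreal (exp (t * x / (a j)\<^sup>2 - t\<^sup>2 / (2 * (a j)\<^sup>2))) * k x) \<partial>lborel)"
    by (intro nn_integral_cong) (simp add: n[simplified] ennreal_mult' mult.assoc)
  also have "\<dots> = (\<integral>\<^sup>+x. ennreal (exp (t * x / (a j)\<^sup>2 - t\<^sup>2 / (2 * (a j)\<^sup>2))) * k x \<partial>N j)"
    by (subst nn_integral_N) auto
  finally show ?thesis .
qed

text \<open>Cylinder sets determine the measure, and on them both sides factor over finitely many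
  coordinates, of which only \<open>j\<close> feels the shift.\<close>

lemma distr_M_shift:
  "distr M M (\<lambda>\<omega>. fun_upd \<omega> j (\<omega> j + t)) = density M (\<lambda>\<omega>. ennreal (exp (t * \<omega> j / (a j)\<^sup>2 - t\<^sup>2 / (2 * (a j)\<^sup>2))))"
proof (rule measure_eqI_PiM_infinite)
  let ?\<tau> = "\<lambda>\<omega>::nat \<Rightarrow> real. fun_upd \<omega> j (\<omega> j + t)"
  let ?e = "\<lambda>x. ennreal (exp (t * x / (a j)\<^sup>2 - t\<^sup>2 / (2 * (a j)\<^sup>2)))"
  have \<tau>[measurable]: "?\<tau> \<in> measurable M M"
    by (rule measurable_PiM_single') (auto simp: space_PiM)
  show "finite_measure (distr M M ?\<tau>)"
    by (rule prob_space.axioms(1)[OF prob_space.prob_space_distr[OF prob_space_M \<tau>]])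
  fix A :: "nat \<Rightarrow> real set" and J :: "nat set" assume J: "finite J" and A: "\<And>i. i \<in> J \<Longrightarrow> A i \<in> sets (N i)"
  \<comment> \<open>Padding with the constant 1 outside \<open>J\<close> allows \<open>j\<close> to
    join the index set without changing the cylinder.\<close>
  define f where "f i x = (if i \<in> J then indicator (A i) x else 1 :: ennreal)" for i and x :: real
  have f[measurable]: "f i \<in> borel_measurable borel" for i
    unfolding f_def using A[of i] by (cases "i \<in> J") auto
  let ?X = "prod_emb UNIV N J (Pi\<^sub>E J A)"
  have X[measurable]: "?X \<in> sets M" using J A by (intro sets_PiM_I) auto
  have ind: "indicator ?X \<omega> = (\<Prod>i\<in>insert j J. f i (\<omega> i))" for \<omega> :: "nat \<Rightarrow> real"
  proof -
    have "(\<Prod>i\<in>insert j J. f i (\<omega> i)) = (\<Prod>i\<in>J. f i (\<omega> i))"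
      by (rule prod.mono_neutral_right) (use J in \<open>auto simp: f_def\<close>)
    also have "\<dots> = (\<Prod>i\<in>J. indicator (A i) (\<omega> i))" by (simp add: f_def)
    also have "\<dots> = indicator ?X \<omega>"
    proof (cases "\<forall>i\<in>J. \<omega> i \<in> A i")
      case True
      then have "\<omega> \<in> ?X" by (auto simp: prod_emb_def)
      with True show ?thesis by simp
    next
      case False
      then have "\<omega> \<notin> ?X" by (auto simp: prod_emb_def PiE_iff)
      then show ?thesis using False J prod_zero[OF J] by (auto simp: indicator_def)
    qed
    finally show ?thesis by simp
  qed
  have "emeasure (distr M M ?\<tau>) ?X = (\<integral>\<^sup>+\<omega>. indicator ?X \<omega> \<partial>distr M M ?\<tau>)"
    by (rule nn_integral_indicator[symmetric]) simp
  also have "\<dots> = (\<integral>\<^sup>+\<omega>. indicator ?X (?\<tau> \<omega>) \<partial>M)"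
    by (rule nn_integral_distr) auto
  also have "\<dots> = (\<integral>\<^sup>+\<omega>. (\<Prod>i\<in>insert j J. (\<lambda>x. f i (if i = j then x + t else x)) (\<omega> i)) \<partial>M)"
    unfolding ind by (intro nn_integral_cong prod.cong) auto
  also have "\<dots> = (\<Prod>i\<in>insert j J. \<integral>\<^sup>+x. f i (if i = j then x + t else x) \<partial>N i)"
    using J by (subst nn_integral_M_prod) auto
  also have "\<dots> = (\<Prod>i\<in>insert j J. \<integral>\<^sup>+x. (if i = j then ?e x else 1) * f i x \<partial>N i)"
  proof (rule prod.cong[OF refl])
    fix i
    show "(\<integral>\<^sup>+x. f i (if i = j then x + t else x) \<partial>N i) = (\<integral>\<^sup>+x. (if i = j then ?e x else 1) * f i x \<partial>N i)"
      by (cases "i = j") (simp_all add: nn_integral_N_shift)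
  qed
  also have "\<dots> = (\<integral>\<^sup>+\<omega>. (\<Prod>i\<in>insert j J. (\<lambda>x. (if i = j then ?e x else 1) * f i x) (\<omega> i)) \<partial>M)"
    using J by (subst nn_integral_M_prod) auto
  also have "\<dots> = (\<integral>\<^sup>+\<omega>. ?e (\<omega> j) * indicator ?X \<omega> \<partial>M)"
  proof (rule nn_integral_cong)
    fix \<omega> :: "nat \<Rightarrow> real"
    have "(\<Prod>i\<in>insert j J. if i = j then ?e (\<omega> i) else 1) = ?e (\<omega> j)"
      using J by (simp add: prod.delta)
    then show "(\<Prod>i\<in>insert j J. (\<lambda>x. (if i = j then ?e x else 1) * f i x) (\<omega> i)) = ?e (\<omega> j) * indicator ?X \<omega>"
      unfolding ind prod.distrib by simp
  qed
  also have "\<dots> = emeasure (density M (\<lambda>\<omega>. ?e (\<omega> j))) ?X"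
    by (subst emeasure_density) auto
  finally show "emeasure (distr M M ?\<tau>) ?X = emeasure (density M (\<lambda>\<omega>. ?e (\<omega> j))) ?X" .
qed auto

lemma nn_integral_G_shift:
  assumes [measurable]: "h \<in> borel_measurable borel"
  shows "(\<integral>\<^sup>+x. h (x + t *\<^sub>R basis j) \<partial>G) = (\<integral>\<^sup>+x. ennreal (shift_density j t x) * h x \<partial>G)"
proof -
  let ?\<tau> = "\<lambda>\<omega>::nat \<Rightarrow> real. fun_upd \<omega> j (\<omega> j + t)"
  have \<tau>[measurable]: "?\<tau> \<in> measurable M M"
    by (rule measurable_PiM_single') (auto simp: space_PiM)
  have [measurable]: "(\<lambda>x. x + t *\<^sub>R basis j) \<in> borel_measurable borel"
    by (intro borel_measurable_continuous_onI continuous_intros)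
  \<comment> \<open>The shift and \<open>to_ell2\<close> are interchanged on square-summable
    sequences only; the others form a null set.\<close>
  have eq: "to_ell2 \<omega> + t *\<^sub>R basis j = to_ell2 (?\<tau> \<omega>)" if "\<omega> \<in> sq_summable" for \<omega>
  proof -
    have "summable (\<lambda>i. (coord (Abs_ell2 \<omega> + t *\<^sub>R basis j) i)\<^sup>2)" by (rule summable_coord_sq)
    moreover have "coord (Abs_ell2 \<omega> + t *\<^sub>R basis j) i = ?\<tau> \<omega> i" for i
      using that by (simp add: sq_summable_def coord_basis)
    ultimately have "?\<tau> \<omega> \<in> sq_summable" by (simp add: sq_summable_def)
    then show ?thesis using that by (intro ell2_eqI) (simp add: coord_to_ell2 coord_basis)
  qed
  have "(\<integral>\<^sup>+x. h (x + t *\<^sub>R basis j) \<partial>G) = (\<integral>\<^sup>+\<omega>. h (to_ell2 \<omega> + t *\<^sub>R basis j) \<partial>M)"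
    by (rule nn_integral_G) measurable
  also have "\<dots> = (\<integral>\<^sup>+\<omega>. h (to_ell2 (?\<tau> \<omega>)) \<partial>M)"
    by (rule nn_integral_cong_AE) (use AE_sq_summable in eventually_elim, simp add: eq)
  also have "\<dots> = (\<integral>\<^sup>+\<omega>. h (to_ell2 \<omega>) \<partial>distr M M ?\<tau>)"
    by (subst nn_integral_distr) auto
  also have "\<dots> = (\<integral>\<^sup>+\<omega>. ennreal (exp (t * \<omega> j / (a j)\<^sup>2 - t\<^sup>2 / (2 * (a j)\<^sup>2))) * h (to_ell2 \<omega>) \<partial>M)"
    unfolding distr_M_shift by (subst nn_integral_density) auto
  also have "\<dots> = (\<integral>\<^sup>+\<omega>. ennreal (shift_density j t (to_ell2 \<omega>)) * h (to_ell2 \<omega>) \<partial>M)"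
    by (rule nn_integral_cong_AE) (use AE_sq_summable in eventually_elim, simp add: shift_density_def coord_to_ell2)
  also have "\<dots> = (\<integral>\<^sup>+x. ennreal (shift_density j t x) * h x \<partial>G)"
    by (rule nn_integral_G[symmetric]) measurable
  finally show ?thesis .
qed

lemma distr_G_shift: "distr G borel (\<lambda>x. x + t *\<^sub>R basis j) = density G (\<lambda>x. ennreal (shift_density j t x))"
proof (rule measure_eqI)
  have [measurable]: "(\<lambda>x. x + t *\<^sub>R basis j) \<in> borel_measurable borel"
    by (intro borel_measurable_continuous_onI continuous_intros)
  fix A assume "A \<in> sets (distr G borel (\<lambda>x. x + t *\<^sub>R basis j))"
  then have [measurable]: "A \<in> sets borel" by simp
  have "emeasure (distr G borel (\<lambda>x. x + t *\<^sub>R basis j)) A = (\<integral>\<^sup>+x. indicator A x \<partial>distr G borel (\<lambda>x. x + t *\<^sub>R basis j))"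
    by (rule nn_integral_indicator[symmetric]) simp
  also have "\<dots> = (\<integral>\<^sup>+x. indicator A (x + t *\<^sub>R basis j) \<partial>G)"
    by (rule nn_integral_distr) auto
  also have "\<dots> = emeasure (density G (\<lambda>x. ennreal (shift_density j t x))) A"
    by (subst nn_integral_G_shift) (auto simp: emeasure_density)
  finally show "emeasure (distr G borel (\<lambda>x. x + t *\<^sub>R basis j)) A = emeasure (density G (\<lambda>x. ennreal (shift_density j t x))) A" .
qed simp

lemma integral_G_shift:
  assumes [measurable]: "u \<in> borel_measurable borel"
  shows "(\<integral>x. u (x + t *\<^sub>R basis j) \<partial>G) = (\<integral>x. shift_density j t x * u x \<partial>G)"
proof -
  have [measurable]: "(\<lambda>x. x + t *\<^sub>R basis j) \<in> borel_measurable borel"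
    by (intro borel_measurable_continuous_onI continuous_intros)
  have "(\<integral>x. u (x + t *\<^sub>R basis j) \<partial>G) = (\<integral>x. u x \<partial>distr G borel (\<lambda>x. x + t *\<^sub>R basis j))"
    by (subst integral_distr) auto
  also have "\<dots> = (\<integral>x. shift_density j t x * u x \<partial>G)"
    unfolding distr_G_shift by (subst integral_density) (auto simp: shift_density_def)
  finally show ?thesis .
qed

lemma has_derivative_shift_density:
  "((\<lambda>t. shift_density j t x) has_real_derivative (coord x j - t) / (a j)\<^sup>2 * shift_density j t x) (at t)"
  unfolding shift_density_def using a_pos[of j]
  by (auto intro!: derivative_eq_intros simp: field_simps)

end

lemma difference_quotient_tendsto:
  assumes "(f has_real_derivative D) (at 0)"
  shows "(\<lambda>n. (f (1 / real (Suc n)) - f 0) / (1 / real (Suc n))) \<longlonglongrightarrow> D"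
proof -
  have "(\<lambda>h. (f (0 + h) - f 0) / h) \<midarrow>0\<rightarrow> D" using assms by (simp add: DERIV_def)
  moreover have "filterlim (\<lambda>n. 1 / real (Suc n)) (at 0) sequentially"
    using LIMSEQ_inverse_real_of_nat by (intro filterlim_atI) (auto simp: inverse_eq_divide)
  ultimately have "(\<lambda>n. (f (0 + 1 / real (Suc n)) - f 0) / (1 / real (Suc n))) \<longlonglongrightarrow> D"
    by (rule filterlim_compose)
  then show ?thesis by simp
qed

lemma ennreal_double_add: "0 \<le> b \<Longrightarrow> 0 \<le> c \<Longrightarrow> 2 * ennreal b + 2 * ennreal c = ennreal (2 * b + 2 * c)"
  by (simp add: ennreal_plus ennreal_mult)

text \<open>The factors 2 are those of \<open>sq_sum_le\<close>, the price of working with squared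
  norms; each half of an estimate therefore receives a quarter of \<open>e\<close>.\<close>

lemma ennreal_double_add_less:
  assumes "x < ennreal (e/4)" "y < ennreal (e/4)" shows "2 * x + 2 * y < ennreal e"
proof -
  obtain r where r: "x = ennreal r" "0 \<le> r" using assms(1) by (cases x rule: ennreal_cases) auto
  obtain s where s: "y = ennreal s" "0 \<le> s" using assms(2) by (cases y rule: ennreal_cases) auto
  have "r < e / 4" "s < e / 4" using assms r s by (auto simp: ennreal_less_iff)
  then show ?thesis using r s by (simp add: ennreal_double_add ennreal_less_iff del: ennreal_plus)
qed

context gaussian_ell2
begin

lemma shift_density_bound:
  assumes "norm x \<le> R" "\<bar>t\<bar> \<le> 1"
  shows "shift_density j t x \<le> exp (R / (a j)\<^sup>2)"
proof -
  have "t * coord x j \<le> R"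
    using assms abs_coord_le_norm[of x j] mult_mono[of "\<bar>t\<bar>" 1 "\<bar>coord x j\<bar>" R]
    by (auto simp: abs_mult[symmetric] intro: order_trans[OF abs_ge_self])
  then have "t * coord x j / (a j)\<^sup>2 \<le> R / (a j)\<^sup>2" using a_pos[of j] by (simp add: divide_right_mono)
  then show ?thesis unfolding shift_density_def by (simp add: order_trans[of _ "t * coord x j / (a j)\<^sup>2"])
qed

lemma F_smooth_UNIV_measurable:
  assumes "F_smooth UNIV u"
  shows "u \<in> borel_measurable borel" "partial j u \<in> borel_measurable borel"
  using F_smoothD(4)[OF assms, of "[]"] F_smoothD(4)[OF assms, of "[j]"]
  by (simp_all add: borel_measurable_restrict_UNIV)

lemma F_smooth_bounded:
  assumes "F_smooth V u"
  obtains B where "\<And>x. x \<in> V \<Longrightarrow> \<bar>u x\<bar> \<le> B"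
  using F_smoothD(2)[OF assms, of "[]"] by (auto simp: bounded_iff)

lemma F_smooth_partial_bounded:
  assumes "F_smooth V u"
  obtains B where "\<And>x. x \<in> V \<Longrightarrow> \<bar>partial j u x\<bar> \<le> B"
  using F_smoothD(2)[OF assms, of "[j]"] by (auto simp: bounded_iff)

text \<open>Both sides are the derivative at \<open>t = 0\<close> of the integral of
  \<open>u (x + t *\<^sub>R basis j)\<close>: one by differentiating \<open>u\<close>, the other by
  differentiating the shift density. Bounded support dominates the second difference
  quotient.\<close>

lemma integration_by_parts:
  assumes u: "F_smooth UNIV u" and supp: "\<And>x. u x \<noteq> 0 \<Longrightarrow> norm x \<le> R"
  shows "(\<integral>x. partial j u x \<partial>G) = (\<integral>x. u x * (coord x j / (a j)\<^sup>2) \<partial>G)"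
proof -
  interpret PG: prob_space G by (rule prob_space_G)
  note [measurable] = F_smooth_UNIV_measurable[OF u]
  obtain B where B: "\<And>x. \<bar>u x\<bar> \<le> B" using F_smooth_bounded[OF u] by auto
  obtain B' where B': "\<And>x. \<bar>partial j u x\<bar> \<le> B'" by (rule F_smooth_partial_bounded[OF u, of j]) auto
  define t where "t n = 1 / real (Suc n)" for n
  have t: "0 < t n" "t n \<le> 1" for n by (auto simp: t_def)
  let ?q = "\<lambda>n x. (u (x + t n *\<^sub>R basis j) - u x) / t n"
  have line: "((\<lambda>s. u (x + s *\<^sub>R basis j)) has_real_derivative partial j u (x + s *\<^sub>R basis j)) (at s)" for x s
    by (rule has_pd_line) (use F_smoothD(1)[OF u, of _ j "[]"] in simp)
  have shm[measurable]: "(\<lambda>x. u (x + s *\<^sub>R basis j)) \<in> borel_measurable borel" for s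
    by (rule measurable_compose[of "\<lambda>x. x + s *\<^sub>R basis j" borel borel])
      (auto intro!: borel_measurable_continuous_onI continuous_intros F_smooth_UNIV_measurable[OF u])
  have lim1: "(\<lambda>n. \<integral>x. ?q n x \<partial>G) \<longlonglongrightarrow> (\<integral>x. partial j u x \<partial>G)"
  proof (rule integral_dominated_convergence[where w="\<lambda>_. B'"])
    show "AE x in G. (\<lambda>n. ?q n x) \<longlonglongrightarrow> partial j u x"
    proof (rule AE_I2)
      fix x
      show "(\<lambda>n. ?q n x) \<longlonglongrightarrow> partial j u x"
        using difference_quotient_tendsto[of "\<lambda>s. u (x + s *\<^sub>R basis j)"] line[of x 0] by (simp add: t_def)
    qed
    show "AE x in G. norm (?q n x) \<le> B'" for n
    proof (rule AE_I2)
      fix x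
      obtain \<xi> where "u (x + t n *\<^sub>R basis j) - u (x + 0 *\<^sub>R basis j) = t n * partial j u (x + \<xi> *\<^sub>R basis j)"
        using mvt_symmetric[of "\<lambda>s. u (x + s *\<^sub>R basis j)" "\<lambda>s. partial j u (x + s *\<^sub>R basis j)" "t n", OF line] by blast
      then show "norm (?q n x) \<le> B'" using t(1)[of n] B' by (simp add: abs_mult)
    qed
  qed (auto intro: PG.integrable_const)
  \<comment> \<open>Bounds the derivative of the density in its parameter on the ball of radius
    \<open>\<bar>R\<bar>\<close>, for parameters of modulus at most 1: the factor
    \<open>coord x j - \<xi>\<close> contributes \<open>\<bar>R\<bar> + 1\<close>.\<close>
  define K where "K = (\<bar>R\<bar> + 1) / (a j)\<^sup>2 * exp (\<bar>R\<bar> / (a j)\<^sup>2)"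
  let ?d = "\<lambda>n x. (shift_density j (t n) x - 1) / t n"
  have K: "\<bar>?d n x\<bar> \<le> K" if "norm x \<le> \<bar>R\<bar>" for n x
  proof -
    obtain \<xi> where xi: "\<bar>\<xi>\<bar> \<le> \<bar>t n\<bar>" "shift_density j (t n) x - shift_density j 0 x = t n * ((coord x j - \<xi>) / (a j)\<^sup>2 * shift_density j \<xi> x)"
      using mvt_symmetric[of "\<lambda>s. shift_density j s x" "\<lambda>s. (coord x j - s) / (a j)\<^sup>2 * shift_density j s x" "t n",
          OF has_derivative_shift_density] by blast
    have "\<bar>coord x j - \<xi>\<bar> \<le> \<bar>R\<bar> + 1" using xi(1) t[of n] abs_coord_le_norm[of x j] that by linarith
    moreover have "shift_density j \<xi> x \<le> exp (\<bar>R\<bar> / (a j)\<^sup>2)"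
      by (rule shift_density_bound) (use that xi(1) t[of n] in auto)
    ultimately have "\<bar>coord x j - \<xi>\<bar> / (a j)\<^sup>2 * shift_density j \<xi> x \<le> K"
      unfolding K_def using a_pos[of j] by (intro mult_mono divide_right_mono) (auto simp: shift_density_def)
    moreover have "?d n x = (coord x j - \<xi>) / (a j)\<^sup>2 * shift_density j \<xi> x"
      using xi(2) t(1)[of n] by (simp add: shift_density_def[of j 0])
    ultimately show ?thesis by (simp add: abs_mult shift_density_def)
  qed
  have bd: "\<bar>u x * ?d n x\<bar> \<le> B * K" for n x
  proof (cases "u x = 0")
    case False
    then have "norm x \<le> \<bar>R\<bar>" using supp by fastforce
    then show ?thesis unfolding abs_mult using K B by (intro mult_mono) (auto intro: order_trans[OF abs_ge_zero])
  next
    case True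
    have "0 \<le> K" "0 \<le> B" using B[of 0] by (auto simp: K_def)
    with True show ?thesis by simp
  qed
  have lim2: "(\<lambda>n. \<integral>x. u x * ?d n x \<partial>G) \<longlonglongrightarrow> (\<integral>x. u x * (coord x j / (a j)\<^sup>2) \<partial>G)"
  proof (rule integral_dominated_convergence[where w="\<lambda>_. B * K"])
    show "AE x in G. (\<lambda>n. u x * ?d n x) \<longlonglongrightarrow> u x * (coord x j / (a j)\<^sup>2)"
    proof (rule AE_I2)
      fix x
      have "((\<lambda>s. shift_density j s x) has_real_derivative coord x j / (a j)\<^sup>2) (at 0)"
        using has_derivative_shift_density[of j x 0] by (simp add: shift_density_def)
      from difference_quotient_tendsto[OF this]
      show "(\<lambda>n. u x * ?d n x) \<longlonglongrightarrow> u x * (coord x j / (a j)\<^sup>2)"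
        by (intro tendsto_mult tendsto_const) (simp add: t_def shift_density_def[of j 0])
    qed
  qed (use bd in \<open>auto intro: PG.integrable_const\<close>)
  have "(\<integral>x. ?q n x \<partial>G) = (\<integral>x. u x * ?d n x \<partial>G)" for n
  proof -
    have i1: "integrable G u"
      by (rule PG.integrable_const_bound[of _ B]) (use B in auto)
    have i2: "integrable G (\<lambda>x. u (x + t n *\<^sub>R basis j))"
      by (rule PG.integrable_const_bound[of _ B]) (use B in auto)
    have i3: "integrable G (\<lambda>x. u x * ?d n x)"
      by (rule PG.integrable_const_bound[of _ "B * K"]) (use bd in auto)
    have eq: "shift_density j (t n) x * u x = u x + t n * (u x * ?d n x)" for x
      using t(1)[of n] by (simp add: field_simps)
    have "(\<integral>x. u (x + t n *\<^sub>R basis j) \<partial>G) = (\<integral>x. u x + t n * (u x * ?d n x) \<partial>G)"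
      unfolding integral_G_shift[OF F_smooth_UNIV_measurable(1)[OF u]] eq ..
    also have "\<dots> = (\<integral>x. u x \<partial>G) + t n * (\<integral>x. u x * ?d n x \<partial>G)"
      using i1 i3 by (subst Bochner_Integration.integral_add) (auto simp del: times_divide_eq_right)
    finally have "(\<integral>x. u (x + t n *\<^sub>R basis j) \<partial>G) - (\<integral>x. u x \<partial>G) = t n * (\<integral>x. u x * ?d n x \<partial>G)" by simp
    then show ?thesis using i1 i2 t(1)[of n] by (simp add: field_simps del: times_divide_eq_right)
  qed
  then have e: "(\<lambda>n. \<integral>x. ?q n x \<partial>G) = (\<lambda>n. \<integral>x. u x * ?d n x \<partial>G)" by (rule ext)
  show ?thesis by (rule LIMSEQ_unique[OF lim1 lim2[folded e]])
qed

subsection \<open>Density of Lipschitz functions\<close>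

text \<open>The square of the distance, so that estimates combine with the squared Sobolev norm; the
  triangle inequality acquires factors 2.\<close>

definition L2_dist :: "(ell2 \<Rightarrow> real) \<Rightarrow> (ell2 \<Rightarrow> real) \<Rightarrow> ennreal"
  where "L2_dist f g = (\<integral>\<^sup>+x. ennreal ((f x - g x)\<^sup>2) \<partial>G)"

definition bd_lipschitz :: "(ell2 \<Rightarrow> real) \<Rightarrow> bool"
  where "bd_lipschitz h \<longleftrightarrow> bounded (range h) \<and> (\<exists>L. L-lipschitz_on UNIV h)"

definition lipschitz_approx :: "(ell2 \<Rightarrow> real) \<Rightarrow> bool"
  where "lipschitz_approx f \<longleftrightarrow> (\<forall>e>0. \<exists>h. bd_lipschitz h \<and> L2_dist f h < ennreal e)"

lemma bd_lipschitz_measurable: "bd_lipschitz h \<Longrightarrow> h \<in> borel_measurable borel"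
  unfolding bd_lipschitz_def using borel_measurable_continuous_onI lipschitz_on_continuous_on by blast

lemma L2_dist_triangle:
  assumes [measurable]: "f \<in> borel_measurable borel" "g \<in> borel_measurable borel" "h \<in> borel_measurable borel"
  shows "L2_dist f h \<le> 2 * L2_dist f g + 2 * L2_dist g h"
proof -
  have "ennreal ((f x - h x)\<^sup>2) \<le> 2 * ennreal ((f x - g x)\<^sup>2) + 2 * ennreal ((g x - h x)\<^sup>2)" for x
  proof -
    have "(f x - h x)\<^sup>2 \<le> 2 * (f x - g x)\<^sup>2 + 2 * (g x - h x)\<^sup>2"
      using sq_sum_le[of "f x - g x" "g x - h x"] by simp
    then show ?thesis by (subst ennreal_double_add) (simp_all add: ennreal_leI del: ennreal_plus)
  qed
  then have "L2_dist f h \<le> (\<integral>\<^sup>+x. 2 * ennreal ((f x - g x)\<^sup>2) + 2 * ennreal ((g x - h x)\<^sup>2) \<partial>G)"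
    unfolding L2_dist_def by (intro nn_integral_mono)
  also have "\<dots> = 2 * L2_dist f g + 2 * L2_dist g h"
    unfolding L2_dist_def by (subst nn_integral_add) (auto simp: nn_integral_cmult)
  finally show ?thesis .
qed

lemma L2_dist_dominated:
  assumes [measurable]: "\<And>n. F n \<in> borel_measurable borel" "f \<in> borel_measurable borel" "g \<in> borel_measurable borel"
    and lim: "\<And>x. (\<lambda>n. F n x) \<longlonglongrightarrow> f x" and bd: "\<And>n x. \<bar>F n x\<bar> \<le> g x"
    and fin: "(\<integral>\<^sup>+x. ennreal ((g x)\<^sup>2) \<partial>G) < \<infinity>"
  shows "(\<lambda>n. L2_dist f (F n)) \<longlonglongrightarrow> 0"
proof -
  have fg: "\<bar>f x\<bar> \<le> g x" for x
    by (rule LIMSEQ_le_const2[OF tendsto_rabs[OF lim]]) (use bd in blast)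
  have "(\<lambda>n. \<integral>\<^sup>+x. ennreal ((f x - F n x)\<^sup>2) \<partial>G) \<longlonglongrightarrow> (\<integral>\<^sup>+x. 0 \<partial>G)"
  proof (rule nn_integral_dominated_convergence[where w="\<lambda>x. ennreal 4 * ennreal ((g x)\<^sup>2)"])
    show "AE x in G. ennreal ((f x - F n x)\<^sup>2) \<le> ennreal 4 * ennreal ((g x)\<^sup>2)" for n
    proof (rule AE_I2)
      fix x
      have "\<bar>f x - F n x\<bar> \<le> \<bar>2 * g x\<bar>" using fg[of x] bd[of n x] by linarith
      then have "(f x - F n x)\<^sup>2 \<le> 4 * (g x)\<^sup>2" by (simp add: abs_le_square_iff power_mult_distrib)
      then show "ennreal ((f x - F n x)\<^sup>2) \<le> ennreal 4 * ennreal ((g x)\<^sup>2)"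
        by (subst ennreal_mult[symmetric]) (auto intro: ennreal_leI)
    qed
    show "(\<integral>\<^sup>+x. ennreal 4 * ennreal ((g x)\<^sup>2) \<partial>G) < \<infinity>"
      using fin by (subst nn_integral_cmult) (auto simp: ennreal_mult_less_top)
    show "AE x in G. (\<lambda>n. ennreal ((f x - F n x)\<^sup>2)) \<longlonglongrightarrow> 0"
    proof (rule AE_I2)
      fix x
      have "(\<lambda>n. (f x - F n x)\<^sup>2) \<longlonglongrightarrow> (f x - f x)\<^sup>2" by (intro tendsto_intros lim)
      from tendsto_ennrealI[OF this] show "(\<lambda>n. ennreal ((f x - F n x)\<^sup>2)) \<longlonglongrightarrow> 0" by simp
    qed
  qed auto
  then show ?thesis by (simp add: L2_dist_def)
qed

lemma lipschitz_approx_add: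
  assumes [measurable]: "f \<in> borel_measurable borel" "g \<in> borel_measurable borel"
    and "lipschitz_approx f" "lipschitz_approx g"
  shows "lipschitz_approx (\<lambda>x. f x + g x)"
  unfolding lipschitz_approx_def
proof (intro allI impI)
  fix e :: real assume e: "e > 0"
  obtain h where h: "bd_lipschitz h" "L2_dist f h < ennreal (e/4)" using assms(3) e unfolding lipschitz_approx_def by (meson divide_pos_pos zero_less_numeral)
  obtain k where k: "bd_lipschitz k" "L2_dist g k < ennreal (e/4)" using assms(4) e unfolding lipschitz_approx_def by (meson divide_pos_pos zero_less_numeral)
  note [measurable] = bd_lipschitz_measurable[OF h(1)] bd_lipschitz_measurable[OF k(1)]
  have "L2_dist (\<lambda>x. f x + g x) (\<lambda>x. h x + k x) \<le> 2 * L2_dist (\<lambda>x. f x + g x) (\<lambda>x. h x + g x) + 2 * L2_dist (\<lambda>x. h x + g x) (\<lambda>x. h x + k x)"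
    by (rule L2_dist_triangle) auto
  also have "\<dots> = 2 * L2_dist f h + 2 * L2_dist g k" by (simp add: L2_dist_def)
  also have "\<dots> < ennreal e" by (rule ennreal_double_add_less[OF h(2) k(2)])
  finally show "\<exists>h. bd_lipschitz h \<and> L2_dist (\<lambda>x. f x + g x) h < ennreal e"
    using h(1) k(1) unfolding bd_lipschitz_def
    by (intro exI[of _ "\<lambda>x. h x + k x"]) (auto intro: bounded_plus_comp lipschitz_on_add)
qed

lemma lipschitz_approx_cmult:
  assumes [measurable]: "f \<in> borel_measurable borel" and "lipschitz_approx f"
  shows "lipschitz_approx (\<lambda>x. c * f x)"
  unfolding lipschitz_approx_def
proof (intro allI impI)
  fix e :: real assume e: "e > 0"
  have "e / (c\<^sup>2 + 1) > 0" using e by (simp add: add_nonneg_pos)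
  then obtain h where h: "bd_lipschitz h" "L2_dist f h < ennreal (e / (c\<^sup>2 + 1))" using assms(2) unfolding lipschitz_approx_def by blast
  note [measurable] = bd_lipschitz_measurable[OF h(1)]
  have "L2_dist (\<lambda>x. c * f x) (\<lambda>x. c * h x) = ennreal (c\<^sup>2) * L2_dist f h"
    unfolding L2_dist_def
    by (subst nn_integral_cmult[symmetric]) (auto simp: ennreal_mult'[symmetric] power_mult_distrib[symmetric] right_diff_distrib)
  also have "\<dots> \<le> ennreal (c\<^sup>2) * ennreal (e / (c\<^sup>2 + 1))" using h(2) by (intro mult_left_mono) auto
  also have "\<dots> = ennreal (c\<^sup>2 * (e / (c\<^sup>2 + 1)))" by (rule ennreal_mult'[symmetric]) simp
  also have "\<dots> < ennreal e"
  proof (rule ennreal_lessI[OF e])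
    have "c\<^sup>2 * e < e * (c\<^sup>2 + 1)" using e by (simp add: algebra_simps)
    moreover have "c\<^sup>2 + 1 > 0" by (simp add: add_nonneg_pos)
    ultimately show "c\<^sup>2 * (e / (c\<^sup>2 + 1)) < e" by (simp add: pos_divide_less_eq)
  qed
  finally have *: "L2_dist (\<lambda>x. c * f x) (\<lambda>x. c * h x) < ennreal e" .
  obtain B L where B: "\<And>x. \<bar>h x\<bar> \<le> B" and L: "L-lipschitz_on UNIV h"
    using h(1) by (auto simp: bd_lipschitz_def bounded_iff)
  have "bounded (range (\<lambda>x. c * h x))"
    using B by (auto simp: bounded_iff abs_mult intro!: exI[of _ "\<bar>c\<bar> * B"] mult_left_mono)
  moreover have "(\<bar>c\<bar> * L)-lipschitz_on UNIV (\<lambda>x. c * h x)"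
    using lipschitz_on_cmult_real[OF L, of c] by simp
  ultimately show "\<exists>h. bd_lipschitz h \<and> L2_dist (\<lambda>x. c * f x) h < ennreal e"
    using * unfolding bd_lipschitz_def by blast
qed

lemma lipschitz_approx_lim:
  assumes [measurable]: "\<And>n. F n \<in> borel_measurable borel" "f \<in> borel_measurable borel"
    and F: "\<And>n::nat. lipschitz_approx (F n)" and lim: "(\<lambda>n. L2_dist f (F n)) \<longlonglongrightarrow> 0"
  shows "lipschitz_approx f"
  unfolding lipschitz_approx_def
proof (intro allI impI)
  fix e :: real assume e: "e > 0"
  then have "eventually (\<lambda>n. L2_dist f (F n) < ennreal (e/4)) sequentially"
    by (intro order_tendstoD(2)[OF lim]) simp
  then obtain n where n: "L2_dist f (F n) < ennreal (e/4)" by (auto simp: eventually_sequentially)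
  obtain h where h: "bd_lipschitz h" "L2_dist (F n) h < ennreal (e/4)"
    using F[of n] e unfolding lipschitz_approx_def by (meson divide_pos_pos zero_less_numeral)
  note [measurable] = bd_lipschitz_measurable[OF h(1)]
  have "L2_dist f h \<le> 2 * L2_dist f (F n) + 2 * L2_dist (F n) h" by (rule L2_dist_triangle) auto
  also have "\<dots> < ennreal e" by (rule ennreal_double_add_less[OF n h(2)])
  finally show "\<exists>h. bd_lipschitz h \<and> L2_dist f h < ennreal e" using h(1) by blast
qed

lemma lipschitz_approx_bd_lipschitz: "bd_lipschitz h \<Longrightarrow> lipschitz_approx h"
  by (auto simp: lipschitz_approx_def L2_dist_def)

lemma bd_lipschitz_const: "bd_lipschitz (\<lambda>x. c)"
proof -
  have "0-lipschitz_on UNIV (\<lambda>x::ell2. c)" by (rule lipschitz_onI) auto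
  then show ?thesis by (auto simp: bd_lipschitz_def bounded_iff)
qed

text \<open>The tents \<open>max 0 (1 - real n * infdist x C)\<close> tend to the indicator, as a
  point outside a nonempty closed set has positive distance from it.\<close>

lemma lipschitz_approx_indicator_closed:
  assumes C: "closed C" shows "lipschitz_approx (indicator C)"
proof (cases "C = {}")
  \<comment> \<open>\<open>infdist\<close> from the empty set is 0 by convention, so the tents used
    below would be constantly 1.\<close>
  case True
  have "(indicator C :: ell2 \<Rightarrow> real) = (\<lambda>x. 0)" using True by (simp add: fun_eq_iff)
  then show ?thesis using lipschitz_approx_bd_lipschitz[OF bd_lipschitz_const, of 0] by simp
next
  case False
  define F where "F n x = max 0 (1 - real n * infdist x C)" for n x
  have 01: "0 \<le> F n x" "F n x \<le> 1" for n x by (auto simp: F_def infdist_nonneg)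
  have lip: "(real n)-lipschitz_on UNIV (F n)" for n
  proof (rule lipschitz_onI)
    fix x y
    have "\<bar>F n x - F n y\<bar> \<le> \<bar>real n * infdist x C - real n * infdist y C\<bar>" unfolding F_def by linarith
    also have "\<dots> = real n * \<bar>infdist x C - infdist y C\<bar>" by (simp add: abs_mult flip: right_diff_distrib)
    also have "\<dots> \<le> real n * dist x y" by (intro mult_left_mono infdist_triangle_abs) auto
    finally show "dist (F n x) (F n y) \<le> real n * dist x y" by (simp add: dist_real_def)
  qed simp
  have "bounded (range (F n))" for n using 01 by (auto simp: bounded_iff intro!: exI[of _ 1])
  then have bl: "bd_lipschitz (F n)" for n
    unfolding bd_lipschitz_def using lip[of n] by blast
  have [measurable]: "C \<in> sets borel" using C by simp
  have lim: "(\<lambda>n. F n x) \<longlonglongrightarrow> indicator C x" for x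
  proof (cases "x \<in> C")
    case False
    then have pos: "infdist x C > 0"
      using in_closed_iff_infdist_zero[OF C \<open>C \<noteq> {}\<close>] infdist_nonneg[of x C] by (simp add: less_le)
    obtain m :: nat where "1 / infdist x C < real m" using reals_Archimedean2 by blast
    then have "1 \<le> real n * infdist x C" if "n \<ge> m" for n
      using pos that by (simp add: pos_divide_less_eq) (meson less_imp_le mult_right_mono of_nat_mono order_trans)
    then have "eventually (\<lambda>n. F n x = indicator C x) sequentially"
      using False unfolding eventually_sequentially F_def by (intro exI[of _ m]) auto
    then show ?thesis by (rule tendsto_eventually)
  qed (simp add: F_def)
  interpret PG: prob_space G by (rule prob_space_G)
  show ?thesis
  proof (rule lipschitz_approx_lim)
    show "(\<lambda>n. L2_dist (indicator C) (F n)) \<longlonglongrightarrow> 0"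
      by (rule L2_dist_dominated[where g="\<lambda>_. 1"])
        (use lim 01 bd_lipschitz_measurable[OF bl] PG.emeasure_space_1 in auto)
  qed (use bl lipschitz_approx_bd_lipschitz bd_lipschitz_measurable in auto)
qed

text \<open>Closed sets form an intersection-stable generator of the Borel sets, so only complements
  and disjoint countable unions have to be treated.\<close>

lemma lipschitz_approx_indicator:
  assumes "A \<in> sets borel" shows "lipschitz_approx (indicator A)"
proof -
  interpret PG: prob_space G by (rule prob_space_G)
  have sb: "sets borel = sigma_sets UNIV (Collect closed :: ell2 set set)"
    by (subst borel_eq_closed) simp
  have "Int_stable (Collect closed :: ell2 set set)" "Collect closed \<subseteq> Pow (UNIV :: ell2 set)"
    "A \<in> sigma_sets UNIV (Collect closed)"
    using assms by (auto simp: Int_stable_def sb)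
  then show ?thesis
  proof (induction rule: sigma_sets_induct_disjoint)
    case (basic A)
    then show ?case by (simp add: lipschitz_approx_indicator_closed)
  next
    case empty
    show ?case by (rule lipschitz_approx_indicator_closed) simp
  next
    case (compl A)
    then have [measurable]: "A \<in> sets borel" by (simp add: sb)
    have "lipschitz_approx (\<lambda>x. 1 + (-1) * indicator A x)"
      by (intro lipschitz_approx_add lipschitz_approx_cmult compl lipschitz_approx_bd_lipschitz bd_lipschitz_const) auto
    also have "(\<lambda>x. 1 + (-1) * indicator A x :: real) = indicator (UNIV - A)" by (auto simp: indicator_def)
    finally show ?case .
  next
    case (union A)
    have A[measurable]: "A i \<in> sets borel" for i using union(2) by (auto simp: sb)
    have fin: "lipschitz_approx (\<lambda>x. \<Sum>i<n. indicator (A i) x)" for n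
    proof (induction n)
      case (Suc n)
      have "lipschitz_approx (\<lambda>x. (\<Sum>i<n. indicator (A i) x) + indicator (A n) x)"
        by (intro lipschitz_approx_add Suc union) measurable
      then show ?case by simp
    qed (use lipschitz_approx_bd_lipschitz[OF bd_lipschitz_const] in auto)
    have eq: "(\<Sum>i<n. indicator (A i) x) = (indicator (\<Union>i<n. A i) x :: real)" for n x
      using union(1) by (subst indicator_UN_disjoint) (auto simp: disjoint_family_on_def)
    have fin': "lipschitz_approx (indicator (\<Union>i<n. A i))" for n
      using fin[of n] unfolding eq by simp
    show ?case
    proof (rule lipschitz_approx_lim[OF _ _ fin'])
      show "(\<lambda>n. L2_dist (indicator (\<Union>i. A i)) (indicator (\<Union>i<n. A i))) \<longlonglongrightarrow> 0"
      proof (rule L2_dist_dominated[where g="\<lambda>_. 1"])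
        show "(\<lambda>n. indicator (\<Union>i<n. A i) x :: real) \<longlonglongrightarrow> indicator (\<Union>i. A i) x" for x
          by (rule LIMSEQ_indicator_UN)
      qed (use PG.emeasure_space_1 in \<open>auto simp: indicator_def\<close>)
    qed auto
  qed
qed

lemma lipschitz_dense:
  assumes [measurable]: "f \<in> borel_measurable borel" and fin: "(\<integral>\<^sup>+x. ennreal ((f x)\<^sup>2) \<partial>G) < \<infinity>"
  shows "lipschitz_approx f"
proof -
  \<comment> \<open>Square integrability is carried as an implication, because nonnegative summands
    and the members of an increasing sequence inherit it by domination from the whole.\<close>
  have pos: "(\<integral>\<^sup>+x. ennreal ((u x)\<^sup>2) \<partial>G) < \<infinity> \<longrightarrow> lipschitz_approx u"
    if "u \<in> borel_measurable borel" "\<And>x. 0 \<le> u x" for u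
    using that
  proof (induction rule: borel_measurable_induct_real)
    case (set A)
    then show ?case by (simp add: lipschitz_approx_indicator)
  next
    case (mult u c)
    note [measurable] = mult(2)
    show ?case
    proof (cases "c = 0")
      case True
      then show ?thesis by (simp add: lipschitz_approx_bd_lipschitz bd_lipschitz_const)
    next
      case False
      have "(\<integral>\<^sup>+x. ennreal ((c * u x)\<^sup>2) \<partial>G) = ennreal (c\<^sup>2) * (\<integral>\<^sup>+x. ennreal ((u x)\<^sup>2) \<partial>G)"
        by (subst nn_integral_cmult[symmetric]) (auto simp: ennreal_mult'[symmetric] power_mult_distrib)
      with False mult show ?thesis
        by (auto simp: ennreal_mult_less_top intro!: lipschitz_approx_cmult)
    qed
  next
    case (add u v)
    note [measurable] = add(1,4)
    show ?case
    proof
      assume *: "(\<integral>\<^sup>+x. ennreal ((v x + u x)\<^sup>2) \<partial>G) < \<infinity>"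
      have "(\<integral>\<^sup>+x. ennreal ((v x)\<^sup>2) \<partial>G) \<le> (\<integral>\<^sup>+x. ennreal ((v x + u x)\<^sup>2) \<partial>G)"
        "(\<integral>\<^sup>+x. ennreal ((u x)\<^sup>2) \<partial>G) \<le> (\<integral>\<^sup>+x. ennreal ((v x + u x)\<^sup>2) \<partial>G)"
        using add by (auto intro!: nn_integral_mono ennreal_leI power_mono)
      then have "lipschitz_approx v" "lipschitz_approx u" using add * by (auto dest: le_less_trans)
      then show "lipschitz_approx (\<lambda>x. v x + u x)" by (intro lipschitz_approx_add) (use add in auto)
    qed
  next
    case (seq U)
    note [measurable] = seq(1)
    have U: "U i x \<le> u x" for i x
      by (rule incseq_le[OF _ seq(4)]) (use seq(3) in \<open>auto simp: incseq_def le_fun_def\<close>)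
    have [measurable]: "u \<in> borel_measurable borel"
      by (rule borel_measurable_LIMSEQ_real[OF seq(4) seq(1)])
    show ?case
    proof
      assume *: "(\<integral>\<^sup>+x. ennreal ((u x)\<^sup>2) \<partial>G) < \<infinity>"
      have "(\<integral>\<^sup>+x. ennreal ((U i x)\<^sup>2) \<partial>G) \<le> (\<integral>\<^sup>+x. ennreal ((u x)\<^sup>2) \<partial>G)" for i
        using seq(2) U by (auto intro!: nn_integral_mono ennreal_leI power_mono)
      then have "lipschitz_approx (U i)" for i using seq(5) * le_less_trans by blast
      then show "lipschitz_approx u"
      proof (rule lipschitz_approx_lim[rotated 2])
        show "(\<lambda>n. L2_dist u (U n)) \<longlonglongrightarrow> 0"
          by (rule L2_dist_dominated[where g=u]) (use seq U * in auto)
      qed auto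
    qed
  qed
  have "lipschitz_approx (\<lambda>x. max 0 (f x))" "lipschitz_approx (\<lambda>x. max 0 (- f x))"
  proof -
    have "(\<integral>\<^sup>+x. ennreal ((max 0 (f x))\<^sup>2) \<partial>G) \<le> (\<integral>\<^sup>+x. ennreal ((f x)\<^sup>2) \<partial>G)"
      "(\<integral>\<^sup>+x. ennreal ((max 0 (- f x))\<^sup>2) \<partial>G) \<le> (\<integral>\<^sup>+x. ennreal ((f x)\<^sup>2) \<partial>G)"
      by (auto intro!: nn_integral_mono ennreal_leI simp: max_def)
    then show "lipschitz_approx (\<lambda>x. max 0 (f x))" "lipschitz_approx (\<lambda>x. max 0 (- f x))"
      using fin by (auto intro!: pos[rule_format] dest: le_less_trans)
  qed
  then have "lipschitz_approx (\<lambda>x. max 0 (f x) + (-1) * max 0 (- f x))"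
    by (intro lipschitz_approx_add lipschitz_approx_cmult) auto
  also have "(\<lambda>x. max 0 (f x) + (-1) * max 0 (- f x)) = f" by (auto simp: max_def)
  finally show ?thesis .
qed


section \<open>Weak derivatives\<close>

definition sq_int :: "(ell2 \<Rightarrow> real) \<Rightarrow> bool"
  where "sq_int f \<longleftrightarrow> f \<in> borel_measurable borel \<and> (\<integral>\<^sup>+x. ennreal ((f x)\<^sup>2) \<partial>G) < \<infinity>"

lemma sq_int_measurable: "sq_int f \<Longrightarrow> f \<in> borel_measurable borel"
  by (simp add: sq_int_def)

lemma sq_int_integrable_sq: "sq_int f \<longleftrightarrow> f \<in> borel_measurable borel \<and> integrable G (\<lambda>x. (f x)\<^sup>2)"
  unfolding sq_int_def integrable_iff_bounded
  using borel_measurable_power[of f borel 2] by (auto simp: cong: measurable_cong_sets)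

lemma sq_int_integrable:
  assumes "sq_int f" shows "integrable G f"
proof -
  interpret PG: prob_space G by (rule prob_space_G)
  note [measurable] = sq_int_measurable[OF assms]
  show ?thesis
  proof (rule Bochner_Integration.integrable_bound)
    show "integrable G (\<lambda>x. 1 + (f x)\<^sup>2)"
      using assms unfolding sq_int_integrable_sq by (intro Bochner_Integration.integrable_add) auto
    show "AE x in G. norm (f x) \<le> norm (1 + (f x)\<^sup>2)"
    proof (rule AE_I2)
      fix x
      have "\<bar>f x\<bar> \<le> 1 + (f x)\<^sup>2" using sum_squares_bound[of "\<bar>f x\<bar>" 1] by simp
      then show "norm (f x) \<le> norm (1 + (f x)\<^sup>2)" by simp
    qed
  qed simp
qed

lemma sq_int_bound:
  assumes "sq_int f" and [measurable]: "g \<in> borel_measurable borel" and "\<And>x. \<bar>g x\<bar> \<le> B * \<bar>f x\<bar>"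
  shows "sq_int g"
proof -
  note [measurable] = sq_int_measurable[OF assms(1)]
  have "(\<integral>\<^sup>+x. ennreal ((g x)\<^sup>2) \<partial>G) \<le> (\<integral>\<^sup>+x. ennreal (B\<^sup>2) * ennreal ((f x)\<^sup>2) \<partial>G)"
  proof (rule nn_integral_mono)
    fix x
    have "\<bar>g x\<bar> \<le> \<bar>B * f x\<bar>" using assms(3)[of x] by (simp add: abs_mult) (meson abs_ge_self abs_ge_zero mult_right_mono order_trans)
    then have "(g x)\<^sup>2 \<le> B\<^sup>2 * (f x)\<^sup>2" by (simp add: abs_le_square_iff power_mult_distrib)
    then show "ennreal ((g x)\<^sup>2) \<le> ennreal (B\<^sup>2) * ennreal ((f x)\<^sup>2)" by (subst ennreal_mult[symmetric]) (auto intro: ennreal_leI)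
  qed
  also have "\<dots> = ennreal (B\<^sup>2) * (\<integral>\<^sup>+x. ennreal ((f x)\<^sup>2) \<partial>G)" by (rule nn_integral_cmult) measurable
  also have "\<dots> < \<infinity>" using assms(1) by (simp add: sq_int_def ennreal_mult_less_top)
  finally show ?thesis by (simp add: sq_int_def)
qed

lemma sq_int_add:
  assumes "sq_int f" "sq_int g" shows "sq_int (\<lambda>x. f x + g x)"
proof -
  note [measurable] = sq_int_measurable[OF assms(1)] sq_int_measurable[OF assms(2)]
  have "integrable G (\<lambda>x. (f x + g x)\<^sup>2)"
  proof (rule Bochner_Integration.integrable_bound)
    show "integrable G (\<lambda>x. 2 * (f x)\<^sup>2 + 2 * (g x)\<^sup>2)"
      using assms unfolding sq_int_integrable_sq by auto
    show "AE x in G. norm ((f x + g x)\<^sup>2) \<le> norm (2 * (f x)\<^sup>2 + 2 * (g x)\<^sup>2)"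
      using sq_sum_le by auto
  qed simp
  then show ?thesis unfolding sq_int_integrable_sq by auto
qed

text \<open>Test functions on \<open>V\<close> are known to be measurable on \<open>V\<close> only;
  the factor that vanishes outside makes the product Borel everywhere.\<close>

lemma measurable_zero_off:
  fixes f g :: "ell2 \<Rightarrow> real"
  assumes V: "open V" and [measurable]: "f \<in> borel_measurable borel"
    and g: "g \<in> borel_measurable (restrict_space borel V)" and z: "\<And>x. x \<notin> V \<Longrightarrow> f x = 0"
  shows "(\<lambda>x. f x * g x) \<in> borel_measurable borel"
proof -
  have [measurable]: "(\<lambda>x. indicator V x *\<^sub>R g x) \<in> borel_measurable borel"
    using g V by (simp add: borel_measurable_restrict_space_iff)
  have "(\<lambda>x. f x * g x) = (\<lambda>x. f x * (indicator V x *\<^sub>R g x))"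
  proof
    fix x show "f x * g x = f x * (indicator V x *\<^sub>R g x)" using z[of x] by (cases "x \<in> V") auto
  qed
  moreover have "(\<lambda>x. f x * (indicator V x *\<^sub>R g x)) \<in> borel_measurable borel" by measurable
  ultimately show ?thesis by simp
qed

lemma sq_int_mult_bounded:
  assumes V: "open V" and f: "sq_int f"
    and g: "g \<in> borel_measurable (restrict_space borel V)" and z: "\<And>x. x \<notin> V \<Longrightarrow> f x = 0"
    and B: "\<And>x. x \<in> V \<Longrightarrow> \<bar>g x\<bar> \<le> B"
  shows "sq_int (\<lambda>x. f x * g x)"
proof (rule sq_int_bound[OF f])
  show "(\<lambda>x. f x * g x) \<in> borel_measurable borel"
    by (rule measurable_zero_off[OF V sq_int_measurable[OF f] g z])
  show "\<bar>f x * g x\<bar> \<le> B * \<bar>f x\<bar>" for x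
    using z[of x] B[of x] by (cases "x \<in> V") (auto simp: abs_mult mult.commute[of _ "\<bar>f x\<bar>"] mult_left_mono)
qed

lemma sq_int_mult:
  assumes "sq_int f" "g \<in> borel_measurable borel" "\<And>x. \<bar>g x\<bar> \<le> B"
  shows "sq_int (\<lambda>x. f x * g x)"
  by (rule sq_int_mult_bounded[OF open_UNIV assms(1)])
    (use assms(2,3) in \<open>auto simp: borel_measurable_restrict_UNIV\<close>)

text \<open>The unbounded factor \<open>coord x j\<close> in \<open>adj_partial\<close> is harmless
  because a test function has bounded support. Pairings with square-integrable functions are then
  integrable.\<close>

lemma C_F0_facts:
  assumes "\<phi> \<in> C_F0 V" "open V"
  obtains B where "\<And>x. x \<in> V \<Longrightarrow> \<bar>\<phi> x\<bar> \<le> B"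
    "\<And>x. x \<in> V \<Longrightarrow> \<bar>adj_partial a j \<phi> x\<bar> \<le> B" "\<phi> \<in> borel_measurable (restrict_space borel V)"
    "adj_partial a j \<phi> \<in> borel_measurable (restrict_space borel V)"
proof -
  have sm: "F_smooth V \<phi>" and wi: "well_inside {x \<in> V. \<phi> x \<noteq> 0} V" using assms C_F0_iff by auto
  obtain b where b: "\<And>x. x \<in> V \<Longrightarrow> \<bar>\<phi> x\<bar> \<le> b" using F_smooth_bounded[OF sm] by auto
  obtain c where c: "\<And>x. x \<in> V \<Longrightarrow> \<bar>partial j \<phi> x\<bar> \<le> c" by (rule F_smooth_partial_bounded[OF sm, of j]) auto
  obtain R where R: "R > 0" "{x \<in> V. \<phi> x \<noteq> 0} \<subseteq> ball 0 R" using wi by (auto simp: well_inside_def)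
  define B where "B = \<bar>b\<bar> + \<bar>c\<bar> + R / (a j)\<^sup>2 * \<bar>b\<bar>"
  have pos: "0 \<le> R / (a j)\<^sup>2 * \<bar>b\<bar>" using R by simp
  have x: "\<bar>coord x j / (a j)\<^sup>2 * \<phi> x\<bar> \<le> R / (a j)\<^sup>2 * \<bar>b\<bar>" if "x \<in> V" for x
  proof (cases "\<phi> x = 0")
    case False
    then have "\<bar>coord x j\<bar> \<le> R" using R(2) that abs_coord_le_norm[of x j] by force
    then have "\<bar>coord x j\<bar> / (a j)\<^sup>2 * \<bar>\<phi> x\<bar> \<le> R / (a j)\<^sup>2 * \<bar>b\<bar>"
      using b[OF that] R by (intro mult_mono divide_right_mono) auto
    then show ?thesis by (simp add: abs_mult)
  qed (use pos in simp)
  have m: "\<phi> \<in> borel_measurable (restrict_space borel V)" "partial j \<phi> \<in> borel_measurable (restrict_space borel V)"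
    using F_smoothD(4)[OF sm, of "[]"] F_smoothD(4)[OF sm, of "[j]"] by simp_all
  have mc: "(\<lambda>x. coord x j) \<in> borel_measurable (restrict_space borel V)"
    by (intro measurable_restrict_space1 coord_measurable)
  show ?thesis
  proof (rule that[of B])
    fix x assume V: "x \<in> V"
    show "\<bar>\<phi> x\<bar> \<le> B" using b[OF V] c[OF V] pos unfolding B_def by linarith
    show "\<bar>adj_partial a j \<phi> x\<bar> \<le> B"
      using c[OF V] x[OF V] unfolding B_def adj_partial_def by linarith
  next
    show "adj_partial a j \<phi> \<in> borel_measurable (restrict_space borel V)"
      unfolding adj_partial_def[abs_def] using m mc by measurable
  qed (use m in auto)
qed

text \<open>One relation for the function and all its weak derivatives, with everything set to 0
  outside \<open>V\<close>, so that every integral runs over the whole space.\<close>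

definition weak :: "ell2 set \<Rightarrow> (ell2 \<Rightarrow> real) \<Rightarrow> (nat \<Rightarrow> ell2 \<Rightarrow> real) \<Rightarrow> bool"
  where "weak V f q \<longleftrightarrow> sq_int f \<and> (\<forall>j. sq_int (q j)) \<and> (\<forall>x. x \<notin> V \<longrightarrow> f x = 0 \<and> (\<forall>j. q j x = 0)) \<and>
    (\<forall>\<phi>\<in>C_F0 V. \<forall>j. (\<integral>x. q j x * \<phi> x \<partial>G) = (\<integral>x. f x * adj_partial a j \<phi> x \<partial>G))"

text \<open>The cutoff is moved to the test function: \<open>adj_partial\<close> of
  \<open>\<beta> * \<phi>\<close> is \<open>\<beta>\<close> times that of \<open>\<phi>\<close>
  minus \<open>partial j \<beta> * \<phi>\<close>. The assumption \<open>test\<close> makes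
  \<open>\<beta> * \<phi>\<close> admissible, both when \<open>W\<close> is \<open>V\<close> and
  when \<open>V\<close> is enlarged.\<close>

lemma weak_mult:
  assumes V: "open V" "V \<subseteq> W" and fq: "weak V f q"
    and \<beta>: "F_smooth UNIV \<beta>"
    and test: "\<And>\<phi>. \<phi> \<in> C_F0 W \<Longrightarrow> (\<lambda>x. \<beta> x * \<phi> x) \<in> C_F0 V \<and> F_smooth V \<phi>"
  shows "weak W (\<lambda>x. \<beta> x * f x) (\<lambda>j x. \<beta> x * q j x + partial j \<beta> x * f x)"
proof -
  note [measurable] = F_smooth_UNIV_measurable[OF \<beta>]
  obtain b where b: "\<And>x. \<bar>\<beta> x\<bar> \<le> b" using F_smooth_bounded[OF \<beta>] by auto
  have f: "sq_int f" "\<And>j. sq_int (q j)" "\<And>x. x \<notin> V \<Longrightarrow> f x = 0" "\<And>x j. x \<notin> V \<Longrightarrow> q j x = 0"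
    and wk: "\<And>\<phi> j. \<phi> \<in> C_F0 V \<Longrightarrow> (\<integral>x. q j x * \<phi> x \<partial>G) = (\<integral>x. f x * adj_partial a j \<phi> x \<partial>G)"
    using fq by (auto simp: weak_def)
  note [measurable] = sq_int_measurable[OF f(1)] sq_int_measurable[OF f(2)]
  have s1: "sq_int (\<lambda>x. \<beta> x * f x)"
    by (rule sq_int_bound[OF f(1), of _ b]) (use b in \<open>auto simp: abs_mult mult_right_mono\<close>)
  have s2: "sq_int (\<lambda>x. \<beta> x * q j x + partial j \<beta> x * f x)" for j
  proof (rule sq_int_add)
    obtain c where c: "\<And>x. \<bar>partial j \<beta> x\<bar> \<le> c" by (rule F_smooth_partial_bounded[OF \<beta>, of j]) auto
    show "sq_int (\<lambda>x. \<beta> x * q j x)"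
      by (rule sq_int_bound[OF f(2)[of j], of _ b]) (use b in \<open>auto simp: abs_mult mult_right_mono\<close>)
    show "sq_int (\<lambda>x. partial j \<beta> x * f x)"
      by (rule sq_int_bound[OF f(1), of _ c]) (use c in \<open>auto simp: abs_mult mult_right_mono\<close>)
  qed
  have "(\<integral>x. (\<beta> x * q j x + partial j \<beta> x * f x) * \<phi> x \<partial>G) = (\<integral>x. (\<beta> x * f x) * adj_partial a j \<phi> x \<partial>G)"
    if \<phi>: "\<phi> \<in> C_F0 W" for \<phi> j
  proof -
    have bp: "(\<lambda>x. \<beta> x * \<phi> x) \<in> C_F0 V" and sm: "F_smooth V \<phi>" using test[OF \<phi>] by auto
    have \<beta>V: "F_smooth V \<beta>" using F_smooth_subset[OF \<beta>] by simp
    obtain B where B: "\<And>x. x \<in> V \<Longrightarrow> \<bar>\<beta> x * \<phi> x\<bar> \<le> B" "\<And>x. x \<in> V \<Longrightarrow> \<bar>adj_partial a j (\<lambda>x. \<beta> x * \<phi> x) x\<bar> \<le> B"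
      "(\<lambda>x. \<beta> x * \<phi> x) \<in> borel_measurable (restrict_space borel V)"
      "adj_partial a j (\<lambda>x. \<beta> x * \<phi> x) \<in> borel_measurable (restrict_space borel V)"
      by (rule C_F0_facts[OF bp V(1), of j]) blast
    obtain c where c: "\<And>x. \<bar>partial j \<beta> x\<bar> \<le> c" by (rule F_smooth_partial_bounded[OF \<beta>, of j]) auto
    obtain d where d: "\<And>x. x \<in> V \<Longrightarrow> \<bar>\<phi> x\<bar> \<le> d" using F_smooth_bounded[OF sm] by auto
    have m: "\<phi> \<in> borel_measurable (restrict_space borel V)" "partial j \<beta> \<in> borel_measurable (restrict_space borel V)"
      using F_smoothD(4)[OF sm, of "[]"] F_smoothD(4)[OF \<beta>V, of "[j]"] by simp_all
    have i1: "integrable G (\<lambda>x. q j x * (\<beta> x * \<phi> x))"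
      by (rule sq_int_integrable[OF sq_int_mult_bounded[OF V(1) f(2) B(3) f(4) B(1)]])
    have i2: "integrable G (\<lambda>x. f x * (partial j \<beta> x * \<phi> x))"
    proof (rule sq_int_integrable[OF sq_int_mult_bounded[OF V(1) f(1) _ f(3)]])
      show "(\<lambda>x. partial j \<beta> x * \<phi> x) \<in> borel_measurable (restrict_space borel V)" using m by measurable
      show "\<bar>partial j \<beta> x * \<phi> x\<bar> \<le> c * d" if "x \<in> V" for x
        unfolding abs_mult using c d[OF that] by (intro mult_mono) (auto intro: order_trans[OF abs_ge_zero])
    qed
    have i3: "integrable G (\<lambda>x. f x * adj_partial a j (\<lambda>x. \<beta> x * \<phi> x) x)"
      by (rule sq_int_integrable[OF sq_int_mult_bounded[OF V(1) f(1) B(4) f(3) B(2)]])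
    have "(\<integral>x. (\<beta> x * q j x + partial j \<beta> x * f x) * \<phi> x \<partial>G) = (\<integral>x. q j x * (\<beta> x * \<phi> x) + f x * (partial j \<beta> x * \<phi> x) \<partial>G)"
      by (simp add: algebra_simps)
    also have "\<dots> = (\<integral>x. q j x * (\<beta> x * \<phi> x) \<partial>G) + (\<integral>x. f x * (partial j \<beta> x * \<phi> x) \<partial>G)"
      by (rule Bochner_Integration.integral_add[OF i1 i2])
    also have "(\<integral>x. q j x * (\<beta> x * \<phi> x) \<partial>G) = (\<integral>x. f x * adj_partial a j (\<lambda>x. \<beta> x * \<phi> x) x \<partial>G)"
      by (rule wk[OF bp])
    also have "\<dots> + (\<integral>x. f x * (partial j \<beta> x * \<phi> x) \<partial>G) = (\<integral>x. f x * adj_partial a j (\<lambda>x. \<beta> x * \<phi> x) x + f x * (partial j \<beta> x * \<phi> x) \<partial>G)"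
      by (rule Bochner_Integration.integral_add[OF i3 i2, symmetric])
    also have "\<dots> = (\<integral>x. (\<beta> x * f x) * adj_partial a j \<phi> x \<partial>G)"
    proof (rule Bochner_Integration.integral_cong[OF refl])
      fix x
      show "f x * adj_partial a j (\<lambda>x. \<beta> x * \<phi> x) x + f x * (partial j \<beta> x * \<phi> x) = (\<beta> x * f x) * adj_partial a j \<phi> x"
      proof (cases "x \<in> V")
        case True
        then show ?thesis using partial_mult[OF \<beta>V sm True, of j] by (simp add: adj_partial_def algebra_simps)
      qed (simp add: f(3))
    qed
    finally show ?thesis .
  qed
  moreover have "x \<notin> W \<Longrightarrow> f x = 0 \<and> q j x = 0" for x j using f(3,4) V by auto
  ultimately show ?thesis unfolding weak_def using s1 s2 by simp
qed

lemma weak_mult_same: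
  assumes V: "open V" and fq: "weak V f q" and \<beta>: "F_smooth UNIV \<beta>" "grad_bound UNIV \<beta> C"
  shows "weak V (\<lambda>x. \<beta> x * f x) (\<lambda>j x. \<beta> x * q j x + partial j \<beta> x * f x)"
proof (rule weak_mult[OF V order_refl fq \<beta>(1)])
  fix \<phi> assume \<phi>: "\<phi> \<in> C_F0 V"
  have "well_inside {x \<in> V. \<phi> x \<noteq> 0} V" using \<phi> C_F0_iff by auto
  then have "well_inside {x \<in> V. \<beta> x * \<phi> x \<noteq> 0} V" by (rule well_inside_mono[rotated]) auto
  moreover have "F_smooth V \<beta>" "grad_bound V \<beta> C"
    using \<beta> F_smooth_subset[OF \<beta>(1), of V] by (auto simp: grad_bound_def)
  ultimately show "(\<lambda>x. \<beta> x * \<phi> x) \<in> C_F0 V \<and> F_smooth V \<phi>"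
    using C_F0_mult[OF V V \<phi> order_refl] \<phi> C_F0_iff by blast
qed

text \<open>A cutoff that lives well inside \<open>V\<close> turns every test function of the whole
  space into one on \<open>V\<close>; extension by zero then creates no boundary term.\<close>

lemma weak_mult_extend:
  assumes V: "open V" and fq: "weak V f q" and \<beta>: "F_smooth UNIV \<beta>" "grad_bound UNIV \<beta> C"
    and wi: "well_inside {x. \<beta> x \<noteq> 0} V"
  shows "weak UNIV (\<lambda>x. \<beta> x * f x) (\<lambda>j x. \<beta> x * q j x + partial j \<beta> x * f x)"
proof (rule weak_mult[OF V _ fq \<beta>(1)])
  fix \<phi> assume \<phi>: "\<phi> \<in> C_F0 UNIV"
  have "well_inside {x \<in> V. \<beta> x * \<phi> x \<noteq> 0} V" by (rule well_inside_mono[OF _ wi]) auto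
  moreover have "F_smooth V \<beta>" "grad_bound V \<beta> C"
    using \<beta> F_smooth_subset[OF \<beta>(1), of V] by (auto simp: grad_bound_def)
  moreover have "F_smooth V \<phi>" using \<phi> C_F0_iff F_smooth_subset by blast
  ultimately show "(\<lambda>x. \<beta> x * \<phi> x) \<in> C_F0 V \<and> F_smooth V \<phi>"
    using C_F0_mult[OF open_UNIV V \<phi>] by simp
qed simp

definition test_fun :: "(ell2 \<Rightarrow> real) \<Rightarrow> bool"
  where "test_fun \<phi> \<longleftrightarrow> F_smooth UNIV \<phi> \<and> (\<exists>C. grad_bound UNIV \<phi> C) \<and> (\<exists>R. \<forall>x. \<phi> x \<noteq> 0 \<longrightarrow> norm x \<le> R)"

lemma test_fun_C_F0: "test_fun \<phi> \<Longrightarrow> \<phi> \<in> C_F0 UNIV"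
proof -
  assume \<phi>: "test_fun \<phi>"
  then obtain R where "\<forall>x. \<phi> x \<noteq> 0 \<longrightarrow> norm x \<le> R" by (auto simp: test_fun_def)
  then have "{x. \<phi> x \<noteq> 0} \<subseteq> ball 0 (\<bar>R\<bar> + 1)" by force
  then have "well_inside {x\<in>UNIV. \<phi> x \<noteq> 0} UNIV"
    unfolding well_inside_def by (intro exI[of _ 1] conjI exI[of _ "\<bar>R\<bar> + 1"]) auto
  then show ?thesis using \<phi> C_F0_iff by (auto simp: test_fun_def)
qed

text \<open>For a test function \<open>\<phi>\<close> on \<open>V\<close> the product
  \<open>u * \<phi>\<close>, extended by zero, is smooth on the whole space with bounded support,
  and \<open>integration_by_parts\<close> applies to it.\<close>

lemma weak_smooth:
  assumes V: "open V" and u: "test_fun u"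
  shows "weak V (\<lambda>x. indicator V x * u x) (\<lambda>j x. indicator V x * partial j u x)"
proof -
  interpret PG: prob_space G by (rule prob_space_G)
  have us: "F_smooth UNIV u" using u by (simp add: test_fun_def)
  note [measurable] = F_smooth_UNIV_measurable[OF us]
  have [measurable]: "V \<in> sets borel" using V by simp
  obtain b where b: "\<And>x. \<bar>u x\<bar> \<le> b" using F_smooth_bounded[OF us] by auto
  have c1: "sq_int (\<lambda>x. 1)" by (simp add: sq_int_def PG.emeasure_space_1[simplified])
  have s1: "sq_int (\<lambda>x. indicator V x * u x)"
    by (rule sq_int_bound[OF c1, of _ "\<bar>b\<bar>"]) (use b in \<open>auto simp: indicator_def intro: order_trans[OF _ abs_ge_self]\<close>)
  have s2: "sq_int (\<lambda>x. indicator V x * partial j u x)" for j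
  proof -
    obtain c where c: "\<And>x. \<bar>partial j u x\<bar> \<le> c" by (rule F_smooth_partial_bounded[OF us, of j]) auto
    show ?thesis
      by (rule sq_int_bound[OF c1, of _ "\<bar>c\<bar>"]) (use c in \<open>auto simp: indicator_def intro: order_trans[OF _ abs_ge_self]\<close>)
  qed
  have "(\<integral>x. indicator V x * partial j u x * \<phi> x \<partial>G) = (\<integral>x. indicator V x * u x * adj_partial a j \<phi> x \<partial>G)"
    if \<phi>: "\<phi> \<in> C_F0 V" for \<phi> j
  proof -
    have sm: "F_smooth V \<phi>" and wi: "well_inside {x \<in> V. \<phi> x \<noteq> 0} V" using \<phi> C_F0_iff by auto
    have uV: "F_smooth V u" using F_smooth_subset[OF us] by simp
    let ?E = "{x \<in> V. \<phi> x \<noteq> 0}"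
    define w where "w x = (if x \<in> V then u x * \<phi> x else 0)" for x
    have wV: "F_smooth V w"
      by (rule F_smooth_cong[OF V _ F_smooth_mult[OF V uV sm]]) (simp add: w_def)
    have w0: "w x = 0" if "x \<notin> ?E" for x using that by (auto simp: w_def)
    have ws: "F_smooth UNIV w" by (rule F_smooth_zero_extension[OF V wV wi w0])
    obtain R where R: "?E \<subseteq> ball 0 R" using wi by (auto simp: well_inside_def)
    have wR: "norm x \<le> R" if "w x \<noteq> 0" for x using w0[of x] that R by force
    have pw: "partial j w x = (if x \<in> V then partial j u x * \<phi> x + u x * partial j \<phi> x else 0)" for x
    proof (cases "x \<in> V")
      case True
      have "partial j w x = partial j (\<lambda>x. u x * \<phi> x) x"
        by (rule partial_cong[OF V True]) (simp add: w_def)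
      then show ?thesis using True partial_mult[OF uV sm True, of j] by simp
    next
      case False
      have "partial j w x = partial j (\<lambda>x. 0) x"
      proof (rule partial_cong[of "- closure ?E"])
        show "x \<in> - closure ?E" using False well_inside_closure[OF wi] by auto
        show "w y = 0" if "y \<in> - closure ?E" for y using that closure_subset w0 by blast
      qed (simp add: open_Compl)
      then show ?thesis using False has_pd_imp_partial[OF has_pd_const] by simp
    qed
    obtain B where B: "\<And>x. x \<in> V \<Longrightarrow> \<bar>\<phi> x\<bar> \<le> B" "\<And>x. x \<in> V \<Longrightarrow> \<bar>adj_partial a j \<phi> x\<bar> \<le> B"
      "\<phi> \<in> borel_measurable (restrict_space borel V)"
      "adj_partial a j \<phi> \<in> borel_measurable (restrict_space borel V)"
      by (rule C_F0_facts[OF \<phi> V, of j]) blast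
    have i1: "integrable G (\<lambda>x. indicator V x * partial j u x * \<phi> x)"
      by (rule sq_int_integrable[OF sq_int_mult_bounded[OF V s2 B(3) _ B(1)]]) auto
    have i2: "integrable G (\<lambda>x. indicator V x * u x * adj_partial a j \<phi> x)"
      by (rule sq_int_integrable[OF sq_int_mult_bounded[OF V s1 B(4) _ B(2)]]) auto
    note [measurable] = F_smooth_UNIV_measurable[OF ws]
    obtain b' c' where b': "\<And>x. \<bar>w x\<bar> \<le> b'" and c': "\<And>x. \<bar>partial j w x\<bar> \<le> c'"
      using F_smooth_bounded[OF ws] F_smooth_partial_bounded[OF ws, of j] by (metis UNIV_I)
    have i3: "integrable G (partial j w)"
      by (rule PG.integrable_const_bound[of _ c']) (use c' in auto)
    have i4: "integrable G (\<lambda>x. w x * (coord x j / (a j)\<^sup>2))"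
    proof (rule PG.integrable_const_bound[of _ "b' * (\<bar>R\<bar> / (a j)\<^sup>2)"])
      show "AE x in G. norm (w x * (coord x j / (a j)\<^sup>2)) \<le> b' * (\<bar>R\<bar> / (a j)\<^sup>2)"
      proof (rule AE_I2)
        fix x
        have b0: "0 \<le> b'" using b'[of x] by linarith
        show "norm (w x * (coord x j / (a j)\<^sup>2)) \<le> b' * (\<bar>R\<bar> / (a j)\<^sup>2)"
        proof (cases "w x = 0")
          case False
          have "\<bar>coord x j\<bar> \<le> \<bar>R\<bar>" using wR[OF False] abs_coord_le_norm[of x j] by linarith
          then have "\<bar>w x\<bar> * (\<bar>coord x j\<bar> / (a j)\<^sup>2) \<le> b' * (\<bar>R\<bar> / (a j)\<^sup>2)"
            using b' b0 by (intro mult_mono divide_right_mono) auto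
          then show ?thesis by (simp add: abs_mult)
        qed (use b0 in auto)
      qed
    qed measurable
    have "(\<integral>x. indicator V x * partial j u x * \<phi> x \<partial>G) - (\<integral>x. indicator V x * u x * adj_partial a j \<phi> x \<partial>G)
      = (\<integral>x. indicator V x * partial j u x * \<phi> x - indicator V x * u x * adj_partial a j \<phi> x \<partial>G)"
      by (rule Bochner_Integration.integral_diff[OF i1 i2, symmetric])
    also have "\<dots> = (\<integral>x. partial j w x - w x * (coord x j / (a j)\<^sup>2) \<partial>G)"
      by (rule Bochner_Integration.integral_cong[OF refl])
        (auto simp: pw w_def adj_partial_def indicator_def algebra_simps)
    also have "\<dots> = (\<integral>x. partial j w x \<partial>G) - (\<integral>x. w x * (coord x j / (a j)\<^sup>2) \<partial>G)"
      by (rule Bochner_Integration.integral_diff[OF i3 i4])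
    also have "\<dots> = 0" using integration_by_parts[OF ws wR] by simp
    finally show ?thesis by simp
  qed
  then show ?thesis unfolding weak_def using s1 s2 by simp
qed

lemma weak_diff:
  assumes V: "open V" and "weak V f q" "weak V g r"
  shows "weak V (\<lambda>x. f x - g x) (\<lambda>j x. q j x - r j x)"
proof -
  have neg: "sq_int (\<lambda>x. - u x)" if "sq_int u" for u
    by (rule sq_int_bound[OF that, of _ 1]) (use sq_int_measurable[OF that] in auto)
  have sub: "sq_int (\<lambda>x. u x - v x)" if "sq_int u" "sq_int v" for u v
    using sq_int_add[OF that(1) neg[OF that(2)]] by simp
  have s: "sq_int f" "sq_int (q j)" "sq_int g" "sq_int (r j)"
    and z: "x \<notin> V \<Longrightarrow> f x = 0" "x \<notin> V \<Longrightarrow> q j x = 0" "x \<notin> V \<Longrightarrow> g x = 0" "x \<notin> V \<Longrightarrow> r j x = 0" for j x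
    using assms by (auto simp: weak_def)
  have "(\<integral>x. (q j x - r j x) * \<phi> x \<partial>G) = (\<integral>x. (f x - g x) * adj_partial a j \<phi> x \<partial>G)"
    if \<phi>: "\<phi> \<in> C_F0 V" for \<phi> j
  proof -
    obtain B where B: "\<And>x. x \<in> V \<Longrightarrow> \<bar>\<phi> x\<bar> \<le> B" "\<And>x. x \<in> V \<Longrightarrow> \<bar>adj_partial a j \<phi> x\<bar> \<le> B"
      "\<phi> \<in> borel_measurable (restrict_space borel V)"
      "adj_partial a j \<phi> \<in> borel_measurable (restrict_space borel V)"
      by (rule C_F0_facts[OF \<phi> V, of j]) blast
    have i: "integrable G (\<lambda>x. q j x * \<phi> x)" "integrable G (\<lambda>x. r j x * \<phi> x)"
      "integrable G (\<lambda>x. f x * adj_partial a j \<phi> x)" "integrable G (\<lambda>x. g x * adj_partial a j \<phi> x)"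
      by (rule sq_int_integrable[OF sq_int_mult_bounded[OF V]], rule s B, rule B, erule z, erule B)+
    have "(\<integral>x. (q j x - r j x) * \<phi> x \<partial>G) = (\<integral>x. q j x * \<phi> x \<partial>G) - (\<integral>x. r j x * \<phi> x \<partial>G)"
      unfolding left_diff_distrib by (rule Bochner_Integration.integral_diff[OF i(1,2)])
    also have "\<dots> = (\<integral>x. f x * adj_partial a j \<phi> x \<partial>G) - (\<integral>x. g x * adj_partial a j \<phi> x \<partial>G)"
      using assms \<phi> by (simp add: weak_def)
    also have "\<dots> = (\<integral>x. (f x - g x) * adj_partial a j \<phi> x \<partial>G)"
      unfolding left_diff_distrib by (rule Bochner_Integration.integral_diff[OF i(3,4), symmetric])
    finally show ?thesis .
  qed
  then show ?thesis unfolding weak_def using s z sub by simp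
qed

text \<open>The fundamental lemma of the calculus of variations. After a cutoff
  \<open>\<psi>\<close>, smoothing turns orthogonality to test functions into orthogonality to all
  bounded Lipschitz functions, and these are dense.\<close>

lemma orthogonal_test_functions_AE_zero:
  assumes V: "open V" and r: "sq_int r" and z: "\<And>x. x \<notin> V \<Longrightarrow> r x = 0"
    and orth: "\<And>\<phi>. \<phi> \<in> C_F0 V \<Longrightarrow> (\<integral>x. r x * \<phi> x \<partial>G) = 0"
  shows "AE x in G. r x = 0"
proof -
  note [measurable] = sq_int_measurable[OF r]
  \<comment> \<open>\<open>A n\<close> is bounded and keeps distance \<open>1 / real (Suc n)\<close>
    from the complement, so a cutoff equal to 1 on it fits inside \<open>V\<close>; these sets
    exhaust \<open>V\<close>.\<close>
  define A where "A n = {x::ell2. norm x \<le> real n \<and> ball x (1 / real (Suc n)) \<subseteq> V}" for n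
  have "AE x in G. x \<in> A n \<longrightarrow> r x = 0" for n
  proof -
    define d where "d = 1 / (2 * real (Suc n))"
    have d: "d > 0" "1 / real (Suc n) = d + d" by (auto simp: d_def field_simps)
    obtain \<psi> C where \<psi>: "F_smooth UNIV \<psi>" "grad_bound UNIV \<psi> C" "\<And>x. 0 \<le> \<psi> x \<and> \<psi> x \<le> 1"
      "\<And>x. x \<in> A n \<Longrightarrow> \<psi> x = 1" "\<And>x. \<psi> x \<noteq> 0 \<Longrightarrow> \<exists>y\<in>A n. dist y x < d"
      by (rule smooth_separation[OF d(1), of "A n"]) blast
    note [measurable] = F_smooth_UNIV_measurable[OF \<psi>(1)]
    have wi: "well_inside {x. \<psi> x \<noteq> 0} V"
    proof -
      have "(\<Union>x\<in>{x. \<psi> x \<noteq> 0}. ball x d) \<subseteq> V"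
      proof clarify
        fix z x assume "\<psi> x \<noteq> 0" "z \<in> ball x d"
        then obtain y where y: "y \<in> A n" "dist y x < d" using \<psi>(5) by blast
        then have "z \<in> ball y (1 / real (Suc n))" using \<open>z \<in> ball x d\<close> dist_triangle[of y z x] d(2) by simp
        then show "z \<in> V" using y(1) by (auto simp: A_def)
      qed
      moreover have "{x. \<psi> x \<noteq> 0} \<subseteq> ball 0 (real n + d + 1)"
      proof clarify
        fix x assume "\<psi> x \<noteq> 0"
        then obtain y where y: "y \<in> A n" "dist y x < d" using \<psi>(5) by blast
        then have "norm x \<le> norm y + dist y x" using norm_triangle_sub[of x y] by (simp add: dist_norm norm_minus_commute)
        then show "x \<in> ball 0 (real n + d + 1)" using y by (simp add: A_def)
      qed
      ultimately show ?thesis unfolding well_inside_def using d(1)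
        by (intro exI[of _ d] conjI exI[of _ "real n + d + 1"]) auto
    qed
    define s where "s x = r x * \<psi> x" for x
    have s: "sq_int s"
    proof (rule sq_int_bound[OF r, of _ 1])
      show "s \<in> borel_measurable borel" unfolding s_def by measurable
      show "\<bar>s x\<bar> \<le> 1 * \<bar>r x\<bar>" for x using \<psi>(3)[of x] by (simp add: s_def abs_mult mult_left_le)
    qed
    note [measurable] = sq_int_measurable[OF s]
    have sh: "(\<integral>x. s x * h x \<partial>G) = 0" if h: "bd_lipschitz h" for h
    proof -
      obtain L where L: "L-lipschitz_on UNIV h" using h by (auto simp: bd_lipschitz_def)
      note [measurable] = bd_lipschitz_measurable[OF h]
      obtain K where K: "\<And>x. \<bar>h x\<bar> \<le> K" using h by (auto simp: bd_lipschitz_def bounded_iff)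
      have ish: "integrable G (\<lambda>x. s x * h x)"
        by (rule sq_int_integrable[OF sq_int_mult[OF s _ K]]) measurable
      have "\<bar>\<integral>x. s x * h x \<partial>G\<bar> \<le> (L + 1) * e * (\<integral>x. \<bar>s x\<bar> \<partial>G)" if e: "e > 0" for e
      proof -
        obtain g where g: "F_smooth UNIV g" "\<And>is. continuous_on UNIV (partials is g)"
          "\<And>v C x. (\<And>x. \<bar>h (x + v) - h x\<bar> \<le> C) \<Longrightarrow> \<bar>g (x + v) - g x\<bar> \<le> C"
          "\<And>x l u. (\<And>y. y \<in> cball x e \<Longrightarrow> l \<le> h y \<and> h y \<le> u) \<Longrightarrow> l \<le> g x \<and> g x \<le> u"
          by (rule Lipschitz_smoothing[OF L _ e]) (use h in \<open>auto simp: bd_lipschitz_def\<close>)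
        have "L-lipschitz_on UNIV g" using L g(3) unfolding lipschitz_iff_shift by blast
        then have gb: "grad_bound UNIV g (L\<^sup>2)" using Lipschitz_grad_bound[OF g(1)] g(2)[of "[_]"] by simp
        have gh: "\<bar>g x - h x\<bar> \<le> (L + 1) * e" for x
        proof -
          have "h x - L * e \<le> g x \<and> g x \<le> h x + L * e"
          proof (rule g(4))
            fix y assume y: "y \<in> cball x e"
            have "\<bar>h y - h x\<bar> \<le> L * dist y x" using lipschitz_onD[OF L, of y x] by (simp add: dist_real_def)
            also have "\<dots> \<le> L * e" using y lipschitz_on_nonneg[OF L] by (intro mult_left_mono) (auto simp: dist_commute)
            finally show "h x - L * e \<le> h y \<and> h y \<le> h x + L * e" by linarith
          qed
          then show ?thesis using e by (simp add: abs_le_iff algebra_simps)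
        qed
        obtain D where D: "grad_bound UNIV (\<lambda>x. g x * \<psi> x) D" using grad_bound_mult[OF g(1) \<psi>(1) gb \<psi>(2)] by blast
        have "(\<lambda>x. \<psi> x * g x) \<in> C_F0 V"
        proof -
          have "F_smooth V (\<lambda>x. \<psi> x * g x)" using F_smooth_subset[OF F_smooth_mult[OF open_UNIV \<psi>(1) g(1)]] by simp
          moreover have "grad_bound V (\<lambda>x. \<psi> x * g x) D" using D by (simp add: grad_bound_def mult.commute)
          moreover have "well_inside {x\<in>V. \<psi> x * g x \<noteq> 0} V" by (rule well_inside_mono[OF _ wi]) auto
          ultimately show ?thesis unfolding C_F0_iff by blast
        qed
        from orth[OF this] have g0: "(\<integral>x. s x * g x \<partial>G) = 0" by (simp add: s_def mult.assoc)
        note [measurable] = F_smooth_UNIV_measurable[OF g(1)]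
        have isgh: "integrable G (\<lambda>x. s x * (g x - h x))"
          by (rule sq_int_integrable[OF sq_int_mult[OF s _ gh]]) measurable
        have "(\<integral>x. s x * (g x - h x) \<partial>G) + (\<integral>x. s x * h x \<partial>G) = (\<integral>x. s x * g x \<partial>G)"
          by (subst Bochner_Integration.integral_add[OF isgh ish, symmetric]) (simp add: algebra_simps)
        then have "\<bar>\<integral>x. s x * h x \<partial>G\<bar> = \<bar>\<integral>x. s x * (g x - h x) \<partial>G\<bar>" using g0 by linarith
        also have "\<dots> \<le> (\<integral>x. \<bar>s x * (g x - h x)\<bar> \<partial>G)" by (rule integral_abs_bound)
        also have "\<dots> \<le> (\<integral>x. (L + 1) * e * \<bar>s x\<bar> \<partial>G)"
        proof (rule integral_mono)
          show "integrable G (\<lambda>x. \<bar>s x * (g x - h x)\<bar>)" using isgh by (rule integrable_abs)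
          show "integrable G (\<lambda>x. (L + 1) * e * \<bar>s x\<bar>)"
            using integrable_abs[OF sq_int_integrable[OF s]] by (rule integrable_mult_right)
          show "\<bar>s x * (g x - h x)\<bar> \<le> (L + 1) * e * \<bar>s x\<bar>" for x
            unfolding abs_mult using mult_right_mono[OF gh[of x], of "\<bar>s x\<bar>"] by (simp add: mult.commute)
        qed
        finally show ?thesis by simp
      qed
      then have lim: "\<bar>\<integral>x. s x * h x \<partial>G\<bar> \<le> e" if "e > 0" for e
      proof -
        let ?I = "(L + 1) * (\<integral>x. \<bar>s x\<bar> \<partial>G)"
        have "?I \<ge> 0" using lipschitz_on_nonneg[OF L] by (intro mult_nonneg_nonneg integral_nonneg_AE) auto
        then have "(L + 1) * (e / (?I + 1)) * (\<integral>x. \<bar>s x\<bar> \<partial>G) \<le> e"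
          using that by (simp add: field_simps)
        moreover have "e / (?I + 1) > 0" using that \<open>?I \<ge> 0\<close> by simp
        ultimately show ?thesis using \<open>\<And>e. e > 0 \<Longrightarrow> \<bar>\<integral>x. s x * h x \<partial>G\<bar> \<le> (L + 1) * e * (\<integral>x. \<bar>s x\<bar> \<partial>G)\<close>[of "e / (?I + 1)"] by linarith
      qed
      then show ?thesis by (meson abs_le_zero_iff field_le_epsilon add_0 order_refl linorder_not_le order_less_irrefl dense_ge)
    qed
    have s2: "integrable G (\<lambda>x. (s x)\<^sup>2)" using s by (simp add: sq_int_integrable_sq)
    have "(\<integral>x. (s x)\<^sup>2 \<partial>G) \<le> e" if e: "e > 0" for e
    proof -
      have "lipschitz_approx s" by (rule lipschitz_dense) (use s in \<open>auto simp: sq_int_def\<close>)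
      then obtain h where h: "bd_lipschitz h" "L2_dist s h < ennreal e" using e by (auto simp: lipschitz_approx_def)
      note [measurable] = bd_lipschitz_measurable[OF h(1)]
      obtain K where K: "\<And>x. \<bar>h x\<bar> \<le> K" using h(1) by (auto simp: bd_lipschitz_def bounded_iff)
      have ish: "integrable G (\<lambda>x. s x * h x)"
        by (rule sq_int_integrable[OF sq_int_mult[OF s _ K]]) measurable
      have "sq_int (\<lambda>x. s x - h x)" using h(2) by (auto simp: sq_int_def L2_dist_def intro: less_trans)
      then have ish2: "integrable G (\<lambda>x. (s x - h x)\<^sup>2)" by (simp add: sq_int_integrable_sq)
      have "ennreal (\<integral>x. (s x - h x)\<^sup>2 \<partial>G) = L2_dist s h"
        unfolding L2_dist_def by (rule nn_integral_eq_integral[symmetric]) (use ish2 in auto)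
      moreover have "0 \<le> (\<integral>x. (s x - h x)\<^sup>2 \<partial>G)" by (rule integral_nonneg_AE) auto
      ultimately have sm: "(\<integral>x. (s x - h x)\<^sup>2 \<partial>G) < e" using h(2) ennreal_less_iff by metis
      \<comment> \<open>Orthogonality to \<open>h\<close> replaces one factor \<open>s\<close> by
        \<open>s - h\<close>; the inequality between product and sum of squares then lets half of
        the left side be absorbed.\<close>
      have "(\<integral>x. (s x)\<^sup>2 \<partial>G) = (\<integral>x. (s x)\<^sup>2 - s x * h x \<partial>G)"
        using s2 ish sh[OF h(1)] by simp
      also have "\<dots> \<le> (\<integral>x. (s x)\<^sup>2 / 2 + (s x - h x)\<^sup>2 / 2 \<partial>G)"
      proof (rule integral_mono)
        fix x
        have "2 * s x * (s x - h x) \<le> (s x)\<^sup>2 + (s x - h x)\<^sup>2" by (rule sum_squares_bound)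
        moreover have "(s x)\<^sup>2 - s x * h x = (2 * s x * (s x - h x)) / 2" by (simp add: power2_eq_square algebra_simps)
        ultimately show "(s x)\<^sup>2 - s x * h x \<le> (s x)\<^sup>2 / 2 + (s x - h x)\<^sup>2 / 2" by linarith
      qed (use s2 ish ish2 in auto)
      also have "\<dots> = (\<integral>x. (s x)\<^sup>2 \<partial>G) / 2 + (\<integral>x. (s x - h x)\<^sup>2 \<partial>G) / 2" using s2 ish2 by simp
      finally show ?thesis using sm by simp
    qed
    then have "(\<integral>x. (s x)\<^sup>2 \<partial>G) \<le> 0" by (rule field_le_epsilon[of _ 0, simplified]) 
    then have "(\<integral>x. (s x)\<^sup>2 \<partial>G) = 0" 
      using integral_nonneg_AE[OF AE_I2, of G "\<lambda>x. (s x)\<^sup>2"] by (simp add: order_antisym)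
    then have "AE x in G. (s x)\<^sup>2 = 0" using integral_nonneg_eq_0_iff_AE[OF s2] by simp
    then show ?thesis by eventually_elim (auto simp: s_def \<psi>(4))
  qed
  then have AE: "AE x in G. \<forall>n. x \<in> A n \<longrightarrow> r x = 0" unfolding AE_all_countable by blast
  have cover: "\<exists>n. x \<in> A n" if xV: "x \<in> V" for x
  proof -
    obtain e where e: "e > 0" "ball x e \<subseteq> V" by (rule openE[OF V xV])
    obtain n1 :: nat where n1: "norm x \<le> n1" using real_arch_simple by blast
    obtain n2 where n2: "1 / real (Suc n2) < e" by (rule nat_approx_posE[OF e(1)])
    let ?n = "max n1 n2"
    have "1 / real (Suc ?n) \<le> 1 / real (Suc n2)" by (intro divide_left_mono) auto
    then have "ball x (1 / real (Suc ?n)) \<subseteq> ball x e" using n2 by (intro subset_ball) simp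
    then have "x \<in> A ?n" using n1 e(2) by (auto simp: A_def)
    then show ?thesis by blast
  qed
  show ?thesis using AE by eventually_elim (use cover z in blast)
qed

text \<open>Makes the representative chosen by \<open>SOME\<close> in \<open>weak_partial\<close>
  immaterial for integrals.\<close>

lemma weak_unique:
  assumes V: "open V" and "weak V f q" "weak V f q'"
  shows "AE x in G. q j x = q' j x"
proof -
  have "weak V (\<lambda>x. f x - f x) (\<lambda>j x. q j x - q' j x)" by (rule weak_diff[OF assms])
  then have "AE x in G. q j x - q' j x = 0"
    by (intro orthogonal_test_functions_AE_zero[OF V]) (auto simp: weak_def)
  then show ?thesis by eventually_elim simp
qed

end

text \<open>Dominated convergence for the counting measure, that is, Tannery's theorem.\<close>

lemma ennreal_suminf_tendsto_zero:
  fixes D :: "nat \<Rightarrow> nat \<Rightarrow> ennreal"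
  assumes lim: "\<And>j. (\<lambda>n. D n j) \<longlonglongrightarrow> 0" and bd: "\<And>n j. D n j \<le> b j" and fin: "(\<Sum>j. b j) < \<infinity>"
  shows "(\<lambda>n. \<Sum>j. D n j) \<longlonglongrightarrow> 0"
proof -
  have "(\<lambda>n. \<integral>\<^sup>+j. D n j \<partial>count_space UNIV) \<longlonglongrightarrow> (\<integral>\<^sup>+j. 0 \<partial>count_space (UNIV::nat set))"
    by (rule nn_integral_dominated_convergence[where w=b]) (use assms in \<open>auto simp: nn_integral_count_space_nat\<close>)
  then show ?thesis by (simp add: nn_integral_count_space_nat)
qed

context gaussian_ell2
begin

section \<open>Approximation in the Sobolev norm\<close>

text \<open>The integrand of the squared Sobolev norm. Keeping it pointwise lets cutoffs and
  translations be compared before integration.\<close>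

definition sob_dens :: "(ell2 \<Rightarrow> real) \<Rightarrow> (nat \<Rightarrow> ell2 \<Rightarrow> real) \<Rightarrow> ell2 \<Rightarrow> ennreal"
  where "sob_dens f q x = ennreal ((f x)\<^sup>2) + (\<Sum>j. ennreal ((a j * q j x)\<^sup>2))"

definition sob_sq :: "ell2 set \<Rightarrow> (ell2 \<Rightarrow> real) \<Rightarrow> (nat \<Rightarrow> ell2 \<Rightarrow> real) \<Rightarrow> ennreal"
  where "sob_sq V f q = (\<integral>\<^sup>+x. indicator V x * sob_dens f q x \<partial>G)"

lemma sob_dens_measurable [measurable]:
  assumes [measurable]: "f \<in> borel_measurable borel" "\<And>j. q j \<in> borel_measurable borel"
  shows "sob_dens f q \<in> borel_measurable borel"
  unfolding sob_dens_def[abs_def] by measurable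

lemma sob_dens_add_le:
  "sob_dens (\<lambda>x. f x + g x) (\<lambda>j x. q j x + r j x) x \<le> 2 * sob_dens f q x + 2 * sob_dens g r x"
proof -
  have sq: "ennreal ((u + v)\<^sup>2) \<le> 2 * ennreal (u\<^sup>2) + 2 * ennreal (v\<^sup>2)" for u v
    using sq_sum_le[of u v] by (subst ennreal_double_add) (simp_all add: ennreal_leI del: ennreal_plus)
  have "(\<Sum>j. ennreal ((a j * (q j x + r j x))\<^sup>2)) \<le> (\<Sum>j. 2 * ennreal ((a j * q j x)\<^sup>2) + 2 * ennreal ((a j * r j x)\<^sup>2))"
    unfolding distrib_left by (intro suminf_le sq) auto
  also have "\<dots> = 2 * (\<Sum>j. ennreal ((a j * q j x)\<^sup>2)) + 2 * (\<Sum>j. ennreal ((a j * r j x)\<^sup>2))"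
    by (simp add: suminf_add[symmetric] ennreal_suminf_cmult)
  finally have "sob_dens (\<lambda>x. f x + g x) (\<lambda>j x. q j x + r j x) x
     \<le> (2 * ennreal ((f x)\<^sup>2) + 2 * ennreal ((g x)\<^sup>2)) + (2 * (\<Sum>j. ennreal ((a j * q j x)\<^sup>2)) + 2 * (\<Sum>j. ennreal ((a j * r j x)\<^sup>2)))"
    unfolding sob_dens_def by (intro add_mono sq)
  also have "\<dots> = 2 * sob_dens f q x + 2 * sob_dens g r x"
    unfolding sob_dens_def by (simp add: distrib_left ac_simps)
  finally show ?thesis .
qed

lemma sob_sq_add_le:
  assumes V[measurable]: "V \<in> sets borel"
    and [measurable]: "f \<in> borel_measurable borel" "\<And>j. q j \<in> borel_measurable borel"
      "g \<in> borel_measurable borel" "\<And>j. r j \<in> borel_measurable borel"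
  shows "sob_sq V (\<lambda>x. f x + g x) (\<lambda>j x. q j x + r j x) \<le> 2 * sob_sq V f q + 2 * sob_sq V g r"
proof -
  have "sob_sq V (\<lambda>x. f x + g x) (\<lambda>j x. q j x + r j x) \<le> (\<integral>\<^sup>+x. 2 * (indicator V x * sob_dens f q x) + 2 * (indicator V x * sob_dens g r x) \<partial>G)"
    unfolding sob_sq_def
  proof (rule nn_integral_mono)
    fix x
    show "indicator V x * sob_dens (\<lambda>x. f x + g x) (\<lambda>j x. q j x + r j x) x \<le> 2 * (indicator V x * sob_dens f q x) + 2 * (indicator V x * sob_dens g r x)"
      using sob_dens_add_le[of f g q r x] by (auto simp: indicator_def)
  qed
  also have "\<dots> = 2 * sob_sq V f q + 2 * sob_sq V g r"
    unfolding sob_sq_def by (subst nn_integral_add) (auto simp: nn_integral_cmult)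
  finally show ?thesis .
qed

lemma sob_sq_mono: "V \<subseteq> W \<Longrightarrow> sob_sq V f q \<le> sob_sq W f q"
  unfolding sob_sq_def by (intro nn_integral_mono mult_right_mono) (auto simp: indicator_def)

text \<open>\<open>b\<close> and \<open>c\<close> belong to the single point \<open>x\<close>; the
  truncation argument uses this with the value of an indicator for \<open>b\<close>.\<close>

lemma sob_dens_mult_le:
  assumes b: "\<bar>\<beta> x\<bar> \<le> b" and c: "\<And>n. (\<Sum>i<n. (a i * partial i \<beta> x)\<^sup>2) \<le> c"
  shows "sob_dens (\<lambda>x. \<beta> x * f x) (\<lambda>j x. \<beta> x * q j x + partial j \<beta> x * f x) x \<le> ennreal (2 * b\<^sup>2 + 2 * c) * sob_dens f q x"
proof -
  let ?F = "ennreal ((f x)\<^sup>2)" and ?S = "\<Sum>j. ennreal ((a j * q j x)\<^sup>2)"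
  have c0: "0 \<le> c" using c[of 0] by simp
  have b2: "(\<beta> x)\<^sup>2 \<le> b\<^sup>2" using b by (metis abs_ge_zero order_trans power2_abs power_mono)
  have "(\<Sum>j. ennreal ((a j * (\<beta> x * q j x + partial j \<beta> x * f x))\<^sup>2))
     \<le> (\<Sum>j. ennreal (2 * b\<^sup>2) * ennreal ((a j * q j x)\<^sup>2) + ennreal (2 * (f x)\<^sup>2) * ennreal ((a j * partial j \<beta> x)\<^sup>2))"
  proof (rule suminf_le)
    fix j
    have "(a j * (\<beta> x * q j x + partial j \<beta> x * f x))\<^sup>2 = (\<beta> x * (a j * q j x) + f x * (a j * partial j \<beta> x))\<^sup>2"
      by (simp add: algebra_simps)
    also have "\<dots> \<le> 2 * (\<beta> x * (a j * q j x))\<^sup>2 + 2 * (f x * (a j * partial j \<beta> x))\<^sup>2" by (rule sq_sum_le)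
    also have "\<dots> \<le> 2 * b\<^sup>2 * (a j * q j x)\<^sup>2 + 2 * (f x)\<^sup>2 * (a j * partial j \<beta> x)\<^sup>2"
      using mult_right_mono[OF b2, of "(a j * q j x)\<^sup>2"] by (simp add: power_mult_distrib)
    finally show "ennreal ((a j * (\<beta> x * q j x + partial j \<beta> x * f x))\<^sup>2)
      \<le> ennreal (2 * b\<^sup>2) * ennreal ((a j * q j x)\<^sup>2) + ennreal (2 * (f x)\<^sup>2) * ennreal ((a j * partial j \<beta> x)\<^sup>2)"
      by (simp add: ennreal_leI ennreal_mult[symmetric] ennreal_plus[symmetric] del: ennreal_plus)
  qed auto
  also have "\<dots> = ennreal (2 * b\<^sup>2) * ?S + ennreal (2 * (f x)\<^sup>2) * (\<Sum>j. ennreal ((a j * partial j \<beta> x)\<^sup>2))"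
    by (simp add: suminf_add[symmetric] ennreal_suminf_cmult)
  also have "\<dots> \<le> ennreal (2 * b\<^sup>2) * ?S + ennreal (2 * (f x)\<^sup>2) * ennreal c"
  proof (intro add_mono mult_left_mono order_refl)
    show "(\<Sum>j. ennreal ((a j * partial j \<beta> x)\<^sup>2)) \<le> ennreal c"
    proof (rule suminf_le_const)
      fix n show "(\<Sum>i<n. ennreal ((a i * partial i \<beta> x)\<^sup>2)) \<le> ennreal c"
        using c[of n] by (simp add: ennreal_leI)
    qed simp
  qed auto
  finally have "sob_dens (\<lambda>x. \<beta> x * f x) (\<lambda>j x. \<beta> x * q j x + partial j \<beta> x * f x) x
     \<le> ennreal ((\<beta> x * f x)\<^sup>2) + (ennreal (2 * b\<^sup>2) * ?S + ennreal (2 * (f x)\<^sup>2) * ennreal c)"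
    unfolding sob_dens_def by (intro add_left_mono)
  also have "ennreal ((\<beta> x * f x)\<^sup>2) \<le> ennreal (2 * b\<^sup>2) * ?F"
  proof -
    have "(\<beta> x)\<^sup>2 * (f x)\<^sup>2 \<le> (2 * b\<^sup>2) * (f x)\<^sup>2" using b2 by (intro mult_right_mono) (auto intro: order_trans)
    then show ?thesis by (simp add: power_mult_distrib ennreal_mult[symmetric] ennreal_leI)
  qed
  also have "ennreal (2 * b\<^sup>2) * ?F + (ennreal (2 * b\<^sup>2) * ?S + ennreal (2 * (f x)\<^sup>2) * ennreal c)
     = ennreal (2 * b\<^sup>2) * (?F + ?S) + ennreal (2 * c) * ?F"
    using c0 by (simp add: distrib_left ac_simps ennreal_mult[symmetric])
  also have "\<dots> \<le> ennreal (2 * b\<^sup>2) * (?F + ?S) + ennreal (2 * c) * (?F + ?S)"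
    by (intro add_mono mult_left_mono order_refl) auto
  also have "\<dots> = ennreal (2 * b\<^sup>2 + 2 * c) * sob_dens f q x"
    using c0 unfolding sob_dens_def by (simp add: distrib_right)
  finally show ?thesis by simp
qed

lemma sum_weighted_partial_le:
  assumes "grad_bound UNIV \<beta> C"
  shows "(\<Sum>i<n. (a i * partial i \<beta> x)\<^sup>2) \<le> (suminf a)\<^sup>2 * C"
proof -
  have ai: "a i \<le> suminf a" for i using sum_le_suminf[OF a_summable, of "{i}"] a_pos by (auto simp: less_imp_le)
  have "(\<Sum>i<n. (a i * partial i \<beta> x)\<^sup>2) \<le> (\<Sum>i<n. (suminf a)\<^sup>2 * (partial i \<beta> x)\<^sup>2)"
    unfolding power_mult_distrib using ai a_pos by (intro sum_mono mult_right_mono power_mono) (auto simp: less_imp_le)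
  also have "\<dots> \<le> (suminf a)\<^sup>2 * C"
    using assms unfolding sum_distrib_left[symmetric] grad_bound_def by (intro mult_left_mono) auto
  finally show ?thesis .
qed

lemma sob_sq_mult_le:
  assumes [measurable]: "V \<in> sets borel" "f \<in> borel_measurable borel" "\<And>j. q j \<in> borel_measurable borel"
    and "\<And>x. \<bar>\<beta> x\<bar> \<le> b" "grad_bound UNIV \<beta> C"
  shows "sob_sq V (\<lambda>x. \<beta> x * f x) (\<lambda>j x. \<beta> x * q j x + partial j \<beta> x * f x)
     \<le> ennreal (2 * b\<^sup>2 + 2 * ((suminf a)\<^sup>2 * C)) * sob_sq V f q"
proof -
  have "sob_sq V (\<lambda>x. \<beta> x * f x) (\<lambda>j x. \<beta> x * q j x + partial j \<beta> x * f x)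
     \<le> (\<integral>\<^sup>+x. ennreal (2 * b\<^sup>2 + 2 * ((suminf a)\<^sup>2 * C)) * (indicator V x * sob_dens f q x) \<partial>G)"
    unfolding sob_sq_def
  proof (rule nn_integral_mono)
    fix x
    show "indicator V x * sob_dens (\<lambda>x. \<beta> x * f x) (\<lambda>j x. \<beta> x * q j x + partial j \<beta> x * f x) x
       \<le> ennreal (2 * b\<^sup>2 + 2 * ((suminf a)\<^sup>2 * C)) * (indicator V x * sob_dens f q x)"
      using sob_dens_mult_le[of \<beta> x b "(suminf a)\<^sup>2 * C" f q] sum_weighted_partial_le[OF assms(5)] assms(4)
      by (auto simp: indicator_def)
  qed
  also have "\<dots> = ennreal (2 * b\<^sup>2 + 2 * ((suminf a)\<^sup>2 * C)) * sob_sq V f q"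
    unfolding sob_sq_def by (rule nn_integral_cmult) measurable
  finally show ?thesis .
qed

lemma sob_sq_UNIV:
  assumes [measurable]: "f \<in> borel_measurable borel" "\<And>j. q j \<in> borel_measurable borel"
  shows "sob_sq UNIV f q = (\<integral>\<^sup>+x. ennreal ((f x)\<^sup>2) \<partial>G) + (\<Sum>j. ennreal ((a j)\<^sup>2) * (\<integral>\<^sup>+x. ennreal ((q j x)\<^sup>2) \<partial>G))"
proof -
  have "sob_sq UNIV f q = (\<integral>\<^sup>+x. ennreal ((f x)\<^sup>2) + (\<Sum>j. ennreal ((a j)\<^sup>2) * ennreal ((q j x)\<^sup>2)) \<partial>G)"
    by (simp add: sob_sq_def sob_dens_def power_mult_distrib ennreal_mult)
  also have "\<dots> = (\<integral>\<^sup>+x. ennreal ((f x)\<^sup>2) \<partial>G) + (\<integral>\<^sup>+x. (\<Sum>j. ennreal ((a j)\<^sup>2) * ennreal ((q j x)\<^sup>2)) \<partial>G)"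
    by (rule nn_integral_add) measurable
  also have "(\<integral>\<^sup>+x. (\<Sum>j. ennreal ((a j)\<^sup>2) * ennreal ((q j x)\<^sup>2)) \<partial>G) = (\<Sum>j. \<integral>\<^sup>+x. ennreal ((a j)\<^sup>2) * ennreal ((q j x)\<^sup>2) \<partial>G)"
    by (rule nn_integral_suminf) measurable
  also have "\<dots> = (\<Sum>j. ennreal ((a j)\<^sup>2) * (\<integral>\<^sup>+x. ennreal ((q j x)\<^sup>2) \<partial>G))"
    by (intro suminf_cong nn_integral_cmult) measurable
  finally show ?thesis .
qed

text \<open>The approximants live on the whole space while the error is measured on \<open>V\<close>
  only, as the final statement demands.\<close>

definition approximable :: "ell2 set \<Rightarrow> (ell2 \<Rightarrow> real) \<Rightarrow> (nat \<Rightarrow> ell2 \<Rightarrow> real) \<Rightarrow> bool"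
  where "approximable V f q \<longleftrightarrow> (\<forall>e>0. \<exists>\<phi>. test_fun \<phi> \<and>
    sob_sq V (\<lambda>x. f x - \<phi> x) (\<lambda>j x. q j x - partial j \<phi> x) < ennreal e)"

lemma test_fun_measurable:
  assumes "test_fun \<phi>" shows "\<phi> \<in> borel_measurable borel" "partial j \<phi> \<in> borel_measurable borel"
  using assms F_smooth_UNIV_measurable by (auto simp: test_fun_def)

lemma partial_add:
  "F_smooth V f \<Longrightarrow> F_smooth V g \<Longrightarrow> x \<in> V \<Longrightarrow>
   partial i (\<lambda>x. f x + g x) x = partial i f x + partial i g x"
  by (intro has_pd_imp_partial has_pd_add F_smooth_has_pd)

lemma test_fun_add:
  assumes "test_fun \<phi>" "test_fun \<psi>" shows "test_fun (\<lambda>x. \<phi> x + \<psi> x)"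
proof -
  obtain C D R S where C: "F_smooth UNIV \<phi>" "grad_bound UNIV \<phi> C" "\<And>x. \<phi> x \<noteq> 0 \<Longrightarrow> norm x \<le> R"
    and D: "F_smooth UNIV \<psi>" "grad_bound UNIV \<psi> D" "\<And>x. \<psi> x \<noteq> 0 \<Longrightarrow> norm x \<le> S"
    using assms by (auto simp: test_fun_def)
  have "grad_bound UNIV (\<lambda>x. \<phi> x + \<psi> x) (2 * C + 2 * D)"
    unfolding grad_bound_def
  proof (intro ballI allI)
    fix x n
    have "(\<Sum>i<n. (partial i (\<lambda>x. \<phi> x + \<psi> x) x)\<^sup>2) \<le> (\<Sum>i<n. 2 * (partial i \<phi> x)\<^sup>2 + 2 * (partial i \<psi> x)\<^sup>2)"
      unfolding partial_add[OF C(1) D(1) UNIV_I] by (intro sum_mono sq_sum_le)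
    also have "\<dots> \<le> 2 * C + 2 * D"
      using C(2) D(2) unfolding grad_bound_def sum.distrib sum_distrib_left[symmetric] by (intro add_mono) auto
    finally show "(\<Sum>i<n. (partial i (\<lambda>x. \<phi> x + \<psi> x) x)\<^sup>2) \<le> 2 * C + 2 * D" .
  qed
  moreover have "norm x \<le> max R S" if "\<phi> x + \<psi> x \<noteq> 0" for x
    using C(3)[of x] D(3)[of x] that by (cases "\<phi> x = 0") auto
  ultimately show ?thesis using F_smooth_add[OF open_UNIV C(1) D(1)] unfolding test_fun_def by blast
qed

lemma approximable_add:
  assumes V: "V \<in> sets borel"
    and [measurable]: "f \<in> borel_measurable borel" "\<And>j. q j \<in> borel_measurable borel"
      "g \<in> borel_measurable borel" "\<And>j. r j \<in> borel_measurable borel"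
    and "approximable V f q" "approximable V g r"
  shows "approximable V (\<lambda>x. f x + g x) (\<lambda>j x. q j x + r j x)"
  unfolding approximable_def
proof (intro allI impI)
  fix e :: real assume e: "e > 0"
  then have e4: "e / 4 > 0" by simp
  obtain \<phi> where \<phi>: "test_fun \<phi>" "sob_sq V (\<lambda>x. f x - \<phi> x) (\<lambda>j x. q j x - partial j \<phi> x) < ennreal (e/4)"
    using assms(6) e4 unfolding approximable_def by blast
  obtain \<psi> where \<psi>: "test_fun \<psi>" "sob_sq V (\<lambda>x. g x - \<psi> x) (\<lambda>j x. r j x - partial j \<psi> x) < ennreal (e/4)"
    using assms(7) e4 unfolding approximable_def by blast
  note [measurable] = test_fun_measurable[OF \<phi>(1)] test_fun_measurable[OF \<psi>(1)]
  have p: "partial j (\<lambda>x. \<phi> x + \<psi> x) x = partial j \<phi> x + partial j \<psi> x" for j x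
    using \<phi>(1) \<psi>(1) partial_add by (auto simp: test_fun_def)
  have "sob_sq V (\<lambda>x. f x + g x - (\<phi> x + \<psi> x)) (\<lambda>j x. q j x + r j x - partial j (\<lambda>x. \<phi> x + \<psi> x) x)
     = sob_sq V (\<lambda>x. (f x - \<phi> x) + (g x - \<psi> x)) (\<lambda>j x. (q j x - partial j \<phi> x) + (r j x - partial j \<psi> x))"
    unfolding p by (simp add: algebra_simps)
  also have "\<dots> \<le> 2 * sob_sq V (\<lambda>x. f x - \<phi> x) (\<lambda>j x. q j x - partial j \<phi> x) + 2 * sob_sq V (\<lambda>x. g x - \<psi> x) (\<lambda>j x. r j x - partial j \<psi> x)"
    by (rule sob_sq_add_le[OF V]) measurable
  also have "\<dots> < ennreal e" by (rule ennreal_double_add_less[OF \<phi>(2) \<psi>(2)])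
  finally show "\<exists>\<phi>. test_fun \<phi> \<and> sob_sq V (\<lambda>x. f x + g x - \<phi> x) (\<lambda>j x. q j x + r j x - partial j \<phi> x) < ennreal e"
    using test_fun_add[OF \<phi>(1) \<psi>(1)] by blast
qed

lemma approximable_closed:
  assumes V: "V \<in> sets borel"
    and [measurable]: "f \<in> borel_measurable borel" "\<And>j. q j \<in> borel_measurable borel"
    and near: "\<And>e. e > 0 \<Longrightarrow> \<exists>g r. g \<in> borel_measurable borel \<and> (\<forall>j. r j \<in> borel_measurable borel) \<and> approximable V g r \<and>
      sob_sq V (\<lambda>x. f x - g x) (\<lambda>j x. q j x - r j x) < ennreal e"
  shows "approximable V f q"
  unfolding approximable_def
proof (intro allI impI)
  fix e :: real assume e: "e > 0"
  then have e4: "e / 4 > 0" by simp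
  obtain g r where g: "g \<in> borel_measurable borel" "\<And>j. r j \<in> borel_measurable borel" "approximable V g r"
      "sob_sq V (\<lambda>x. f x - g x) (\<lambda>j x. q j x - r j x) < ennreal (e/4)"
    using near[OF e4] by blast
  note [measurable] = g(1,2)
  obtain \<psi> where \<psi>: "test_fun \<psi>" "sob_sq V (\<lambda>x. g x - \<psi> x) (\<lambda>j x. r j x - partial j \<psi> x) < ennreal (e/4)"
    using g(3) e4 unfolding approximable_def by blast
  note [measurable] = test_fun_measurable[OF \<psi>(1)]
  have "sob_sq V (\<lambda>x. f x - \<psi> x) (\<lambda>j x. q j x - partial j \<psi> x)
     = sob_sq V (\<lambda>x. (f x - g x) + (g x - \<psi> x)) (\<lambda>j x. (q j x - r j x) + (r j x - partial j \<psi> x))" by simp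
  also have "\<dots> \<le> 2 * sob_sq V (\<lambda>x. f x - g x) (\<lambda>j x. q j x - r j x) + 2 * sob_sq V (\<lambda>x. g x - \<psi> x) (\<lambda>j x. r j x - partial j \<psi> x)"
    by (rule sob_sq_add_le[OF V]) measurable
  also have "\<dots> < ennreal e" by (rule ennreal_double_add_less[OF g(4) \<psi>(2)])
  finally show "\<exists>\<phi>. test_fun \<phi> \<and> sob_sq V (\<lambda>x. f x - \<phi> x) (\<lambda>j x. q j x - partial j \<phi> x) < ennreal e"
    using \<psi>(1) by blast
qed

section \<open>The Mehler kernel in finitely many coordinates\<close>

text \<open>The exponent of Mehler's formula for variance \<open>(a i)\<^sup>2\<close> and
  correlation \<open>c\<close>: this is the coefficient of \<open>u\<^sup>2 + v\<^sup>2\<close>, up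
  to sign, and \<open>mehler_off\<close> that of \<open>u * v\<close>.\<close>

definition mehler_diag :: "real \<Rightarrow> nat \<Rightarrow> real" where "mehler_diag c i = c\<^sup>2 / (2 * (a i)\<^sup>2 * (1 - c\<^sup>2))"
definition mehler_off :: "real \<Rightarrow> nat \<Rightarrow> real" where "mehler_off c i = c / ((a i)\<^sup>2 * (1 - c\<^sup>2))"

text \<open>The transition density of the Ornstein--Uhlenbeck process with correlation \<open>c\<close>, taken with
  respect to its invariant Gaussian law. The operator below is this transition in the first \<open>m\<close>
  coordinates and integrates out the others.\<close>

definition mehler1 :: "real \<Rightarrow> nat \<Rightarrow> real \<Rightarrow> real \<Rightarrow> real"
  where "mehler1 c i u v = 1 / sqrt (1 - c\<^sup>2) * exp (mehler_off c i * u * v - mehler_diag c i * (u\<^sup>2 + v\<^sup>2))"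

definition mehler :: "nat \<Rightarrow> real \<Rightarrow> ell2 \<Rightarrow> ell2 \<Rightarrow> real"
  where "mehler m c x z = (\<Prod>i<m. mehler1 c i (coord x i) (coord z i))"

lemma mehler_commute: "mehler m c x z = mehler m c z x"
  by (simp add: mehler_def mehler1_def ac_simps)

lemma mehler1_measurable [measurable]: "mehler1 c i u \<in> borel_measurable borel"
  unfolding mehler1_def[abs_def] by measurable

lemma mehler_measurable [measurable (raw)]:
  assumes [measurable]: "f \<in> measurable A borel" "g \<in> measurable A borel"
  shows "(\<lambda>w. mehler m c (f w) (g w)) \<in> borel_measurable A"
proof -
  have [measurable]: "(\<lambda>w. coord (f w) i) \<in> borel_measurable A" "(\<lambda>w. coord (g w) i) \<in> borel_measurable A" for i
    by (rule measurable_compose[OF _ coord_measurable]; measurable)+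
  show ?thesis unfolding mehler_def mehler1_def by measurable
qed

definition mehler_op :: "real \<Rightarrow> nat \<Rightarrow> (ell2 \<Rightarrow> real) \<Rightarrow> ell2 \<Rightarrow> real"
  where "mehler_op c m f x = (\<integral>z. f z * mehler m c x z \<partial>G)"

lemma sq_int_diff: "sq_int f \<Longrightarrow> sq_int g \<Longrightarrow> sq_int (\<lambda>x. f x - g x)"
  using sq_int_add[of f "\<lambda>x. - g x"] sq_int_bound[of g "\<lambda>x. - g x" 1] sq_int_measurable[of g] by auto

lemma bd_lipschitz_sq_int: "bd_lipschitz h \<Longrightarrow> sq_int h"
proof -
  interpret PG: prob_space G by (rule prob_space_G)
  assume h: "bd_lipschitz h"
  then obtain K where K: "\<And>x. \<bar>h x\<bar> \<le> K" by (auto simp: bd_lipschitz_def bounded_iff)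
  have "sq_int (\<lambda>x. 1)" by (simp add: sq_int_def PG.emeasure_space_1[simplified])
  from sq_int_mult[OF this bd_lipschitz_measurable[OF h] K] show ?thesis by simp
qed

context
  fixes c :: real assumes c: "0 < c" "c < 1"
begin

lemma c2: "0 < 1 - c\<^sup>2"
  using c by (simp add: power_less_one_iff)

text \<open>Completing the square: against the Gaussian law the kernel is the normal transition with
  mean \<open>c * u\<close> and variance \<open>(1 - c\<^sup>2) * (a i)\<^sup>2\<close>. Its mass
  and second moments are read off from this.\<close>

lemma mehler1_normal:
  "normal_density 0 (a i) v * mehler1 c i u v = normal_density (c * u) (sqrt (1 - c\<^sup>2) * a i) v"
proof -
  define s where "s = 1 - c\<^sup>2"
  have s: "s > 0" using c2 by (simp add: s_def)
  have ai: "a i > 0" by (rule a_pos)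
  have "- (v - 0)\<^sup>2 / (2 * (a i)\<^sup>2) + (mehler_off c i * u * v - mehler_diag c i * (u\<^sup>2 + v\<^sup>2)) = - (v - c * u)\<^sup>2 / (2 * (s * (a i)\<^sup>2))"
  proof -
    have "- (v - 0)\<^sup>2 / (2 * (a i)\<^sup>2) = - (s * v\<^sup>2) / (2 * (s * (a i)\<^sup>2))" using s by simp
    moreover have "mehler_off c i * u * v = 2 * c * u * v / (2 * (s * (a i)\<^sup>2))" by (simp add: mehler_off_def s_def ac_simps)
    moreover have "mehler_diag c i * (u\<^sup>2 + v\<^sup>2) = c\<^sup>2 * (u\<^sup>2 + v\<^sup>2) / (2 * (s * (a i)\<^sup>2))" by (simp add: mehler_diag_def s_def ac_simps)
    ultimately have "- (v - 0)\<^sup>2 / (2 * (a i)\<^sup>2) + (mehler_off c i * u * v - mehler_diag c i * (u\<^sup>2 + v\<^sup>2))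
       = (- (s * v\<^sup>2) + (2 * c * u * v - c\<^sup>2 * (u\<^sup>2 + v\<^sup>2))) / (2 * (s * (a i)\<^sup>2))"
      by (simp only: add_divide_distrib diff_divide_distrib)
    also have "- (s * v\<^sup>2) + (2 * c * u * v - c\<^sup>2 * (u\<^sup>2 + v\<^sup>2)) = - (v - c * u)\<^sup>2"
      by (simp add: s_def power2_eq_square algebra_simps)
    finally show ?thesis .
  qed
  moreover have "1 / sqrt (2 * pi * (a i)\<^sup>2) * (1 / sqrt s) = 1 / sqrt (2 * pi * (s * (a i)\<^sup>2))"
    by (simp add: real_sqrt_mult)
  moreover have "(sqrt s * a i)\<^sup>2 = s * (a i)\<^sup>2" using s by (simp add: power_mult_distrib)
  ultimately show ?thesis
    unfolding normal_density_def mehler1_def s_def[symmetric] by (simp add: exp_add[symmetric] mult.assoc mult.left_commute[of "exp _"])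
qed

lemma mehler1_nonneg: "0 \<le> mehler1 c i u v"
  using c2 by (simp add: mehler1_def)

lemma mehler_nonneg: "0 \<le> mehler m c x z"
  unfolding mehler_def by (intro prod_nonneg) (simp add: mehler1_nonneg)

lemma nn_integral_mehler1: "(\<integral>\<^sup>+v. ennreal (mehler1 c i u v) \<partial>N i) = 1"
proof -
  have s: "sqrt (1 - c\<^sup>2) * a i > 0" using c2 a_pos[of i] by simp
  have "(\<integral>\<^sup>+v. ennreal (mehler1 c i u v) \<partial>N i) = (\<integral>\<^sup>+v. ennreal (normal_density (c * u) (sqrt (1 - c\<^sup>2) * a i) v) \<partial>lborel)"
    by (subst nn_integral_N) (auto simp: ennreal_mult'[symmetric] mehler1_normal)
  also have "\<dots> = 1"
    by (subst nn_integral_eq_integral) (use s in \<open>auto simp: integrable_normal_density integral_normal_density\<close>)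
  finally show ?thesis .
qed

lemma nn_integral_mehler1_sq:
  "(\<integral>\<^sup>+v. ennreal (mehler1 c i u v) * ennreal ((v - w)\<^sup>2) \<partial>N i) = ennreal ((1 - c\<^sup>2) * (a i)\<^sup>2 + (c * u - w)\<^sup>2)"
proof -
  have s: "sqrt (1 - c\<^sup>2) * a i > 0" using c2 a_pos[of i] by simp
  have "(\<integral>\<^sup>+v. ennreal (mehler1 c i u v) * ennreal ((v - w)\<^sup>2) \<partial>N i) = (\<integral>\<^sup>+v. ennreal (normal_density (c * u) (sqrt (1 - c\<^sup>2) * a i) v * (v - w)\<^sup>2) \<partial>lborel)"
    by (subst nn_integral_N) (auto simp: ennreal_mult'[symmetric] mehler1_normal mult.assoc[symmetric] mehler1_nonneg)
  also have "\<dots> = ennreal ((sqrt (1 - c\<^sup>2) * a i)\<^sup>2 + (c * u - w)\<^sup>2)" by (rule nn_integral_normal_sq[OF s])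
  finally show ?thesis using c2 by (simp add: power_mult_distrib)
qed

lemma ennreal_mehler: "ennreal (mehler m c x z) = (\<Prod>i<m. ennreal (mehler1 c i (coord x i) (coord z i)))"
  unfolding mehler_def by (rule prod_ennreal[symmetric]) (simp add: mehler1_nonneg)

lemma nn_integral_mehler: "(\<integral>\<^sup>+z. ennreal (mehler m c x z) \<partial>G) = 1"
  unfolding ennreal_mehler
  using nn_integral_G_prod[of "{..<m}" "\<lambda>i v. ennreal (mehler1 c i (coord x i) v)"]
  by (simp add: nn_integral_mehler1)

text \<open>Coordinates below \<open>m\<close> make the transition, which gives its variance plus
  the squared bias \<open>(1 - c) * coord x j\<close>; the others are replaced by an independent
  sample.\<close>

lemma nn_integral_mehler_sq:
  "(\<integral>\<^sup>+z. ennreal (mehler m c x z) * ennreal ((coord z j - coord x j)\<^sup>2) \<partial>G)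
    = ennreal (if j < m then (1 - c\<^sup>2) * (a j)\<^sup>2 + (1 - c)\<^sup>2 * (coord x j)\<^sup>2 else (a j)\<^sup>2 + (coord x j)\<^sup>2)"
proof -
  let ?u = "coord x"
  let ?f = "\<lambda>i v. (if i < m then ennreal (mehler1 c i (?u i) v) else 1) * (if i = j then ennreal ((v - ?u j)\<^sup>2) else 1)"
  have f: "?f i \<in> borel_measurable borel" for i by measurable
  have "ennreal (mehler m c x z) * ennreal ((coord z j - coord x j)\<^sup>2) = (\<Prod>i\<in>insert j {..<m}. ?f i (coord z i))" for z
  proof -
    have "(\<Prod>i\<in>insert j {..<m}. if i < m then ennreal (mehler1 c i (?u i) (coord z i)) else 1) = ennreal (mehler m c x z)"
      unfolding ennreal_mehler by (rule prod.mono_neutral_cong_right) auto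
    moreover have "(\<Prod>i\<in>insert j {..<m}. if i = j then ennreal ((coord z i - ?u j)\<^sup>2) else 1) = ennreal ((coord z j - ?u j)\<^sup>2)"
      by (subst prod.delta) auto
    ultimately show ?thesis unfolding prod.distrib by simp
  qed
  then have "(\<integral>\<^sup>+z. ennreal (mehler m c x z) * ennreal ((coord z j - coord x j)\<^sup>2) \<partial>G) = (\<Prod>i\<in>insert j {..<m}. \<integral>\<^sup>+v. ?f i v \<partial>N i)"
    using nn_integral_G_prod[of "insert j {..<m}" ?f, OF _ f] by simp
  also have "\<dots> = (\<Prod>i\<in>insert j {..<m}. if i = j then (\<integral>\<^sup>+v. ?f j v \<partial>N j) else 1)"
    by (intro prod.cong) (auto simp: nn_integral_mehler1)
  also have "\<dots> = (\<integral>\<^sup>+v. ?f j v \<partial>N j)" by (subst prod.delta) auto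
  also have "\<dots> = ennreal (if j < m then (1 - c\<^sup>2) * (a j)\<^sup>2 + (1 - c)\<^sup>2 * (coord x j)\<^sup>2 else (a j)\<^sup>2 + (coord x j)\<^sup>2)"
  proof (cases "j < m")
    case True
    have "(c * ?u j - ?u j)\<^sup>2 = (1 - c)\<^sup>2 * (?u j)\<^sup>2" by (simp add: power2_eq_square algebra_simps)
    then show ?thesis using True by (simp add: nn_integral_mehler1_sq del: ennreal_plus)
  next
    case False
    have "(\<integral>\<^sup>+v. ennreal ((v - ?u j)\<^sup>2) \<partial>N j) = (\<integral>\<^sup>+v. ennreal (normal_density 0 (a j) v * (v - ?u j)\<^sup>2) \<partial>lborel)"
      by (subst nn_integral_N) (auto simp: ennreal_mult')
    then show ?thesis using False nn_integral_normal_sq[OF a_pos, of 0 j "?u j"] by simp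
  qed
  finally show ?thesis .
qed

text \<open>With a Gaussian starting point each moved coordinate contributes
  \<open>(1 - c\<^sup>2) + (1 - c)\<^sup>2 = 2 - 2 * c\<close> times its variance. The total is
  small when \<open>c\<close> is close to 1 and \<open>m\<close> is large.\<close>

lemma nn_integral_mehler_dist:
  "(\<integral>\<^sup>+x. (\<integral>\<^sup>+z. ennreal (mehler m c x z) * ennreal ((norm (z - x))\<^sup>2) \<partial>G) \<partial>G)
    = (\<Sum>j. ennreal ((if j < m then 2 - 2 * c else 2) * (a j)\<^sup>2))"
proof -
  have n: "ennreal ((norm (z - x))\<^sup>2) = (\<Sum>j. ennreal ((coord z j - coord x j)\<^sup>2))" for x z
    unfolding norm_sq_ell2 using summable_coord_sq[of "z - x"] by (subst suminf_ennreal2) auto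
  have "(\<integral>\<^sup>+z. ennreal (mehler m c x z) * ennreal ((norm (z - x))\<^sup>2) \<partial>G)
     = (\<Sum>j. \<integral>\<^sup>+z. ennreal (mehler m c x z) * ennreal ((coord z j - coord x j)\<^sup>2) \<partial>G)" for x
    unfolding n ennreal_suminf_cmult[symmetric] by (rule nn_integral_suminf) measurable
  then have "(\<integral>\<^sup>+x. (\<integral>\<^sup>+z. ennreal (mehler m c x z) * ennreal ((norm (z - x))\<^sup>2) \<partial>G) \<partial>G)
     = (\<integral>\<^sup>+x. (\<Sum>j. ennreal (if j < m then (1 - c\<^sup>2) * (a j)\<^sup>2 + (1 - c)\<^sup>2 * (coord x j)\<^sup>2 else (a j)\<^sup>2 + (coord x j)\<^sup>2)) \<partial>G)"
    by (simp only: nn_integral_mehler_sq)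
  also have "\<dots> = (\<Sum>j. \<integral>\<^sup>+x. ennreal (if j < m then (1 - c\<^sup>2) * (a j)\<^sup>2 + (1 - c)\<^sup>2 * (coord x j)\<^sup>2 else (a j)\<^sup>2 + (coord x j)\<^sup>2) \<partial>G)"
    by (rule nn_integral_suminf) measurable
  also have "\<dots> = (\<Sum>j. ennreal ((if j < m then 2 - 2 * c else 2) * (a j)\<^sup>2))"
  proof (rule suminf_cong)
    interpret PG: prob_space G by (rule prob_space_G)
    fix j
    have A: "(\<integral>\<^sup>+x. ennreal (p + r * (coord x j)\<^sup>2) \<partial>G) = ennreal (p + r * (a j)\<^sup>2)" if "p \<ge> 0" "r \<ge> 0" for p r
    proof -
      have "(\<integral>\<^sup>+x. ennreal (p + r * (coord x j)\<^sup>2) \<partial>G) = (\<integral>\<^sup>+x. ennreal p + ennreal r * ennreal ((coord x j)\<^sup>2) \<partial>G)"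
        using that by (simp add: ennreal_plus ennreal_mult)
      also have "\<dots> = ennreal p + ennreal r * ennreal ((a j)\<^sup>2)"
        using PG.emeasure_space_1 by (subst nn_integral_add) (auto simp: nn_integral_cmult nn_integral_coord_sq)
      finally show ?thesis using that by (simp add: ennreal_plus ennreal_mult)
    qed
    show "(\<integral>\<^sup>+x. ennreal (if j < m then (1 - c\<^sup>2) * (a j)\<^sup>2 + (1 - c)\<^sup>2 * (coord x j)\<^sup>2 else (a j)\<^sup>2 + (coord x j)\<^sup>2) \<partial>G)
       = ennreal ((if j < m then 2 - 2 * c else 2) * (a j)\<^sup>2)"
    proof (cases "j < m")
      case True
      have "(1 - c\<^sup>2) * (a j)\<^sup>2 + (1 - c)\<^sup>2 * (a j)\<^sup>2 = (2 - 2 * c) * (a j)\<^sup>2" by (simp add: power2_eq_square algebra_simps)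
      then show ?thesis using True A[of "(1 - c\<^sup>2) * (a j)\<^sup>2" "(1 - c)\<^sup>2"] c2 by simp
    next
      case False
      then show ?thesis using A[of "(a j)\<^sup>2" 1] by simp
    qed
  qed
  finally show ?thesis .
qed

text \<open>A bound in \<open>z\<close> for fixed \<open>x\<close> is enough for integrability; the
  exponent is a downward parabola in \<open>v\<close> with vertex at \<open>u / c\<close>.\<close>

lemma mehler_bounded: "\<exists>K. \<forall>z. mehler m c x z \<le> K"
proof -
  have "mehler1 c i u v \<le> 1 / sqrt (1 - c\<^sup>2) * exp (mehler_diag c i * (u / c)\<^sup>2)" for i u v
  proof -
    have d: "mehler_diag c i \<ge> 0" using c2 by (simp add: mehler_diag_def)
    have o: "mehler_off c i = 2 * mehler_diag c i / c" using c by (simp add: mehler_off_def mehler_diag_def power2_eq_square)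
    have "0 \<le> mehler_diag c i * ((v - u / c)\<^sup>2 + u\<^sup>2)" using d by simp
    also have "\<dots> = mehler_diag c i * (u / c)\<^sup>2 - (mehler_off c i * u * v - mehler_diag c i * (u\<^sup>2 + v\<^sup>2))"
      unfolding o by (simp add: power2_eq_square algebra_simps)
    finally show ?thesis using c2 unfolding mehler1_def by (intro mult_left_mono) auto
  qed
  then have "mehler m c x z \<le> (\<Prod>i<m. 1 / sqrt (1 - c\<^sup>2) * exp (mehler_diag c i * (coord x i / c)\<^sup>2))" for z
    unfolding mehler_def by (intro prod_mono) (simp add: mehler1_nonneg)
  then show ?thesis by blast
qed

lemma mehler_op_measurable:
  assumes [measurable]: "f \<in> borel_measurable borel"
  shows "mehler_op c m f \<in> borel_measurable borel"
proof -
  interpret PG: prob_space G by (rule prob_space_G)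
  have "(\<lambda>x. \<integral>z. f z * mehler m c x z \<partial>G) \<in> borel_measurable borel"
    by (rule PG.borel_measurable_lebesgue_integral) measurable
  then show ?thesis by (simp add: mehler_op_def[abs_def])
qed

lemma integrable_mehler: "sq_int f \<Longrightarrow> integrable G (\<lambda>z. f z * mehler m c x z)"
proof -
  assume f: "sq_int f"
  obtain K where "\<And>z. mehler m c x z \<le> K" using mehler_bounded by blast
  then show ?thesis
    by (intro sq_int_integrable[OF sq_int_mult[OF f, of _ K]]) (auto simp: mehler_nonneg)
qed

lemma integrable_mehler': "sq_int f \<Longrightarrow> integrable G (\<lambda>z. (f z)\<^sup>2 * mehler m c x z)"
proof -
  assume f: "sq_int f"
  note [measurable] = sq_int_measurable[OF f]
  obtain K where K: "\<And>z. mehler m c x z \<le> K" using mehler_bounded by blast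
  show ?thesis
  proof (rule Bochner_Integration.integrable_bound)
    show "integrable G (\<lambda>z. K * (f z)\<^sup>2)" using f by (simp add: sq_int_integrable_sq)
    show "AE z in G. norm ((f z)\<^sup>2 * mehler m c x z) \<le> norm (K * (f z)\<^sup>2)"
    proof (rule AE_I2)
      fix z
      have "(f z)\<^sup>2 * mehler m c x z \<le> K * (f z)\<^sup>2" using mult_left_mono[OF K[of z], of "(f z)\<^sup>2"] by (simp add: mult.commute)
      then show "norm ((f z)\<^sup>2 * mehler m c x z) \<le> norm (K * (f z)\<^sup>2)" using mehler_nonneg[of m x z] by simp
    qed
  qed measurable
qed

text \<open>Jensen's inequality for the probability law with density \<open>mehler m c x\<close>,
  obtained from the nonnegative variance of \<open>g\<close>.\<close>

lemma mehler_jensen: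
  assumes g: "sq_int g"
  shows "ennreal ((mehler_op c m g x)\<^sup>2) \<le> (\<integral>\<^sup>+z. ennreal (mehler m c x z) * ennreal ((g z)\<^sup>2) \<partial>G)"
proof -
  interpret PG: prob_space G by (rule prob_space_G)
  define t where "t = mehler_op c m g x"
  have ik: "integrable G (mehler m c x)"
  proof -
    obtain K where "\<And>z. mehler m c x z \<le> K" using mehler_bounded by blast
    then show ?thesis by (intro PG.integrable_const_bound[of _ K]) (auto simp: mehler_nonneg)
  qed
  have k1: "(\<integral>z. mehler m c x z \<partial>G) = 1"
    using nn_integral_eq_integral[OF ik] nn_integral_mehler[of m x] mehler_nonneg by simp
  have "0 \<le> (\<integral>z. (g z - t)\<^sup>2 * mehler m c x z \<partial>G)"
    by (rule integral_nonneg_AE) (auto simp: mehler_nonneg)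
  also have "\<dots> = (\<integral>z. (g z)\<^sup>2 * mehler m c x z - 2 * t * (g z * mehler m c x z) + t\<^sup>2 * mehler m c x z \<partial>G)"
    by (rule Bochner_Integration.integral_cong) (auto simp: power2_eq_square algebra_simps)
  also have "\<dots> = (\<integral>z. (g z)\<^sup>2 * mehler m c x z \<partial>G) - 2 * t * t + t\<^sup>2"
    using integrable_mehler[OF g, of m x] integrable_mehler'[OF g, of m x] ik k1
    by (simp add: t_def mehler_op_def)
  finally have "t\<^sup>2 \<le> (\<integral>z. (g z)\<^sup>2 * mehler m c x z \<partial>G)" by (simp add: power2_eq_square)
  then have "ennreal (t\<^sup>2) \<le> ennreal (\<integral>z. (g z)\<^sup>2 * mehler m c x z \<partial>G)" by (rule ennreal_leI)
  also have "\<dots> = (\<integral>\<^sup>+z. ennreal ((g z)\<^sup>2 * mehler m c x z) \<partial>G)"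
    by (rule nn_integral_eq_integral[symmetric]) (use integrable_mehler'[OF g] mehler_nonneg in auto)
  finally show ?thesis by (simp add: t_def ennreal_mult' mult.commute mehler_nonneg)
qed

text \<open>After Jensen and Fubini, the symmetry of the kernel gives mass 1 in the other variable
  as well.\<close>

lemma mehler_contraction:
  assumes f: "sq_int f"
  shows "(\<integral>\<^sup>+x. ennreal ((mehler_op c m f x)\<^sup>2) \<partial>G) \<le> (\<integral>\<^sup>+x. ennreal ((f x)\<^sup>2) \<partial>G)"
proof -
  interpret PG: prob_space G by (rule prob_space_G)
  interpret PGG: pair_sigma_finite G G by standard
  note [measurable] = sq_int_measurable[OF f]
  have "(\<integral>\<^sup>+x. ennreal ((mehler_op c m f x)\<^sup>2) \<partial>G) \<le> (\<integral>\<^sup>+x. (\<integral>\<^sup>+z. ennreal (mehler m c x z) * ennreal ((f z)\<^sup>2) \<partial>G) \<partial>G)"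
    by (intro nn_integral_mono mehler_jensen f)
  also have "\<dots> = (\<integral>\<^sup>+z. (\<integral>\<^sup>+x. ennreal (mehler m c x z) * ennreal ((f z)\<^sup>2) \<partial>G) \<partial>G)"
    by (rule PGG.Fubini'[symmetric]) measurable
  also have "\<dots> = (\<integral>\<^sup>+z. (\<integral>\<^sup>+x. ennreal (mehler m c z x) \<partial>G) * ennreal ((f z)\<^sup>2) \<partial>G)"
    by (intro nn_integral_cong) (subst nn_integral_multc, auto simp: mehler_commute[of m c _ "_::ell2"])
  also have "\<dots> = (\<integral>\<^sup>+z. ennreal ((f z)\<^sup>2) \<partial>G)" by (simp add: nn_integral_mehler)
  finally show ?thesis .
qed

lemma mehler_op_diff:
  "sq_int f \<Longrightarrow> sq_int g \<Longrightarrow> mehler_op c m f x - mehler_op c m g x = mehler_op c m (\<lambda>x. f x - g x) x"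
  unfolding mehler_op_def left_diff_distrib
  by (rule Bochner_Integration.integral_diff[symmetric]) (rule integrable_mehler, assumption)+

text \<open>Since the kernel has mass 1, the error at \<open>x\<close> is an average of
  \<open>h z - h x\<close>; Jensen and the Lipschitz bound reduce it to the mean squared
  displacement.\<close>

lemma mehler_op_lipschitz:
  assumes h: "bd_lipschitz h" "L-lipschitz_on UNIV h"
  shows "L2_dist h (mehler_op c m h) \<le> ennreal (L\<^sup>2) * (\<Sum>j. ennreal ((if j < m then 2 - 2 * c else 2) * (a j)\<^sup>2))"
proof -
  interpret PG: prob_space G by (rule prob_space_G)
  have hs: "sq_int h" by (rule bd_lipschitz_sq_int[OF h(1)])
  have [measurable]: "(\<lambda>w. norm (fst w - snd w)) \<in> borel_measurable (borel \<Otimes>\<^sub>M (borel :: ell2 measure))"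
  proof -
    have eq: "norm (fst w - snd w) = sqrt (\<Sum>i. (coord (fst w) i - coord (snd w) i)\<^sup>2)" for w :: "ell2 \<times> ell2"
      using norm_sq_ell2[of "fst w - snd w"] by (simp add: real_sqrt_unique)
    show ?thesis unfolding eq by measurable
  qed
  have m2[measurable]: "(\<lambda>z. norm (z - x)) \<in> borel_measurable borel" for x :: ell2
    by (intro borel_measurable_continuous_onI continuous_intros)
  have c0: "sq_int (\<lambda>z. h x)" for x using bd_lipschitz_sq_int[OF bd_lipschitz_const] .
  have pt: "ennreal ((h x - mehler_op c m h x)\<^sup>2) \<le> ennreal (L\<^sup>2) * (\<integral>\<^sup>+z. ennreal (mehler m c x z) * ennreal ((norm (z - x))\<^sup>2) \<partial>G)" for x
  proof -
    have ik: "integrable G (mehler m c x)"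
    proof -
      obtain K where "\<And>z. mehler m c x z \<le> K" using mehler_bounded by blast
      then show ?thesis by (intro PG.integrable_const_bound[of _ K]) (auto simp: mehler_nonneg)
    qed
    have k1: "(\<integral>z. mehler m c x z \<partial>G) = 1"
      using nn_integral_eq_integral[OF ik] nn_integral_mehler[of m x] mehler_nonneg by simp
    have "mehler_op c m (\<lambda>z. h z - h x) x = mehler_op c m h x - mehler_op c m (\<lambda>z. h x) x"
      using mehler_op_diff[OF hs c0] by simp
    also have "mehler_op c m (\<lambda>z. h x) x = h x" using k1 by (simp add: mehler_op_def)
    finally have "ennreal ((h x - mehler_op c m h x)\<^sup>2) = ennreal ((mehler_op c m (\<lambda>z. h z - h x) x)\<^sup>2)"
      by (simp add: power2_commute)
    also have "\<dots> \<le> (\<integral>\<^sup>+z. ennreal (mehler m c x z) * ennreal ((h z - h x)\<^sup>2) \<partial>G)"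
      by (rule mehler_jensen[OF sq_int_diff[OF hs c0]])
    also have "\<dots> \<le> (\<integral>\<^sup>+z. ennreal (L\<^sup>2) * (ennreal (mehler m c x z) * ennreal ((norm (z - x))\<^sup>2)) \<partial>G)"
    proof (rule nn_integral_mono)
      fix z
      have "\<bar>h z - h x\<bar> \<le> L * norm (z - x)" using lipschitz_onD[OF h(2), of z x] by (simp add: dist_norm)
      then have "(h z - h x)\<^sup>2 \<le> L\<^sup>2 * (norm (z - x))\<^sup>2"
        using power_mono[of "\<bar>h z - h x\<bar>" "L * norm (z - x)" 2] by (simp add: power_mult_distrib)
      then have "ennreal ((h z - h x)\<^sup>2) \<le> ennreal (L\<^sup>2) * ennreal ((norm (z - x))\<^sup>2)"
        by (simp add: ennreal_leI ennreal_mult[symmetric])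
      then have "ennreal (mehler m c x z) * ennreal ((h z - h x)\<^sup>2) \<le> ennreal (mehler m c x z) * (ennreal (L\<^sup>2) * ennreal ((norm (z - x))\<^sup>2))"
        by (rule mult_left_mono) simp
      then show "ennreal (mehler m c x z) * ennreal ((h z - h x)\<^sup>2) \<le> ennreal (L\<^sup>2) * (ennreal (mehler m c x z) * ennreal ((norm (z - x))\<^sup>2))"
        by (simp add: ac_simps)
    qed
    also have "\<dots> = ennreal (L\<^sup>2) * (\<integral>\<^sup>+z. ennreal (mehler m c x z) * ennreal ((norm (z - x))\<^sup>2) \<partial>G)"
      by (rule nn_integral_cmult) measurable
    finally show ?thesis .
  qed
  have "L2_dist h (mehler_op c m h) \<le> (\<integral>\<^sup>+x. ennreal (L\<^sup>2) * (\<integral>\<^sup>+z. ennreal (mehler m c x z) * ennreal ((norm (z - x))\<^sup>2) \<partial>G) \<partial>G)"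
    unfolding L2_dist_def by (rule nn_integral_mono) (rule pt)
  also have "\<dots> = ennreal (L\<^sup>2) * (\<integral>\<^sup>+x. (\<integral>\<^sup>+z. ennreal (mehler m c x z) * ennreal ((norm (z - x))\<^sup>2) \<partial>G) \<partial>G)"
  proof (rule nn_integral_cmult)
    have "(\<lambda>w. ennreal (mehler m c (fst w) (snd w)) * ennreal ((norm (snd w - fst w))\<^sup>2)) \<in> borel_measurable (borel \<Otimes>\<^sub>M G)"
      unfolding norm_minus_commute[of "snd _"] by measurable
    then show "(\<lambda>x. \<integral>\<^sup>+z. ennreal (mehler m c x z) * ennreal ((norm (z - x))\<^sup>2) \<partial>G) \<in> borel_measurable G"
      by (intro PG.borel_measurable_nn_integral) (simp add: case_prod_beta' cong: measurable_cong_sets)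
  qed
  finally show ?thesis unfolding nn_integral_mehler_dist .
qed

end

end

lemma tendsto_zero_ennrealI:
  fixes X :: "nat \<Rightarrow> ennreal"
  assumes "\<And>e::real. e > 0 \<Longrightarrow> eventually (\<lambda>n. X n < ennreal e) sequentially"
  shows "X \<longlonglongrightarrow> 0"
proof (rule order_tendstoI)
  fix b :: ennreal assume b: "0 < b"
  obtain e where e: "e > 0" "ennreal e \<le> b"
  proof (cases b rule: ennreal_cases)
    case (real r)
    then show ?thesis using b that[of r] by auto
  next
    case top
    then show ?thesis using that[of 1] by simp
  qed
  show "eventually (\<lambda>n. X n < b) sequentially"
    using assms[OF e(1)] by eventually_elim (use e(2) in auto)
qed simp

context gaussian_ell2
begin

text \<open>Any sequence in the open unit interval that tends to 1 would do; \<open>n + 2\<close>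
  keeps the first member positive.\<close>

definition mehler_c :: "nat \<Rightarrow> real" where "mehler_c n = 1 - 1 / real (n + 2)"

lemma mehler_c: "0 < mehler_c n" "mehler_c n < 1"
  by (simp_all add: mehler_c_def)

lemma mehler_c_tendsto: "mehler_c \<longlonglongrightarrow> 1"
proof -
  have "(\<lambda>n. 1 - 1 / real (n + 2)) \<longlonglongrightarrow> 1 - 0"
    using LIMSEQ_ignore_initial_segment[OF lim_1_over_n, of 2] by (intro tendsto_diff tendsto_const) simp
  then show ?thesis by (simp add: mehler_c_def[abs_def])
qed

text \<open>Lipschitz functions converge by the explicit estimate; their density and the contraction
  property carry the convergence to all square-integrable \<open>f\<close>.\<close>

lemma mehler_op_tendsto:
  assumes f: "sq_int f"
  shows "(\<lambda>n. L2_dist f (mehler_op (mehler_c n) n f)) \<longlonglongrightarrow> 0"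
proof (rule tendsto_zero_ennrealI)
  fix e :: real assume e: "e > 0"
  let ?T = "\<lambda>n. mehler_op (mehler_c n) n"
  let ?V = "\<lambda>n. \<Sum>j. ennreal ((if j < n then 2 - 2 * mehler_c n else 2) * (a j)\<^sup>2)"
  have V: "?V \<longlonglongrightarrow> 0"
  proof (rule ennreal_suminf_tendsto_zero[where b="\<lambda>j. ennreal (2 * (a j)\<^sup>2)"])
    fix j
    have "(\<lambda>n. ennreal ((2 - 2 * mehler_c n) * (a j)\<^sup>2)) \<longlonglongrightarrow> ennreal ((2 - 2 * 1) * (a j)\<^sup>2)"
      by (intro tendsto_intros tendsto_ennrealI mehler_c_tendsto)
    moreover have "eventually (\<lambda>n. ennreal ((2 - 2 * mehler_c n) * (a j)\<^sup>2) = ennreal ((if j < n then 2 - 2 * mehler_c n else 2) * (a j)\<^sup>2)) sequentially"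
      using eventually_gt_at_top[of j] by eventually_elim simp
    ultimately show "(\<lambda>n. ennreal ((if j < n then 2 - 2 * mehler_c n else 2) * (a j)\<^sup>2)) \<longlonglongrightarrow> 0"
      by (simp cong: filterlim_cong add: Lim_transform_eventually)
  next
    fix n j
    show "ennreal ((if j < n then 2 - 2 * mehler_c n else 2) * (a j)\<^sup>2) \<le> ennreal (2 * (a j)\<^sup>2)"
      using mehler_c[of n] by (intro ennreal_leI mult_right_mono) auto
  next
    have "summable (\<lambda>j. 2 * (a j)\<^sup>2)" by (intro summable_mult a_sq_summable)
    then have "(\<Sum>j. ennreal (2 * (a j)\<^sup>2)) \<noteq> \<infinity>" by (subst (asm) summable_iff_ennreal) auto
    then show "(\<Sum>j. ennreal (2 * (a j)\<^sup>2)) < \<infinity>" by (simp add: less_top)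
  qed
  note [measurable] = sq_int_measurable[OF f]
  have "lipschitz_approx f" using lipschitz_dense f by (auto simp: sq_int_def)
  \<comment> \<open>Two nested triangle inequalities, each of which asks for a quarter.\<close>
  moreover have "e / 16 > 0" using e by simp
  ultimately obtain h where h: "bd_lipschitz h" "L2_dist f h < ennreal (e / 16)"
    unfolding lipschitz_approx_def by blast
  obtain L where L: "L-lipschitz_on UNIV h" using h(1) by (auto simp: bd_lipschitz_def)
  note [measurable] = bd_lipschitz_measurable[OF h(1)]
  have hs: "sq_int h" by (rule bd_lipschitz_sq_int[OF h(1)])
  have "(\<lambda>n. ennreal (L\<^sup>2) * ?V n) \<longlonglongrightarrow> ennreal (L\<^sup>2) * 0"
    by (intro ennreal_tendsto_cmult V) simp
  then have "eventually (\<lambda>n. ennreal (L\<^sup>2) * ?V n < ennreal (e / 16)) sequentially"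
    using e by (intro order_tendstoD(2)) auto
  then show "eventually (\<lambda>n. L2_dist f (?T n f) < ennreal e) sequentially"
  proof eventually_elim
    case (elim n)
    note [measurable] = mehler_op_measurable[OF mehler_c sq_int_measurable[OF f], of n n] mehler_op_measurable[OF mehler_c sq_int_measurable[OF hs], of n n]
    have A: "L2_dist h (?T n h) < ennreal ((e / 4) / 4)"
      using le_less_trans[OF mehler_op_lipschitz[OF mehler_c h(1) L] elim] by simp
    have "L2_dist (?T n h) (?T n f) = (\<integral>\<^sup>+x. ennreal ((?T n (\<lambda>x. h x - f x) x)\<^sup>2) \<partial>G)"
      by (simp add: L2_dist_def mehler_op_diff[OF mehler_c hs f])
    also have "\<dots> \<le> (\<integral>\<^sup>+x. ennreal ((h x - f x)\<^sup>2) \<partial>G)"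
      by (rule mehler_contraction[OF mehler_c sq_int_diff[OF hs f]])
    also have "\<dots> = L2_dist f h" by (simp add: L2_dist_def power2_commute)
    finally have B: "L2_dist (?T n h) (?T n f) < ennreal ((e / 4) / 4)" using h(2) by simp
    have "L2_dist h (?T n f) \<le> 2 * L2_dist h (?T n h) + 2 * L2_dist (?T n h) (?T n f)" by (rule L2_dist_triangle) measurable
    also have "\<dots> < ennreal (e / 4)" by (rule ennreal_double_add_less[OF A B])
    finally have C: "L2_dist h (?T n f) < ennreal (e / 4)" .
    have D: "L2_dist f h < ennreal (e / 4)" using h(2) e by (auto intro: less_le_trans simp: ennreal_leI)
    have "L2_dist f (?T n f) \<le> 2 * L2_dist f h + 2 * L2_dist h (?T n f)" by (rule L2_dist_triangle) measurable
    also have "\<dots> < ennreal e" by (rule ennreal_double_add_less[OF D C])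
    finally show ?case .
  qed
qed

subsection \<open>Smoothness of the Mehler operator\<close>

text \<open>Bounds are required on each ball only, which is what the kernel family below provides; a
  cutoff later makes them global.\<close>

definition loc_smooth :: "(ell2 \<Rightarrow> real) \<Rightarrow> bool"
  where "loc_smooth f \<longleftrightarrow> (\<forall>\<rho>. F_smooth (ball 0 \<rho>) f \<and> (\<exists>C. grad_bound (ball 0 \<rho>) f C))"

lemma test_fun_mult_loc_smooth:
  assumes f: "loc_smooth f" and \<eta>: "test_fun \<eta>"
  shows "test_fun (\<lambda>x. \<eta> x * f x)"
proof -
  obtain C R where C: "F_smooth UNIV \<eta>" "grad_bound UNIV \<eta> C" "\<And>x. \<eta> x \<noteq> 0 \<Longrightarrow> norm x \<le> R"
    using \<eta> by (auto simp: test_fun_def)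
  let ?V = "ball (0::ell2) (\<bar>R\<bar> + 2)"
  obtain D where D: "F_smooth ?V f" "grad_bound ?V f D" using f by (auto simp: loc_smooth_def)
  have C': "F_smooth ?V \<eta>" "grad_bound ?V \<eta> C" using C F_smooth_subset[OF C(1)] by (auto simp: grad_bound_def)
  have z: "\<eta> x * f x = 0" if "x \<in> - cball 0 \<bar>R\<bar>" for x using C(3)[of x] that by fastforce
  have sm: "F_smooth UNIV (\<lambda>x. \<eta> x * f x)"
  proof (rule F_smooth_zero_extension[of ?V _ "cball 0 \<bar>R\<bar>"])
    show "F_smooth ?V (\<lambda>x. \<eta> x * f x)" by (rule F_smooth_mult[OF open_ball C'(1) D(1)])
    have "(\<Union>x\<in>cball (0::ell2) \<bar>R\<bar>. ball x 1) \<subseteq> ?V"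
    proof clarify
      fix x y :: ell2 assume "x \<in> cball 0 \<bar>R\<bar>" "y \<in> ball x 1"
      then show "y \<in> ?V" using dist_triangle[of 0 y x] by simp
    qed
    moreover have "cball (0::ell2) \<bar>R\<bar> \<subseteq> ball 0 (\<bar>R\<bar> + 1)" by auto
    ultimately show "well_inside (cball 0 \<bar>R\<bar>) ?V" unfolding well_inside_def
      by (intro exI[of _ 1] conjI exI[of _ "\<bar>R\<bar> + 1"]) auto
  qed (use z in auto)
  obtain E where E: "grad_bound ?V (\<lambda>x. \<eta> x * f x) E" using grad_bound_mult[OF C'(1) D(1) C'(2) D(2)] by blast
  have E0: "0 \<le> E" using E unfolding grad_bound_def by (force dest!: bspec[of _ _ 0] spec[of _ 0])
  have "grad_bound UNIV (\<lambda>x. \<eta> x * f x) E"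
    unfolding grad_bound_def
  proof (intro ballI allI)
    fix x n
    show "(\<Sum>i<n. (partial i (\<lambda>x. \<eta> x * f x) x)\<^sup>2) \<le> E"
    proof (cases "x \<in> ?V")
      case True then show ?thesis using E by (simp add: grad_bound_def)
    next
      case False
      then have x: "x \<in> - cball 0 \<bar>R\<bar>" by auto
      have "partial i (\<lambda>x. \<eta> x * f x) x = partial i (\<lambda>x. 0) x" for i
        by (rule partial_cong[OF _ x z]) (auto simp: open_Compl)
      then have "partial i (\<lambda>x. \<eta> x * f x) x = 0" for i using has_pd_imp_partial[OF has_pd_const] by simp
      then show ?thesis using E0 by simp
    qed
  qed
  moreover have "\<And>x. \<eta> x * f x \<noteq> 0 \<Longrightarrow> norm x \<le> R" using C(3) by auto
  ultimately show ?thesis using sm unfolding test_fun_def by blast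
qed

text \<open>If only the first \<open>m\<close> partial derivatives can be nonzero, the squared
  gradient is a finite sum of bounded terms.\<close>

lemma finite_grad_bound:
  assumes f: "F_smooth V f" and z: "\<And>x j. x \<in> V \<Longrightarrow> m \<le> j \<Longrightarrow> partial j f x = 0"
  shows "\<exists>C. grad_bound V f C"
proof -
  have "\<exists>B. \<forall>x\<in>V. \<bar>partial j f x\<bar> \<le> B" for j
    by (rule F_smooth_partial_bounded[OF f, of j]) blast
  then obtain B where B: "\<And>j x. x \<in> V \<Longrightarrow> \<bar>partial j f x\<bar> \<le> B j" by metis
  have "(\<Sum>i<n. (partial i f x)\<^sup>2) \<le> (\<Sum>i<m. (B i)\<^sup>2)" if x: "x \<in> V" for x n
  proof -
    have "(\<Sum>i<n. (partial i f x)\<^sup>2) = (\<Sum>i\<in>{..<n} \<inter> {..<m}. (partial i f x)\<^sup>2)"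
      by (rule sum.mono_neutral_right) (use z[OF x] in \<open>force simp: not_less[symmetric]\<close>)+
    also have "\<dots> \<le> (\<Sum>i\<in>{..<n} \<inter> {..<m}. (B i)\<^sup>2)"
    proof (rule sum_mono)
      fix i show "(partial i f x)\<^sup>2 \<le> (B i)\<^sup>2" using power_mono[OF B[OF x, of i], of 2] by simp
    qed
    also have "\<dots> \<le> (\<Sum>i<m. (B i)\<^sup>2)" by (rule sum_mono2) auto
    finally show ?thesis .
  qed
  then show ?thesis unfolding grad_bound_def by blast
qed

text \<open>Differentiating the Mehler kernel in \<open>x\<close> brings down linear factors in both
  points. This is the coinduction family for the kernel and, after integration, for the Mehler
  operator.\<close>

inductive_set kern :: "nat \<Rightarrow> real \<Rightarrow> (ell2 \<Rightarrow> ell2 \<Rightarrow> real) set" for m c where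
  base: "mehler m c \<in> kern m c"
| cmult: "K \<in> kern m c \<Longrightarrow> (\<lambda>x z. r * K x z) \<in> kern m c"
| mulx: "K \<in> kern m c \<Longrightarrow> (\<lambda>x z. coord x i * K x z) \<in> kern m c"
| mulz: "K \<in> kern m c \<Longrightarrow> (\<lambda>x z. coord z i * K x z) \<in> kern m c"
| add: "K \<in> kern m c \<Longrightarrow> L \<in> kern m c \<Longrightarrow> (\<lambda>x z. K x z + L x z) \<in> kern m c"

lemma mehler_exp:
  "mehler m c x z = (1 / sqrt (1 - c\<^sup>2)) ^ m *
     exp (\<Sum>i<m. mehler_off c i * coord x i * coord z i - mehler_diag c i * ((coord x i)\<^sup>2 + (coord z i)\<^sup>2))"
  unfolding mehler_def mehler1_def prod.distrib by (simp add: exp_sum)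

lemma has_pd_mehler:
  "has_pd (\<lambda>x. mehler m c x z) i x
     ((if i < m then mehler_off c i * coord z i - 2 * mehler_diag c i * coord x i else 0) * mehler m c x z)"
proof -
  let ?g = "\<lambda>k t. mehler_off c k * coord (x + t *\<^sub>R basis i) k * coord z k - mehler_diag c k * ((coord (x + t *\<^sub>R basis i) k)\<^sup>2 + (coord z k)\<^sup>2)"
  let ?d = "\<lambda>k. if k = i then mehler_off c i * coord z i - 2 * mehler_diag c i * coord x i else 0"
  have "(?g k has_real_derivative ?d k) (at 0)" for k
    by (cases "k = i") (auto intro!: derivative_eq_intros simp: coord_basis)
  then have "((\<lambda>t. \<Sum>k<m. ?g k t) has_real_derivative (\<Sum>k<m. ?d k)) (at 0)" by (intro DERIV_sum) auto
  also have "(\<Sum>k<m. ?d k) = (if i < m then mehler_off c i * coord z i - 2 * mehler_diag c i * coord x i else 0)" by simp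
  finally have "((\<lambda>t. (1 / sqrt (1 - c\<^sup>2)) ^ m * exp (\<Sum>k<m. ?g k t)) has_real_derivative
      (1 / sqrt (1 - c\<^sup>2)) ^ m * (exp (\<Sum>k<m. ?g k 0) * (if i < m then mehler_off c i * coord z i - 2 * mehler_diag c i * coord x i else 0))) (at 0)"
    by (intro DERIV_cmult DERIV_fun_exp)
  then show ?thesis unfolding has_pd_def mehler_exp by (simp add: ac_simps)
qed

lemma kern_step:
  assumes "K \<in> kern m c"
  shows "\<exists>K'\<in>kern m c. \<forall>x z. has_pd (\<lambda>x. K x z) i x (K' x z)"
  using assms
proof induction
  case base
  let ?K = "\<lambda>x z. (if i < m then mehler_off c i else 0) * (coord z i * mehler m c x z) +
     (if i < m then - 2 * mehler_diag c i else 0) * (coord x i * mehler m c x z)"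
  have "?K \<in> kern m c" by (intro kern.intros)
  moreover have "has_pd (\<lambda>x. mehler m c x z) i x (?K x z)" for x z
    using has_pd_mehler[of m c z i x] by (cases "i < m") (simp_all add: algebra_simps)
  ultimately show ?case by (intro bexI[of _ ?K]) auto
next
  case (cmult K r)
  then obtain K' where K': "K' \<in> kern m c" "\<And>x z. has_pd (\<lambda>x. K x z) i x (K' x z)" by blast
  have "has_pd (\<lambda>x. r * K x z) i x (r * K' x z)" for x z
    using has_pd_mult[OF has_pd_const K'(2)] by simp
  then show ?case using K'(1) by (intro bexI[of _ "\<lambda>x z. r * K' x z"]) (auto intro: kern.intros)
next
  case (mulx K j)
  then obtain K' where K': "K' \<in> kern m c" "\<And>x z. has_pd (\<lambda>x. K x z) i x (K' x z)" by blast
  have "has_pd (\<lambda>x. coord x j * K x z) i x ((if i = j then 1 else 0) * K x z + coord x j * K' x z)" for x z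
    by (rule has_pd_mult[OF has_pd_coord K'(2)])
  then show ?case using K'(1) mulx
    by (intro bexI[of _ "\<lambda>x z. (if i = j then 1 else 0) * K x z + coord x j * K' x z"]) (auto intro: kern.intros)
next
  case (mulz K j)
  then obtain K' where K': "K' \<in> kern m c" "\<And>x z. has_pd (\<lambda>x. K x z) i x (K' x z)" by blast
  have "has_pd (\<lambda>x. coord z j * K x z) i x (coord z j * K' x z)" for x z
    using has_pd_mult[OF has_pd_const K'(2)] by simp
  then show ?case using K'(1) by (intro bexI[of _ "\<lambda>x z. coord z j * K' x z"]) (auto intro: kern.intros)
next
  case (add K L)
  then obtain K' L' where K': "K' \<in> kern m c" "\<And>x z. has_pd (\<lambda>x. K x z) i x (K' x z)"
    and L': "L' \<in> kern m c" "\<And>x z. has_pd (\<lambda>x. L x z) i x (L' x z)" by blast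
  then show ?case
    by (intro bexI[of _ "\<lambda>x z. K' x z + L' x z"]) (auto intro: kern.intros has_pd_add)
qed

lemma kern_continuous:
  assumes "K \<in> kern m c"
  shows "continuous_on UNIV (\<lambda>x. K x z)" "continuous_on UNIV (\<lambda>z. K x z)"
  using assms
proof (induction arbitrary: x z)
  case base
  { case 1 show ?case unfolding mehler_exp by (intro continuous_intros) }
  { case 2 show ?case unfolding mehler_exp by (intro continuous_intros) }
qed (auto intro!: continuous_intros)

lemma kern_bounded:
  assumes c: "0 < c" "c < 1" and "K \<in> kern m c"
  shows "\<exists>C. \<forall>x z. norm x \<le> R \<longrightarrow> norm z \<le> R \<longrightarrow> \<bar>K x z\<bar> \<le> C"
  using assms(3)
proof induction
  case base
  have "\<bar>mehler m c x z\<bar> \<le> (1 / sqrt (1 - c\<^sup>2)) ^ m * exp (\<Sum>i<m. \<bar>mehler_off c i\<bar> * R * R)"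
    if "norm x \<le> R" "norm z \<le> R" for x z
  proof -
    have "mehler_off c i * coord x i * coord z i - mehler_diag c i * ((coord x i)\<^sup>2 + (coord z i)\<^sup>2) \<le> \<bar>mehler_off c i\<bar> * R * R" for i
    proof -
      have "mehler_off c i * coord x i * coord z i \<le> \<bar>mehler_off c i\<bar> * \<bar>coord x i\<bar> * \<bar>coord z i\<bar>"
        by (metis abs_ge_self abs_mult)
      also have "\<dots> \<le> \<bar>mehler_off c i\<bar> * R * R"
        using that abs_coord_le_norm[of x i] abs_coord_le_norm[of z i] by (intro mult_mono) auto
      finally have "mehler_off c i * coord x i * coord z i \<le> \<bar>mehler_off c i\<bar> * R * R" .
      moreover have "0 \<le> mehler_diag c i * ((coord x i)\<^sup>2 + (coord z i)\<^sup>2)"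
        using c2[OF c] unfolding mehler_diag_def by (intro mult_nonneg_nonneg divide_nonneg_nonneg add_nonneg_nonneg) auto
      ultimately show ?thesis by linarith
    qed
    then show ?thesis using c2[OF c] unfolding mehler_exp abs_mult by (auto intro!: mult_left_mono sum_mono)
  qed
  then show ?case by blast
next
  case (cmult K r)
  then obtain C where "\<And>x z. norm x \<le> R \<Longrightarrow> norm z \<le> R \<Longrightarrow> \<bar>K x z\<bar> \<le> C" by blast
  then show ?case by (intro exI[of _ "\<bar>r\<bar> * C"]) (auto simp: abs_mult intro: mult_left_mono)
next
  case (mulx K i)
  then obtain C where C: "\<And>x z. norm x \<le> R \<Longrightarrow> norm z \<le> R \<Longrightarrow> \<bar>K x z\<bar> \<le> C" by blast
  show ?case
  proof (intro exI[of _ "R * C"] allI impI)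
    fix x z :: ell2 assume xz: "norm x \<le> R" "norm z \<le> R"
    then have "\<bar>coord x i\<bar> \<le> R" "0 \<le> R" using abs_coord_le_norm[of x i] norm_ge_zero[of x] by linarith+
    then show "\<bar>coord x i * K x z\<bar> \<le> R * C" unfolding abs_mult by (intro mult_mono C xz) auto
  qed
next
  case (mulz K i)
  then obtain C where C: "\<And>x z. norm x \<le> R \<Longrightarrow> norm z \<le> R \<Longrightarrow> \<bar>K x z\<bar> \<le> C" by blast
  show ?case
  proof (intro exI[of _ "R * C"] allI impI)
    fix x z :: ell2 assume xz: "norm x \<le> R" "norm z \<le> R"
    then have "\<bar>coord z i\<bar> \<le> R" "0 \<le> R" using abs_coord_le_norm[of z i] norm_ge_zero[of x] by linarith+
    then show "\<bar>coord z i * K x z\<bar> \<le> R * C" unfolding abs_mult by (intro mult_mono C xz) auto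
  qed
next
  case (add K L)
  then obtain C D where "\<And>x z. norm x \<le> R \<Longrightarrow> norm z \<le> R \<Longrightarrow> \<bar>K x z\<bar> \<le> C"
    "\<And>x z. norm x \<le> R \<Longrightarrow> norm z \<le> R \<Longrightarrow> \<bar>L x z\<bar> \<le> D" by blast
  then show ?case by (intro exI[of _ "C + D"]) (auto intro: order_trans[OF abs_triangle_ineq add_mono])
qed

text \<open>Smoothness in the second point is wanted because the kernel itself will serve as a test
  function there; symmetry reduces it to the first point.\<close>

lemma loc_smooth_mehler:
  assumes c: "0 < c" "c < 1"
  shows "loc_smooth (\<lambda>z. mehler m c x z)"
  unfolding loc_smooth_def mehler_commute[of m c x]
proof (intro allI conjI)
  fix \<rho> :: real
  show sm: "F_smooth (ball 0 \<rho>) (\<lambda>z. mehler m c z x)"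
  proof (rule F_smooth_coinduct[where S="{\<lambda>z. K z x |K. K \<in> kern m c}"])
    show "(\<lambda>z. mehler m c z x) \<in> {\<lambda>z. K z x |K. K \<in> kern m c}" using kern.base by blast
  next
    fix h assume "h \<in> {\<lambda>z. K z x |K. K \<in> kern m c}"
    then obtain K where K: "h = (\<lambda>z. K z x)" "K \<in> kern m c" by blast
    obtain C where C: "\<And>y z. norm y \<le> max \<rho> (norm x) \<Longrightarrow> norm z \<le> max \<rho> (norm x) \<Longrightarrow> \<bar>K y z\<bar> \<le> C"
      using kern_bounded[OF c K(2)] by blast
    have "bounded (h ` ball 0 \<rho>)" unfolding K(1) bounded_iff by (auto intro!: exI[of _ C] C)
    moreover have ch: "continuous_on UNIV h" using kern_continuous(1)[OF K(2)] K(1) by simp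
    ultimately show "bounded (h ` ball 0 \<rho>) \<and> F_continuous (ball 0 \<rho>) h \<and> h \<in> borel_measurable (restrict_space borel (ball 0 \<rho>))"
      using continuous_on_subset[OF ch] continuous_imp_F_continuous borel_measurable_continuous_onI[OF ch] measurable_restrict_space1
      by blast
  next
    fix h i assume "h \<in> {\<lambda>z. K z x |K. K \<in> kern m c}"
    then obtain K where K: "h = (\<lambda>z. K z x)" "K \<in> kern m c" by blast
    obtain K' where "K' \<in> kern m c" "\<And>y z. has_pd (\<lambda>x. K x z) i y (K' y z)" using kern_step[OF K(2)] by blast
    then show "\<exists>h'\<in>{\<lambda>z. K z x |K. K \<in> kern m c}. \<forall>z\<in>ball 0 \<rho>. has_pd h i z (h' z)"
      unfolding K(1) by (intro bexI[of _ "\<lambda>z. K' z x"]) auto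
  qed simp
  show "\<exists>C. grad_bound (ball 0 \<rho>) (\<lambda>z. mehler m c z x) C"
  proof (rule finite_grad_bound[OF sm])
    fix z j assume "m \<le> j"
    then show "partial j (\<lambda>z. mehler m c z x) z = 0" using has_pd_imp_partial[OF has_pd_mehler[of m c x j z]] by simp
  qed
qed

definition kern_int :: "(ell2 \<Rightarrow> real) \<Rightarrow> (ell2 \<Rightarrow> ell2 \<Rightarrow> real) \<Rightarrow> ell2 \<Rightarrow> real"
  where "kern_int F K x = (\<integral>z. F z * K x z \<partial>G)"

context
  fixes c :: real and m :: nat and F :: "ell2 \<Rightarrow> real" and R :: real
  assumes c: "0 < c" "c < 1" and F: "sq_int F" and supp: "\<And>z. F z \<noteq> 0 \<Longrightarrow> norm z \<le> R"
begin

lemma kern_int_bound: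
  assumes "K \<in> kern m c"
  shows "\<exists>C. \<forall>x z. norm x \<le> \<rho> \<longrightarrow> \<bar>F z * K x z\<bar> \<le> C * \<bar>F z\<bar>"
proof -
  obtain C where C: "\<And>x z. norm x \<le> max \<rho> R \<Longrightarrow> norm z \<le> max \<rho> R \<Longrightarrow> \<bar>K x z\<bar> \<le> C"
    using kern_bounded[OF c assms] by blast
  have "\<bar>F z * K x z\<bar> \<le> C * \<bar>F z\<bar>" if "norm x \<le> \<rho>" for x z
  proof (cases "F z = 0")
    case False
    then have "\<bar>K x z\<bar> \<le> C" using supp[of z] that by (intro C) auto
    then show ?thesis using mult_left_mono[of "\<bar>K x z\<bar>" C "\<bar>F z\<bar>"] by (simp add: abs_mult mult.commute)
  qed simp
  then show ?thesis by blast
qed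

lemma kern_int_measurable:
  assumes "K \<in> kern m c" shows "(\<lambda>z. F z * K x z) \<in> borel_measurable borel"
  by (intro borel_measurable_times sq_int_measurable[OF F] borel_measurable_continuous_onI kern_continuous(2)[OF assms])

lemma kern_int_integrable:
  assumes "K \<in> kern m c" shows "integrable G (\<lambda>z. F z * K x z)"
proof -
  obtain C where C: "\<And>y z. norm y \<le> norm x \<Longrightarrow> \<bar>F z * K y z\<bar> \<le> C * \<bar>F z\<bar>" using kern_int_bound[OF assms, of "norm x"] by blast
  show ?thesis
    by (rule sq_int_integrable[OF sq_int_bound[OF F kern_int_measurable[OF assms] C[OF order_refl]]])
qed

lemma kern_int_continuous:
  assumes K: "K \<in> kern m c" shows "continuous_on UNIV (kern_int F K)"
  unfolding continuous_on_sequentially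
proof (intro allI ballI impI)
  fix u :: "nat \<Rightarrow> ell2" and y assume u: "(\<forall>n. u n \<in> UNIV) \<and> u \<longlonglongrightarrow> y"
  then have "Bseq u" using convergentI convergent_imp_Bseq by blast
  then obtain \<rho> where \<rho>: "\<And>n. norm (u n) \<le> \<rho>" unfolding Bseq_def by blast
  obtain C where C: "\<And>x z. norm x \<le> \<rho> \<Longrightarrow> \<bar>F z * K x z\<bar> \<le> C * \<bar>F z\<bar>" using kern_int_bound[OF K] by blast
  have "(\<lambda>n. \<integral>z. F z * K (u n) z \<partial>G) \<longlonglongrightarrow> (\<integral>z. F z * K y z \<partial>G)"
  proof (rule integral_dominated_convergence[where w="\<lambda>z. C * \<bar>F z\<bar>"])
    show "AE z in G. (\<lambda>n. F z * K (u n) z) \<longlonglongrightarrow> F z * K y z"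
    proof (rule AE_I2)
      fix z
      have "(\<lambda>n. K (u n) z) \<longlonglongrightarrow> K y z"
        by (rule continuous_on_tendsto_compose[OF kern_continuous(1)[OF K]]) (use u in auto)
      then show "(\<lambda>n. F z * K (u n) z) \<longlonglongrightarrow> F z * K y z" by (intro tendsto_intros)
    qed
    show "integrable G (\<lambda>z. C * \<bar>F z\<bar>)" using sq_int_integrable[OF F] by simp
  qed (use kern_int_measurable[OF K] C \<rho> in auto)
  then show "(kern_int F K \<circ> u) \<longlonglongrightarrow> kern_int F K y" by (simp add: kern_int_def comp_def)
qed

text \<open>Differentiation under the integral: the mean value theorem replaces the quotient by the
  derivative kernel at a nearby point, which is bounded on the bounded support of
  \<open>F\<close>.\<close>

lemma kern_int_pd:
  assumes K: "K \<in> kern m c" and K': "K' \<in> kern m c" "\<And>x z. has_pd (\<lambda>x. K x z) i x (K' x z)"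
  shows "has_pd (kern_int F K) i x (kern_int F K' x)"
proof -
  let ?q = "\<lambda>h z. (F z * K (x + h *\<^sub>R basis i) z - F z * K x z) / h"
  have line: "((\<lambda>t. K (x + t *\<^sub>R basis i) z) has_real_derivative K' (x + t *\<^sub>R basis i) z) (at t)" for t z
  proof -
    have "has_partial i (\<lambda>x. K x z) (x + t *\<^sub>R basis i)" using K'(2) has_partial_iff by blast
    then show ?thesis using has_pd_line[of i "\<lambda>x. K x z" x t] has_pd_imp_partial[OF K'(2)] by simp
  qed
  have "(\<lambda>h. \<integral>z. ?q h z \<partial>G) \<midarrow>0\<rightarrow> (\<integral>z. F z * K' x z \<partial>G)"
    unfolding tendsto_at_iff_sequentially comp_def
  proof (intro allI impI)
    fix t :: "nat \<Rightarrow> real" assume t0: "\<forall>n. t n \<in> UNIV - {0}" and t: "t \<longlonglongrightarrow> 0"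
    then have "Bseq t" using convergentI convergent_imp_Bseq by blast
    then obtain b where b: "\<And>n. \<bar>t n\<bar> \<le> b" unfolding Bseq_def by auto
    obtain C where C: "\<And>y z. norm y \<le> norm x + b \<Longrightarrow> \<bar>F z * K' y z\<bar> \<le> C * \<bar>F z\<bar>" using kern_int_bound[OF K'(1)] by blast
    show "(\<lambda>n. \<integral>z. ?q (t n) z \<partial>G) \<longlonglongrightarrow> (\<integral>z. F z * K' x z \<partial>G)"
    proof (rule integral_dominated_convergence[where w="\<lambda>z. C * \<bar>F z\<bar>"])
      show "AE z in G. (\<lambda>n. ?q (t n) z) \<longlonglongrightarrow> F z * K' x z"
      proof (rule AE_I2)
        fix z
        have "(\<lambda>h. (K (x + (0 + h) *\<^sub>R basis i) z - K (x + 0 *\<^sub>R basis i) z) / h) \<midarrow>0\<rightarrow> K' x z"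
          using line[of z 0] unfolding DERIV_def by simp
        then have "(\<lambda>n. (K (x + (0 + t n) *\<^sub>R basis i) z - K (x + 0 *\<^sub>R basis i) z) / t n) \<longlonglongrightarrow> K' x z"
          unfolding tendsto_at_iff_sequentially comp_def using t0 t by blast
        from tendsto_mult[OF tendsto_const[of "F z"] this]
        show "(\<lambda>n. ?q (t n) z) \<longlonglongrightarrow> F z * K' x z" by (simp add: right_diff_distrib)
      qed
      show "AE z in G. norm (?q (t n) z) \<le> C * \<bar>F z\<bar>" for n
      proof (rule AE_I2)
        fix z
        obtain \<xi> where xi: "\<bar>\<xi>\<bar> \<le> \<bar>t n\<bar>" "K (x + t n *\<^sub>R basis i) z - K (x + 0 *\<^sub>R basis i) z = t n * K' (x + \<xi> *\<^sub>R basis i) z"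
          using mvt_symmetric[of "\<lambda>t. K (x + t *\<^sub>R basis i) z" "\<lambda>t. K' (x + t *\<^sub>R basis i) z" "t n", OF line] by blast
        have "norm (x + \<xi> *\<^sub>R basis i) \<le> norm x + b"
          using norm_triangle_ineq[of x "\<xi> *\<^sub>R basis i"] xi(1) b[of n] by simp
        moreover have "?q (t n) z = F z * K' (x + \<xi> *\<^sub>R basis i) z"
          using xi(2) t0 by (simp add: right_diff_distrib[symmetric])
        ultimately show "norm (?q (t n) z) \<le> C * \<bar>F z\<bar>" using C by simp
      qed
      show "integrable G (\<lambda>z. C * \<bar>F z\<bar>)" using sq_int_integrable[OF F] by simp
    qed (use kern_int_measurable[OF K] kern_int_measurable[OF K'(1)] in auto)
  qed
  moreover have "(\<integral>z. ?q h z \<partial>G) = (kern_int F K (x + (0 + h) *\<^sub>R basis i) - kern_int F K (x + 0 *\<^sub>R basis i)) / h" for h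
    using kern_int_integrable[OF K] by (simp add: kern_int_def)
  ultimately show ?thesis unfolding has_pd_def DERIV_def kern_int_def[of F K' x] by (simp only:)
qed

lemma mehler_op_kern_int: "mehler_op c m F = kern_int F (mehler m c)"
  by (rule ext) (simp add: mehler_op_def kern_int_def)

lemma partial_mehler_op:
  "partial j (mehler_op c m F) x =
     (\<integral>z. F z * ((if j < m then mehler_off c j * coord z j - 2 * mehler_diag c j * coord x j else 0) * mehler m c x z) \<partial>G)"
proof -
  obtain K' where K': "K' \<in> kern m c" "\<And>x z. has_pd (\<lambda>x. mehler m c x z) j x (K' x z)"
    using kern_step[OF kern.base] by blast
  have "K' x z = (if j < m then mehler_off c j * coord z j - 2 * mehler_diag c j * coord x j else 0) * mehler m c x z" for z
    using has_pd_imp_partial[OF K'(2)] has_pd_imp_partial[OF has_pd_mehler] by metis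
  then show ?thesis
    using has_pd_imp_partial[OF kern_int_pd[OF kern.base K']] unfolding mehler_op_kern_int by (simp add: kern_int_def)
qed

lemma loc_smooth_mehler_op: "loc_smooth (mehler_op c m F)"
  unfolding loc_smooth_def
proof (intro allI conjI)
  fix \<rho> :: real
  show sm: "F_smooth (ball 0 \<rho>) (mehler_op c m F)"
  proof (rule F_smooth_coinduct[where S="{kern_int F K |K. K \<in> kern m c}"])
    show "mehler_op c m F \<in> {kern_int F K |K. K \<in> kern m c}" using kern.base mehler_op_kern_int by blast
  next
    fix h assume "h \<in> {kern_int F K |K. K \<in> kern m c}"
    then obtain K where K: "h = kern_int F K" "K \<in> kern m c" by blast
    obtain C where C: "\<And>x z. norm x \<le> \<rho> \<Longrightarrow> \<bar>F z * K x z\<bar> \<le> C * \<bar>F z\<bar>" using kern_int_bound[OF K(2)] by blast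
    have "\<bar>h x\<bar> \<le> (\<integral>z. C * \<bar>F z\<bar> \<partial>G)" if "norm x \<le> \<rho>" for x
    proof -
      have "\<bar>h x\<bar> \<le> (\<integral>z. \<bar>F z * K x z\<bar> \<partial>G)" unfolding K(1) kern_int_def by (rule integral_abs_bound)
      also have "\<dots> \<le> (\<integral>z. C * \<bar>F z\<bar> \<partial>G)"
        by (rule integral_mono) (use C[OF that] kern_int_integrable[OF K(2)] sq_int_integrable[OF F] in auto)
      finally show ?thesis .
    qed
    then have "bounded (h ` ball 0 \<rho>)" unfolding bounded_iff by (auto intro!: exI[of _ "\<integral>z. C * \<bar>F z\<bar> \<partial>G"])
    moreover have ch: "continuous_on UNIV h" using kern_int_continuous[OF K(2)] K(1) by simp
    ultimately show "bounded (h ` ball 0 \<rho>) \<and> F_continuous (ball 0 \<rho>) h \<and> h \<in> borel_measurable (restrict_space borel (ball 0 \<rho>))"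
      using continuous_on_subset[OF ch] continuous_imp_F_continuous borel_measurable_continuous_onI[OF ch] measurable_restrict_space1
      by blast
  next
    fix h i assume "h \<in> {kern_int F K |K. K \<in> kern m c}"
    then obtain K where K: "h = kern_int F K" "K \<in> kern m c" by blast
    obtain K' where "K' \<in> kern m c" "\<And>y z. has_pd (\<lambda>x. K x z) i y (K' y z)" using kern_step[OF K(2)] by blast
    then show "\<exists>h'\<in>{kern_int F K |K. K \<in> kern m c}. \<forall>x\<in>ball 0 \<rho>. has_pd h i x (h' x)"
      unfolding K(1) using kern_int_pd[OF K(2)] by blast
  qed simp
  show "\<exists>C. grad_bound (ball 0 \<rho>) (mehler_op c m F) C"
    by (rule finite_grad_bound[OF sm, of m]) (simp add: partial_mehler_op)
qed

end

text \<open>For \<open>j < m\<close>, \<open>c\<close> times the adjoint derivative of the kernel in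
  \<open>z\<close> equals its derivative in \<open>x\<close>. With the kernel as test function, the
  weak derivative formula turns the derivative of the operator on \<open>F\<close> into the operator
  on \<open>Q j\<close>.\<close>

lemma partial_mehler_op_weak:
  assumes c: "0 < c" "c < 1" and w: "weak UNIV F Q"
    and supp: "\<And>z. F z \<noteq> 0 \<Longrightarrow> norm z < R" "\<And>z j. Q j z \<noteq> 0 \<Longrightarrow> norm z < R"
  shows "partial j (mehler_op c m F) x = (if j < m then c * mehler_op c m (Q j) x else 0)"
proof -
  have F: "sq_int F" and wk: "\<And>\<phi> j. \<phi> \<in> C_F0 UNIV \<Longrightarrow> (\<integral>z. Q j z * \<phi> z \<partial>G) = (\<integral>z. F z * adj_partial a j \<phi> z \<partial>G)"
    using w by (auto simp: weak_def)
  have supp': "\<And>z. F z \<noteq> 0 \<Longrightarrow> norm z \<le> R" using supp(1) less_imp_le by blast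
  note p = partial_mehler_op[OF c F supp']
  show ?thesis
  proof (cases "j < m")
    case False
    then show ?thesis using p by simp
  next
    case True
    have one: "(0::real) < 1" by simp
    \<comment> \<open>The kernel itself has no bounded support, and \<open>\<eta>\<close> makes it a
      test function. \<open>F\<close> and \<open>Q j\<close> vanish off the open ball where
      \<open>\<eta>\<close> is 1, so the derivative of \<open>\<eta>\<close> does not enter.\<close>
    obtain \<eta> C where \<eta>: "F_smooth UNIV \<eta>" "grad_bound UNIV \<eta> C" "\<And>x. x \<in> ball 0 R \<Longrightarrow> \<eta> x = 1"
      "\<And>x. \<eta> x \<noteq> 0 \<Longrightarrow> \<exists>y\<in>ball 0 R. dist y x < 1"
      by (rule smooth_separation[OF one, of "ball 0 R"]) blast
    have "norm x \<le> R + 1" if \<eta>x: "\<eta> x \<noteq> 0" for x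
    proof -
      obtain y where "norm y < R" "dist y x < 1" using \<eta>(4)[OF \<eta>x] by auto
      then show ?thesis using norm_triangle_sub[of x y] by (simp add: dist_norm norm_minus_commute)
    qed
    then have t\<eta>: "test_fun \<eta>" using \<eta> unfolding test_fun_def by blast
    let ?\<phi> = "\<lambda>z. \<eta> z * mehler m c x z"
    have \<phi>: "?\<phi> \<in> C_F0 UNIV"
      by (intro test_fun_C_F0 test_fun_mult_loc_smooth loc_smooth_mehler c t\<eta>)
    have adj: "adj_partial a j ?\<phi> z = (- (mehler_off c j * coord x j - 2 * mehler_diag c j * coord z j) + coord z j / (a j)\<^sup>2) * mehler m c x z"
      if z: "z \<in> ball 0 R" for z
    proof -
      have "partial j ?\<phi> z = partial j (\<lambda>z. mehler m c z x) z"
        by (rule partial_cong[OF open_ball z]) (simp add: \<eta>(3) mehler_commute)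
      also have "\<dots> = (mehler_off c j * coord x j - 2 * mehler_diag c j * coord z j) * mehler m c x z"
        using has_pd_imp_partial[OF has_pd_mehler[of m c x j z]] True by (simp add: mehler_commute)
      finally show ?thesis using \<eta>(3)[OF z] by (simp add: adj_partial_def algebra_simps)
    qed
    \<comment> \<open>The relation between the two derivatives of the kernel, coefficient by
      coefficient; it comes down to \<open>c\<^sup>2 + (1 - c\<^sup>2) = 1\<close>.\<close>
    have coef: "c * (- (mehler_off c j * coord x j - 2 * mehler_diag c j * coord z j) + coord z j / (a j)\<^sup>2)
       = mehler_off c j * coord z j - 2 * mehler_diag c j * coord x j" for z
    proof -
      define s where "s = 1 - c\<^sup>2"
      have s: "s > 0" using c2[OF c] by (simp add: s_def)
      have aj: "a j > 0" by (rule a_pos)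
      have "c * (- (c / ((a j)\<^sup>2 * s) * coord x j - 2 * (c\<^sup>2 / (2 * (a j)\<^sup>2 * s)) * coord z j) + coord z j / (a j)\<^sup>2)
         = (- (c\<^sup>2 * coord x j) + c * (c\<^sup>2 + s) * coord z j) / ((a j)\<^sup>2 * s)"
        using s aj by (simp add: field_simps power2_eq_square)
      also have "c\<^sup>2 + s = 1" by (simp add: s_def)
      finally show ?thesis unfolding mehler_off_def mehler_diag_def s_def[symmetric]
        using s aj by (simp add: field_simps power2_eq_square)
    qed
    have "c * mehler_op c m (Q j) x = c * (\<integral>z. Q j z * ?\<phi> z \<partial>G)"
    proof -
      have "Q j z * mehler m c x z = Q j z * ?\<phi> z" for z
        using \<eta>(3)[of z] supp(2)[of j z] by (cases "Q j z = 0") auto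
      then have "(\<lambda>z. Q j z * mehler m c x z) = (\<lambda>z. Q j z * ?\<phi> z)" by (rule ext)
      then show ?thesis by (simp only: mehler_op_def)
    qed
    also have "\<dots> = c * (\<integral>z. F z * adj_partial a j ?\<phi> z \<partial>G)" using wk[OF \<phi>] by simp
    also have "\<dots> = (\<integral>z. c * (F z * adj_partial a j ?\<phi> z) \<partial>G)" by simp
    also have "\<dots> = (\<integral>z. F z * ((mehler_off c j * coord z j - 2 * mehler_diag c j * coord x j) * mehler m c x z) \<partial>G)"
    proof (rule Bochner_Integration.integral_cong[OF refl])
      fix z
      show "c * (F z * adj_partial a j ?\<phi> z) = F z * ((mehler_off c j * coord z j - 2 * mehler_diag c j * coord x j) * mehler m c x z)"
      proof (cases "F z = 0")
        case False
        then have "z \<in> ball 0 R" using supp(1) by simp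
        from adj[OF this] coef[of z] show ?thesis by (simp add: mult.assoc[symmetric] mult.commute[of c])
      qed simp
    qed
    also have "\<dots> = partial j (mehler_op c m F) x" using p True by simp
    finally show ?thesis using True by simp
  qed
qed

lemma L2_dist_cmult_mehler_le:
  assumes c: "0 < c" "c < 1" and q: "sq_int q"
  shows "L2_dist q (\<lambda>x. c * mehler_op c m q x) \<le> 2 * L2_dist q (mehler_op c m q) + 2 * (ennreal ((1 - c)\<^sup>2) * (\<integral>\<^sup>+x. ennreal ((q x)\<^sup>2) \<partial>G))"
proof -
  note [measurable] = sq_int_measurable[OF q] mehler_op_measurable[OF c sq_int_measurable[OF q]]
  have "L2_dist q (\<lambda>x. c * mehler_op c m q x) \<le> 2 * L2_dist q (mehler_op c m q) + 2 * L2_dist (mehler_op c m q) (\<lambda>x. c * mehler_op c m q x)"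
    by (rule L2_dist_triangle) measurable
  also have "L2_dist (mehler_op c m q) (\<lambda>x. c * mehler_op c m q x) = (\<integral>\<^sup>+x. ennreal ((1 - c)\<^sup>2) * ennreal ((mehler_op c m q x)\<^sup>2) \<partial>G)"
    unfolding L2_dist_def by (intro nn_integral_cong) (simp add: ennreal_mult[symmetric] power_mult_distrib[symmetric] left_diff_distrib)
  also have "\<dots> = ennreal ((1 - c)\<^sup>2) * (\<integral>\<^sup>+x. ennreal ((mehler_op c m q x)\<^sup>2) \<partial>G)"
    by (rule nn_integral_cmult) measurable
  also have "\<dots> \<le> ennreal ((1 - c)\<^sup>2) * (\<integral>\<^sup>+x. ennreal ((q x)\<^sup>2) \<partial>G)"
    by (intro mult_left_mono mehler_contraction[OF c q]) simp
  finally show ?thesis by (simp add: add_left_mono mult_left_mono)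
qed

lemma L2_dist_zero: "L2_dist q (\<lambda>x. 0) = (\<integral>\<^sup>+x. ennreal ((q x)\<^sup>2) \<partial>G)"
  by (simp add: L2_dist_def)

text \<open>Dominated convergence over the directions: every fixed \<open>j\<close> is eventually
  below \<open>n\<close>, where the operator commutes with the derivative, and contraction bounds
  each term by four times the squared norm of \<open>Q j\<close>.\<close>

lemma mehler_sob_tendsto:
  assumes w: "weak UNIV F Q" and fin: "sob_sq UNIV F Q < \<infinity>"
    and supp: "\<And>z. F z \<noteq> 0 \<Longrightarrow> norm z < R" "\<And>z j. Q j z \<noteq> 0 \<Longrightarrow> norm z < R"
  shows "(\<lambda>n. sob_sq UNIV (\<lambda>x. F x - mehler_op (mehler_c n) n F x)
            (\<lambda>j x. Q j x - partial j (mehler_op (mehler_c n) n F) x)) \<longlonglongrightarrow> 0"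
proof -
  let ?T = "\<lambda>n. mehler_op (mehler_c n) n"
  have F: "sq_int F" and Q: "\<And>j. sq_int (Q j)" using w by (auto simp: weak_def)
  note [measurable] = sq_int_measurable[OF F] sq_int_measurable[OF Q]
    mehler_op_measurable[OF mehler_c sq_int_measurable[OF F]] mehler_op_measurable[OF mehler_c sq_int_measurable[OF Q]]
  define D where "D n j = (if j < n then (\<lambda>x. mehler_c n * ?T n (Q j) x) else (\<lambda>x. 0))" for n j
  have [measurable]: "D n j \<in> borel_measurable borel" for n j unfolding D_def by auto
  have D: "partial j (?T n F) = D n j" for n j
    using partial_mehler_op_weak[OF mehler_c w supp] by (auto simp: D_def)
  let ?I = "\<lambda>j. \<integral>\<^sup>+x. ennreal ((Q j x)\<^sup>2) \<partial>G"
  have eq: "sob_sq UNIV (\<lambda>x. F x - ?T n F x) (\<lambda>j x. Q j x - partial j (?T n F) x)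
     = L2_dist F (?T n F) + (\<Sum>j. ennreal ((a j)\<^sup>2) * L2_dist (Q j) (D n j))" for n
    unfolding D by (subst sob_sq_UNIV) (auto simp: L2_dist_def)
  have sumI: "(\<Sum>j. ennreal ((a j)\<^sup>2) * ?I j) < \<infinity>"
    using fin by (subst (asm) sob_sq_UNIV) auto
  have bd: "L2_dist (Q j) (D n j) \<le> 4 * ?I j" for n j
  proof -
    have "L2_dist (Q j) (D n j) \<le> 2 * L2_dist (Q j) (\<lambda>x. 0) + 2 * L2_dist (\<lambda>x. 0) (D n j)"
      by (rule L2_dist_triangle) measurable
    also have "L2_dist (\<lambda>x. 0) (D n j) \<le> ?I j"
    proof (cases "j < n")
      case True
      have "L2_dist (\<lambda>x. 0) (D n j) \<le> (\<integral>\<^sup>+x. ennreal ((?T n (Q j) x)\<^sup>2) \<partial>G)"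
        unfolding L2_dist_def D_def using True mehler_c[of n]
        by (intro nn_integral_mono ennreal_leI) (auto simp: power_mult_distrib power_le_one intro!: mult_left_le_one_le)
      also have "\<dots> \<le> ?I j" by (rule mehler_contraction[OF mehler_c Q])
      finally show ?thesis .
    qed (simp add: D_def L2_dist_def)
    finally show ?thesis by (simp add: L2_dist_zero add_left_mono mult_left_mono distrib_right[symmetric] flip: mult_2)
  qed
  have "(\<lambda>n. \<Sum>j. ennreal ((a j)\<^sup>2) * L2_dist (Q j) (D n j)) \<longlonglongrightarrow> 0"
  proof (rule ennreal_suminf_tendsto_zero[where b="\<lambda>j. ennreal ((a j)\<^sup>2) * (4 * ?I j)"])
    fix j
    have Ij: "?I j < \<infinity>" using Q[of j] by (simp add: sq_int_def)
    have lim: "(\<lambda>n. 2 * L2_dist (Q j) (?T n (Q j)) + 2 * (?I j * ennreal ((1 - mehler_c n)\<^sup>2))) \<longlonglongrightarrow> 2 * 0 + 2 * (?I j * 0)"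
    proof (intro tendsto_add ennreal_tendsto_cmult)
      show "(\<lambda>n. L2_dist (Q j) (?T n (Q j))) \<longlonglongrightarrow> 0" by (rule mehler_op_tendsto[OF Q])
      have "(\<lambda>n. (1 - mehler_c n)\<^sup>2) \<longlonglongrightarrow> (1 - 1)\<^sup>2" by (intro tendsto_intros mehler_c_tendsto)
      from tendsto_ennrealI[OF this] show "(\<lambda>n. ennreal ((1 - mehler_c n)\<^sup>2)) \<longlonglongrightarrow> 0" by simp
    qed (use Ij in auto)
    have "(\<lambda>n. L2_dist (Q j) (D n j)) \<longlonglongrightarrow> 0"
    proof (rule tendsto_sandwich[OF _ _ tendsto_const])
      show "eventually (\<lambda>n. L2_dist (Q j) (D n j) \<le> 2 * L2_dist (Q j) (?T n (Q j)) + 2 * (?I j * ennreal ((1 - mehler_c n)\<^sup>2))) sequentially"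
        using eventually_gt_at_top[of j]
      proof eventually_elim
        case (elim n)
        then show ?case using L2_dist_cmult_mehler_le[OF mehler_c Q, of j n n] by (simp add: D_def mult.commute)
      qed
    qed (use lim in auto)
    then have "(\<lambda>n. ennreal ((a j)\<^sup>2) * L2_dist (Q j) (D n j)) \<longlonglongrightarrow> ennreal ((a j)\<^sup>2) * 0"
      by (intro ennreal_tendsto_cmult) auto
    then show "(\<lambda>n. ennreal ((a j)\<^sup>2) * L2_dist (Q j) (D n j)) \<longlonglongrightarrow> 0" by simp
  next
    show "ennreal ((a j)\<^sup>2) * L2_dist (Q j) (D n j) \<le> ennreal ((a j)\<^sup>2) * (4 * ?I j)" for n j
      by (intro mult_left_mono bd) simp
  next
    have "(\<Sum>j. ennreal ((a j)\<^sup>2) * (4 * ?I j)) = 4 * (\<Sum>j. ennreal ((a j)\<^sup>2) * ?I j)"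
      by (subst ennreal_suminf_cmult[symmetric]) (simp add: ac_simps)
    then show "(\<Sum>j. ennreal ((a j)\<^sup>2) * (4 * ?I j)) < \<infinity>" using sumI by (simp add: ennreal_mult_less_top)
  qed
  from tendsto_add[OF mehler_op_tendsto[OF F] this] show ?thesis unfolding eq by simp
qed

text \<open>A cutoff restores bounded support after the Mehler operator. The radius
  \<open>2 * r\<close> is recorded because the approximant will be translated, and the shift density
  is bounded on bounded sets only.\<close>

lemma approximable_UNIV:
  assumes w: "weak UNIV F Q" and fin: "sob_sq UNIV F Q < \<infinity>" and r: "r > 0"
    and supp: "\<And>z. F z \<noteq> 0 \<Longrightarrow> dist x0 z < r" "\<And>z j. Q j z \<noteq> 0 \<Longrightarrow> dist x0 z < r"
    and e: "e > 0"
  shows "\<exists>\<phi>. test_fun \<phi> \<and> (\<forall>x. \<phi> x \<noteq> 0 \<longrightarrow> dist x0 x < 2 * r) \<and>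
    sob_sq UNIV (\<lambda>x. F x - \<phi> x) (\<lambda>j x. Q j x - partial j \<phi> x) < ennreal e"
proof -
  have F: "sq_int F" and Q: "\<And>j. sq_int (Q j)" using w by (auto simp: weak_def)
  obtain \<beta> C where \<beta>: "F_smooth UNIV \<beta>" "grad_bound UNIV \<beta> C" "\<And>x. 0 \<le> \<beta> x \<and> \<beta> x \<le> 1" "\<And>x. x \<in> ball x0 r \<Longrightarrow> \<beta> x = 1"
      "\<And>x. \<beta> x \<noteq> 0 \<Longrightarrow> \<exists>y\<in>ball x0 r. dist y x < r"
    by (rule smooth_separation[OF r, of "ball x0 r"]) blast
  have \<beta>s: "dist x0 x < 2 * r" if \<beta>x: "\<beta> x \<noteq> 0" for x
  proof -
    obtain y where "dist x0 y < r" "dist y x < r" using \<beta>(5)[OF \<beta>x] by auto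
    then show ?thesis using dist_triangle[of x0 x y] by simp
  qed
  have near: "norm z < norm x0 + s" if "dist x0 z < s" for z s
    using that norm_triangle_sub[of z x0] by (simp add: dist_norm norm_minus_commute)
  have "norm x \<le> norm x0 + 2 * r" if "\<beta> x \<noteq> 0" for x using near[OF \<beta>s[OF that]] by simp
  then have t\<beta>: "test_fun \<beta>" using \<beta> unfolding test_fun_def by blast
  let ?R = "norm x0 + r"
  have supp': "\<And>z. F z \<noteq> 0 \<Longrightarrow> norm z < ?R" "\<And>z j. Q j z \<noteq> 0 \<Longrightarrow> norm z < ?R" using near supp by blast+
  have supp'': "\<And>z. F z \<noteq> 0 \<Longrightarrow> norm z \<le> ?R" using supp'(1) less_imp_le by blast
  let ?T = "\<lambda>n. mehler_op (mehler_c n) n F"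
  let ?K = "2 * 1\<^sup>2 + 2 * ((suminf a)\<^sup>2 * C)"
  have "(\<lambda>n. ennreal ?K * sob_sq UNIV (\<lambda>x. F x - ?T n x) (\<lambda>j x. Q j x - partial j (?T n) x)) \<longlonglongrightarrow> ennreal ?K * 0"
    by (intro ennreal_tendsto_cmult mehler_sob_tendsto[OF w fin supp']) auto
  then have "eventually (\<lambda>n. ennreal ?K * sob_sq UNIV (\<lambda>x. F x - ?T n x) (\<lambda>j x. Q j x - partial j (?T n) x) < ennreal e) sequentially"
    using e by (intro order_tendstoD(2)) auto
  then obtain n where n: "ennreal ?K * sob_sq UNIV (\<lambda>x. F x - ?T n x) (\<lambda>j x. Q j x - partial j (?T n) x) < ennreal e"
    by (auto simp: eventually_sequentially)
  have ls: "loc_smooth (?T n)" by (rule loc_smooth_mehler_op[OF mehler_c F supp''])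
  let ?\<phi> = "\<lambda>x. \<beta> x * ?T n x"
  have t\<phi>: "test_fun ?\<phi>" by (rule test_fun_mult_loc_smooth[OF ls t\<beta>])
  have pT: "partial j (?T n) = (if j < n then (\<lambda>x. mehler_c n * mehler_op (mehler_c n) n (Q j) x) else (\<lambda>x. 0))" for j
    using partial_mehler_op_weak[OF mehler_c w supp'] by auto
  note [measurable] = sq_int_measurable[OF F] sq_int_measurable[OF Q]
    mehler_op_measurable[OF mehler_c sq_int_measurable[OF F]] mehler_op_measurable[OF mehler_c sq_int_measurable[OF Q]]
  have mp: "partial j (?T n) \<in> borel_measurable borel" for j unfolding pT by auto
  \<comment> \<open>\<open>\<beta>\<close> is 1 on an open ball off which \<open>F\<close> and all
    \<open>Q j\<close> vanish, so the error after the cutoff is the cutoff of the error, and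
    \<open>sob_sq_mult_le\<close> applies.\<close>
  have 1: "F x - ?\<phi> x = \<beta> x * (F x - ?T n x)" for x
    using supp(1)[of x] \<beta>(4)[of x] by (cases "F x = 0") (auto simp: right_diff_distrib)
  have 2: "Q j x - partial j ?\<phi> x = \<beta> x * (Q j x - partial j (?T n) x) + partial j \<beta> x * (F x - ?T n x)" for j x
  proof -
    let ?V = "ball (0::ell2) (norm x + 1)"
    have "partial j ?\<phi> x = partial j \<beta> x * ?T n x + \<beta> x * partial j (?T n) x"
      by (rule partial_mult[of ?V]) (use ls F_smooth_subset[OF \<beta>(1)] in \<open>auto simp: loc_smooth_def\<close>)
    moreover have "Q j x = \<beta> x * Q j x" using supp(2)[of j x] \<beta>(4)[of x] by (cases "Q j x = 0") auto
    moreover have "partial j \<beta> x * F x = 0"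
    proof (cases "F x = 0")
      case False
      then have x: "x \<in> ball x0 r" using supp(1) by simp
      have "partial j \<beta> x = partial j (\<lambda>x. 1) x" by (rule partial_cong[OF open_ball x \<beta>(4)])
      then show ?thesis using has_pd_imp_partial[OF has_pd_const] by simp
    qed simp
    ultimately show ?thesis by (auto simp: algebra_simps)
  qed
  have "sob_sq UNIV (\<lambda>x. F x - ?\<phi> x) (\<lambda>j x. Q j x - partial j ?\<phi> x)
     \<le> ennreal ?K * sob_sq UNIV (\<lambda>x. F x - ?T n x) (\<lambda>j x. Q j x - partial j (?T n) x)"
    unfolding 1 2 by (rule sob_sq_mult_le) (use mp \<beta>(2,3) in auto)
  also note n
  finally have "sob_sq UNIV (\<lambda>x. F x - ?\<phi> x) (\<lambda>j x. Q j x - partial j ?\<phi> x) < ennreal e" .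
  moreover have "dist x0 x < 2 * r" if "?\<phi> x \<noteq> 0" for x using \<beta>s[of x] that by auto
  ultimately show ?thesis using t\<phi> by blast
qed


section \<open>Translation towards the interior\<close>

lemma shift_measurable [measurable]: "(\<lambda>x. x + v) \<in> borel_measurable (borel :: ell2 measure)"
  by (intro borel_measurable_continuous_onI continuous_intros)

lemma nn_integral_shift_le:
  assumes [measurable]: "h \<in> borel_measurable borel" and supp: "\<And>x. h x \<noteq> 0 \<Longrightarrow> norm x \<le> R" and t: "\<bar>t\<bar> \<le> 1"
  shows "(\<integral>\<^sup>+x. h (x + t *\<^sub>R basis i) \<partial>G) \<le> ennreal (exp (R / (a i)\<^sup>2)) * (\<integral>\<^sup>+x. h x \<partial>G)"
proof -
  have "(\<integral>\<^sup>+x. h (x + t *\<^sub>R basis i) \<partial>G) = (\<integral>\<^sup>+x. ennreal (shift_density i t x) * h x \<partial>G)"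
    by (rule nn_integral_G_shift) measurable
  also have "\<dots> \<le> (\<integral>\<^sup>+x. ennreal (exp (R / (a i)\<^sup>2)) * h x \<partial>G)"
  proof (rule nn_integral_mono)
    fix x
    show "ennreal (shift_density i t x) * h x \<le> ennreal (exp (R / (a i)\<^sup>2)) * h x"
      using shift_density_bound[OF supp t] by (cases "h x = 0") (auto intro!: mult_right_mono ennreal_leI)
  qed
  also have "\<dots> = ennreal (exp (R / (a i)\<^sup>2)) * (\<integral>\<^sup>+x. h x \<partial>G)"
    by (rule nn_integral_cmult) measurable
  finally show ?thesis .
qed

text \<open>A Lipschitz approximant moves little under a small shift, and its error stays controlled
  after the shift because the shift density is bounded on the ball in question.\<close>

lemma translation_L2_tendsto:
  assumes f: "sq_int f" and supp: "\<And>x. f x \<noteq> 0 \<Longrightarrow> norm x \<le> R"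
    and t: "\<And>n. \<bar>t n\<bar> \<le> 1" "t \<longlonglongrightarrow> 0"
  shows "(\<lambda>n. L2_dist f (\<lambda>x. f (x + t n *\<^sub>R basis i))) \<longlonglongrightarrow> 0"
proof (rule tendsto_zero_ennrealI)
  fix e :: real assume e: "e > 0"
  interpret PG: prob_space G by (rule prob_space_G)
  note [measurable] = sq_int_measurable[OF f]
  define K where "K = exp ((R + 2) / (a i)\<^sup>2)"
  have K: "K > 0" by (simp add: K_def)
  \<comment> \<open>Solves \<open>2 * \<delta> + 4 * (K * \<delta>) = e / 2\<close>; the
    coefficients are those of the pointwise estimate below.\<close>
  define \<delta> where "\<delta> = e / 2 / (2 + 4 * K)"
  have \<delta>: "\<delta> > 0" using e K by (simp add: \<delta>_def)
  have "2 * \<delta> + 4 * (K * \<delta>) = (2 + 4 * K) * \<delta>" by (simp add: algebra_simps)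
  also have "\<dots> = e / 2"
  proof -
    have *: "u * (v / u) = v" if "u \<noteq> 0" for u v :: real using that by simp
    show ?thesis unfolding \<delta>_def by (rule *) (use K in simp)
  qed
  finally have \<delta>e: "2 * \<delta> + 4 * (K * \<delta>) = e / 2" .
  have "lipschitz_approx f" using lipschitz_dense f by (auto simp: sq_int_def)
  then obtain h where h: "bd_lipschitz h" "L2_dist f h < ennreal \<delta>" using \<delta> unfolding lipschitz_approx_def by blast
  obtain L where L: "L-lipschitz_on UNIV h" using h(1) by (auto simp: bd_lipschitz_def)
  note [measurable] = bd_lipschitz_measurable[OF h(1)]
  \<comment> \<open>The approximant \<open>h\<close> need not have bounded support, so its error is
    cut to a ball. Radius \<open>R + 2\<close> contains the shift of every \<open>x\<close> of norm
    at most \<open>R + 1\<close>; for other \<open>x\<close> both values of \<open>f\<close>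
    vanish.\<close>
  define g where "g x = indicator (cball 0 (R + 2)) x * ennreal ((f x - h x)\<^sup>2)" for x
  have [measurable]: "cball 0 (R + 2) \<in> sets (borel :: ell2 measure)" by simp
  have [measurable]: "g \<in> borel_measurable borel" unfolding g_def by measurable
  have bound: "L2_dist f (\<lambda>x. f (x + s *\<^sub>R basis i)) \<le> ennreal (4 * L\<^sup>2 * s\<^sup>2 + e / 2)" if s: "\<bar>s\<bar> \<le> 1" for s
  proof -
    have pt: "ennreal ((f x - f (x + s *\<^sub>R basis i))\<^sup>2) \<le> ennreal 2 * ennreal ((f x - h x)\<^sup>2) + (ennreal (4 * L\<^sup>2 * s\<^sup>2) + ennreal 4 * g (x + s *\<^sub>R basis i))" for x
    proof (cases "norm x \<le> R + 1")
      case True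
      let ?y = "x + s *\<^sub>R basis i"
      have y: "norm ?y \<le> R + 2" using True s norm_triangle_ineq[of x "s *\<^sub>R basis i"] by simp
      have "\<bar>h x - h ?y\<bar> \<le> L * \<bar>s\<bar>" using lipschitz_onD[OF L, of x ?y] by (simp add: dist_norm)
      then have "(h x - h ?y)\<^sup>2 \<le> L\<^sup>2 * s\<^sup>2"
        using power_mono[of "\<bar>h x - h ?y\<bar>" "L * \<bar>s\<bar>" 2] by (simp add: power_mult_distrib)
      moreover have "(f x - f ?y)\<^sup>2 \<le> 2 * (f x - h x)\<^sup>2 + 2 * (h x - f ?y)\<^sup>2"
        using sq_sum_le[of "f x - h x" "h x - f ?y"] by simp
      moreover have "(h x - f ?y)\<^sup>2 \<le> 2 * (h x - h ?y)\<^sup>2 + 2 * (h ?y - f ?y)\<^sup>2"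
        using sq_sum_le[of "h x - h ?y" "h ?y - f ?y"] by simp
      ultimately have "(f x - f ?y)\<^sup>2 \<le> 2 * (f x - h x)\<^sup>2 + (4 * L\<^sup>2 * s\<^sup>2 + 4 * (f ?y - h ?y)\<^sup>2)"
        by (simp add: power2_commute[of "h ?y"])
      then have "ennreal ((f x - f ?y)\<^sup>2) \<le> ennreal (2 * (f x - h x)\<^sup>2 + (4 * L\<^sup>2 * s\<^sup>2 + 4 * (f ?y - h ?y)\<^sup>2))"
        by (rule ennreal_leI)
      also have "\<dots> = ennreal 2 * ennreal ((f x - h x)\<^sup>2) + (ennreal (4 * L\<^sup>2 * s\<^sup>2) + ennreal 4 * g ?y)"
        using y by (simp add: g_def ennreal_plus ennreal_mult)
      finally show ?thesis .
    next
      case False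
      have "f x = 0" using supp[of x] False by force
      moreover have "norm x \<le> norm (x + s *\<^sub>R basis i) + 1"
        using s norm_triangle_ineq4[of "x + s *\<^sub>R basis i" "s *\<^sub>R basis i"] by simp
      then have "f (x + s *\<^sub>R basis i) = 0" using supp[of "x + s *\<^sub>R basis i"] False by force
      ultimately show ?thesis by simp
    qed
    have "L2_dist f (\<lambda>x. f (x + s *\<^sub>R basis i)) \<le> (\<integral>\<^sup>+x. ennreal 2 * ennreal ((f x - h x)\<^sup>2) + (ennreal (4 * L\<^sup>2 * s\<^sup>2) + ennreal 4 * g (x + s *\<^sub>R basis i)) \<partial>G)"
      unfolding L2_dist_def by (rule nn_integral_mono) (rule pt)
    also have "\<dots> = ennreal 2 * L2_dist f h + (ennreal (4 * L\<^sup>2 * s\<^sup>2) + ennreal 4 * (\<integral>\<^sup>+x. g (x + s *\<^sub>R basis i) \<partial>G))"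
      unfolding L2_dist_def using PG.emeasure_space_1
      by (subst nn_integral_add, simp, simp, subst nn_integral_add) (simp_all add: nn_integral_cmult del: ennreal_numeral)
    also have "\<dots> \<le> ennreal 2 * ennreal \<delta> + (ennreal (4 * L\<^sup>2 * s\<^sup>2) + ennreal 4 * (ennreal K * ennreal \<delta>))"
    proof (intro add_mono mult_left_mono order_refl)
      show "L2_dist f h \<le> ennreal \<delta>" using h(2) by simp
      have "(\<integral>\<^sup>+x. g (x + s *\<^sub>R basis i) \<partial>G) \<le> ennreal K * (\<integral>\<^sup>+x. g x \<partial>G)"
        unfolding K_def by (rule nn_integral_shift_le[OF _ _ s]) (auto simp: g_def indicator_def split: if_splits)
      also have "\<dots> \<le> ennreal K * L2_dist f h" unfolding L2_dist_def
        by (intro mult_left_mono nn_integral_mono) (auto simp: g_def indicator_def)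
      also have "\<dots> \<le> ennreal K * ennreal \<delta>" using h(2) by (intro mult_left_mono) auto
      finally show "(\<integral>\<^sup>+x. g (x + s *\<^sub>R basis i) \<partial>G) \<le> ennreal K * ennreal \<delta>" .
    qed auto
    also have "\<dots> = ennreal (2 * \<delta> + (4 * L\<^sup>2 * s\<^sup>2 + 4 * (K * \<delta>)))"
      using \<delta> K by (simp add: ennreal_plus ennreal_mult)
    also have "2 * \<delta> + (4 * L\<^sup>2 * s\<^sup>2 + 4 * (K * \<delta>)) = 4 * L\<^sup>2 * s\<^sup>2 + e / 2" using \<delta>e by simp
    finally show ?thesis .
  qed
  have "(\<lambda>n. 4 * L\<^sup>2 * (t n)\<^sup>2 + e / 2) \<longlonglongrightarrow> 4 * L\<^sup>2 * 0\<^sup>2 + e / 2" by (intro tendsto_intros t(2))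
  then have "eventually (\<lambda>n. 4 * L\<^sup>2 * (t n)\<^sup>2 + e / 2 < e) sequentially" using e by (elim order_tendstoD(2)) auto
  then show "eventually (\<lambda>n. L2_dist f (\<lambda>x. f (x + t n *\<^sub>R basis i)) < ennreal e) sequentially"
  proof eventually_elim
    case (elim n)
    have "ennreal (4 * L\<^sup>2 * (t n)\<^sup>2 + e / 2) < ennreal e" using elim e by (intro ennreal_lessI) auto
    then show ?case using bound[OF t(1)[of n]] by (rule le_less_trans[rotated])
  qed
qed

lemma translation_sob_tendsto:
  assumes f: "sq_int f" "\<And>j. sq_int (q j)" and fin: "sob_sq UNIV f q < \<infinity>"
    and supp: "\<And>x. f x \<noteq> 0 \<Longrightarrow> norm x \<le> R" "\<And>x j. q j x \<noteq> 0 \<Longrightarrow> norm x \<le> R"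
    and t: "\<And>n. \<bar>t n\<bar> \<le> 1" "t \<longlonglongrightarrow> 0"
  shows "(\<lambda>n. sob_sq UNIV (\<lambda>x. f x - f (x + t n *\<^sub>R basis i)) (\<lambda>j x. q j x - q j (x + t n *\<^sub>R basis i))) \<longlonglongrightarrow> 0"
proof -
  note [measurable] = sq_int_measurable[OF f(1)] sq_int_measurable[OF f(2)]
  let ?I = "\<lambda>j. \<integral>\<^sup>+x. ennreal ((q j x)\<^sup>2) \<partial>G"
  define K where "K = ennreal (exp (R / (a i)\<^sup>2))"
  have eq: "sob_sq UNIV (\<lambda>x. f x - f (x + t n *\<^sub>R basis i)) (\<lambda>j x. q j x - q j (x + t n *\<^sub>R basis i))
     = L2_dist f (\<lambda>x. f (x + t n *\<^sub>R basis i)) + (\<Sum>j. ennreal ((a j)\<^sup>2) * L2_dist (q j) (\<lambda>x. q j (x + t n *\<^sub>R basis i)))" for n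
    by (subst sob_sq_UNIV) (auto simp: L2_dist_def)
  have sumI: "(\<Sum>j. ennreal ((a j)\<^sup>2) * ?I j) < \<infinity>"
    using fin by (subst (asm) sob_sq_UNIV) auto
  have bd: "L2_dist (q j) (\<lambda>x. q j (x + t n *\<^sub>R basis i)) \<le> (2 + 2 * K) * ?I j" for n j
  proof -
    have "L2_dist (q j) (\<lambda>x. q j (x + t n *\<^sub>R basis i)) \<le> 2 * L2_dist (q j) (\<lambda>x. 0) + 2 * L2_dist (\<lambda>x. 0) (\<lambda>x. q j (x + t n *\<^sub>R basis i))"
      by (rule L2_dist_triangle) measurable
    also have "L2_dist (\<lambda>x. 0) (\<lambda>x. q j (x + t n *\<^sub>R basis i)) \<le> K * ?I j"
      unfolding L2_dist_def K_def
      using nn_integral_shift_le[of "\<lambda>x. ennreal ((q j x)\<^sup>2)" R "t n" i] supp(2)[of j] t(1)[of n] by auto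
    finally show ?thesis by (simp add: L2_dist_zero add_left_mono mult_left_mono distrib_right mult.assoc)
  qed
  have "(\<lambda>n. \<Sum>j. ennreal ((a j)\<^sup>2) * L2_dist (q j) (\<lambda>x. q j (x + t n *\<^sub>R basis i))) \<longlonglongrightarrow> 0"
  proof (rule ennreal_suminf_tendsto_zero[where b="\<lambda>j. ennreal ((a j)\<^sup>2) * ((2 + 2 * K) * ?I j)"])
    fix j
    have "(\<lambda>n. ennreal ((a j)\<^sup>2) * L2_dist (q j) (\<lambda>x. q j (x + t n *\<^sub>R basis i))) \<longlonglongrightarrow> ennreal ((a j)\<^sup>2) * 0"
      by (intro ennreal_tendsto_cmult translation_L2_tendsto[OF f(2) supp(2) t]) auto
    then show "(\<lambda>n. ennreal ((a j)\<^sup>2) * L2_dist (q j) (\<lambda>x. q j (x + t n *\<^sub>R basis i))) \<longlonglongrightarrow> 0" by simp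
  next
    show "ennreal ((a j)\<^sup>2) * L2_dist (q j) (\<lambda>x. q j (x + t n *\<^sub>R basis i)) \<le> ennreal ((a j)\<^sup>2) * ((2 + 2 * K) * ?I j)" for n j
      by (intro mult_left_mono bd) simp
  next
    have "(\<Sum>j. ennreal ((a j)\<^sup>2) * ((2 + 2 * K) * ?I j)) = (2 + 2 * K) * (\<Sum>j. ennreal ((a j)\<^sup>2) * ?I j)"
      by (subst ennreal_suminf_cmult[symmetric]) (simp add: ac_simps)
    then show "(\<Sum>j. ennreal ((a j)\<^sup>2) * ((2 + 2 * K) * ?I j)) < \<infinity>"
      using sumI by (simp add: ennreal_mult_less_top K_def ennreal_add_less_top)
  qed
  from tendsto_add[OF translation_L2_tendsto[OF f(1) supp(1) t] this] show ?thesis unfolding eq by simp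
qed

lemma partial_eq_0_on_open:
  assumes "open V" "x \<in> V" "\<And>y. y \<in> V \<Longrightarrow> f y = k"
  shows "partial j f x = 0"
proof -
  have "partial j f x = partial j (\<lambda>x. k) x" by (rule partial_cong[OF assms])
  then show ?thesis using has_pd_imp_partial[OF has_pd_const] by simp
qed

lemma test_fun_shift:
  assumes \<phi>: "test_fun \<phi>" shows "test_fun (\<lambda>x. \<phi> (x + v))"
proof -
  obtain C R where C: "F_smooth UNIV \<phi>" "grad_bound UNIV \<phi> C" "\<And>x. \<phi> x \<noteq> 0 \<Longrightarrow> norm x \<le> R"
    using \<phi> by (auto simp: test_fun_def)
  have "partial i (\<lambda>x. \<phi> (x + v)) = (\<lambda>x. partial i \<phi> (x + v))" for i using partials_shift[of "[i]" \<phi> v] by simp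
  then have "grad_bound UNIV (\<lambda>x. \<phi> (x + v)) C" using C(2) by (simp add: grad_bound_def)
  moreover have "norm x \<le> R + norm v" if "\<phi> (x + v) \<noteq> 0" for x
    using C(3)[OF that] norm_triangle_ineq4[of "x + v" v] by simp
  ultimately show ?thesis using F_smooth_shift[OF C(1)] unfolding test_fun_def by blast
qed

text \<open>Cutting off on the translate of \<open>U\<close>, which keeps a positive distance to the complement
  of \<open>U\<close>, gives an element of the Sobolev space of the whole space; moving it back by \<open>t\<close>
  changes nothing on \<open>U\<close> except for the translation.\<close>

lemma approximate_translate:
  assumes U: "open U" and w: "weak U f q" and fin: "sob_sq UNIV f q < \<infinity>" and r: "r > 0"
    and supp: "\<And>z. f z \<noteq> 0 \<Longrightarrow> dist x0 z < r" "\<And>z j. q j z \<noteq> 0 \<Longrightarrow> dist x0 z < r"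
    and t: "\<bar>t\<bar> \<le> 1" and d: "d > 0"
    and sep: "\<And>z y. dist x0 z < r \<Longrightarrow> z - t *\<^sub>R basis i \<in> U \<Longrightarrow> dist z y < d \<Longrightarrow> y \<in> U"
    and e: "e > 0"
  shows "\<exists>\<phi>. test_fun \<phi> \<and> sob_sq U (\<lambda>x. f (x + t *\<^sub>R basis i) - \<phi> x) (\<lambda>j x. q j (x + t *\<^sub>R basis i) - partial j \<phi> x) < ennreal e"
proof -
  let ?v = "t *\<^sub>R basis i"
  \<comment> \<open>The part of the translate of \<open>U\<close> inside the ball; by
    \<open>sep\<close> its \<open>d\<close>-neighbourhood stays in \<open>U\<close>.\<close>
  define A where "A = {z. dist x0 z < r \<and> z - ?v \<in> U}"
  have A: "open A"
  proof -
    have "A = ball x0 r \<inter> (\<lambda>z. z - ?v) -` U" by (auto simp: A_def)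
    moreover have "open ((\<lambda>z. z - ?v) -` U)" by (intro open_vimage[OF U] continuous_intros)
    ultimately show ?thesis by auto
  qed
  have d2: "d / 2 > 0" using d by simp
  obtain \<kappa> C where \<kappa>: "F_smooth UNIV \<kappa>" "grad_bound UNIV \<kappa> C" "\<And>x. 0 \<le> \<kappa> x \<and> \<kappa> x \<le> 1" "\<And>x. x \<in> A \<Longrightarrow> \<kappa> x = 1"
      "\<And>x. \<kappa> x \<noteq> 0 \<Longrightarrow> \<exists>y\<in>A. dist y x < d / 2"
    by (rule smooth_separation[OF d2, of A]) blast
  have wi: "well_inside {x. \<kappa> x \<noteq> 0} U"
  proof -
    have "(\<Union>x\<in>{x. \<kappa> x \<noteq> 0}. ball x (d/2)) \<subseteq> U"
    proof clarify
      fix z x assume "\<kappa> x \<noteq> 0" "z \<in> ball x (d/2)"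
      then obtain y where y: "y \<in> A" "dist y x < d / 2" using \<kappa>(5) by blast
      then have "dist y z < d" using \<open>z \<in> ball x (d/2)\<close> dist_triangle[of y z x] by simp
      then show "z \<in> U" using y(1) sep[of y z] by (auto simp: A_def)
    qed
    moreover have "{x. \<kappa> x \<noteq> 0} \<subseteq> ball 0 (norm x0 + r + d)"
    proof clarify
      fix x assume "\<kappa> x \<noteq> 0"
      then obtain y where y: "y \<in> A" "dist y x < d / 2" using \<kappa>(5) by blast
      then have "dist x0 x < r + d" using dist_triangle[of x0 x y] d by (simp add: A_def)
      then show "x \<in> ball 0 (norm x0 + r + d)" using norm_triangle_sub[of x x0] by (simp add: dist_norm norm_minus_commute)
    qed
    ultimately show ?thesis unfolding well_inside_def using d2 r d
      by (intro exI[of _ "d/2"] conjI exI[of _ "norm x0 + r + d"]) (auto intro: add_nonneg_pos)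
  qed
  let ?F = "\<lambda>x. \<kappa> x * f x" and ?Q = "\<lambda>j x. \<kappa> x * q j x + partial j \<kappa> x * f x"
  have W: "weak UNIV ?F ?Q" by (rule weak_mult_extend[OF U w \<kappa>(1,2) wi])
  have mfq: "f \<in> borel_measurable borel" "\<And>j. q j \<in> borel_measurable borel"
    using w by (auto simp: weak_def sq_int_measurable)
  have "sob_sq UNIV ?F ?Q \<le> ennreal (2 * 1\<^sup>2 + 2 * ((suminf a)\<^sup>2 * C)) * sob_sq UNIV f q"
    by (rule sob_sq_mult_le) (use mfq \<kappa>(2,3) in auto)
  also have "\<dots> < \<infinity>" using fin by (simp add: ennreal_mult_less_top)
  finally have Fin: "sob_sq UNIV ?F ?Q < \<infinity>" .
  have Fs: "?F z \<noteq> 0 \<Longrightarrow> dist x0 z < r" for z using supp(1) by auto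
  have Qs: "?Q j z \<noteq> 0 \<Longrightarrow> dist x0 z < r" for z j
    using supp(1)[of z] supp(2)[of j z] by (cases "f z = 0"; cases "q j z = 0") auto
  \<comment> \<open>Function and approximant vanish beyond distance \<open>2 * r\<close> from
    \<open>x0\<close>, hence beyond norm \<open>R\<close>. There \<open>K\<close> bounds the shift
    density, and accuracy \<open>e / K\<close> pays for moving back.\<close>
  define R where "R = norm x0 + 2 * r"
  define K where "K = exp (R / (a i)\<^sup>2)"
  have K: "K > 0" by (simp add: K_def)
  then have eK: "e / K > 0" using e by simp
  have "\<exists>\<phi>. test_fun \<phi> \<and> (\<forall>x. \<phi> x \<noteq> 0 \<longrightarrow> dist x0 x < 2 * r) \<and>
      sob_sq UNIV (\<lambda>x. ?F x - \<phi> x) (\<lambda>j x. ?Q j x - partial j \<phi> x) < ennreal (e / K)"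
    by (rule approximable_UNIV[OF W Fin r _ _ eK]) (erule Fs, erule Qs)
  then obtain \<phi> where \<phi>: "test_fun \<phi>" "\<And>x. \<phi> x \<noteq> 0 \<Longrightarrow> dist x0 x < 2 * r"
      "sob_sq UNIV (\<lambda>x. ?F x - \<phi> x) (\<lambda>j x. ?Q j x - partial j \<phi> x) < ennreal (e / K)"
    by blast
  define h where "h = sob_dens (\<lambda>x. ?F x - \<phi> x) (\<lambda>j x. ?Q j x - partial j \<phi> x)"
  note [measurable] = mfq F_smooth_UNIV_measurable[OF \<kappa>(1)] test_fun_measurable[OF \<phi>(1)]
  have [measurable]: "h \<in> borel_measurable borel" unfolding h_def by measurable
  have hs: "norm x \<le> R" if "h x \<noteq> 0" for x
  proof (rule ccontr)
    assume x: "\<not> norm x \<le> R"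
    have far: "dist x0 y \<ge> 2 * r" if "y \<in> - cball 0 R" for y
      using that norm_triangle_sub[of y x0] by (auto simp: R_def dist_norm norm_minus_commute)
    have x': "x \<in> - cball 0 R" using x by simp
    have "partial j \<phi> x = 0" for j
    proof (rule partial_eq_0_on_open[OF _ x'])
      show "\<phi> y = 0" if "y \<in> - cball 0 R" for y using \<phi>(2)[of y] far[OF that] by force
    qed (simp add: open_Compl)
    moreover have "\<phi> x = 0" using \<phi>(2)[of x] far[OF x'] by force
    moreover have "f x = 0" "q j x = 0" for j using supp(1)[of x] supp(2)[of j x] far[OF x'] r by force+
    ultimately have "h x = 0" by (simp add: h_def sob_dens_def)
    with that show False by simp
  qed
  let ?\<phi> = "\<lambda>x. \<phi> (x + ?v)"
  have p: "partial j ?\<phi> = (\<lambda>x. partial j \<phi> (x + ?v))" for j using partials_shift[of "[j]" \<phi> ?v] by simp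
  \<comment> \<open>For \<open>x\<close> in \<open>U\<close> the point \<open>x + ?v\<close> either
    lies in \<open>A\<close>, where the cutoff is 1 with zero derivative, or outside the ball, where
    \<open>f\<close> and \<open>q j\<close> vanish.\<close>
  have eqU: "f (x + ?v) = ?F (x + ?v)" "q j (x + ?v) = ?Q j (x + ?v)" if "x \<in> U" for x j
  proof -
    have "f (x + ?v) = ?F (x + ?v) \<and> q j (x + ?v) = ?Q j (x + ?v)"
    proof (cases "dist x0 (x + ?v) < r")
      case True
      then have xA: "x + ?v \<in> A" using that by (simp add: A_def)
      then show ?thesis using \<kappa>(4)[OF xA] partial_eq_0_on_open[OF A xA \<kappa>(4)] by simp
    next
      case False
      then have "f (x + ?v) = 0" "q j (x + ?v) = 0" using supp(1)[of "x + ?v"] supp(2)[of j "x + ?v"] by auto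
      then show ?thesis by simp
    qed
    then show "f (x + ?v) = ?F (x + ?v)" "q j (x + ?v) = ?Q j (x + ?v)" by auto
  qed
  have dens_cong: "sob_dens F Q x = sob_dens F' Q' y"
    if "F x = F' y" "\<And>j. Q j x = Q' j y" for F F' :: "ell2 \<Rightarrow> real" and Q Q' and x y
    using that by (simp add: sob_dens_def)
  have "sob_sq U (\<lambda>x. f (x + ?v) - ?\<phi> x) (\<lambda>j x. q j (x + ?v) - partial j ?\<phi> x) \<le> (\<integral>\<^sup>+x. h (x + ?v) \<partial>G)"
    unfolding sob_sq_def
  proof (rule nn_integral_mono)
    fix x
    show "indicator U x * sob_dens (\<lambda>x. f (x + ?v) - ?\<phi> x) (\<lambda>j x. q j (x + ?v) - partial j ?\<phi> x) x \<le> h (x + ?v)"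
    proof (cases "x \<in> U")
      case True
      have "sob_dens (\<lambda>x. f (x + ?v) - ?\<phi> x) (\<lambda>j x. q j (x + ?v) - partial j ?\<phi> x) x = h (x + ?v)"
        unfolding h_def
      proof (rule dens_cong)
        show "f (x + ?v) - ?\<phi> x = ?F (x + ?v) - \<phi> (x + ?v)"
          by (rule arg_cong[where f = "\<lambda>u. u - \<phi> (x + ?v)", OF eqU(1)[OF True]])
        show "q j (x + ?v) - partial j ?\<phi> x = ?Q j (x + ?v) - partial j \<phi> (x + ?v)" for j
          unfolding p by (rule arg_cong[where f = "\<lambda>u. u - partial j \<phi> (x + ?v)", OF eqU(2)[OF True]])
      qed
      with True show ?thesis by simp
    qed simp
  qed
  also have "\<dots> \<le> ennreal K * (\<integral>\<^sup>+x. h x \<partial>G)" unfolding K_def by (rule nn_integral_shift_le[OF _ hs t]) measurable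
  also have "\<dots> = ennreal K * sob_sq UNIV (\<lambda>x. ?F x - \<phi> x) (\<lambda>j x. ?Q j x - partial j \<phi> x)"
    by (simp add: h_def sob_sq_def)
  also have "\<dots> < ennreal K * ennreal (e / K)"
    using \<phi>(3) K by (intro ennreal_mult_strict_left_mono) auto
  also have "\<dots> = ennreal e" using K e by (simp add: ennreal_mult[symmetric])
  finally show ?thesis using test_fun_shift[OF \<phi>(1)] by blast
qed

section \<open>Local approximation at interior, boundary and exterior points\<close>

definition locally_approximable :: "ell2 set \<Rightarrow> ell2 \<Rightarrow> real \<Rightarrow> bool"
  where "locally_approximable U x0 r \<longleftrightarrow> (\<forall>f q. weak U f q \<longrightarrow> sob_sq UNIV f q < \<infinity> \<longrightarrow>
    (\<forall>z. f z \<noteq> 0 \<longrightarrow> dist x0 z < r) \<longrightarrow> (\<forall>j z. q j z \<noteq> 0 \<longrightarrow> dist x0 z < r) \<longrightarrow> approximable U f q)"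

lemma locally_approximable_interior:
  assumes U: "open U" and r: "r > 0" and sub: "ball x0 (2 * r) \<subseteq> U"
  shows "locally_approximable U x0 r"
  unfolding locally_approximable_def
proof (intro allI impI)
  fix f q assume w: "weak U f q" "sob_sq UNIV f q < \<infinity>" "\<forall>z. f z \<noteq> 0 \<longrightarrow> dist x0 z < r" "\<forall>j z. q j z \<noteq> 0 \<longrightarrow> dist x0 z < r"
  show "approximable U f q"
    unfolding approximable_def
  proof (intro allI impI)
    fix e :: real assume e: "e > 0"
    have "y \<in> U" if "dist x0 z < r" "dist z y < r" for z y
      using dist_triangle[of x0 y z] that sub by (auto simp: subset_iff)
    then show "\<exists>\<phi>. test_fun \<phi> \<and> sob_sq U (\<lambda>x. f x - \<phi> x) (\<lambda>j x. q j x - partial j \<phi> x) < ennreal e"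
      using approximate_translate[OF U w(1,2) r, of x0 0 r undefined e] w(3,4) r e by simp
  qed
qed

text \<open>A continuous functional that vanishes on all basis vectors vanishes on their dense span.
  It matters because only shifts along basis vectors are under control.\<close>

lemma blinfun_nonzero_basis:
  assumes "(T :: ell2 \<Rightarrow>\<^sub>L real) \<noteq> 0" shows "\<exists>i. T (basis i) \<noteq> 0"
proof (rule ccontr)
  assume z: "\<nexists>i. T (basis i) \<noteq> 0"
  have "T x = 0" for x
  proof -
    have "(\<lambda>n. T (\<Sum>k<n. coord x k *\<^sub>R basis k)) \<longlonglongrightarrow> T x"
      by (intro tendsto_intros basis_expansion)
    moreover have "T (\<Sum>k<n. coord x k *\<^sub>R basis k) = 0" for n
      using z by (simp add: blinfun.sum_right blinfun.scaleR_right)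
    ultimately show ?thesis by (simp add: LIMSEQ_const_iff)
  qed
  then have "T = 0" by (intro blinfun_eqI) simp
  with assms show False by simp
qed

text \<open>Continuity keeps \<open>\<sigma> * Dg x (basis i)\<close> above \<open>\<delta>\<close>
  and \<open>Dg\<close> bounded by \<open>L\<close> near \<open>x0\<close>; the mean value theorem
  on the convex ball turns this into growth of \<open>g\<close> along
  \<open>\<sigma> *\<^sub>R basis i\<close> and a Lipschitz bound.\<close>

lemma boundary_transversal:
  fixes g :: "ell2 \<Rightarrow> real" and Dg :: "ell2 \<Rightarrow> ell2 \<Rightarrow>\<^sub>L real"
  assumes g: "\<And>x. (g has_derivative blinfun_apply (Dg x)) (at x)" and c: "continuous_on UNIV Dg"
    and U: "U = {x. g x > 0}" and ne: "Dg x0 \<noteq> 0"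
  obtains i \<sigma> R \<delta> L where "R > 0" "\<delta> > 0" "L > 0" "\<bar>\<sigma>\<bar> = 1"
    "\<And>z s. 0 < s \<Longrightarrow> z \<in> ball x0 R \<Longrightarrow> z - (\<sigma> * s) *\<^sub>R basis i \<in> ball x0 R \<Longrightarrow> g z \<ge> g (z - (\<sigma> * s) *\<^sub>R basis i) + \<delta> * s"
    "\<And>z y. z \<in> ball x0 R \<Longrightarrow> y \<in> ball x0 R \<Longrightarrow> \<bar>g z - g y\<bar> \<le> L * dist z y"
proof -
  obtain i where i: "Dg x0 (basis i) \<noteq> 0" using blinfun_nonzero_basis[OF ne] by blast
  define \<sigma> where "\<sigma> = sgn (Dg x0 (basis i))"
  \<comment> \<open>Half of the derivative at \<open>x0\<close>; the other half is left for its
    variation within the ball.\<close>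
  define \<delta> where "\<delta> = \<bar>Dg x0 (basis i)\<bar> / 2"
  define L where "L = norm (Dg x0) + 1"
  have \<sigma>: "\<bar>\<sigma>\<bar> = 1" and \<delta>: "\<delta> > 0" and L: "L > 0" using i by (auto simp: \<sigma>_def \<delta>_def L_def sgn_real_def add_nonneg_pos)
  have s2: "\<sigma> * Dg x0 (basis i) = 2 * \<delta>" by (simp add: \<sigma>_def \<delta>_def sgn_real_def)
  have "continuous (at x0) Dg" using c by (simp add: continuous_on_eq_continuous_at)
  then obtain R where R: "R > 0" "\<And>x. dist x x0 < R \<Longrightarrow> dist (Dg x) (Dg x0) < min \<delta> 1"
    unfolding continuous_at_eps_delta using \<delta> by (metis min_less_iff_conj zero_less_one)
  have D: "\<sigma> * Dg x (basis i) \<ge> \<delta>" "norm (Dg x) \<le> L" if "x \<in> ball x0 R" for x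
  proof -
    have n: "norm (Dg x - Dg x0) < min \<delta> 1" using R(2)[of x] that by (simp add: dist_norm norm_minus_commute)
    have "\<bar>(Dg x - Dg x0) (basis i)\<bar> \<le> norm (Dg x - Dg x0)"
      using norm_blinfun[of "Dg x - Dg x0" "basis i"] by simp
    then have "\<bar>\<sigma> * (Dg x (basis i) - Dg x0 (basis i))\<bar> \<le> \<delta>" using n \<sigma> by (simp add: abs_mult blinfun.diff_left)
    then show "\<sigma> * Dg x (basis i) \<ge> \<delta>" using s2 by (simp add: right_diff_distrib abs_le_iff)
    show "norm (Dg x) \<le> L" using n norm_triangle_sub[of "Dg x" "Dg x0"] by (simp add: L_def)
  qed
  show ?thesis
  proof (rule that[OF R(1) \<delta> L \<sigma>])
    fix z s assume s: "(0::real) < s" and z: "z \<in> ball x0 R" "z - (\<sigma> * s) *\<^sub>R basis i \<in> ball x0 R"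
    let ?w = "z - (\<sigma> * s) *\<^sub>R basis i"
    let ?l = "\<lambda>\<tau>. ?w + (\<sigma> * \<tau>) *\<^sub>R basis i"
    have line: "((\<lambda>\<tau>. g (?l \<tau>)) has_real_derivative Dg (?l \<tau>) (\<sigma> *\<^sub>R basis i)) (at \<tau>)" for \<tau>
    proof -
      have "(?l has_derivative (\<lambda>h. h *\<^sub>R (\<sigma> *\<^sub>R basis i))) (at \<tau>)"
        by (auto intro!: derivative_eq_intros simp: mult.commute)
      from has_derivative_compose[OF this g]
      have "((\<lambda>\<tau>. g (?l \<tau>)) has_derivative (\<lambda>h. Dg (?l \<tau>) (h *\<^sub>R (\<sigma> *\<^sub>R basis i)))) (at \<tau>)" .
      moreover have "(\<lambda>h. Dg (?l \<tau>) (h *\<^sub>R (\<sigma> *\<^sub>R basis i))) = (*) (Dg (?l \<tau>) (\<sigma> *\<^sub>R basis i))"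
        by (rule ext) (simp add: blinfun.scaleR_right)
      ultimately show ?thesis unfolding has_field_derivative_def by (simp only:)
    qed
    obtain \<xi> where xi: "0 < \<xi>" "\<xi> < s" "g (?l s) - g (?l 0) = (s - 0) * Dg (?l \<xi>) (\<sigma> *\<^sub>R basis i)"
      using MVT2[of 0 s "\<lambda>\<tau>. g (?l \<tau>)" "\<lambda>\<tau>. Dg (?l \<tau>) (\<sigma> *\<^sub>R basis i)"] s line by blast
    have "?l \<xi> \<in> ball x0 R"
    proof -
      have "(1 - \<xi> / s) *\<^sub>R ?w + (\<xi> / s) *\<^sub>R z \<in> ball x0 R"
        by (rule convexD[OF convex_ball z(2,1)]) (use xi s in auto)
      also have "(1 - \<xi> / s) *\<^sub>R ?w + (\<xi> / s) *\<^sub>R z = ?l \<xi>"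
        using s by (simp add: algebra_simps)
      finally show ?thesis .
    qed
    from D(1)[OF this] have "\<delta> \<le> Dg (?l \<xi>) (\<sigma> *\<^sub>R basis i)" by (simp add: blinfun.scaleR_right)
    then have "s * \<delta> \<le> s * Dg (?l \<xi>) (\<sigma> *\<^sub>R basis i)" using s by (intro mult_left_mono) auto
    then show "g z \<ge> g ?w + \<delta> * s" using xi(3) by (simp add: mult.commute)
  next
    fix z y assume zy: "z \<in> ball x0 R" "y \<in> ball x0 R"
    have "norm (g z - g y) \<le> L * norm (z - y)"
    proof (rule differentiable_bound[OF convex_ball _ _ zy])
      show "(g has_derivative blinfun_apply (Dg x)) (at x within ball x0 R)" for x
        using g has_derivative_at_withinI by blast
      show "onorm (blinfun_apply (Dg x)) \<le> L" if "x \<in> ball x0 R" for x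
        using D(2)[OF that] by (simp add: norm_blinfun.rep_eq)
    qed
    then show "\<bar>g z - g y\<bar> \<le> L * dist z y" by (simp add: dist_norm)
  qed
qed

text \<open>Moving by \<open>s\<close> raises \<open>g\<close> by at least
  \<open>\<delta> * s\<close>, whereas a displacement shorter than \<open>\<delta> * s / L\<close>
  lowers it by less than that. The translated domain thus keeps this distance from the
  complement.\<close>

lemma locally_approximable_boundary:
  fixes g :: "ell2 \<Rightarrow> real" and Dg :: "ell2 \<Rightarrow> ell2 \<Rightarrow>\<^sub>L real"
  assumes g: "\<And>x. (g has_derivative blinfun_apply (Dg x)) (at x)" and c: "continuous_on UNIV Dg"
    and U: "open U" "U = {x. g x > 0}" and ne: "Dg x0 \<noteq> 0"
  shows "\<exists>r>0. locally_approximable U x0 r"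
proof -
  obtain i \<sigma> R \<delta> L where R: "R > 0" "\<delta> > 0" "L > 0" "\<bar>\<sigma>\<bar> = 1"
    and inc: "\<And>z s. 0 < s \<Longrightarrow> z \<in> ball x0 R \<Longrightarrow> z - (\<sigma> * s) *\<^sub>R basis i \<in> ball x0 R \<Longrightarrow> g z \<ge> g (z - (\<sigma> * s) *\<^sub>R basis i) + \<delta> * s"
    and lip: "\<And>z y. z \<in> ball x0 R \<Longrightarrow> y \<in> ball x0 R \<Longrightarrow> \<bar>g z - g y\<bar> \<le> L * dist z y"
    by (rule boundary_transversal[OF g c U(2) ne]) blast
  \<comment> \<open>\<open>z\<close>, its translate and the nearby \<open>y\<close> then all stay
    within \<open>2 * r\<close> of \<open>x0\<close>, inside the ball where the estimates on
    \<open>g\<close> hold.\<close>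
  define r where "r = R / 4"
  have r: "r > 0" using R by (simp add: r_def)
  have "locally_approximable U x0 r"
    unfolding locally_approximable_def
  proof (intro allI impI)
    fix f q assume w: "weak U f q" and fin: "sob_sq UNIV f q < \<infinity>"
      and supp: "\<forall>z. f z \<noteq> 0 \<longrightarrow> dist x0 z < r" "\<forall>j z. q j z \<noteq> 0 \<longrightarrow> dist x0 z < r"
    have sq: "sq_int f" "\<And>j. sq_int (q j)" using w by (auto simp: weak_def)
    note [measurable] = sq_int_measurable[OF sq(1)] sq_int_measurable[OF sq(2)]
    have near: "norm z \<le> norm x0 + r" if "dist x0 z < r" for z
      using that norm_triangle_sub[of z x0] by (simp add: dist_norm norm_minus_commute)
    have s1: "\<And>z. f z \<noteq> 0 \<Longrightarrow> dist x0 z < r" and s2: "\<And>z j. q j z \<noteq> 0 \<Longrightarrow> dist x0 z < r" using supp by auto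
    show "approximable U f q"
      unfolding approximable_def
    proof (intro allI impI)
      fix e :: real assume e: "e > 0"
      define t where "t n = \<sigma> * (1 / real (Suc n))" for n
      have t1: "\<bar>t n\<bar> \<le> 1" for n using R(4) by (simp add: t_def abs_mult)
      have l0: "(\<lambda>n. 1 / real (Suc n)) \<longlonglongrightarrow> 0" using LIMSEQ_inverse_real_of_nat by (simp add: inverse_eq_divide)
      from tendsto_mult[OF tendsto_const this, of \<sigma>] have t0: "t \<longlonglongrightarrow> 0" by (simp add: t_def[abs_def])
      have "(\<lambda>n. sob_sq UNIV (\<lambda>x. f x - f (x + t n *\<^sub>R basis i)) (\<lambda>j x. q j x - q j (x + t n *\<^sub>R basis i))) \<longlonglongrightarrow> 0"
        by (rule translation_sob_tendsto[OF sq fin _ _ t1 t0]) (use near s1 s2 in blast)+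
      then have "eventually (\<lambda>n. sob_sq UNIV (\<lambda>x. f x - f (x + t n *\<^sub>R basis i)) (\<lambda>j x. q j x - q j (x + t n *\<^sub>R basis i)) < ennreal (e / 4)) sequentially"
        using e by (intro order_tendstoD(2)) auto
      moreover have "eventually (\<lambda>n. 1 / real (Suc n) < r) sequentially" using r by (intro order_tendstoD(2)[OF l0]) auto
      ultimately have "eventually (\<lambda>n. sob_sq UNIV (\<lambda>x. f x - f (x + t n *\<^sub>R basis i)) (\<lambda>j x. q j x - q j (x + t n *\<^sub>R basis i)) < ennreal (e / 4)
         \<and> 1 / real (Suc n) < r) sequentially" by (rule eventually_conj)
      then obtain n where n: "sob_sq UNIV (\<lambda>x. f x - f (x + t n *\<^sub>R basis i)) (\<lambda>j x. q j x - q j (x + t n *\<^sub>R basis i)) < ennreal (e / 4)"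
        and nr: "1 / real (Suc n) < r" by (auto simp: eventually_sequentially)
      define s where "s = 1 / real (Suc n)"
      have s: "0 < s" "s < r" "t n = \<sigma> * s" using nr by (auto simp: s_def t_def)
      define d where "d = min r (\<delta> * s / L)"
      have d: "d > 0" using r R s by (simp add: d_def)
      have sep: "y \<in> U" if z: "dist x0 z < r" "z - t n *\<^sub>R basis i \<in> U" "dist z y < d" for z y
      proof -
        have "dist x0 (z - t n *\<^sub>R basis i) \<le> dist x0 z + dist z (z - t n *\<^sub>R basis i)" by (rule dist_triangle)
        also have "dist z (z - t n *\<^sub>R basis i) = s" using s R(4) by (simp add: dist_norm abs_mult)
        finally have in1: "z - t n *\<^sub>R basis i \<in> ball x0 R" using z(1) s(2) r by (simp add: r_def)
        have in2: "z \<in> ball x0 R" using z(1) r by (simp add: r_def)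
        have "dist x0 y < r + r" using dist_triangle[of x0 y z] z(1,3) by (simp add: d_def)
        then have in3: "y \<in> ball x0 R" using r by (simp add: r_def)
        have "g z \<ge> g (z - t n *\<^sub>R basis i) + \<delta> * s" using inc[OF s(1) in2] in1 by (simp add: s(3))
        moreover have "g (z - t n *\<^sub>R basis i) > 0" using z(2) U(2) by simp
        moreover have "\<bar>g z - g y\<bar> \<le> L * dist z y" by (rule lip[OF in2 in3])
        moreover have "L * dist z y < \<delta> * s"
        proof -
          have "dist z y < \<delta> * s / L" using z(3) by (simp add: d_def)
          then show ?thesis using R(3) by (simp add: pos_less_divide_eq mult.commute)
        qed
        ultimately have "g y > 0" by linarith
        then show ?thesis using U(2) by simp
      qed
      have e4: "e / 4 > 0" using e by simp
      have "\<exists>\<phi>. test_fun \<phi> \<and>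
        sob_sq U (\<lambda>x. f (x + t n *\<^sub>R basis i) - \<phi> x) (\<lambda>j x. q j (x + t n *\<^sub>R basis i) - partial j \<phi> x) < ennreal (e / 4)"
        by (rule approximate_translate[OF U(1) w fin r _ _ t1 d _ e4]) (erule s1, erule s2, rule sep)
      then obtain \<phi> where \<phi>: "test_fun \<phi>"
        "sob_sq U (\<lambda>x. f (x + t n *\<^sub>R basis i) - \<phi> x) (\<lambda>j x. q j (x + t n *\<^sub>R basis i) - partial j \<phi> x) < ennreal (e / 4)"
        by blast
      note [measurable] = test_fun_measurable[OF \<phi>(1)]
      have Us: "U \<in> sets borel" using U(1) by simp
      have "sob_sq U (\<lambda>x. f x - \<phi> x) (\<lambda>j x. q j x - partial j \<phi> x)
         = sob_sq U (\<lambda>x. (f x - f (x + t n *\<^sub>R basis i)) + (f (x + t n *\<^sub>R basis i) - \<phi> x))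
             (\<lambda>j x. (q j x - q j (x + t n *\<^sub>R basis i)) + (q j (x + t n *\<^sub>R basis i) - partial j \<phi> x))" by simp
      also have "\<dots> \<le> 2 * sob_sq U (\<lambda>x. f x - f (x + t n *\<^sub>R basis i)) (\<lambda>j x. q j x - q j (x + t n *\<^sub>R basis i))
         + 2 * sob_sq U (\<lambda>x. f (x + t n *\<^sub>R basis i) - \<phi> x) (\<lambda>j x. q j (x + t n *\<^sub>R basis i) - partial j \<phi> x)"
        by (rule sob_sq_add_le[OF Us]) measurable
      also have "\<dots> < ennreal e"
        by (rule ennreal_double_add_less[OF le_less_trans[OF sob_sq_mono n] \<phi>(2)]) simp
      finally show "\<exists>\<phi>. test_fun \<phi> \<and> sob_sq U (\<lambda>x. f x - \<phi> x) (\<lambda>j x. q j x - partial j \<phi> x) < ennreal e"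
        using \<phi>(1) by blast
    qed
  qed
  with r show ?thesis by blast
qed

lemma locally_approximable_exists:
  fixes g :: "ell2 \<Rightarrow> real" and Dg :: "ell2 \<Rightarrow> ell2 \<Rightarrow>\<^sub>L real"
  assumes g: "\<And>x. (g has_derivative blinfun_apply (Dg x)) (at x)" and c: "continuous_on UNIV Dg"
    and U: "open U" "U = {x. g x > 0}" and ne: "\<And>x. x \<in> frontier U \<Longrightarrow> Dg x \<noteq> 0"
  shows "\<exists>r>0. locally_approximable U x0 r"
proof -
  consider "x0 \<in> U" | "x0 \<in> frontier U" | "x0 \<in> - closure U"
    using U(1) by (auto simp: frontier_def interior_open)
  then show ?thesis
  proof cases
    case 1
    obtain e where e: "e > 0" "ball x0 e \<subseteq> U" using openE[OF U(1) 1] by blast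
    then have "locally_approximable U x0 (e / 2)" by (intro locally_approximable_interior[OF U(1)]) auto
    then show ?thesis using e(1) half_gt_zero by blast
  next
    case 2
    show ?thesis by (rule locally_approximable_boundary[OF g c U ne[OF 2]])
  next
    \<comment> \<open>A ball around an exterior point misses \<open>U\<close>, so a weak function
      confined to it vanishes and 0 approximates it.\<close>
    case 3
    moreover have "open (- closure U)" by (simp add: open_Compl)
    ultimately obtain r where r: "r > 0" "ball x0 r \<subseteq> - closure U" using openE by blast
    have "locally_approximable U x0 r"
      unfolding locally_approximable_def
    proof (intro allI impI)
      fix f q assume w: "weak U f q" and supp: "\<forall>z. f z \<noteq> 0 \<longrightarrow> dist x0 z < r" "\<forall>j z. q j z \<noteq> 0 \<longrightarrow> dist x0 z < r"
      have z: "f x = 0 \<and> q j x = 0" for x j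
      proof (cases "x \<in> U")
        case True
        then have "x \<notin> ball x0 r" using r(2) closure_subset by blast
        then show ?thesis using supp by auto
      qed (use w in \<open>auto simp: weak_def\<close>)
      have t: "test_fun (\<lambda>x. 0)"
        using F_smooth_const[OF open_UNIV, of 0] has_pd_imp_partial[OF has_pd_const]
        unfolding test_fun_def grad_bound_def by (auto intro!: exI[of _ 0])
      show "approximable U f q"
        unfolding approximable_def using t z has_pd_imp_partial[OF has_pd_const]
        by (auto intro!: exI[of _ "\<lambda>x. 0"] simp: sob_sq_def sob_dens_def)
    qed
    then show ?thesis using r(1) by blast
  qed
qed

end

text \<open>A Hilbert cube: the box is compact in the product topology by Tychonoff, and on it
  coordinatewise convergence is dominated by the summable squares, hence convergence in
  norm.\<close>

lemma compact_ell2_box: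
  fixes b :: "nat \<Rightarrow> real"
  assumes b: "summable (\<lambda>i. (b i)\<^sup>2)"
  shows "compact {x. \<forall>i. \<bar>coord x i\<bar> \<le> b i}"
proof -
  define P where "P = PiE UNIV (\<lambda>i. {- b i..b i})"
  have P: "compact P"
  proof -
    have "compactin (product_topology (\<lambda>i. euclideanreal) UNIV) P"
      unfolding P_def by (subst compactin_PiE) auto
    then show ?thesis by (simp add: euclidean_product_topology)
  qed
  have sm: "summable (\<lambda>i. (u i)\<^sup>2)" if "u \<in> P" for u
  proof (rule summable_comparison_test'[OF b])
    fix i
    have "u i \<in> {- b i..b i}" using that unfolding P_def by (rule PiE_mem) simp
    then have "\<bar>u i\<bar> \<le> b i" by (simp add: abs_le_iff)
    then show "norm ((u i)\<^sup>2) \<le> (b i)\<^sup>2" using power_mono[of "\<bar>u i\<bar>" "b i" 2] by simp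
  qed
  have "continuous_on P Abs_ell2"
    unfolding continuous_on_sequentially
  proof (intro allI ballI impI)
    fix u :: "nat \<Rightarrow> nat \<Rightarrow> real" and v assume v: "v \<in> P" and u: "(\<forall>n. u n \<in> P) \<and> u \<longlonglongrightarrow> v"
    have uc: "(\<lambda>n. u n i) \<longlonglongrightarrow> v i" for i
      by (rule continuous_on_tendsto_compose[OF continuous_on_product_coordinates[of i]]) (use u in auto)
    have "(\<lambda>n. \<Sum>i. ennreal ((u n i - v i)\<^sup>2)) \<longlonglongrightarrow> 0"
    proof (rule ennreal_suminf_tendsto_zero[where b="\<lambda>i. ennreal (4 * (b i)\<^sup>2)"])
      fix i
      have "(\<lambda>n. (u n i - v i)\<^sup>2) \<longlonglongrightarrow> (v i - v i)\<^sup>2" by (intro tendsto_intros uc)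
      from tendsto_ennrealI[OF this] show "(\<lambda>n. ennreal ((u n i - v i)\<^sup>2)) \<longlonglongrightarrow> 0" by simp
    next
      fix n i
      have "u n \<in> P" using u by blast
      then have "- b i \<le> u n i" "u n i \<le> b i" "- b i \<le> v i" "v i \<le> b i" using v unfolding P_def PiE_iff by auto
      then have "\<bar>u n i - v i\<bar> \<le> 2 * b i" by linarith
      then have "(u n i - v i)\<^sup>2 \<le> 4 * (b i)\<^sup>2"
        using power_mono[of "\<bar>u n i - v i\<bar>" "2 * b i" 2] by (simp add: power_mult_distrib)
      then show "ennreal ((u n i - v i)\<^sup>2) \<le> ennreal (4 * (b i)\<^sup>2)" by (rule ennreal_leI)
    next
      have "summable (\<lambda>i. 4 * (b i)\<^sup>2)" by (intro summable_mult b)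
      then have "(\<Sum>i. ennreal (4 * (b i)\<^sup>2)) \<noteq> \<infinity>" by (subst (asm) summable_iff_ennreal) auto
      then show "(\<Sum>i. ennreal (4 * (b i)\<^sup>2)) < \<infinity>" by (simp add: less_top)
    qed
    moreover have "(\<Sum>i. ennreal ((u n i - v i)\<^sup>2)) = ennreal ((dist (Abs_ell2 (u n)) (Abs_ell2 v))\<^sup>2)" for n
    proof -
      have un: "u n \<in> P" using u by blast
      have c: "coord (Abs_ell2 (u n) - Abs_ell2 v) i = u n i - v i" for i using sm[OF un] sm[OF v] by simp
      show ?thesis unfolding dist_norm norm_sq_ell2
        using summable_coord_sq[of "Abs_ell2 (u n) - Abs_ell2 v"] unfolding c by (subst suminf_ennreal2) auto
    qed
    ultimately have "(\<lambda>n. ennreal ((dist (Abs_ell2 (u n)) (Abs_ell2 v))\<^sup>2)) \<longlonglongrightarrow> ennreal 0" by simp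
    then have "(\<lambda>n. (dist (Abs_ell2 (u n)) (Abs_ell2 v))\<^sup>2) \<longlonglongrightarrow> 0"
      by (subst (asm) tendsto_ennreal_iff) auto
    then have "(\<lambda>n. sqrt ((dist (Abs_ell2 (u n)) (Abs_ell2 v))\<^sup>2)) \<longlonglongrightarrow> sqrt 0" by (rule tendsto_real_sqrt)
    then have "(\<lambda>n. dist (Abs_ell2 (u n)) (Abs_ell2 v)) \<longlonglongrightarrow> 0" by simp
    then show "(Abs_ell2 \<circ> u) \<longlonglongrightarrow> Abs_ell2 v" unfolding comp_def by (rule tendsto_dist_iff[THEN iffD2])
  qed
  then have "compact (Abs_ell2 ` P)" using P by (rule compact_continuous_image)
  also have "Abs_ell2 ` P = {x. \<forall>i. \<bar>coord x i\<bar> \<le> b i}"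
  proof (intro subset_antisym subsetI)
    fix x assume "x \<in> Abs_ell2 ` P"
    then obtain u where u: "u \<in> P" "x = Abs_ell2 u" by blast
    have "- b i \<le> u i" "u i \<le> b i" for i using u(1) unfolding P_def PiE_iff by auto
    then show "x \<in> {x. \<forall>i. \<bar>coord x i\<bar> \<le> b i}" using sm[OF u(1)] u(2) by (simp add: abs_le_iff minus_le_iff)
  next
    fix x assume "x \<in> {x. \<forall>i. \<bar>coord x i\<bar> \<le> b i}"
    then have "coord x \<in> P" by (auto simp: P_def PiE_iff abs_le_iff minus_le_iff)
    then show "x \<in> Abs_ell2 ` P" using coord_inverse[of x] by (metis imageI)
  qed
  finally show ?thesis .
qed

context gaussian_ell2
begin

section \<open>Truncation near compact sets\<close>

definition trunc_weight :: "real \<Rightarrow> nat \<Rightarrow> real" where "trunc_weight T i = min (1 / a i) T"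

text \<open>Realises the weighted norm as \<open>norm (rescale T x)\<close>, which gives it the
  triangle inequality of \<open>ell2\<close>.\<close>

definition rescale :: "real \<Rightarrow> ell2 \<Rightarrow> ell2"
  where "rescale T x = Abs_ell2 (\<lambda>i. sqrt (trunc_weight T i) * coord x i)"

context
  fixes T :: real assumes T: "T > 0"
begin

lemma trunc_weight: "0 < trunc_weight T i" "trunc_weight T i \<le> T" "trunc_weight T i \<le> 1 / a i"
  using T a_pos[of i] by (simp_all add: trunc_weight_def)

lemma coord_rescale: "coord (rescale T x) i = sqrt (trunc_weight T i) * coord x i"
proof -
  have "summable (\<lambda>i. (sqrt (trunc_weight T i) * coord x i)\<^sup>2)"
  proof (rule summable_comparison_test'[OF summable_mult[OF summable_coord_sq]])
    show "norm ((sqrt (trunc_weight T i) * coord x i)\<^sup>2) \<le> T * (coord x i)\<^sup>2" for i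
      using trunc_weight[of i] by (simp add: power_mult_distrib mult_right_mono)
  qed
  then show ?thesis by (simp add: rescale_def)
qed

lemma rescale_add: "rescale T (x + v) = rescale T x + rescale T v"
  by (rule ell2_eqI) (simp add: coord_rescale algebra_simps)

lemma norm_rescale_sq: "(norm (rescale T x))\<^sup>2 = (\<Sum>i. trunc_weight T i * (coord x i)\<^sup>2)"
  unfolding norm_sq_ell2 coord_rescale using trunc_weight(1) by (simp add: power_mult_distrib less_imp_le)

lemma summable_rescale: "summable (\<lambda>i. trunc_weight T i * (coord x i)\<^sup>2)"
  using summable_coord_sq[of "rescale T x"] trunc_weight(1) by (simp add: coord_rescale power_mult_distrib less_imp_le)

lemma norm_rescale_le: "norm (rescale T x) \<le> sqrt T * norm x"
proof -
  have "(norm (rescale T x))\<^sup>2 \<le> (\<Sum>i. T * (coord x i)\<^sup>2)"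
    unfolding norm_rescale_sq
    by (intro suminf_le summable_rescale summable_mult summable_coord_sq mult_right_mono trunc_weight(2)) auto
  also have "\<dots> = (sqrt T * norm x)\<^sup>2"
    using T by (simp add: suminf_mult[OF summable_coord_sq] norm_sq_ell2[symmetric] power_mult_distrib)
  finally show ?thesis by (rule power2_le_imp_le) (use T in simp)
qed

text \<open>\<open>1 / (a i)\<^sup>2\<close> is the weight of the Cameron--Martin norm, dual to the
  weighted gradient sum in the Sobolev norm. Since
  \<open>1 / a i \<le> suminf a / (a i)\<^sup>2\<close>, it dominates the rescaled norm with a
  constant free of \<open>T\<close>.\<close>

lemma norm_rescale_sum_basis:
  "norm (rescale T (\<Sum>i<n. s i *\<^sub>R basis i)) \<le> sqrt (suminf a) * sqrt (\<Sum>i<n. 1 / (a i)\<^sup>2 * (s i)\<^sup>2)"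
proof -
  have A: "0 \<le> suminf a" using a_pos by (intro suminf_nonneg a_summable) (simp add: less_imp_le)
  have "(norm (rescale T (\<Sum>i<n. s i *\<^sub>R basis i)))\<^sup>2 = (\<Sum>i<n. trunc_weight T i * (s i)\<^sup>2)"
    unfolding norm_rescale_sq coord_sum_basis by (subst suminf_finite[of "{..<n}"]) auto
  also have "\<dots> \<le> (\<Sum>i<n. suminf a * (1 / (a i)\<^sup>2 * (s i)\<^sup>2))"
  proof (rule sum_mono)
    fix i
    have "a i \<le> suminf a" using sum_le_suminf[OF a_summable, of "{i}"] a_pos by (auto simp: less_imp_le)
    then have "1 / a i \<le> suminf a * (1 / (a i)\<^sup>2)" using a_pos[of i] by (simp add: field_simps power2_eq_square)
    then have "trunc_weight T i \<le> suminf a * (1 / (a i)\<^sup>2)" using trunc_weight(3)[of i] by linarith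
    from mult_right_mono[OF this, of "(s i)\<^sup>2"]
    show "trunc_weight T i * (s i)\<^sup>2 \<le> suminf a * (1 / (a i)\<^sup>2 * (s i)\<^sup>2)" by (simp add: mult.assoc)
  qed
  also have "\<dots> = (sqrt (suminf a) * sqrt (\<Sum>i<n. 1 / (a i)\<^sup>2 * (s i)\<^sup>2))\<^sup>2"
    using A by (simp add: power_mult_distrib sum_distrib_left sum_nonneg)
  finally show ?thesis
    by (rule power2_le_imp_le) (use A in \<open>intro mult_nonneg_nonneg real_sqrt_ge_zero sum_nonneg; simp\<close>)
qed

text \<open>One function with two Lipschitz bounds: \<open>sqrt T / \<rho>\<close> in the norm of
  \<open>ell2\<close>, which gives the plain gradient bound, and
  \<open>sqrt (suminf a) / \<rho>\<close> in the Cameron--Martin norm, which bounds its Sobolev cost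
  independently of \<open>T\<close>.\<close>

lemma weighted_cutoff:
  assumes \<rho>: "\<rho> > 0"
  obtains \<theta> C where "F_smooth UNIV \<theta>" "grad_bound UNIV \<theta> C" "\<And>x. 0 \<le> \<theta> x \<and> \<theta> x \<le> 1"
    "\<And>x n. (\<Sum>i<n. (a i * partial i \<theta> x)\<^sup>2) \<le> suminf a / \<rho>\<^sup>2"
    "\<And>x. norm (rescale T x) \<le> \<rho> / 2 \<Longrightarrow> \<theta> x = 1"
    "\<And>x. \<theta> x \<noteq> 0 \<Longrightarrow> norm (rescale T x) < 3 * \<rho>"
proof -
  define h where "h x = max 0 (min 1 (2 - norm (rescale T x) / \<rho>))" for x
  have sh: "\<bar>h (x + v) - h x\<bar> \<le> norm (rescale T v) / \<rho>" for x v
  proof -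
    have "\<bar>h (x + v) - h x\<bar> \<le> \<bar>norm (rescale T (x + v)) / \<rho> - norm (rescale T x) / \<rho>\<bar>"
      unfolding h_def by linarith
    also have "\<dots> = \<bar>norm (rescale T (x + v)) - norm (rescale T x)\<bar> / \<rho>" using \<rho> by (simp add: diff_divide_distrib[symmetric])
    also have "\<dots> \<le> norm (rescale T v) / \<rho>"
      using norm_triangle_ineq3[of "rescale T (x + v)" "rescale T x"] \<rho> by (intro divide_right_mono) (auto simp: rescale_add)
    finally show ?thesis .
  qed
  have lip: "(sqrt T / \<rho>)-lipschitz_on UNIV h"
    unfolding lipschitz_iff_shift
  proof (intro conjI allI)
    fix v x
    have "norm (rescale T v) / \<rho> \<le> sqrt T * norm v / \<rho>" using norm_rescale_le[of v] \<rho> by (intro divide_right_mono) auto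
    then show "\<bar>h (x + v) - h x\<bar> \<le> sqrt T / \<rho> * norm v" using sh[of x v] by simp
  qed (use T \<rho> in simp)
  have bd: "bounded (range h)" by (auto simp: bounded_iff h_def intro!: exI[of _ 1])
  \<comment> \<open>A ball of this radius changes the rescaled norm by at most
    \<open>\<rho> / 2\<close>, so the plateau of \<open>h\<close> up to \<open>\<rho>\<close>
    shrinks to \<open>\<rho> / 2\<close>, and its zero set from \<open>2 * \<rho>\<close> on still
    contains all points from \<open>3 * \<rho>\<close> on.\<close>
  define e where "e = \<rho> / (2 * sqrt T)"
  have e: "e > 0" using T \<rho> by (simp add: e_def)
  obtain g where g: "F_smooth UNIV g" "\<And>is. continuous_on UNIV (partials is g)"
    "\<And>v C x. (\<And>x. \<bar>h (x + v) - h x\<bar> \<le> C) \<Longrightarrow> \<bar>g (x + v) - g x\<bar> \<le> C"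
    "\<And>x l u. (\<And>y. y \<in> cball x e \<Longrightarrow> l \<le> h y \<and> h y \<le> u) \<Longrightarrow> l \<le> g x \<and> g x \<le> u"
    by (rule Lipschitz_smoothing[OF lip bd e]) blast
  have gl: "(sqrt T / \<rho>)-lipschitz_on UNIV g" using lip g(3) unfolding lipschitz_iff_shift by blast
  have cg: "continuous_on UNIV (partial i g)" for i using g(2)[of "[i]"] by simp
  have near: "\<bar>norm (rescale T y) - norm (rescale T x)\<bar> \<le> \<rho> / 2" if "y \<in> cball x e" for x y
  proof -
    have "\<bar>norm (rescale T y) - norm (rescale T x)\<bar> \<le> norm (rescale T (y - x))"
      using norm_triangle_ineq3[of "rescale T (x + (y - x))" "rescale T x"] rescale_add[of x "y - x"] by simp
    also have "\<dots> \<le> sqrt T * norm (y - x)" by (rule norm_rescale_le)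
    also have "\<dots> \<le> sqrt T * e" using that T by (intro mult_left_mono) (auto simp: dist_norm norm_minus_commute)
    also have "\<dots> = \<rho> / 2" using T by (simp add: e_def)
    finally show ?thesis .
  qed
  show ?thesis
  proof (rule that[OF g(1) Lipschitz_grad_bound[OF g(1) cg gl]])
    show "0 \<le> g x \<and> g x \<le> 1" for x by (rule g(4)) (simp add: h_def)
    show "g x = 1" if x: "norm (rescale T x) \<le> \<rho> / 2" for x
    proof -
      have "1 \<le> g x \<and> g x \<le> 1"
      proof (rule g(4))
        fix y assume "y \<in> cball x e"
        then have "norm (rescale T y) \<le> \<rho>" using near[of y x] x by linarith
        then have "norm (rescale T y) / \<rho> \<le> 1" using \<rho> by simp
        then show "1 \<le> h y \<and> h y \<le> 1" by (simp add: h_def)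
      qed
      then show ?thesis by simp
    qed
    show "norm (rescale T x) < 3 * \<rho>" if x: "g x \<noteq> 0" for x
    proof (rule ccontr)
      assume far: "\<not> norm (rescale T x) < 3 * \<rho>"
      have "0 \<le> g x \<and> g x \<le> 0"
      proof (rule g(4))
        fix y assume "y \<in> cball x e"
        then have "2 * \<rho> \<le> norm (rescale T y)" using near[of y x] far \<rho> by linarith
        then have "2 \<le> norm (rescale T y) / \<rho>" using \<rho> by (simp add: pos_le_divide_eq)
        then show "0 \<le> h y \<and> h y \<le> 0" by (simp add: h_def)
      qed
      then show False using x by simp
    qed
    show "(\<Sum>i<n. (a i * partial i g x)\<^sup>2) \<le> suminf a / \<rho>\<^sup>2" for x n
    proof -
      have A: "0 \<le> suminf a" using a_pos by (intro suminf_nonneg a_summable) (simp add: less_imp_le)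
      have "(\<Sum>i<n. (partial i g x)\<^sup>2 / (1 / (a i)\<^sup>2)) \<le> (sqrt (suminf a) / \<rho>)\<^sup>2"
      proof (rule weighted_gradient_bound[OF g(1) cg])
        show "0 < 1 / (a i)\<^sup>2" for i using a_pos[of i] by simp
        show "0 \<le> sqrt (suminf a) / \<rho>" using A \<rho> by simp
        fix x s
        show "\<bar>g (x + (\<Sum>i<n. s i *\<^sub>R basis i)) - g x\<bar> \<le> sqrt (suminf a) / \<rho> * sqrt (\<Sum>i<n. 1 / (a i)\<^sup>2 * (s i)\<^sup>2)"
        proof (rule g(3))
          fix x
          have "norm (rescale T (\<Sum>i<n. s i *\<^sub>R basis i)) / \<rho> \<le> sqrt (suminf a) * sqrt (\<Sum>i<n. 1 / (a i)\<^sup>2 * (s i)\<^sup>2) / \<rho>"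
            using norm_rescale_sum_basis \<rho> by (intro divide_right_mono) auto
          then show "\<bar>h (x + (\<Sum>i<n. s i *\<^sub>R basis i)) - h x\<bar> \<le> sqrt (suminf a) / \<rho> * sqrt (\<Sum>i<n. 1 / (a i)\<^sup>2 * (s i)\<^sup>2)"
            using sh[of x "\<Sum>i<n. s i *\<^sub>R basis i"] by simp
        qed
      qed
      then show ?thesis using A \<rho> by (simp add: power_mult_distrib power_divide mult.commute)
    qed
  qed
qed

text \<open>Dropping the coordinates with \<open>1 / a i > T\<close> gives the point of the box: the
  kept ones carry the full weight \<open>1 / a i\<close>, which yields the box bounds; the dropped
  ones carry weight \<open>T\<close>, so their squares sum to less than
  \<open>9 * \<rho>\<^sup>2 / T\<close>.\<close>

lemma norm_rescale_near_box:
  assumes x: "norm (rescale T x) < 3 * \<rho>" and \<delta>: "\<delta> > 0" "9 * \<rho>\<^sup>2 \<le> T * \<delta>\<^sup>2" and \<rho>: "\<rho> > 0"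
  shows "\<exists>y. (\<forall>i. \<bar>coord y i\<bar> \<le> 3 * \<rho> * sqrt (a i)) \<and> dist y x < \<delta>"
proof -
  define y where "y = Abs_ell2 (\<lambda>i. if 1 / a i \<le> T then coord x i else 0)"
  have cy: "coord y i = (if 1 / a i \<le> T then coord x i else 0)" for i
  proof -
    have "summable (\<lambda>i. (if 1 / a i \<le> T then coord x i else 0)\<^sup>2)"
      by (rule summable_comparison_test'[OF summable_coord_sq[of x]]) auto
    then show ?thesis by (simp add: y_def)
  qed
  have N: "(norm (rescale T x))\<^sup>2 < 9 * \<rho>\<^sup>2" using power_strict_mono[OF x, of 2] by (simp add: power_mult_distrib)
  have "\<bar>coord y i\<bar> \<le> 3 * \<rho> * sqrt (a i)" for i
  proof (cases "1 / a i \<le> T")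
    case True
    have "(\<Sum>i\<in>{i}. trunc_weight T i * (coord x i)\<^sup>2) \<le> (\<Sum>i. trunc_weight T i * (coord x i)\<^sup>2)"
      by (rule sum_le_suminf[OF summable_rescale]) (use trunc_weight(1) in \<open>auto simp: less_imp_le\<close>)
    then have "(coord x i)\<^sup>2 / a i \<le> 9 * \<rho>\<^sup>2" using True N norm_rescale_sq by (simp add: trunc_weight_def)
    then have "(coord x i)\<^sup>2 \<le> 9 * \<rho>\<^sup>2 * a i" using a_pos[of i] by (simp add: pos_divide_le_eq)
    also have "\<dots> = (3 * \<rho> * sqrt (a i))\<^sup>2" using a_pos[of i] by (simp add: power_mult_distrib less_imp_le)
    finally have "\<bar>coord x i\<bar> \<le> \<bar>3 * \<rho> * sqrt (a i)\<bar>" by (simp only: abs_le_square_iff)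
    then show ?thesis using True \<rho> a_pos[of i] by (simp add: cy)
  qed (use \<rho> a_pos[of i] in \<open>simp add: cy\<close>)
  moreover have "dist y x < \<delta>"
  proof -
    have "T * (norm (y - x))\<^sup>2 = (\<Sum>i. T * (coord (y - x) i)\<^sup>2)"
      by (simp only: norm_sq_ell2 suminf_mult[OF summable_coord_sq])
    also have "\<dots> \<le> (\<Sum>i. trunc_weight T i * (coord x i)\<^sup>2)"
    proof (rule suminf_le)
      show "T * (coord (y - x) i)\<^sup>2 \<le> trunc_weight T i * (coord x i)\<^sup>2" for i
        using trunc_weight(1)[of i] by (auto simp: cy trunc_weight_def)
    qed (intro summable_mult summable_coord_sq summable_rescale)+
    also have "\<dots> < T * \<delta>\<^sup>2" using N \<delta>(2) unfolding norm_rescale_sq by linarith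
    finally have "(norm (y - x))\<^sup>2 < \<delta>\<^sup>2" using T by simp
    then show ?thesis using \<delta>(1) power_less_imp_less_base[of "norm (y - x)" 2 \<delta>] by (simp add: dist_norm)
  qed
  ultimately show ?thesis by blast
qed

end

text \<open>Almost every \<open>x\<close> has a finite weighted sum and so eventually leaves these
  sets, while \<open>sob_dens f q\<close> dominates. The radius \<open>real n / 2\<close> is that of
  the plateau of the cutoff at scale \<open>n\<close>.\<close>

lemma truncation_tendsto:
  assumes [measurable]: "f \<in> borel_measurable borel" "\<And>j. q j \<in> borel_measurable borel"
    and fin: "sob_sq UNIV f q < \<infinity>"
  shows "(\<lambda>n. (\<integral>\<^sup>+x. indicator {x. (\<Sum>i. ennreal ((coord x i)\<^sup>2 / a i)) > ennreal ((real n / 2)\<^sup>2)} x * sob_dens f q x \<partial>G)) \<longlonglongrightarrow> 0"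
proof -
  let ?s = "\<lambda>x. \<Sum>i. ennreal ((coord x i)\<^sup>2 / a i)"
  have [measurable]: "{x. ?s x > ennreal ((real n / 2)\<^sup>2)} \<in> sets borel" for n by measurable
  have "(\<lambda>n. (\<integral>\<^sup>+x. indicator {x. ?s x > ennreal ((real n / 2)\<^sup>2)} x * sob_dens f q x \<partial>G)) \<longlonglongrightarrow> (\<integral>\<^sup>+x. 0 \<partial>G)"
  proof (rule nn_integral_dominated_convergence[where w="sob_dens f q"])
    show "AE x in G. indicator {x. ?s x > ennreal ((real n / 2)\<^sup>2)} x * sob_dens f q x \<le> sob_dens f q x" for n
      by (rule AE_I2) (auto simp: indicator_def)
    show "(\<integral>\<^sup>+x. sob_dens f q x \<partial>G) < \<infinity>" using fin by (simp add: sob_sq_def)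
    show "AE x in G. (\<lambda>n. indicator {x. ?s x > ennreal ((real n / 2)\<^sup>2)} x * sob_dens f q x) \<longlonglongrightarrow> 0"
      using AE_weighted_summable
    proof eventually_elim
      case (elim x)
      then obtain r where r: "?s x = ennreal r" "r \<ge> 0" by (cases "?s x" rule: ennreal_cases) auto
      obtain n0 :: nat where n0: "2 * (r + 1) \<le> real n0" using real_arch_simple by blast
      have "indicator {x. ?s x > ennreal ((real n / 2)\<^sup>2)} x * sob_dens f q x = 0" if "n \<ge> n0" for n
      proof -
        have n: "r + 1 \<le> real n / 2" using n0 that by (simp add: order_trans[of _ "real n0"])
        have "r \<le> (r + 1) * (r + 1)" using r(2) by (simp add: algebra_simps)
        also have "\<dots> \<le> (real n / 2) * (real n / 2)" using n r(2) by (intro mult_mono) auto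
        finally have "ennreal r \<le> ennreal ((real n / 2)\<^sup>2)" by (intro ennreal_leI) (simp add: power2_eq_square)
        then show ?thesis using r(1) by (simp add: not_less)
      qed
      then have "eventually (\<lambda>n. indicator {x. ?s x > ennreal ((real n / 2)\<^sup>2)} x * sob_dens f q x = 0) sequentially"
        unfolding eventually_sequentially by blast
      then show ?case by (rule tendsto_eventually)
    qed
  qed auto
  then show ?thesis by simp
qed

section \<open>Gluing over a finite cover and removing the truncation\<close>

lemma weak_measurable:
  assumes "weak V f q" shows "f \<in> borel_measurable borel" "q j \<in> borel_measurable borel"
  using assms by (auto simp: weak_def sq_int_measurable)

lemma F_smooth_one_minus:
  assumes "F_smooth UNIV \<psi>" "grad_bound UNIV \<psi> C"
  shows "F_smooth UNIV (\<lambda>x. 1 - \<psi> x)" "grad_bound UNIV (\<lambda>x. 1 - \<psi> x) C" "partial j (\<lambda>x. 1 - \<psi> x) x = - partial j \<psi> x"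
proof -
  have "F_smooth UNIV (\<lambda>x. 1 + (-1) * \<psi> x)"
    by (intro F_smooth_add F_smooth_mult F_smooth_const assms(1) open_UNIV)
  then show "F_smooth UNIV (\<lambda>x. 1 - \<psi> x)" by simp
  have p: "partial j (\<lambda>x. 1 - \<psi> x) x = - partial j \<psi> x" for j x
  proof -
    have "has_pd (\<lambda>x. 1 + (-1) * \<psi> x) j x (0 + (0 * \<psi> x + (-1) * partial j \<psi> x))"
      by (intro has_pd_add has_pd_const has_pd_mult F_smooth_has_pd[OF assms(1)]) simp
    then have "has_pd (\<lambda>x. 1 - \<psi> x) j x (- partial j \<psi> x)" by simp
    then show ?thesis by (rule has_pd_imp_partial)
  qed
  then show "partial j (\<lambda>x. 1 - \<psi> x) x = - partial j \<psi> x" .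
  show "grad_bound UNIV (\<lambda>x. 1 - \<psi> x) C" using assms(2) by (simp add: grad_bound_def p)
qed

text \<open>A partition of unity that peels off one ball at a time: the factor \<open>\<psi>\<close>
  localises at \<open>y\<close>, and \<open>1 - \<psi>\<close> removes everything from the half ball
  around \<open>y\<close>. The half radii leave room for \<open>\<psi>\<close> to fall to 0 within
  \<open>r y\<close>.\<close>

lemma approximable_finite_cover:
  assumes U: "open U" and X: "finite X"
    and r: "\<And>x. x \<in> X \<Longrightarrow> r x > 0" "\<And>x. x \<in> X \<Longrightarrow> locally_approximable U x (r x)"
    and w: "weak U f q" "sob_sq UNIV f q < \<infinity>"
    and supp: "\<And>z. f z \<noteq> 0 \<Longrightarrow> z \<in> (\<Union>x\<in>X. ball x (r x / 2))" "\<And>j z. q j z \<noteq> 0 \<Longrightarrow> z \<in> (\<Union>x\<in>X. ball x (r x / 2))"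
  shows "approximable U f q"
  using X r w supp
proof (induction X arbitrary: f q rule: finite_induct)
  case empty
  have z: "f x = 0" "q j x = 0" for x j using empty.prems(5)[of x] empty.prems(6)[of j x] by auto
  have "test_fun (\<lambda>x. 0)"
    using F_smooth_const[OF open_UNIV, of 0] has_pd_imp_partial[OF has_pd_const]
    unfolding test_fun_def grad_bound_def by (auto intro!: exI[of _ 0])
  then show ?case
    unfolding approximable_def using z has_pd_imp_partial[OF has_pd_const]
    by (auto intro!: exI[of _ "\<lambda>x. 0"] simp: sob_sq_def sob_dens_def)
next
  case (insert y X)
  have ry: "r y > 0" and la: "locally_approximable U y (r y)" using insert.prems(1,2) by auto
  have d: "r y / 4 > 0" using ry by simp
  obtain \<psi> C where \<psi>: "F_smooth UNIV \<psi>" "grad_bound UNIV \<psi> C" "\<And>x. 0 \<le> \<psi> x \<and> \<psi> x \<le> 1" "\<And>x. x \<in> ball y (r y / 2) \<Longrightarrow> \<psi> x = 1"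
      "\<And>x. \<psi> x \<noteq> 0 \<Longrightarrow> \<exists>z\<in>ball y (r y / 2). dist z x < r y / 4"
    by (rule smooth_separation[OF d, of "ball y (r y / 2)"]) blast
  have \<psi>0: "\<psi> x = 0" if "x \<in> - cball y (3 * r y / 4)" for x
  proof (rule ccontr)
    assume "\<psi> x \<noteq> 0"
    then obtain z where "dist y z < r y / 2" "dist z x < r y / 4" using \<psi>(5)[of x] by auto
    then have "dist y x < 3 * r y / 4" using dist_triangle[of y x z] by simp
    then show False using that by simp
  qed
  have d\<psi>0: "partial j \<psi> x = 0" if "x \<in> - cball y (3 * r y / 4)" for x j
    by (rule partial_eq_0_on_open[OF _ that \<psi>0]) (auto simp: open_Compl)
  have d\<psi>1: "partial j \<psi> x = 0" if "x \<in> ball y (r y / 2)" for x j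
    by (rule partial_eq_0_on_open[OF _ that \<psi>(4)]) auto
  note om = F_smooth_one_minus[OF \<psi>(1,2)]
  let ?f1 = "\<lambda>x. \<psi> x * f x" and ?q1 = "\<lambda>j x. \<psi> x * q j x + partial j \<psi> x * f x"
  let ?f2 = "\<lambda>x. (1 - \<psi> x) * f x" and ?q2 = "\<lambda>j x. (1 - \<psi> x) * q j x + partial j (\<lambda>x. 1 - \<psi> x) x * f x"
  note mfq = weak_measurable[OF insert.prems(3)]
  have w1: "weak U ?f1 ?q1" by (rule weak_mult_same[OF U insert.prems(3) \<psi>(1,2)])
  have w2: "weak U ?f2 ?q2" by (rule weak_mult_same[OF U insert.prems(3) om(1,2)])
  have s1: "sob_sq UNIV ?f1 ?q1 < \<infinity>"
  proof -
    have "sob_sq UNIV ?f1 ?q1 \<le> ennreal (2 * 1\<^sup>2 + 2 * ((suminf a)\<^sup>2 * C)) * sob_sq UNIV f q"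
      by (rule sob_sq_mult_le) (use mfq \<psi>(2,3) in auto)
    also have "\<dots> < \<infinity>" using insert.prems(4) by (simp add: ennreal_mult_less_top)
    finally show ?thesis .
  qed
  have s2: "sob_sq UNIV ?f2 ?q2 < \<infinity>"
  proof -
    have "sob_sq UNIV ?f2 ?q2 \<le> ennreal (2 * 1\<^sup>2 + 2 * ((suminf a)\<^sup>2 * C)) * sob_sq UNIV f q"
    proof (rule sob_sq_mult_le)
      show "\<bar>1 - \<psi> x\<bar> \<le> 1" for x using \<psi>(3)[of x] by (simp add: abs_le_iff)
    qed (use mfq om(2) in auto)
    also have "\<dots> < \<infinity>" using insert.prems(4) by (simp add: ennreal_mult_less_top)
    finally show ?thesis .
  qed
  have "approximable U ?f1 ?q1"
  proof -
    have in_ball: "dist y z < r y" if "\<psi> z \<noteq> 0 \<or> partial j \<psi> z \<noteq> 0" for z j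
    proof (rule ccontr)
      assume "\<not> dist y z < r y"
      then have "z \<in> - cball y (3 * r y / 4)" using ry by simp
      then show False using \<psi>0 d\<psi>0 that by blast
    qed
    have "\<forall>z. ?f1 z \<noteq> 0 \<longrightarrow> dist y z < r y" using in_ball by auto
    moreover have "\<forall>j z. ?q1 j z \<noteq> 0 \<longrightarrow> dist y z < r y" using in_ball by (metis add_0 mult_zero_left)
    ultimately show ?thesis using la w1 s1 unfolding locally_approximable_def by blast
  qed
  moreover have "approximable U ?f2 ?q2"
  proof (rule insert.IH[OF _ _ w2 s2])
    fix z
    show "z \<in> (\<Union>x\<in>X. ball x (r x / 2))" if "?f2 z \<noteq> 0"
      using insert.prems(5)[of z] \<psi>(4)[of z] that by auto
    show "z \<in> (\<Union>x\<in>X. ball x (r x / 2))" if "?q2 j z \<noteq> 0" for j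
    proof (cases "z \<in> ball y (r y / 2)")
      case True
      then show ?thesis using that \<psi>(4)[OF True] d\<psi>1[OF True] om(3) by simp
    next
      case False
      have "f z \<noteq> 0 \<or> q j z \<noteq> 0" using that by auto
      then show ?thesis using insert.prems(5)[of z] insert.prems(6)[of j z] False by auto
    qed
  qed (use insert.prems in auto)
  ultimately have "approximable U (\<lambda>x. ?f1 x + ?f2 x) (\<lambda>j x. ?q1 j x + ?q2 j x)"
    using U weak_measurable[OF w1] weak_measurable[OF w2] by (intro approximable_add) auto
  moreover have "(\<lambda>x. ?f1 x + ?f2 x) = f" by (auto simp: algebra_simps)
  moreover have "(\<lambda>j x. ?q1 j x + ?q2 j x) = q" by (auto simp: om(3) algebra_simps)
  ultimately show ?case by simp
qed

text \<open>The order of choices matters: the scale \<open>\<rho>\<close> makes both error terms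
  small, the box at that scale fixes a finite cover and its Lebesgue number \<open>\<delta>\<close>,
  and \<open>T\<close> comes last. This works because the cost
  \<open>suminf a / \<rho>\<^sup>2\<close> of the cutoff does not involve \<open>T\<close>.\<close>

lemma approximable_of_local:
  assumes U: "open U" and loc: "\<And>x. \<exists>r>0. locally_approximable U x r"
    and w: "weak U f q" "sob_sq UNIV f q < \<infinity>"
  shows "approximable U f q"
proof (rule approximable_closed)
  note [measurable] = weak_measurable[OF w(1)]
  show "U \<in> sets borel" using U by simp
  fix e :: real assume e: "e > 0"
  let ?s = "\<lambda>x. \<Sum>i. ennreal ((coord x i)\<^sup>2 / a i)"
  let ?Z = "\<lambda>n. {x. ?s x > ennreal ((real n / 2)\<^sup>2)}"
  let ?A = "suminf a"
  have A: "0 \<le> ?A" using a_pos by (intro suminf_nonneg a_summable) (simp add: less_imp_le)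
  obtain S where S: "sob_sq UNIV f q = ennreal S" "S \<ge> 0" using w(2) by (cases "sob_sq UNIV f q" rule: ennreal_cases) auto
  \<comment> \<open>The tail enters the final estimate twice and the gradient term once, so eighths
    leave ample room.\<close>
  have "eventually (\<lambda>n. (\<integral>\<^sup>+x. indicator (?Z n) x * sob_dens f q x \<partial>G) < ennreal (e / 8)) sequentially"
    using e by (intro order_tendstoD(2)[OF truncation_tendsto] w(2)) auto
  moreover have "eventually (\<lambda>n. 2 * ?A / (real n)\<^sup>2 * S < e / 8) sequentially"
  proof -
    have "(\<lambda>n. 2 * ?A * (1 / real n * (1 / real n)) * S) \<longlonglongrightarrow> 2 * ?A * (0 * 0) * S"
      by (intro tendsto_intros lim_1_over_n)
    then have "eventually (\<lambda>n. 2 * ?A * (1 / real n * (1 / real n)) * S < e / 8) sequentially"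
      using e by (intro order_tendstoD(2)) auto
    then show ?thesis by eventually_elim (simp add: power2_eq_square)
  qed
  ultimately have "eventually (\<lambda>n. (\<integral>\<^sup>+x. indicator (?Z n) x * sob_dens f q x \<partial>G) < ennreal (e / 8) \<and>
      2 * ?A / (real n)\<^sup>2 * S < e / 8 \<and> n > 0) sequentially"
    using eventually_gt_at_top[of 0] by eventually_elim simp
  then obtain n where n: "(\<integral>\<^sup>+x. indicator (?Z n) x * sob_dens f q x \<partial>G) < ennreal (e / 8)" "2 * ?A / (real n)\<^sup>2 * S < e / 8" "n > 0"
    by (auto simp: eventually_sequentially)
  define \<rho> where "\<rho> = real n"
  have \<rho>: "\<rho> > 0" using n(3) by (simp add: \<rho>_def)
  define K where "K = {x. \<forall>i. \<bar>coord x i\<bar> \<le> 3 * \<rho> * sqrt (a i)}"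
  have K: "compact K"
  proof -
    have "summable (\<lambda>i. 9 * \<rho>\<^sup>2 * a i)" by (intro summable_mult a_summable)
    moreover have "(3 * \<rho> * sqrt (a i))\<^sup>2 = 9 * \<rho>\<^sup>2 * a i" for i
      using a_pos[of i] by (simp add: power_mult_distrib less_imp_le)
    ultimately show ?thesis unfolding K_def by (intro compact_ell2_box) simp
  qed
  obtain r where r: "\<And>x. r x > 0" "\<And>x. locally_approximable U x (r x)" using loc by metis
  have "K \<subseteq> (\<Union>x\<in>K. ball x (r x / 2))" using r(1) by force
  then obtain X where X: "X \<subseteq> K" "finite X" "K \<subseteq> (\<Union>x\<in>X. ball x (r x / 2))"
    using compactE_image[OF K, of K "\<lambda>x. ball x (r x / 2)"] by blast
  have "K \<subseteq> \<Union>((\<lambda>x. ball x (r x / 2)) ` X)" using X(3) by simp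
  then obtain \<delta> where \<delta>: "\<delta> > 0" "\<And>x. x \<in> K \<Longrightarrow> \<exists>B\<in>(\<lambda>x. ball x (r x / 2)) ` X. ball x \<delta> \<subseteq> B"
    by (rule Heine_Borel_lemma[OF K]) auto
  \<comment> \<open>Equality in the condition of \<open>norm_rescale_near_box\<close>: the cutoff
    then vanishes off the \<open>\<delta>\<close>-neighbourhood of the box, which the finite cover
    contains.\<close>
  define T where "T = 9 * \<rho>\<^sup>2 / \<delta>\<^sup>2"
  have T: "T > 0" "9 * \<rho>\<^sup>2 \<le> T * \<delta>\<^sup>2" using \<rho> \<delta>(1) by (simp_all add: T_def)
  obtain \<theta> C where \<theta>: "F_smooth UNIV \<theta>" "grad_bound UNIV \<theta> C" "\<And>x. 0 \<le> \<theta> x \<and> \<theta> x \<le> 1"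
    "\<And>x n. (\<Sum>i<n. (a i * partial i \<theta> x)\<^sup>2) \<le> ?A / \<rho>\<^sup>2"
    "\<And>x. norm (rescale T x) \<le> \<rho> / 2 \<Longrightarrow> \<theta> x = 1"
    "\<And>x. \<theta> x \<noteq> 0 \<Longrightarrow> norm (rescale T x) < 3 * \<rho>"
    by (rule weighted_cutoff[OF T(1) \<rho>]) blast
  have near: "x \<in> (\<Union>x\<in>X. ball x (r x / 2))" if x: "norm (rescale T x) < 3 * \<rho>" for x
  proof -
    obtain y where y: "y \<in> K" "dist y x < \<delta>"
      using norm_rescale_near_box[OF T(1) x \<delta>(1) T(2) \<rho>] by (auto simp: K_def)
    obtain z where z: "z \<in> X" "ball y \<delta> \<subseteq> ball z (r z / 2)" using \<delta>(2)[OF y(1)] by blast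
    moreover have "x \<in> ball y \<delta>" using y(2) by simp
    ultimately show ?thesis by blast
  qed
  let ?f = "\<lambda>x. \<theta> x * f x" and ?q = "\<lambda>j x. \<theta> x * q j x + partial j \<theta> x * f x"
  have wf: "weak U ?f ?q" by (rule weak_mult_same[OF U w(1) \<theta>(1,2)])
  have sf: "sob_sq UNIV ?f ?q < \<infinity>"
  proof -
    have "sob_sq UNIV ?f ?q \<le> ennreal (2 * 1\<^sup>2 + 2 * ((suminf a)\<^sup>2 * C)) * sob_sq UNIV f q"
      by (rule sob_sq_mult_le) (use \<theta>(2,3) in auto)
    also have "\<dots> < \<infinity>" using w(2) by (simp add: ennreal_mult_less_top)
    finally show ?thesis .
  qed
  have "approximable U ?f ?q"
  proof (rule approximable_finite_cover[OF U X(2) r(1) r(2) wf sf])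
    fix z
    show "z \<in> (\<Union>x\<in>X. ball x (r x / 2))" if "?f z \<noteq> 0" using near[OF \<theta>(6)[of z]] that by auto
    show "z \<in> (\<Union>x\<in>X. ball x (r x / 2))" if nz: "?q j z \<noteq> 0" for j
    proof (rule ccontr)
      assume out: "z \<notin> (\<Union>x\<in>X. ball x (r x / 2))"
      then have \<theta>0: "\<theta> z = 0" using near[OF \<theta>(6)[of z]] by auto
      \<comment> \<open>\<open>z\<close> is a minimum of the nonnegative function \<open>\<theta>\<close>\<close>
      have "((\<lambda>t. \<theta> (z + t *\<^sub>R basis j)) has_real_derivative partial j \<theta> z) (at 0)"
        using F_smooth_has_pd[OF \<theta>(1), of z j] by (simp add: has_pd_def)
      then have "partial j \<theta> z = 0"
        by (rule DERIV_local_min[of _ _ _ 1]) (use \<theta>(3) \<theta>0 in auto)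
      then show False using nz \<theta>0 by simp
    qed
  qed
  moreover have "sob_sq U (\<lambda>x. f x - ?f x) (\<lambda>j x. q j x - ?q j x) < ennreal e"
  proof -
    let ?\<beta> = "\<lambda>x. 1 - \<theta> x"
    note om = F_smooth_one_minus[OF \<theta>(1,2)]
    have eq: "f x - ?f x = ?\<beta> x * f x" "q j x - ?q j x = ?\<beta> x * q j x + partial j ?\<beta> x * f x" for j x
      by (simp_all add: om(3) algebra_simps)
    have pt: "sob_dens (\<lambda>x. ?\<beta> x * f x) (\<lambda>j x. ?\<beta> x * q j x + partial j ?\<beta> x * f x) x
       \<le> 2 * (indicator (?Z n) x * sob_dens f q x) + ennreal (2 * (?A / \<rho>\<^sup>2)) * sob_dens f q x" for x
    proof -
      let ?b = "indicator (?Z n) x :: real"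
      \<comment> \<open>Outside \<open>?Z n\<close> the rescaled norm is at most
        \<open>\<rho> / 2\<close>, as its weights do not exceed \<open>1 / a i\<close>; there the
        cutoff is 1 and only the gradient term remains in the bound.\<close>
      have "\<bar>?\<beta> x\<bar> \<le> ?b"
      proof (cases "x \<in> ?Z n")
        case True
        then show ?thesis using \<theta>(3)[of x] by (simp add: abs_le_iff)
      next
        case False
        have "(norm (rescale T x))\<^sup>2 \<le> (\<rho> / 2)\<^sup>2"
        proof -
          have "ennreal ((norm (rescale T x))\<^sup>2) = (\<Sum>i. ennreal (trunc_weight T i * (coord x i)\<^sup>2))"
            unfolding norm_rescale_sq[OF T(1)]
            by (rule suminf_ennreal2[symmetric]) (use trunc_weight(1)[OF T(1)] summable_rescale[OF T(1)] in \<open>auto simp: less_imp_le\<close>)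
          also have "\<dots> \<le> ?s x"
          proof (rule suminf_le)
            show "ennreal (trunc_weight T i * (coord x i)\<^sup>2) \<le> ennreal ((coord x i)\<^sup>2 / a i)" for i
              using mult_right_mono[OF trunc_weight(3)[OF T(1), of i], of "(coord x i)\<^sup>2"] by (simp add: ennreal_leI)
          qed auto
          also have "\<dots> \<le> ennreal ((\<rho> / 2)\<^sup>2)" using False by (simp add: \<rho>_def not_less)
          finally show ?thesis by (simp add: ennreal_le_iff)
        qed
        then have "norm (rescale T x) \<le> \<rho> / 2" by (rule power2_le_imp_le) (use \<rho> in simp)
        then show ?thesis using \<theta>(5) by simp
      qed
      moreover have "(\<Sum>i<n. (a i * partial i ?\<beta> x)\<^sup>2) \<le> ?A / \<rho>\<^sup>2" for n using \<theta>(4)[where x=x and n=n] by (simp add: om(3))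
      ultimately have "sob_dens (\<lambda>x. ?\<beta> x * f x) (\<lambda>j x. ?\<beta> x * q j x + partial j ?\<beta> x * f x) x
         \<le> ennreal (2 * ?b\<^sup>2 + 2 * (?A / \<rho>\<^sup>2)) * sob_dens f q x"
        by (rule sob_dens_mult_le[of ?\<beta> x])
      also have "\<dots> = 2 * (indicator (?Z n) x * sob_dens f q x) + ennreal (2 * (?A / \<rho>\<^sup>2)) * sob_dens f q x"
        using A by (cases "x \<in> ?Z n") (simp_all add: distrib_right)
      finally show ?thesis .
    qed
    have Zm[measurable]: "?Z n \<in> sets borel" by measurable
    have "sob_sq U (\<lambda>x. f x - ?f x) (\<lambda>j x. q j x - ?q j x) \<le> sob_sq UNIV (\<lambda>x. f x - ?f x) (\<lambda>j x. q j x - ?q j x)"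
      by (rule sob_sq_mono) simp
    also have "\<dots> \<le> (\<integral>\<^sup>+x. 2 * (indicator (?Z n) x * sob_dens f q x) + ennreal (2 * (?A / \<rho>\<^sup>2)) * sob_dens f q x \<partial>G)"
      unfolding sob_sq_def eq by (rule nn_integral_mono) (use pt in simp)
    also have "\<dots> = 2 * (\<integral>\<^sup>+x. indicator (?Z n) x * sob_dens f q x \<partial>G) + ennreal (2 * (?A / \<rho>\<^sup>2)) * sob_sq UNIV f q"
      unfolding sob_sq_def by (subst nn_integral_add) (auto simp: nn_integral_cmult)
    also have "\<dots> \<le> 2 * ennreal (e / 8) + ennreal (2 * (?A / \<rho>\<^sup>2)) * ennreal S"
      using n(1) S(1) by (intro add_mono mult_left_mono) auto
    also have "\<dots> = ennreal (2 * (e / 8) + 2 * (?A / \<rho>\<^sup>2) * S)"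
    proof -
      have "2 * ennreal (e / 8) = ennreal (2 * (e / 8))" using e by (subst ennreal_mult) auto
      moreover have "ennreal (2 * (?A / \<rho>\<^sup>2)) * ennreal S = ennreal (2 * (?A / \<rho>\<^sup>2) * S)"
        using S(2) A by (intro ennreal_mult[symmetric]) auto
      moreover have "ennreal (2 * (e / 8)) + ennreal (2 * (?A / \<rho>\<^sup>2) * S) = ennreal (2 * (e / 8) + 2 * (?A / \<rho>\<^sup>2) * S)"
        using e S(2) A by (intro ennreal_plus[symmetric]) auto
      ultimately show ?thesis by (simp only:)
    qed
    also have "\<dots> < ennreal e"
      using n(2) e by (intro ennreal_lessI) (auto simp: \<rho>_def)
    finally show ?thesis .
  qed
  ultimately show "\<exists>g r. g \<in> borel_measurable borel \<and> (\<forall>j. r j \<in> borel_measurable borel) \<and> approximable U g r \<and>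
      sob_sq U (\<lambda>x. f x - g x) (\<lambda>j x. q j x - r j x) < ennreal e"
    using weak_measurable[OF wf] by (intro exI[of _ ?f] exI[of _ ?q]) auto
qed (use weak_measurable[OF w(1)] in auto)

section \<open>The Sobolev space\<close>

lemma L2_iff_sq_int:
  assumes U: "open U" shows "f \<in> L2 a U \<longleftrightarrow> sq_int (\<lambda>x. indicator U x * f x)"
proof -
  have "(\<lambda>x. (indicator U x * f x)\<^sup>2) = (\<lambda>x. indicator U x * (f x)\<^sup>2)" by (auto simp: indicator_def)
  moreover have "(\<lambda>x. indicator U x * f x) \<in> borel_measurable G \<longleftrightarrow> (\<lambda>x. indicator U x * f x) \<in> borel_measurable borel"
    by (simp cong: measurable_cong_sets)
  ultimately show ?thesis
    unfolding L2_def sq_int_integrable_sq set_borel_measurable_def set_integrable_def by simp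
qed

text \<open>Extending by zero turns the set integrals into integrals over the whole space, where the
  internal theory lives.\<close>

lemma has_weak_partial_iff:
  assumes U: "open U"
  shows "(\<forall>j. has_weak_partial a U j f (q j)) \<longleftrightarrow> weak U (\<lambda>x. indicator U x * f x) (\<lambda>j x. indicator U x * q j x)"
  unfolding has_weak_partial_def weak_def L2_iff_sq_int[OF U] set_lebesgue_integral_def
  by (auto simp: mult.assoc)

lemma set_integral_sq:
  fixes f :: "ell2 \<Rightarrow> real"
  shows "(LINT x:U|G. (f x)\<^sup>2) = (\<integral>x. (indicator U x * f x)\<^sup>2 \<partial>G)"
  unfolding set_lebesgue_integral_def by (intro Bochner_Integration.integral_cong) (auto simp: indicator_def)

text \<open>Finiteness in \<open>ennreal\<close> gives the summability without which the real series
  in \<open>W12_norm\<close> would have no meaning.\<close>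

lemma sob_sq_eq_real:
  assumes w: "sq_int f" "\<And>j. sq_int (q j)" and fin: "sob_sq UNIV f q < \<infinity>"
  shows "summable (\<lambda>j. (a j)\<^sup>2 * (\<integral>x. (q j x)\<^sup>2 \<partial>G))"
    "ennreal ((\<integral>x. (f x)\<^sup>2 \<partial>G) + (\<Sum>j. (a j)\<^sup>2 * (\<integral>x. (q j x)\<^sup>2 \<partial>G))) = sob_sq UNIV f q"
proof -
  have n: "(\<integral>\<^sup>+x. ennreal ((u x)\<^sup>2) \<partial>G) = ennreal (\<integral>x. (u x)\<^sup>2 \<partial>G)" if "sq_int u" for u
    by (rule nn_integral_eq_integral) (use that in \<open>auto simp: sq_int_integrable_sq\<close>)
  have p: "0 \<le> (\<integral>x. (u x)\<^sup>2 \<partial>G)" for u :: "ell2 \<Rightarrow> real" by (rule integral_nonneg_AE) auto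
  have eq: "sob_sq UNIV f q = ennreal (\<integral>x. (f x)\<^sup>2 \<partial>G) + (\<Sum>j. ennreal ((a j)\<^sup>2 * (\<integral>x. (q j x)\<^sup>2 \<partial>G)))"
    using p by (subst sob_sq_UNIV) (auto simp: sq_int_measurable w n ennreal_mult)
  show s: "summable (\<lambda>j. (a j)\<^sup>2 * (\<integral>x. (q j x)\<^sup>2 \<partial>G))"
  proof (subst summable_iff_ennreal)
    show "(\<Sum>j. ennreal ((a j)\<^sup>2 * (\<integral>x. (q j x)\<^sup>2 \<partial>G))) \<noteq> \<infinity>"
    proof
      assume "(\<Sum>j. ennreal ((a j)\<^sup>2 * (\<integral>x. (q j x)\<^sup>2 \<partial>G))) = \<infinity>"
      then show False using fin unfolding eq by simp
    qed
  qed (use p in auto)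
  show "ennreal ((\<integral>x. (f x)\<^sup>2 \<partial>G) + (\<Sum>j. (a j)\<^sup>2 * (\<integral>x. (q j x)\<^sup>2 \<partial>G))) = sob_sq UNIV f q"
    unfolding eq using p by (subst suminf_ennreal2[OF _ s]) (auto simp: ennreal_plus suminf_nonneg[OF s])
qed

lemma W12_imp_weak:
  assumes U: "open U" and f: "f \<in> W12 a U"
  defines "f' \<equiv> \<lambda>x. indicator U x * f x" and "q' \<equiv> \<lambda>j x. indicator U x * weak_partial a U j f x"
  shows "weak U f' q'" "sob_sq UNIV f' q' < \<infinity>"
proof -
  have "has_weak_partial a U j f (weak_partial a U j f)" for j
  proof -
    have "\<exists>q. has_weak_partial a U j f q" using f by (auto simp: W12_def)
    then show ?thesis unfolding weak_partial_def by (rule someI_ex)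
  qed
  then have "\<forall>j. has_weak_partial a U j f (weak_partial a U j f)" by blast
  then show w: "weak U f' q'" unfolding f'_def q'_def by (rule has_weak_partial_iff[OF U, THEN iffD1])
  have sq: "sq_int f'" "\<And>j. sq_int (q' j)" using w by (auto simp: weak_def)
  have n: "(\<integral>\<^sup>+x. ennreal ((u x)\<^sup>2) \<partial>G) = ennreal (\<integral>x. (u x)\<^sup>2 \<partial>G)" if "sq_int u" for u
    by (rule nn_integral_eq_integral) (use that in \<open>auto simp: sq_int_integrable_sq\<close>)
  have p: "0 \<le> (\<integral>x. (u x)\<^sup>2 \<partial>G)" for u :: "ell2 \<Rightarrow> real" by (rule integral_nonneg_AE) auto
  have "summable (\<lambda>j. (a j)\<^sup>2 * (\<integral>x. (q' j x)\<^sup>2 \<partial>G))"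
    using f by (simp add: W12_def set_integral_sq q'_def)
  then have "(\<Sum>j. ennreal ((a j)\<^sup>2 * (\<integral>x. (q' j x)\<^sup>2 \<partial>G))) \<noteq> \<infinity>"
    by (rule summable_iff_ennreal[THEN iffD1, rotated]) (use p in simp)
  then show "sob_sq UNIV f' q' < \<infinity>"
    using p by (subst sob_sq_UNIV) (auto simp: sq_int_measurable sq n ennreal_mult less_top ennreal_add_less_top)
qed

text \<open>\<open>weak_partial\<close> is an arbitrary choice of weak derivative; by
  \<open>weak_unique\<close> its squared integrals agree with those of the explicit family, which
  transfers both finiteness and the value of the norm.\<close>

lemma weak_imp_W12:
  assumes U: "open U" and w: "weak U (\<lambda>x. indicator U x * f x) (\<lambda>j x. indicator U x * q j x)"
    and fin: "sob_sq UNIV (\<lambda>x. indicator U x * f x) (\<lambda>j x. indicator U x * q j x) < \<infinity>"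
  shows "f \<in> W12 a U"
    "ennreal ((W12_norm a U f)\<^sup>2) = sob_sq UNIV (\<lambda>x. indicator U x * f x) (\<lambda>j x. indicator U x * q j x)"
proof -
  let ?f = "\<lambda>x. indicator U x * f x" and ?q = "\<lambda>j x. indicator U x * q j x"
  let ?p = "\<lambda>j x. indicator U x * weak_partial a U j f x"
  have hw: "has_weak_partial a U j f (q j)" for j using has_weak_partial_iff[OF U, THEN iffD2, OF w] by blast
  have "has_weak_partial a U j f (weak_partial a U j f)" for j
    unfolding weak_partial_def by (rule someI[where P = "has_weak_partial a U j f", OF hw])
  then have "\<forall>j. has_weak_partial a U j f (weak_partial a U j f)" by blast
  then have wp: "weak U ?f ?p" by (rule has_weak_partial_iff[OF U, THEN iffD1])
  have sq: "sq_int ?f" "\<And>j. sq_int (?q j)" "\<And>j. sq_int (?p j)" using w wp by (auto simp: weak_def)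
  have eq: "(LINT x:U|G. (weak_partial a U j f x)\<^sup>2) = (\<integral>x. (?q j x)\<^sup>2 \<partial>G)" for j
    unfolding set_integral_sq
  proof (rule integral_cong_AE)
    show "AE x in G. (?p j x)\<^sup>2 = (?q j x)\<^sup>2"
      using weak_unique[OF U wp w, of j] by eventually_elim (rule arg_cong[where f = "\<lambda>u. u\<^sup>2"])
    show "(\<lambda>x. (?p j x)\<^sup>2) \<in> borel_measurable G" "(\<lambda>x. (?q j x)\<^sup>2) \<in> borel_measurable G"
      using sq(2,3)[of j] by (auto simp: sq_int_integrable_sq)
  qed
  note real = sob_sq_eq_real[OF sq(1,2) fin]
  show "f \<in> W12 a U"
  proof -
    have "f \<in> L2 a U" using hw[of 0] by (simp add: has_weak_partial_def)
    moreover have "\<forall>i. \<exists>q. has_weak_partial a U i f q" using hw by blast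
    ultimately show ?thesis unfolding W12_def mem_Collect_eq eq using real(1) by blast
  qed
  have "0 \<le> (\<integral>x. (?f x)\<^sup>2 \<partial>G) + (\<Sum>j. (a j)\<^sup>2 * (\<integral>x. (?q j x)\<^sup>2 \<partial>G))"
    by (intro add_nonneg_nonneg suminf_nonneg[OF real(1)] mult_nonneg_nonneg integral_nonneg_AE) auto
  then show "ennreal ((W12_norm a U f)\<^sup>2) = sob_sq UNIV ?f ?q"
    unfolding real(2)[symmetric] W12_norm_def set_integral_sq[of U f] eq by simp
qed

text \<open>Membership of the difference in \<open>W12\<close> belongs to the conclusion, since
  \<open>W12_norm\<close> rests on \<open>SOME\<close> and on a real series and carries no
  information for other functions.\<close>

lemma W12_approximation:
  assumes U: "open U" and f: "f \<in> W12 a U" and loc: "\<And>x. \<exists>r>0. locally_approximable U x r" and e: "e > 0"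
  shows "\<exists>\<phi>. \<phi> \<in> C_Fb UNIV \<inter> C_F0 UNIV \<and> (\<lambda>x. \<phi> x - f x) \<in> W12 a U \<and> (W12_norm a U (\<lambda>x. \<phi> x - f x))\<^sup>2 < e"
proof -
  let ?f = "\<lambda>x. indicator U x * f x" and ?q = "\<lambda>j x. indicator U x * weak_partial a U j f x"
  note w = W12_imp_weak[OF U f]
  obtain \<phi> where \<phi>: "test_fun \<phi>" "sob_sq U (\<lambda>x. ?f x - \<phi> x) (\<lambda>j x. ?q j x - partial j \<phi> x) < ennreal e"
    using approximable_of_local[OF U loc w] e unfolding approximable_def by blast
  let ?d = "\<lambda>x. \<phi> x - f x" and ?p = "\<lambda>j x. partial j \<phi> x - weak_partial a U j f x"
  \<comment> \<open>On \<open>U\<close> the classical partial derivatives of \<open>\<phi>\<close>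
    are weak ones, so the difference comes with an explicit family of weak derivatives; its sign is
    opposite to that in \<open>approximable\<close>, which the squares do not see.\<close>
  have "weak U (\<lambda>x. indicator U x * \<phi> x - ?f x) (\<lambda>j x. indicator U x * partial j \<phi> x - ?q j x)"
    by (rule weak_diff[OF U weak_smooth[OF U \<phi>(1)] w(1)])
  then have wd: "weak U (\<lambda>x. indicator U x * ?d x) (\<lambda>j x. indicator U x * ?p j x)"
    by (simp add: right_diff_distrib)
  have "sob_sq UNIV (\<lambda>x. indicator U x * ?d x) (\<lambda>j x. indicator U x * ?p j x) = sob_sq U (\<lambda>x. ?f x - \<phi> x) (\<lambda>j x. ?q j x - partial j \<phi> x)"
    unfolding sob_sq_def sob_dens_def
  proof (rule nn_integral_cong)
    fix x
    have "(a j * (partial j \<phi> x - weak_partial a U j f x))\<^sup>2 = (a j * (weak_partial a U j f x - partial j \<phi> x))\<^sup>2" for j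
      unfolding power_mult_distrib by (simp add: power2_commute)
    then show "indicator UNIV x * (ennreal ((indicator U x * ?d x)\<^sup>2) + (\<Sum>j. ennreal ((a j * (indicator U x * ?p j x))\<^sup>2)))
      = indicator U x * (ennreal ((?f x - \<phi> x)\<^sup>2) + (\<Sum>j. ennreal ((a j * (?q j x - partial j \<phi> x))\<^sup>2)))"
      by (cases "x \<in> U") (simp_all add: power2_commute[of "\<phi> x"])
  qed
  then have lt: "sob_sq UNIV (\<lambda>x. indicator U x * ?d x) (\<lambda>j x. indicator U x * ?p j x) < ennreal e" using \<phi>(2) by simp
  then have fin: "sob_sq UNIV (\<lambda>x. indicator U x * ?d x) (\<lambda>j x. indicator U x * ?p j x) < \<infinity>"
    by (rule less_trans) simp
  note W = weak_imp_W12[OF U wd fin]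
  have "ennreal ((W12_norm a U ?d)\<^sup>2) < ennreal e" using W(2) lt by simp
  then have "(W12_norm a U ?d)\<^sup>2 < e" by (simp add: ennreal_less_iff)
  moreover have "\<phi> \<in> C_Fb UNIV \<inter> C_F0 UNIV"
    using F_smooth_imp_C_Fb test_fun_C_F0[OF \<phi>(1)] \<phi>(1) by (auto simp: test_fun_def)
  ultimately show ?thesis using W(1) by blast
qed

end

theorem theorem176:
  fixes a :: "nat \<Rightarrow> real" and U :: "ell2 set" and f :: "ell2 \<Rightarrow> real"
  assumes a_pos: "\<And>i. a i > 0" and a_summable: "summable a"
    and U_open: "open U"
    and U_boundary: "\<exists>(g :: ell2 \<Rightarrow> real) (Dg :: ell2 \<Rightarrow> ell2 \<Rightarrow>\<^sub>L real).
          (\<forall>x. (g has_derivative blinfun_apply (Dg x)) (at x)) \<and> continuous_on UNIV Dg \<and>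
          frontier U = {x. g x = 0} \<and> U = {x. g x > 0} \<and> (\<forall>x\<in>frontier U. Dg x \<noteq> 0)"
    and f_W12: "f \<in> W12 a U"
  shows "\<exists>\<phi> :: nat \<Rightarrow> ell2 \<Rightarrow> real.
      (\<forall>n. \<phi> n \<in> C_Fb UNIV \<inter> C_F0 UNIV) \<and>
      (\<forall>n. (\<lambda>x. \<phi> n x - f x) \<in> W12 a U) \<and>
      (\<lambda>n. W12_norm a U (\<lambda>x. \<phi> n x - f x)) \<longlonglongrightarrow> 0"
proof -
  interpret gaussian_ell2 a by unfold_locales (fact a_pos a_summable)+
  obtain g :: "ell2 \<Rightarrow> real" and Dg :: "ell2 \<Rightarrow> ell2 \<Rightarrow>\<^sub>L real" where
    g: "\<And>x. (g has_derivative blinfun_apply (Dg x)) (at x)" "continuous_on UNIV Dg"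
      "U = {x. g x > 0}" "\<And>x. x \<in> frontier U \<Longrightarrow> Dg x \<noteq> 0"
    using U_boundary by blast
  have loc: "\<exists>r>0. locally_approximable U x r" for x
    by (rule locally_approximable_exists[OF g(1,2) U_open g(3,4)])
  have "\<exists>\<phi>. \<phi> \<in> C_Fb UNIV \<inter> C_F0 UNIV \<and> (\<lambda>x. \<phi> x - f x) \<in> W12 a U \<and>
      (W12_norm a U (\<lambda>x. \<phi> x - f x))\<^sup>2 < 1 / real (Suc n)" for n
    by (rule W12_approximation[OF U_open f_W12 loc]) simp
  then obtain \<phi> where \<phi>: "\<And>n. \<phi> n \<in> C_Fb UNIV \<inter> C_F0 UNIV" "\<And>n. (\<lambda>x. \<phi> n x - f x) \<in> W12 a U"
      "\<And>n. (W12_norm a U (\<lambda>x. \<phi> n x - f x))\<^sup>2 < 1 / real (Suc n)"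
    by metis
  have "(\<lambda>n. (W12_norm a U (\<lambda>x. \<phi> n x - f x))\<^sup>2) \<longlonglongrightarrow> 0"
  proof (rule tendsto_sandwich[OF _ _ tendsto_const])
    show "(\<lambda>n. 1 / real (Suc n)) \<longlonglongrightarrow> 0" using LIMSEQ_inverse_real_of_nat by (simp add: inverse_eq_divide)
  qed (use \<phi>(3) less_imp_le in \<open>auto intro!: always_eventually\<close>)
  then have "(\<lambda>n. W12_norm a U (\<lambda>x. \<phi> n x - f x)) \<longlonglongrightarrow> 0" by simp
  with \<phi> show ?thesis by blast
qed

end
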